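(* Fix $T>0$ and a deterministic $f\in\mathbb{R}^d$. Let $U_t=K_t^\top Y_t+V_t$, $t\in[0,T]$, be any admissible control input, where $K\in C_{\mathcal{Z}}^{d\times m}$, $V\in C_{\mathcal{Z}}^{m}$ and $Y$ solves the backward ODE $$\frac{\mathrm{d}Y_t}{\mathrm{d}t}=-AY_t-HU_t,\qquad Y_T=f .$$ Define the linear estimator $$S_T=Y_0^\top\pi_0-\int_0^TU_t^\top\,\mathrm{d}Z_t ,$$ the error process $$\mathcal{E}_t=Y_0^\top(X_0-\pi_0)+\int_0^tU_\tau^\top\,\mathrm{d}W_\tau+\int_0^tY_\tau^\top\,\mathrm{d}B_\tau,\qquad t\in[0,T],$$ and the objective $$J(U)=\mathsf{E}\Big(\tfrac12|Y_0^\top X_0-Y_0^\top\pi_0|^2+\int_0^T\tfrac12U_t^\top RU_t\,\mathrm{d}t+\int_0^T\tfrac12Y_t^\top\,\mathrm{d}\langle X,X^\top\rangle_t\,Y_t+\int_0^T\mathcal{E}_tU_t^\top\,\mathrm{d}W_t+\int_0^T\mathcal{E}_tY_t^\top\,\mathrm{d}B_t\Big).$$ Then $$J(U)=\tfrac12\,\mathsf{E}\big[|S_T-f^\top X_T|^2\big].$$ In particular, $J(U)\ge0$ for every admissible control.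
   Context: Filtering model: the state space is the canonical basis $\mathbb{S}=\{e_1,\dots,e_d\}$ of $\mathbb{R}^d$. $X=\{X_t:t\in[0,T]\}$ is a continuous-time Markov chain on $\mathbb{S}$ with rate matrix (generator) $A\in\mathbb{R}^{d\times d}$ ($A_{ij}$ is the rate from $e_i$ to $e_j$ for $i\neq j$, rows sum to zero) and initial distribution $\pi_0$, regarded as a vector in the probability simplex of $\mathbb{R}^d$. $B_t=X_t-\int_0^tA^\top X_\tau\,\mathrm{d}\tau$ is a martingale, so $\mathrm{d}X_t=A^\top X_t\,\mathrm{d}t+\mathrm{d}B_t$. The observation process is $\mathrm{d}Z_t=H^\top X_t\,\mathrm{d}t+\mathrm{d}W_t$, $Z_0=0$, with $H\in\mathbb{R}^{d\times m}$ and $W$ an $m$-dimensional Wiener process with covariance $R\succ0$ (i.e. $\mathsf{E}[W_tW_t^\top]=Rt$), independent of $X$. Filtrations: $\mathcal{F}_t=\sigma(X_\tau,W_\tau:0\le\tau\le t)$, $\mathcal{Z}_t=\sigma(Z_\tau:0\le\tau\le t)$. $C^p_{\mathcal{Z}}$ denotes the $\mathbb{R}^p$-valued continuous $\mathcal{Z}$-adapted processes on $[0,T]$. The admissible control inputs are $U_t=K_t^\top Y_t+V_t$ with $K\in C^{d\times m}_{\mathcal{Z}}$, $V\in C^m_{\mathcal{Z}}$, where $Y$ is the pathwise solution of the backward ODE with this control; $Y$ and $U$ need not be adapted. Stochastic integrals: all integrals and brackets are forward ones, i.e. limits of left-endpoint sums $\sum_i\phi_{t_{i-1}}(\psi_{t_i}-\psi_{t_{i-1}})$,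 respectively $\langle\phi,\psi\rangle_t=\lim\sum_i(\phi_{t_i}-\phi_{t_{i-1}})(\psi_{t_i}-\psi_{t_{i-1}})$, as the mesh of the partition of $[0,t]$ tends to $0$. $\langle X,X^\top\rangle_t$ is the matrix-valued quadratic variation of $X$. The non-adapted processes here have the form $F^\top\xi_t+\alpha_t$ with $F=Y_0$ a $\mathcal{Z}_T$-measurable random vector and $\xi,\alpha$ $\mathcal{F}$-adapted. Indeed $Y_t=\Phi_tY_0+\eta_t$ and $U_t=\kappa_t^\top Y_0+\gamma_t$ with $\mathcal{Z}$-adapted $\Phi,\eta,\kappa,\gamma$, where $\dot\Phi_t=-(A+HK_t^\top)\Phi_t$, $\Phi_0=I$, $\dot\eta_t=-(A+HK_t^\top)\eta_t-HV_t$, $\eta_0=0$, $\kappa_t=\Phi_t^\top K_t$, $\gamma_t=K_t^\top\eta_t+V_t$. Forward integrals are evaluated by pulling the time-independent factors $Y_0$ out of the integral, leaving standard Itô integrals of adapted processes; for example $\int_0^tU_\tau^\top\,\mathrm{d}Z_\tau=Y_0^\top\int_0^t\kappa_\tau\,\mathrm{d}Z_\tau+\int_0^t\gamma_\tau^\top\,\mathrm{d}Z_\tau$, and for $\phi=F^\top\xi+\alpha$, $\psi=G^\top\zeta+\beta$: $\int\phi\,\mathrm{d}\psi=F^\top(\int\xi\,\mathrm{d}\zeta^\top)G+F^\top\int\xi\,\mathrm{d}\beta+G^\top\int\alpha\,\mathrm{d}\zeta+\int\alpha\,\mathrm{d}\beta$. *)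

theory Defs
  imports "HOL-Probability.Probability"
begin

section \<open>Processes and the filtering model\<close>

text \<open>Processes are functions of time and sample point; only times in \<open>{0..T}\<close> are relevant.\<close>

definition generated_algebra ::
    "'a measure \<Rightarrow> real set \<Rightarrow> (real \<Rightarrow> 'a \<Rightarrow> 'b::topological_space) \<Rightarrow> 'a measure" where
  "generated_algebra M I X =
     sigma (space M) {X s -` B \<inter> space M | s B. s \<in> I \<and> B \<in> sets borel}"

definition cadlag_on :: "real \<Rightarrow> (real \<Rightarrow> 'b::topological_space) \<Rightarrow> bool" where
  "cadlag_on T x \<longleftrightarrow>
     (\<forall>t\<in>{0..<T}. (x \<longlongrightarrow> x t) (at_right t)) \<and> (\<forall>t\<in>{0<..T}. \<exists>l. (x \<longlongrightarrow> l) (at_left t))"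

definition matrix_exp :: "real^'d^'d \<Rightarrow> real^'d^'d" where
  "matrix_exp Q = (\<Sum>n. (1 / fact n) *\<^sub>R ((\<lambda>P. Q ** P) ^^ n) (mat 1))"

definition rate_matrix :: "real^'d^'d \<Rightarrow> bool" where
  "rate_matrix A \<longleftrightarrow> (\<forall>i j. i \<noteq> j \<longrightarrow> 0 \<le> A $ i $ j) \<and> (\<forall>i. (\<Sum>j\<in>UNIV. A $ i $ j) = 0)"

text \<open>The last clause is the Markov property with respect to the natural filtration of \<open>X\<close>,
  with transition matrix \<open>exp ((t - s) A)\<close>, written without conditional probabilities so that
  states of probability zero need no special treatment.\<close>

definition markov_chain ::
    "'a measure \<Rightarrow> real \<Rightarrow> real^'d^'d \<Rightarrow> real^'d \<Rightarrow> (real \<Rightarrow> 'a \<Rightarrow> real^'d) \<Rightarrow> bool" where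
  "markov_chain M T A p X \<longleftrightarrow>
     rate_matrix A \<and>
     (\<forall>t\<in>{0..T}. X t \<in> borel_measurable M \<and> X t \<in> space M \<rightarrow> Basis) \<and>
     (\<forall>\<omega>\<in>space M. cadlag_on T (\<lambda>t. X t \<omega>)) \<and>
     (\<forall>i. measure M {\<omega>\<in>space M. X 0 \<omega> = axis i 1} = p $ i) \<and>
     (\<forall>s t i j. \<forall>G\<in>sets (generated_algebra M {0..s} X). 0 \<le> s \<and> s \<le> t \<and> t \<le> T \<longrightarrow>
        measure M (G \<inter> {\<omega>\<in>space M. X s \<omega> = axis i 1 \<and> X t \<omega> = axis j 1}) =
        measure M (G \<inter> {\<omega>\<in>space M. X s \<omega> = axis i 1}) * matrix_exp ((t - s) *\<^sub>R A) $ i $ j)"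

definition pos_def_matrix :: "real^'m^'m \<Rightarrow> bool" where
  "pos_def_matrix R \<longleftrightarrow> transpose R = R \<and> (\<forall>c. c \<noteq> 0 \<longrightarrow> 0 < c \<bullet> (R *v c))"

text \<open>An increment over \<open>[s, t]\<close> has the centred Gaussian law with covariance \<open>(t - s) R\<close>: every
  nontrivial linear functional of it is a (nondegenerate, as \<open>R\<close> is positive definite) normal
  variable. Note that \<open>normal_density\<close> takes the standard deviation.\<close>

definition wiener_process ::
    "'a measure \<Rightarrow> real \<Rightarrow> real^'m^'m \<Rightarrow> (real \<Rightarrow> 'a \<Rightarrow> real^'m) \<Rightarrow> bool" where
  "wiener_process M T R W \<longleftrightarrow>
     (\<forall>t\<in>{0..T}. W t \<in> borel_measurable M) \<and>
     (\<forall>\<omega>\<in>space M. W 0 \<omega> = 0 \<and> continuous_on {0..T} (\<lambda>t. W t \<omega>)) \<and>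
     (\<forall>s t. 0 \<le> s \<and> s < t \<and> t \<le> T \<longrightarrow>
        prob_space.indep_set M
          (sets (generated_algebra M {0..s} W))
          (sets (vimage_algebra (space M) (\<lambda>\<omega>. W t \<omega> - W s \<omega>) borel)) \<and>
        (\<forall>c. c \<noteq> 0 \<longrightarrow>
           distributed M lborel (\<lambda>\<omega>. c \<bullet> (W t \<omega> - W s \<omega>))
             (normal_density 0 (sqrt ((t - s) * (c \<bullet> (R *v c)))))))"

definition filtering_model ::
    "'a measure \<Rightarrow> real \<Rightarrow> real^'d^'d \<Rightarrow> real^'d \<Rightarrow> real^'m^'m
      \<Rightarrow> (real \<Rightarrow> 'a \<Rightarrow> real^'d) \<Rightarrow> (real \<Rightarrow> 'a \<Rightarrow> real^'m) \<Rightarrow> bool" where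
  "filtering_model M T A p R X W \<longleftrightarrow>
     prob_space M \<and> markov_chain M T A p X \<and> pos_def_matrix R \<and> wiener_process M T R W \<and>
     prob_space.indep_set M
       (sets (generated_algebra M {0..T} X)) (sets (generated_algebra M {0..T} W))"

definition martingale_part ::
    "real^'d^'d \<Rightarrow> (real \<Rightarrow> 'a \<Rightarrow> real^'d) \<Rightarrow> real \<Rightarrow> 'a \<Rightarrow> real^'d" where
  "martingale_part A X t \<omega> = X t \<omega> - integral {0..t} (\<lambda>s. transpose A *v X s \<omega>)"

definition observation ::
    "real^'m^'d \<Rightarrow> (real \<Rightarrow> 'a \<Rightarrow> real^'d) \<Rightarrow> (real \<Rightarrow> 'a \<Rightarrow> real^'m) \<Rightarrow> real \<Rightarrow> 'a \<Rightarrow> real^'m" where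
  "observation H X W t \<omega> = integral {0..t} (\<lambda>s. transpose H *v X s \<omega>) + W t \<omega>"

text \<open>Continuous processes on \<open>{0..T}\<close> adapted to the natural filtration of \<open>Z\<close>.\<close>

definition continuous_adapted ::
    "'a measure \<Rightarrow> real \<Rightarrow> (real \<Rightarrow> 'a \<Rightarrow> 'c::topological_space)
      \<Rightarrow> (real \<Rightarrow> 'a \<Rightarrow> 'b::topological_space) set" where
  "continuous_adapted M T Z = {P.
     (\<forall>t\<in>{0..T}. P t \<in> borel_measurable (generated_algebra M {0..t} Z)) \<and>
     (\<forall>\<omega>\<in>space M. continuous_on {0..T} (\<lambda>t. P t \<omega>))}"

definition backward_ode ::
    "'a measure \<Rightarrow> real \<Rightarrow> real^'d^'d \<Rightarrow> real^'m^'d \<Rightarrow> real^'d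
      \<Rightarrow> (real \<Rightarrow> 'a \<Rightarrow> real^'m) \<Rightarrow> (real \<Rightarrow> 'a \<Rightarrow> real^'d) \<Rightarrow> bool" where
  "backward_ode M T A H f U Y \<longleftrightarrow>
     (\<forall>\<omega>\<in>space M. Y T \<omega> = f \<and>
        (\<forall>t\<in>{0..T}. ((\<lambda>s. Y s \<omega>) has_vector_derivative (- (A *v Y t \<omega>) - H *v U t \<omega>))
                       (at t within {0..T})))"


section \<open>Forward integrals and brackets\<close>

text \<open>A partition of \<open>{0..t}\<close> is the list of its points; for \<open>t = 0\<close> it is \<open>[0]\<close>, so that the
  filter below is proper for every \<open>t \<ge> 0\<close>.\<close>

definition partitions :: "real \<Rightarrow> real \<Rightarrow> real list set" where
  "partitions t \<delta> = {ts. ts \<noteq> [] \<and> sorted_wrt (<) ts \<and> hd ts = 0 \<and> last ts = t \<and>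
     (\<forall>i. Suc i < length ts \<longrightarrow> ts ! Suc i - ts ! i < \<delta>)}"

definition mesh_to_0 :: "real \<Rightarrow> real list filter" where
  "mesh_to_0 t = (INF \<delta>\<in>{0<..}. principal (partitions t \<delta>))"

text \<open>Measurability is part of the definition because \<open>measure\<close> is 0 on non-measurable sets.\<close>

definition tendsto_in_prob ::
    "'a measure \<Rightarrow> ('i \<Rightarrow> 'a \<Rightarrow> 'b::real_normed_vector) \<Rightarrow> ('a \<Rightarrow> 'b) \<Rightarrow> 'i filter \<Rightarrow> bool" where
  "tendsto_in_prob M S L F \<longleftrightarrow>
     (\<forall>\<^sub>F i in F. S i \<in> borel_measurable M) \<and> L \<in> borel_measurable M \<and>
     (\<forall>\<epsilon>>0. ((\<lambda>i. measure M {\<omega>\<in>space M. \<epsilon> < norm (S i \<omega> - L \<omega>)}) \<longlongrightarrow> 0) F)"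

text \<open>Left-endpoint sums and their limits, for an arbitrary product \<open>b\<close> of the integrand with the
  increment of the integrator. The limit is determined up to a null set for each \<open>t\<close>; the choice
  of version is immaterial, also when the integral is itself used as (part of) an integrand or
  integrator, since a sum over a partition involves only finitely many times.\<close>

definition forward_sum ::
    "('b \<Rightarrow> 'c \<Rightarrow> 'e) \<Rightarrow> (real \<Rightarrow> 'a \<Rightarrow> 'b) \<Rightarrow> (real \<Rightarrow> 'a \<Rightarrow> 'c::real_vector) \<Rightarrow> real list \<Rightarrow> 'a
      \<Rightarrow> 'e::real_normed_vector" where
  "forward_sum b \<phi> \<psi> ts \<omega> =
     (\<Sum>i<length ts - 1. b (\<phi> (ts ! i) \<omega>) (\<psi> (ts ! Suc i) \<omega> - \<psi> (ts ! i) \<omega>))"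

definition forward_integral ::
    "'a measure \<Rightarrow> ('b \<Rightarrow> 'c \<Rightarrow> 'e) \<Rightarrow> (real \<Rightarrow> 'a \<Rightarrow> 'b) \<Rightarrow> (real \<Rightarrow> 'a \<Rightarrow> 'c::real_vector)
      \<Rightarrow> real \<Rightarrow> 'a \<Rightarrow> 'e::real_normed_vector" where
  "forward_integral M b \<phi> \<psi> t = (SOME L. tendsto_in_prob M (forward_sum b \<phi> \<psi>) L (mesh_to_0 t))"

definition outer_product :: "real^'d \<Rightarrow> real^'e \<Rightarrow> real^'e^'d" where
  "outer_product x y = (\<chi> i j. x $ i * y $ j)"

definition bracket_sum ::
    "(real \<Rightarrow> 'a \<Rightarrow> real^'d) \<Rightarrow> (real \<Rightarrow> 'a \<Rightarrow> real^'e) \<Rightarrow> real list \<Rightarrow> 'a \<Rightarrow> real^'e^'d" where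
  "bracket_sum \<phi> \<psi> ts \<omega> =
     (\<Sum>i<length ts - 1. outer_product (\<phi> (ts ! Suc i) \<omega> - \<phi> (ts ! i) \<omega>)
                                      (\<psi> (ts ! Suc i) \<omega> - \<psi> (ts ! i) \<omega>))"

definition bracket ::
    "'a measure \<Rightarrow> (real \<Rightarrow> 'a \<Rightarrow> real^'d) \<Rightarrow> (real \<Rightarrow> 'a \<Rightarrow> real^'e) \<Rightarrow> real \<Rightarrow> 'a \<Rightarrow> real^'e^'d" where
  "bracket M \<phi> \<psi> t = (SOME L. tendsto_in_prob M (bracket_sum \<phi> \<psi>) L (mesh_to_0 t))"


section \<open>Estimator, error process and objective\<close>

text \<open>Admissible controls need not be square integrable, so expectations are taken in the extended
  reals: the Bochner integral would return 0 for a nonnegative variable of infinite mean.\<close>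

definition ext_expectation :: "'a measure \<Rightarrow> ('a \<Rightarrow> real) \<Rightarrow> ereal" where
  "ext_expectation M \<xi> =
     enn2ereal (\<integral>\<^sup>+\<omega>. ennreal (\<xi> \<omega>) \<partial>M) - enn2ereal (\<integral>\<^sup>+\<omega>. ennreal (- \<xi> \<omega>) \<partial>M)"

definition estimator ::
    "'a measure \<Rightarrow> real \<Rightarrow> real^'d \<Rightarrow> (real \<Rightarrow> 'a \<Rightarrow> real^'m)
      \<Rightarrow> (real \<Rightarrow> 'a \<Rightarrow> real^'m) \<Rightarrow> (real \<Rightarrow> 'a \<Rightarrow> real^'d) \<Rightarrow> 'a \<Rightarrow> real" where
  "estimator M T p Z U Y \<omega> = Y 0 \<omega> \<bullet> p - forward_integral M (\<bullet>) U Z T \<omega>"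

definition error_process ::
    "'a measure \<Rightarrow> real^'d^'d \<Rightarrow> real^'d \<Rightarrow> (real \<Rightarrow> 'a \<Rightarrow> real^'d) \<Rightarrow> (real \<Rightarrow> 'a \<Rightarrow> real^'m)
      \<Rightarrow> (real \<Rightarrow> 'a \<Rightarrow> real^'m) \<Rightarrow> (real \<Rightarrow> 'a \<Rightarrow> real^'d) \<Rightarrow> real \<Rightarrow> 'a \<Rightarrow> real" where
  "error_process M A p X W U Y t \<omega> =
     Y 0 \<omega> \<bullet> (X 0 \<omega> - p) + forward_integral M (\<bullet>) U W t \<omega>
       + forward_integral M (\<bullet>) Y (martingale_part A X) t \<omega>"

definition objective ::
    "'a measure \<Rightarrow> real \<Rightarrow> real^'d^'d \<Rightarrow> real^'d \<Rightarrow> real^'m^'m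
      \<Rightarrow> (real \<Rightarrow> 'a \<Rightarrow> real^'d) \<Rightarrow> (real \<Rightarrow> 'a \<Rightarrow> real^'m)
      \<Rightarrow> (real \<Rightarrow> 'a \<Rightarrow> real^'m) \<Rightarrow> (real \<Rightarrow> 'a \<Rightarrow> real^'d) \<Rightarrow> ereal" where
  "objective M T A p R X W U Y =
     (let \<E> = error_process M A p X W U Y in
      ext_expectation M (\<lambda>\<omega>.
          1/2 * \<bar>Y 0 \<omega> \<bullet> X 0 \<omega> - Y 0 \<omega> \<bullet> p\<bar>\<^sup>2
        + integral {0..T} (\<lambda>t. 1/2 * (U t \<omega> \<bullet> (R *v U t \<omega>)))
        + forward_integral M (\<lambda>y q. 1/2 * (y \<bullet> (q *v y))) Y (bracket M X X) T \<omega>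
        + forward_integral M (\<bullet>) (\<lambda>t \<omega>. \<E> t \<omega> *\<^sub>R U t \<omega>) W T \<omega>
        + forward_integral M (\<bullet>) (\<lambda>t \<omega>. \<E> t \<omega> *\<^sub>R Y t \<omega>) (martingale_part A X) T \<omega>))"

end

theory Submission
  imports Defs
begin

text \<open>The backward equation gives \<open>d(Y\<^sup>T X) = U\<^sup>T dW + Y\<^sup>T dB - U\<^sup>T dZ\<close>, so that \<open>S\<^sub>T - f\<^sup>T X\<^sub>T = - E\<^sub>T\<close> for
  the error process \<open>E\<close>, and squaring, \<open>E\<^sub>T\<^sup>2 = E\<^sub>0\<^sup>2 + 2 \<integral> E dE + \<langle>E, E\<rangle>\<^sub>T\<close>. Both are identities between
  random variables: the integrand of the objective is almost surely half of the squared estimation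
  error, and no martingale property of the stochastic integrals is needed.

  The anticipating integrands are handled one trajectory at a time. As \<open>Y\<close> is continuously
  differentiable, \<open>\<integral> Y\<^sup>T dN\<close> is defined by parts from the Ito integral \<open>N = \<integral> K dW\<close> of the adapted
  gain. A limit in probability along partitions is characterised by almost sure convergence along
  subsequences, and Kolmogorov's maximal inequality with truncated coefficients provides, uniformly in
  time, almost sure convergence of a subsequence of the sums for \<open>N\<close> and for the quadratic variation
  of \<open>W\<close>. Once the filtration is enlarged by the whole trajectory of \<open>X\<close>, which is independent of
  \<open>W\<close>, the state is a path with finitely many jumps known in advance, and all sums involving it
  converge pathwise.\<close>

subsection \<open>Partitions\<close>

text \<open>The obstacle is the integral of E U^T against W. Its integrand anticipates and is not of
  finite variation, so no direct convergence argument applies. For the discretised error process the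
  square expands exactly, and every term of that expansion other than this sum has a limit that can
  be found separately; the sum is forced to converge to what remains. Replacing the discretised
  process by the true one costs a product of the approximation error with the next increment of W.
  Smallness of the error alone does not control it, because W has infinite variation; it is again a
  martingale sum and is estimated together with the construction of N. The anticipating factor Y has
  bounded variation, so Abel summation removes it from the sums against W and leaves adapted
  coefficients. The gains are merely continuous and have no moments, whence the truncation.\<close>

definition mesh_seq :: "real \<Rightarrow> (nat \<Rightarrow> real list) \<Rightarrow> bool" where
  "mesh_seq t \<pi> \<longleftrightarrow> (\<forall>\<delta>>0. \<forall>\<^sub>F n in sequentially. \<pi> n \<in> partitions t \<delta>)"

lemma partitions_mono: "\<delta> \<le> \<delta>' \<Longrightarrow> partitions t \<delta> \<subseteq> partitions t \<delta>'"
  by (force simp: partitions_def)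

lemma eventually_mesh_to_0:
  "eventually P (mesh_to_0 t) \<longleftrightarrow> (\<exists>\<delta>>0. \<forall>ts\<in>partitions t \<delta>. P ts)"
proof -
  have "eventually P (mesh_to_0 t) \<longleftrightarrow> (\<exists>\<delta>\<in>{0<..}. eventually P (principal (partitions t \<delta>)))"
    unfolding mesh_to_0_def
  proof (rule eventually_INF_base)
    fix a b :: real assume "a \<in> {0<..}" "b \<in> {0<..}"
    then show "\<exists>x\<in>{0<..}. principal (partitions t x)
        \<le> inf (principal (partitions t a)) (principal (partitions t b))"
      using partitions_mono[of "min a b" a t] partitions_mono[of "min a b" b t]
      by (intro bexI[of _ "min a b"]) auto
  qed auto
  then show ?thesis by (auto simp: eventually_principal)
qed

lemma partition_nth_less:
  "ts \<in> partitions t \<delta> \<Longrightarrow> i < j \<Longrightarrow> j < length ts \<Longrightarrow> ts ! i < ts ! j"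
  by (auto simp: partitions_def sorted_wrt_iff_nth_less)

lemma partition_nth_le:
  "ts \<in> partitions t \<delta> \<Longrightarrow> i \<le> j \<Longrightarrow> j < length ts \<Longrightarrow> ts ! i \<le> ts ! j"
  using partition_nth_less[of ts t \<delta> i j] by (cases "i = j") auto

lemma partition_nth_0: "ts \<in> partitions t \<delta> \<Longrightarrow> ts ! 0 = 0"
  by (auto simp: partitions_def hd_conv_nth)

lemma partition_nth_last: "ts \<in> partitions t \<delta> \<Longrightarrow> ts ! (length ts - 1) = t"
  by (auto simp: partitions_def last_conv_nth)

lemma partition_length: "ts \<in> partitions t \<delta> \<Longrightarrow> 0 < length ts"
  by (auto simp: partitions_def)

lemma partition_nth_mem:
  assumes "ts \<in> partitions t \<delta>" "i < length ts"
  shows "ts ! i \<in> {0..t}"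
  using partition_nth_le[OF assms(1), of 0 i] partition_nth_le[OF assms(1), of i "length ts - 1"]
    partition_nth_0[OF assms(1)] partition_nth_last[OF assms(1)] assms(2) by auto

lemma partition_step:
  "ts \<in> partitions t \<delta> \<Longrightarrow> i < length ts - 1 \<Longrightarrow> ts ! Suc i - ts ! i < \<delta>"
  by (auto simp: partitions_def)

lemma partition_sum_steps:
  "ts \<in> partitions t \<delta> \<Longrightarrow> (\<Sum>i<length ts - 1. ts ! Suc i - ts ! i) = t"
  using sum_lessThan_telescope[of "\<lambda>i. ts ! i" "length ts - 1"]
    partition_nth_0[of ts t \<delta>] partition_nth_last[of ts t \<delta>] by simp

text \<open>The intervals are open on the left and closed on the right: a jump of a right-continuous
  path at \<open>s\<close> falls into the interval whose left endpoint lies strictly before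
  \<open>s\<close>, so that left limits appear in left-endpoint sums. The index is one below the
  first point that reaches \<open>s\<close>.\<close>

lemma partition_interval:
  assumes "ts \<in> partitions t \<delta>" "0 < s" "s \<le> t"
  obtains i where "i < length ts - 1" "ts ! i < s" "s \<le> ts ! Suc i"
proof -
  define k where "k = (LEAST k. s \<le> ts ! k \<and> k < length ts)"
  have ex: "s \<le> ts ! (length ts - 1) \<and> length ts - 1 < length ts"
    using assms partition_nth_last partition_length by force
  have k: "s \<le> ts ! k" "k < length ts"
    unfolding k_def using LeastI[where P="\<lambda>k. s \<le> ts ! k \<and> k < length ts", OF ex] by auto
  have "k \<noteq> 0" using k assms partition_nth_0[OF assms(1)] by (auto intro: ccontr)
  then obtain i where i: "k = Suc i" by (cases k) auto
  have "\<not> (s \<le> ts ! i \<and> i < length ts)"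
    using not_less_Least[of i "\<lambda>k. s \<le> ts ! k \<and> k < length ts"] i k_def by auto
  with i k show ?thesis by (intro that[of i]) auto
qed

text \<open>The case \<open>t = 0\<close> is separate because the points of a partition increase
  strictly, which leaves only \<open>[0]\<close>. With \<open>Suc n\<close> steps the denominator is
  positive for every index.\<close>

definition uniform_partition :: "real \<Rightarrow> nat \<Rightarrow> real list" where
  "uniform_partition t n = (if t = 0 then [0] else map (\<lambda>i. t * real i / real (Suc n)) [0..<n + 2])"

lemma uniform_partition_in:
  assumes "0 \<le> t" "t / real (Suc n) < \<delta>"
  shows "uniform_partition t n \<in> partitions t \<delta>"
proof (cases "t = 0")
  case False
  have "last (map (\<lambda>i. t * real i / real (Suc n)) [0..<n + 2]) = t"
    by (simp add: last_map)
  moreover have "hd (map (\<lambda>i. t * real i / real (Suc n)) [0..<n + 2]) = 0"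
    by (simp add: hd_map del: upt_Suc)
  moreover have "t * real (Suc i) / real (Suc n) - t * real i / real (Suc n) < \<delta>" for i
    using assms(2) by (simp add: diff_divide_distrib[symmetric] algebra_simps)
  ultimately show ?thesis using False assms
    by (auto simp: partitions_def uniform_partition_def sorted_wrt_iff_nth_less divide_strict_right_mono
        simp del: upt_Suc of_nat_Suc)
qed (auto simp: partitions_def uniform_partition_def)

lemma mesh_seq_uniform: "0 \<le> t \<Longrightarrow> mesh_seq t (uniform_partition t)"
  unfolding mesh_seq_def
proof (intro allI impI)
  fix \<delta> :: real assume t: "0 \<le> t" and d: "0 < \<delta>"
  have "(\<lambda>n. t * inverse (real (Suc n))) \<longlonglongrightarrow> t * 0"
    by (intro tendsto_mult tendsto_const LIMSEQ_inverse_real_of_nat)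
  then have "\<forall>\<^sub>F n in sequentially. t * inverse (real (Suc n)) < \<delta>"
    using d by (intro order_tendstoD(2)[of _ "0"]) auto
  then show "\<forall>\<^sub>F n in sequentially. uniform_partition t n \<in> partitions t \<delta>"
    by eventually_elim (use t uniform_partition_in in \<open>auto simp: divide_inverse\<close>)
qed

text \<open>Limits along an improper filter would not be unique; properness is witnessed by the
  uniform partitions.\<close>

lemma mesh_to_0_neq_bot: "0 \<le> t \<Longrightarrow> mesh_to_0 t \<noteq> bot"
proof
  assume t: "0 \<le> t" and "mesh_to_0 t = bot"
  then have "eventually (\<lambda>_. False) (mesh_to_0 t)" by simp
  then obtain \<delta> where d: "0 < \<delta>" "partitions t \<delta> = {}" by (auto simp: eventually_mesh_to_0)
  have "\<forall>\<^sub>F n in sequentially. uniform_partition t n \<in> partitions t \<delta>"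
    using mesh_seq_uniform[OF t] d by (auto simp: mesh_seq_def)
  with d show False by (auto simp: eventually_sequentially)
qed

lemma mesh_seq_subseq: "mesh_seq t \<pi> \<Longrightarrow> strict_mono r \<Longrightarrow> mesh_seq t (\<lambda>n. \<pi> (r n))"
  unfolding mesh_seq_def using filterlim_subseq[of r]
  by (auto simp: filterlim_iff)

subsection \<open>Limits in probability via subsequences\<close>

text \<open>No measurability is asked of \<open>L\<close>, which is usually an expression evaluated
  path by path; a measurable version is produced only on the way back to
  \<open>tendsto_in_prob\<close>. The subsequence may depend on the sequence of partitions, but not
  on the sample point.\<close>

definition subseq_limit ::
    "'a measure \<Rightarrow> real \<Rightarrow> (real list \<Rightarrow> 'a \<Rightarrow> 'b::topological_space) \<Rightarrow> ('a \<Rightarrow> 'b) \<Rightarrow> bool" where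
  "subseq_limit M t S L \<longleftrightarrow> (\<forall>\<pi>. mesh_seq t \<pi> \<longrightarrow>
     (\<exists>r. strict_mono r \<and> (AE \<omega> in M. (\<lambda>n. S (\<pi> (r n)) \<omega>) \<longlonglongrightarrow> L \<omega>)))"

lemma (in prob_space) prob_tendsto_0_if_AE_eventually_not:
  assumes A: "\<And>n. A n \<in> events" and "AE \<omega> in M. \<forall>\<^sub>F n in sequentially. \<omega> \<notin> A n"
  shows "(\<lambda>n. prob (A n)) \<longlonglongrightarrow> 0"
proof -
  have "(\<lambda>n. \<integral>\<omega>. indicator (A n) \<omega> \<partial>M) \<longlonglongrightarrow> (\<integral>\<omega>. (0::real) \<partial>M)"
  proof (rule integral_dominated_convergence[where w="\<lambda>_. 1"])
    show "AE \<omega> in M. (\<lambda>n. indicator (A n) \<omega> :: real) \<longlonglongrightarrow> 0"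
      using assms(2)
    proof eventually_elim
      case (elim \<omega>)
      then have "\<forall>\<^sub>F n in sequentially. (indicator (A n) \<omega> :: real) = 0"
        by eventually_elim auto
      then show ?case by (rule tendsto_eventually)
    qed
  qed (use A in \<open>auto simp: indicator_def\<close>)
  then show ?thesis using A by simp
qed

text \<open>Borel-Cantelli on a diagonal: the indices \<open>r k\<close> increase and are chosen
  with probability below \<open>(1/2)^k\<close>, and these bounds are summable. With
  \<open>A k n\<close> the event that the \<open>n\<close>-th error exceeds
  \<open>1 / (k + 1)\<close>, a single subsequence serves all tolerances.\<close>

lemma (in prob_space) AE_subseq_of_prob_tendsto_0:
  assumes A: "\<And>n k. A k n \<in> events" and lim: "\<And>k. (\<lambda>n. prob (A k n)) \<longlonglongrightarrow> 0"
  shows "\<exists>r::nat\<Rightarrow>nat. strict_mono r \<and> (AE \<omega> in M. \<forall>\<^sub>F n in sequentially. \<omega> \<notin> A n (r n))"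
proof -
  have ex: "\<exists>n>m. prob (A k n) < (1/2)^k" for k m
  proof -
    have "\<forall>\<^sub>F n in sequentially. prob (A k n) < (1/2)^k"
      using lim[of k] by (rule order_tendstoD) simp
    then obtain N where "\<And>n. N \<le> n \<Longrightarrow> prob (A k n) < (1/2)^k" by (auto simp: eventually_sequentially)
    then show ?thesis by (intro exI[of _ "max N (Suc m)"]) auto
  qed
  obtain r where r: "\<And>k. prob (A k (r k)) < (1/2)^k" "\<And>k. r k < r (Suc k)"
    using dependent_nat_choice[of "\<lambda>k n. prob (A k n) < (1/2)^k" "\<lambda>_ m n. m < n"] ex by (meson)
  have "strict_mono r" using r by (simp add: strict_mono_Suc_iff)
  moreover have "prob (A k (r k)) \<le> (1/2)^k" for k
    using r(1)[of k] by simp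
  then have "summable (\<lambda>k. prob (A k (r k)))"
    by (intro summable_comparison_test[of "\<lambda>k. prob (A k (r k))" "\<lambda>k. (1/2)^k"]) (auto intro: summable_geometric)
  then have "AE \<omega> in M. \<forall>\<^sub>F n in sequentially. \<omega> \<in> space M - A n (r n)"
    using A by (intro borel_cantelli_AE1) (auto simp: emeasure_eq_measure)
  then have "AE \<omega> in M. \<forall>\<^sub>F n in sequentially. \<omega> \<notin> A n (r n)"
    by eventually_elim (auto elim: eventually_mono)
  ultimately show ?thesis by blast
qed

text \<open>If the two limits differ by more than \<open>2 * e\<close>, every approximation is at
  distance above \<open>e\<close> from one of them. Both probabilities vanish along
  \<open>F\<close>, and since the filter is proper the bound passes to the limit.\<close>

lemma (in prob_space) tendsto_in_prob_unique:
  fixes L L' :: "'a \<Rightarrow> 'b::euclidean_space"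
  assumes "tendsto_in_prob M S L F" "tendsto_in_prob M S L' F" "F \<noteq> bot"
  shows "AE \<omega> in M. L \<omega> = L' \<omega>"
proof -
  have [measurable]: "L \<in> borel_measurable M" "L' \<in> borel_measurable M"
    using assms by (auto simp: tendsto_in_prob_def)
  have null: "prob {\<omega>\<in>space M. 2 * e < norm (L \<omega> - L' \<omega>)} = 0" if e: "e > 0" for e
  proof -
    let ?g = "\<lambda>L i. prob {\<omega>\<in>space M. e < norm (S i \<omega> - L \<omega>)}"
    have "((\<lambda>i. ?g L i + ?g L' i) \<longlongrightarrow> 0 + 0) F"
      using assms e by (intro tendsto_add) (auto simp: tendsto_in_prob_def)
    moreover have "\<forall>\<^sub>F i in F. prob {\<omega>\<in>space M. 2 * e < norm (L \<omega> - L' \<omega>)} \<le> ?g L i + ?g L' i"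
    proof -
      have "\<forall>\<^sub>F i in F. S i \<in> borel_measurable M" using assms by (auto simp: tendsto_in_prob_def)
      then show ?thesis
      proof eventually_elim
        case [measurable]: (elim i)
        have "2 * e < norm (L \<omega> - L' \<omega>) \<Longrightarrow> e < norm (S i \<omega> - L \<omega>) \<or> e < norm (S i \<omega> - L' \<omega>)" for \<omega>
          using norm_triangle_ineq4[of "S i \<omega> - L' \<omega>" "S i \<omega> - L \<omega>"] by auto
        then have "prob {\<omega>\<in>space M. 2 * e < norm (L \<omega> - L' \<omega>)} \<le>
          prob ({\<omega>\<in>space M. e < norm (S i \<omega> - L \<omega>)} \<union> {\<omega>\<in>space M. e < norm (S i \<omega> - L' \<omega>)})"
          by (intro finite_measure_mono) auto
        also have "\<dots> \<le> ?g L i + ?g L' i" by (intro measure_subadditive) auto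
        finally show ?case .
      qed
    qed
    ultimately have "prob {\<omega>\<in>space M. 2 * e < norm (L \<omega> - L' \<omega>)} \<le> 0 + 0"
      using tendsto_lowerbound assms(3) by blast
    then show ?thesis by (simp add: measure_le_0_iff)
  qed
  have "AE \<omega> in M. \<not> (2 * inverse (real (Suc n)) < norm (L \<omega> - L' \<omega>))" for n
    using null[of "inverse (real (Suc n))"]
    by (subst AE_iff_measurable[OF _ refl]) (auto simp: emeasure_eq_measure)
  then have "AE \<omega> in M. \<forall>n. \<not> (2 * inverse (real (Suc n)) < norm (L \<omega> - L' \<omega>))"
    by (simp add: AE_all_countable)
  then show ?thesis
  proof eventually_elim
    case (elim \<omega>)
    show ?case
    proof (rule ccontr)
      assume "L \<omega> \<noteq> L' \<omega>"
      then have "0 < norm (L \<omega> - L' \<omega>) / 2" by simp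
      from reals_Archimedean[OF this] obtain n where "inverse (real (Suc n)) < norm (L \<omega> - L' \<omega>) / 2" by auto
      with elim[rule_format, of n] show False by simp
    qed
  qed
qed

text \<open>If convergence in probability failed, there would be partitions of mesh below
  \<open>1 / (n + 1)\<close> along which the exceptional probability stays above some
  \<open>\<eta>\<close>. A subsequence of them converges almost surely, hence by dominated
  convergence in probability, a contradiction.\<close>

lemma (in prob_space) tendsto_in_prob_if_subseq_limit:
  fixes S :: "real list \<Rightarrow> 'a \<Rightarrow> 'b::euclidean_space"
  assumes t: "0 \<le> t" and meas: "\<And>ts. ts \<in> partitions t 1 \<Longrightarrow> S ts \<in> borel_measurable M"
    and lim: "subseq_limit M t S L"
  shows "\<exists>L'. tendsto_in_prob M S L' (mesh_to_0 t) \<and> (AE \<omega> in M. L' \<omega> = L \<omega>)"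
proof -
  obtain r where r: "strict_mono r" "AE \<omega> in M. (\<lambda>n. S (uniform_partition t (r n)) \<omega>) \<longlonglongrightarrow> L \<omega>"
    using lim mesh_seq_uniform[OF t] by (auto simp: subseq_limit_def)
  have "\<forall>\<^sub>F n in sequentially. uniform_partition t (r n) \<in> partitions t 1"
    using mesh_seq_subseq[OF mesh_seq_uniform[OF t] r(1)] by (auto simp: mesh_seq_def)
  then obtain n0 where n0: "\<And>n. n0 \<le> n \<Longrightarrow> uniform_partition t (r n) \<in> partitions t 1"
    by (auto simp: eventually_sequentially)
  \<comment> \<open>Taking \<open>lim\<close> of measurable functions gives a measurable limit
    although \<open>L\<close> need not be one. The shift by \<open>n0\<close> skips the indices at
    which the partition may be too coarse for \<open>meas\<close> to apply.\<close>
  define L' where "L' \<omega> = lim (\<lambda>n. S (uniform_partition t (r (n + n0))) \<omega>)" for \<omega>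
  have [measurable]: "L' \<in> borel_measurable M"
    unfolding L'_def by (intro borel_measurable_lim_metric meas n0) simp
  have eq: "AE \<omega> in M. L' \<omega> = L \<omega>"
    using r(2) unfolding L'_def by eventually_elim (intro limI LIMSEQ_ignore_initial_segment)
  have "((\<lambda>ts. prob {\<omega>\<in>space M. e < norm (S ts \<omega> - L' \<omega>)}) \<longlongrightarrow> 0) (mesh_to_0 t)" if e: "e > 0" for e
  proof (rule ccontr)
    let ?p = "\<lambda>ts. prob {\<omega>\<in>space M. e < norm (S ts \<omega> - L' \<omega>)}"
    assume "\<not> ?thesis"
    then obtain \<eta> where \<eta>: "\<eta> > 0" "\<not> (\<forall>\<^sub>F ts in mesh_to_0 t. ?p ts < \<eta>)"
      unfolding tendsto_iff by (auto simp: dist_norm)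
    have "\<exists>ts\<in>partitions t (inverse (real (Suc n))). \<eta> \<le> ?p ts" for n
      using \<eta>(2) unfolding eventually_mesh_to_0
      by (metis inverse_positive_iff_positive not_le of_nat_0_less_iff zero_less_Suc)
    then obtain \<pi> where \<pi>: "\<And>n. \<pi> n \<in> partitions t (inverse (real (Suc n)))" "\<And>n. \<eta> \<le> ?p (\<pi> n)"
      by metis
    have "mesh_seq t \<pi>" unfolding mesh_seq_def
    proof (intro allI impI)
      fix d :: real assume "0 < d"
      then have "\<forall>\<^sub>F n in sequentially. inverse (real (Suc n)) < d"
        by (intro order_tendstoD(2)[OF LIMSEQ_inverse_real_of_nat])
      then show "\<forall>\<^sub>F n in sequentially. \<pi> n \<in> partitions t d"
        by eventually_elim (use \<pi>(1) partitions_mono less_imp_le in blast)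
    qed
    then obtain q where q: "strict_mono q" "AE \<omega> in M. (\<lambda>n. S (\<pi> (q n)) \<omega>) \<longlonglongrightarrow> L \<omega>"
      using lim by (auto simp: subseq_limit_def)
    have [measurable]: "S (\<pi> n) \<in> borel_measurable M" for n
      using \<pi>(1)[of n] partitions_mono[of "inverse (real (Suc n))" 1 t]
      by (intro meas) (auto simp: inverse_eq_divide)
    have "(\<lambda>n. ?p (\<pi> (q n))) \<longlonglongrightarrow> 0"
    proof (rule prob_tendsto_0_if_AE_eventually_not)
      show "AE \<omega> in M. \<forall>\<^sub>F n in sequentially. \<omega> \<notin> {\<omega>\<in>space M. e < norm (S (\<pi> (q n)) \<omega> - L' \<omega>)}"
        using q(2) eq
      proof eventually_elim
        case (elim \<omega>)
        then have "\<forall>\<^sub>F n in sequentially. dist (S (\<pi> (q n)) \<omega>) (L' \<omega>) < e"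
          using e by (intro tendstoD) simp_all
        then show ?case by eventually_elim (auto simp: dist_norm)
      qed
    qed measurable
    then have "\<eta> \<le> 0" by (rule LIMSEQ_le_const) (use \<pi>(2) in auto)
    with \<eta> show False by simp
  qed
  moreover have "\<forall>\<^sub>F ts in mesh_to_0 t. S ts \<in> borel_measurable M"
    unfolding eventually_mesh_to_0 using meas by (intro exI[of _ 1]) auto
  ultimately have "tendsto_in_prob M S L' (mesh_to_0 t)"
    by (auto simp: tendsto_in_prob_def)
  with eq show ?thesis by blast
qed

text \<open>The choice made by \<open>SOME\<close> is known only up to a null set: existence makes
  it a limit at all, and uniqueness along a proper filter identifies it with \<open>L\<close> almost
  surely.\<close>

lemma (in prob_space) SOME_tendsto_in_prob:
  fixes S :: "real list \<Rightarrow> 'a \<Rightarrow> 'b::euclidean_space"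
  assumes t: "0 \<le> t" and meas: "\<And>ts. ts \<in> partitions t 1 \<Longrightarrow> S ts \<in> borel_measurable M"
    and lim: "subseq_limit M t S L"
  defines "I \<equiv> SOME L. tendsto_in_prob M S L (mesh_to_0 t)"
  shows "I \<in> borel_measurable M" "AE \<omega> in M. I \<omega> = L \<omega>"
proof -
  obtain L' where L': "tendsto_in_prob M S L' (mesh_to_0 t)" "AE \<omega> in M. L' \<omega> = L \<omega>"
    using tendsto_in_prob_if_subseq_limit[OF assms(1-3)] by blast
  from L'(1) have I: "tendsto_in_prob M S I (mesh_to_0 t)"
    unfolding I_def by (rule someI[of "\<lambda>L. tendsto_in_prob M S L (mesh_to_0 t)"])
  then show "I \<in> borel_measurable M" by (simp add: tendsto_in_prob_def)
  show "AE \<omega> in M. I \<omega> = L \<omega>"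
    using tendsto_in_prob_unique[OF I L'(1) mesh_to_0_neq_bot[OF t]] L'(2)
    by eventually_elim simp
qed

lemmas (in prob_space) forward_integral_limit =
  SOME_tendsto_in_prob[where S="forward_sum b \<phi> \<psi>" for b \<phi> \<psi>, folded forward_integral_def]

lemmas (in prob_space) bracket_limit =
  SOME_tendsto_in_prob[where S="bracket_sum \<phi> \<psi>" for \<phi> \<psi>, folded bracket_def]

subsection \<open>Sums of martingale differences\<close>

lemma (in prob_space) integrable_of_square:
  fixes f :: "'a \<Rightarrow> real"
  assumes [measurable]: "f \<in> borel_measurable M" and f2: "integrable M (\<lambda>\<omega>. (f \<omega>)\<^sup>2)"
  shows "integrable M f"
proof (rule Bochner_Integration.integrable_bound[of M "\<lambda>\<omega>. 1 + (f \<omega>)\<^sup>2"])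
  have "\<bar>f \<omega>\<bar> \<le> 1 + (f \<omega>)\<^sup>2" for \<omega>
  proof -
    have "0 \<le> (\<bar>f \<omega>\<bar> - 1)\<^sup>2" by simp
    also have "\<dots> = (f \<omega>)\<^sup>2 - 2 * \<bar>f \<omega>\<bar> + 1"
      by (simp add: power2_eq_square algebra_simps)
    finally show ?thesis by (smt (verit) zero_le_power2)
  qed
  then show "AE \<omega> in M. norm (f \<omega>) \<le> norm (1 + (f \<omega>)\<^sup>2)" by simp
qed (use f2 in auto)

text \<open>The partial sum times the next coefficient is measurable with respect to
  \<open>F l\<close>, hence independent of the centred \<open>\<zeta> l\<close>, so the cross term
  in the square has mean zero. Independence takes the place of conditional expectations; boundedness
  of the coefficients makes all products integrable.\<close>

lemma (in prob_space) martingale_difference_second_moment: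
  fixes \<beta> \<zeta> :: "nat \<Rightarrow> 'a \<Rightarrow> real" and v :: "nat \<Rightarrow> real"
  assumes sub: "\<And>i j. i \<le> j \<Longrightarrow> j \<le> n \<Longrightarrow> subalgebra (F j) (F i)" "subalgebra M (F n)"
    and \<beta>: "\<And>i. i < n \<Longrightarrow> \<beta> i \<in> borel_measurable (F i)" "\<And>i \<omega>. i < n \<Longrightarrow> \<bar>\<beta> i \<omega>\<bar> \<le> c"
    and \<zeta>: "\<And>i. i < n \<Longrightarrow> \<zeta> i \<in> borel_measurable (F (Suc i))"
    and indep: "\<And>i g. i < n \<Longrightarrow> g \<in> borel_measurable (F i) \<Longrightarrow> indep_var borel g borel (\<zeta> i)"
    and mean: "\<And>i. i < n \<Longrightarrow> expectation (\<zeta> i) = 0"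
    and sq: "\<And>i. i < n \<Longrightarrow> integrable M (\<lambda>\<omega>. (\<zeta> i \<omega>)\<^sup>2)"
      "\<And>i. i < n \<Longrightarrow> expectation (\<lambda>\<omega>. (\<zeta> i \<omega>)\<^sup>2) \<le> v i"
    and l: "l \<le> n"
  shows "(\<lambda>\<omega>. \<Sum>i<l. \<beta> i \<omega> * \<zeta> i \<omega>) \<in> borel_measurable (F l) \<and>
    integrable M (\<lambda>\<omega>. (\<Sum>i<l. \<beta> i \<omega> * \<zeta> i \<omega>)\<^sup>2) \<and>
    expectation (\<lambda>\<omega>. (\<Sum>i<l. \<beta> i \<omega> * \<zeta> i \<omega>)\<^sup>2) \<le> c\<^sup>2 * (\<Sum>i<l. v i)"
  using l
proof (induction l)
  case (Suc l)
  define S where "S \<omega> = (\<Sum>i<l. \<beta> i \<omega> * \<zeta> i \<omega>)" for \<omega>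
  have ln: "l < n" using Suc by simp
  from Suc have IH: "S \<in> borel_measurable (F l)" "integrable M (\<lambda>\<omega>. (S \<omega>)\<^sup>2)"
    "expectation (\<lambda>\<omega>. (S \<omega>)\<^sup>2) \<le> c\<^sup>2 * (\<Sum>i<l. v i)" unfolding S_def[abs_def] by auto
  have toM: "f \<in> borel_measurable (F i) \<Longrightarrow> i \<le> n \<Longrightarrow> f \<in> borel_measurable M" for f :: "'a \<Rightarrow> real" and i
    by (rule measurable_from_subalg[OF sub(2) measurable_from_subalg[OF sub(1)[of i n]]]) auto
  have up: "f \<in> borel_measurable (F l) \<Longrightarrow> f \<in> borel_measurable (F (Suc l))" for f :: "'a \<Rightarrow> real"
    by (rule measurable_from_subalg[OF sub(1)[of l "Suc l"]]) (use ln in auto)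
  note bm = \<beta>(1)[OF ln] and zm = \<zeta>[OF ln]
  have [measurable]: "S \<in> borel_measurable M" "\<beta> l \<in> borel_measurable M" "\<zeta> l \<in> borel_measurable M"
    using toM[OF IH(1)] toM[OF bm] toM[OF zm] ln by simp_all
  have b: "\<bar>\<beta> l \<omega>\<bar> \<le> c" for \<omega> using \<beta>(2) ln by auto
  have intS: "integrable M S" by (rule integrable_of_square) (use IH in auto)
  have intz: "integrable M (\<zeta> l)" by (rule integrable_of_square) (use sq ln in auto)
  have intSb: "integrable M (\<lambda>\<omega>. S \<omega> * \<beta> l \<omega>)"
    by (rule Bochner_Integration.integrable_bound[of M "\<lambda>\<omega>. c * S \<omega>"])
      (use intS in \<open>auto simp: abs_mult mult.commute[of "\<bar>S _\<bar>"] intro!: mult_right_mono order_trans[OF b abs_ge_self]\<close>)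
  have b2: "(\<beta> l \<omega>)\<^sup>2 \<le> c\<^sup>2" for \<omega> using b[of \<omega>] by (simp add: abs_le_square_iff[symmetric])
  have intb2: "integrable M (\<lambda>\<omega>. (\<beta> l \<omega>)\<^sup>2)"
    by (rule integrable_const_bound[where B="c\<^sup>2"]) (use b2 in auto)
  have ind1: "indep_var borel (\<lambda>\<omega>. S \<omega> * \<beta> l \<omega>) borel (\<zeta> l)"
    by (rule indep[OF ln]) (intro borel_measurable_times IH bm)
  have "indep_var borel (\<lambda>\<omega>. (\<beta> l \<omega>)\<^sup>2) borel (\<zeta> l)"
    by (rule indep[OF ln]) (intro borel_measurable_power bm)
  from indep_var_compose[OF this, of "\<lambda>x. x" borel "\<lambda>x. x\<^sup>2" borel]
  have ind2: "indep_var borel (\<lambda>\<omega>. (\<beta> l \<omega>)\<^sup>2) borel (\<lambda>\<omega>. (\<zeta> l \<omega>)\<^sup>2)"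
    by (simp add: comp_def)
  have eq: "(\<Sum>i<Suc l. \<beta> i \<omega> * \<zeta> i \<omega>)\<^sup>2
      = (S \<omega>)\<^sup>2 + 2 * ((S \<omega> * \<beta> l \<omega>) * \<zeta> l \<omega>) + (\<beta> l \<omega>)\<^sup>2 * (\<zeta> l \<omega>)\<^sup>2" for \<omega>
    by (simp add: S_def power2_eq_square algebra_simps)
  have int1: "integrable M (\<lambda>\<omega>. (S \<omega> * \<beta> l \<omega>) * \<zeta> l \<omega>)"
    by (rule indep_var_integrable[OF ind1 intSb intz])
  have int2: "integrable M (\<lambda>\<omega>. (\<beta> l \<omega>)\<^sup>2 * (\<zeta> l \<omega>)\<^sup>2)"
    by (rule indep_var_integrable[OF ind2 intb2 sq(1)[OF ln]])
  have e1: "expectation (\<lambda>\<omega>. (S \<omega> * \<beta> l \<omega>) * \<zeta> l \<omega>) = 0"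
    using indep_var_lebesgue_integral[OF ind1 intSb intz] mean[OF ln] by simp
  have "expectation (\<lambda>\<omega>. (\<beta> l \<omega>)\<^sup>2 * (\<zeta> l \<omega>)\<^sup>2)
      = expectation (\<lambda>\<omega>. (\<beta> l \<omega>)\<^sup>2) * expectation (\<lambda>\<omega>. (\<zeta> l \<omega>)\<^sup>2)"
    by (rule indep_var_lebesgue_integral[OF ind2 intb2 sq(1)[OF ln]])
  also have "\<dots> \<le> c\<^sup>2 * v l"
  proof (rule mult_mono)
    have "expectation (\<lambda>\<omega>. (\<beta> l \<omega>)\<^sup>2) \<le> expectation (\<lambda>\<omega>. c\<^sup>2)"
      by (rule integral_mono) (use intb2 b2 in auto)
    then show "expectation (\<lambda>\<omega>. (\<beta> l \<omega>)\<^sup>2) \<le> c\<^sup>2" by (simp add: prob_space)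
  qed (use sq(2)[OF ln] in auto)
  finally have e2: "expectation (\<lambda>\<omega>. (\<beta> l \<omega>)\<^sup>2 * (\<zeta> l \<omega>)\<^sup>2) \<le> c\<^sup>2 * v l" .
  have "expectation (\<lambda>\<omega>. (\<Sum>i<Suc l. \<beta> i \<omega> * \<zeta> i \<omega>)\<^sup>2) \<le> c\<^sup>2 * (\<Sum>i<Suc l. v i)"
    unfolding eq using IH(2,3) int1 int2 e1 e2 by (simp add: distrib_left)
  moreover have "integrable M (\<lambda>\<omega>. (\<Sum>i<Suc l. \<beta> i \<omega> * \<zeta> i \<omega>)\<^sup>2)"
    unfolding eq using IH(2) int1 int2 by simp
  moreover have "(\<lambda>\<omega>. \<Sum>i<Suc l. \<beta> i \<omega> * \<zeta> i \<omega>) \<in> borel_measurable (F (Suc l))"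
    using borel_measurable_add[OF up[OF IH(1)] borel_measurable_times[OF up[OF bm] zm]]
    by (simp add: S_def)
  ultimately show ?case by blast
qed simp

text \<open>Kolmogorov's maximal inequality, with the coefficients truncated at the level \<open>c\<close>: stopping
  the sum when it first exceeds \<open>\<epsilon>\<close> keeps it a sum of martingale differences.\<close>

lemma (in prob_space) maximal_inequality_truncated:
  fixes \<beta> \<zeta> :: "nat \<Rightarrow> 'a \<Rightarrow> real" and v :: "nat \<Rightarrow> real"
  assumes sub: "\<And>i j. i \<le> j \<Longrightarrow> j \<le> n \<Longrightarrow> subalgebra (F j) (F i)" "subalgebra M (F n)"
    and \<beta>: "\<And>i. i < n \<Longrightarrow> \<beta> i \<in> borel_measurable (F i)"
    and \<zeta>: "\<And>i. i < n \<Longrightarrow> \<zeta> i \<in> borel_measurable (F (Suc i))"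
    and indep: "\<And>i g. i < n \<Longrightarrow> g \<in> borel_measurable (F i) \<Longrightarrow> indep_var borel g borel (\<zeta> i)"
    and mean: "\<And>i. i < n \<Longrightarrow> expectation (\<zeta> i) = 0"
    and sq: "\<And>i. i < n \<Longrightarrow> integrable M (\<lambda>\<omega>. (\<zeta> i \<omega>)\<^sup>2)"
      "\<And>i. i < n \<Longrightarrow> expectation (\<lambda>\<omega>. (\<zeta> i \<omega>)\<^sup>2) \<le> v i"
    and \<epsilon>: "0 < \<epsilon>" and c: "0 \<le> c"
  shows "prob {\<omega>\<in>space M. \<exists>l\<le>n. \<epsilon> < \<bar>\<Sum>i<l. \<beta> i \<omega> * \<zeta> i \<omega>\<bar>}
    \<le> prob {\<omega>\<in>space M. \<exists>i<n. c < \<bar>\<beta> i \<omega>\<bar>} + c\<^sup>2 * (\<Sum>i<n. v i) / \<epsilon>\<^sup>2"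
proof -
  define S where "S l \<omega> = (\<Sum>i<l. \<beta> i \<omega> * \<zeta> i \<omega>)" for l \<omega>
  \<comment> \<open>Both conditions are decided by \<open>F i\<close>, so the modified coefficient
    is still adapted, and it is bounded by \<open>c\<close> whatever \<open>\<beta>\<close>
    does.\<close>
  define \<beta>' where "\<beta>' i \<omega> = (if \<bar>\<beta> i \<omega>\<bar> \<le> c \<and> (\<forall>k\<in>{..i}. \<bar>S k \<omega>\<bar> \<le> \<epsilon>) then \<beta> i \<omega> else 0)" for i \<omega>
  define T where "T \<omega> = (\<Sum>i<n. \<beta>' i \<omega> * \<zeta> i \<omega>)" for \<omega>
  have mono: "f \<in> borel_measurable (F i) \<Longrightarrow> i \<le> j \<Longrightarrow> j \<le> n \<Longrightarrow> f \<in> borel_measurable (F j)"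
    for f :: "'a \<Rightarrow> real" and i j
    by (rule measurable_from_subalg[OF sub(1)[of i j]])
  have toM: "f \<in> borel_measurable (F i) \<Longrightarrow> i \<le> n \<Longrightarrow> f \<in> borel_measurable M" for f :: "'a \<Rightarrow> real" and i
    by (rule measurable_from_subalg[OF sub(2) mono[of f i n]]) auto
  have Sm: "S l \<in> borel_measurable (F l)" if "l \<le> n" for l
    unfolding S_def[abs_def] using that
    by (intro borel_measurable_sum borel_measurable_times mono[OF \<beta>] mono[OF \<zeta>]) auto
  have \<beta>'m: "\<beta>' i \<in> borel_measurable (F i)" if i: "i < n" for i
  proof -
    have [measurable]: "S k \<in> borel_measurable (F i)" if "k \<le> i" for k
      using that i by (intro mono[OF Sm]) auto
    have [measurable]: "\<beta> i \<in> borel_measurable (F i)" using \<beta> i by auto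
    have m2: "Measurable.pred (F i) (\<lambda>\<omega>. \<forall>k\<in>{..i}. \<bar>S k \<omega>\<bar> \<le> \<epsilon>)"
      by (intro pred_intros_finite) auto
    show ?thesis unfolding \<beta>'_def[abs_def] using m2 by measurable
  qed
  have \<beta>'b: "\<bar>\<beta>' i \<omega>\<bar> \<le> c" for i \<omega> using c by (auto simp: \<beta>'_def)
  have [measurable]: "S l \<in> borel_measurable M" if "l \<le> n" for l
    by (rule toM[OF Sm[OF that] that])
  have [measurable]: "\<beta> i \<in> borel_measurable M" if "i < n" for i
    by (rule toM[OF \<beta>[OF that] less_imp_le[OF that]])
  have T: "T \<in> borel_measurable (F n)" "integrable M (\<lambda>\<omega>. (T \<omega>)\<^sup>2)"
    "expectation (\<lambda>\<omega>. (T \<omega>)\<^sup>2) \<le> c\<^sup>2 * (\<Sum>i<n. v i)"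
    using martingale_difference_second_moment[OF sub \<beta>'m \<beta>'b \<zeta> indep mean sq order_refl]
    unfolding T_def[abs_def] by blast+
  have [measurable]: "T \<in> borel_measurable M" by (rule toM[OF T(1)]) simp
  have ex_le: "(\<exists>l\<le>n. P l) \<longleftrightarrow> (\<exists>l\<in>{..n}. P l)" "(\<exists>l<n. P l) \<longleftrightarrow> (\<exists>l\<in>{..<n}. P l)" for P by auto
  have A: "{\<omega>\<in>space M. \<exists>i<n. c < \<bar>\<beta> i \<omega>\<bar>} \<in> events"
    unfolding ex_le by measurable
  have "{\<omega>\<in>space M. \<exists>l\<le>n. \<epsilon> < \<bar>S l \<omega>\<bar>}
      \<subseteq> {\<omega>\<in>space M. \<exists>i<n. c < \<bar>\<beta> i \<omega>\<bar>} \<union> {\<omega>\<in>space M. \<epsilon>\<^sup>2 \<le> (T \<omega>)\<^sup>2}"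
  proof (intro subsetI)
    fix \<omega> assume "\<omega> \<in> {\<omega>\<in>space M. \<exists>l\<le>n. \<epsilon> < \<bar>S l \<omega>\<bar>}"
    then have sp: "\<omega> \<in> space M" and ex: "\<exists>l. l \<le> n \<and> \<epsilon> < \<bar>S l \<omega>\<bar>" by auto
    \<comment> \<open>At the first index where the sum exceeds \<open>\<epsilon>\<close> the stopped
      sum is frozen: coefficients before \<open>l\<close> are kept, those from \<open>l\<close> on
      are cut because the condition at \<open>k = l\<close> fails. Hence \<open>T\<close> equals
      \<open>S l\<close> unless some coefficient was truncated.\<close>
    define l where "l = (LEAST l. l \<le> n \<and> \<epsilon> < \<bar>S l \<omega>\<bar>)"
    have l: "l \<le> n" "\<epsilon> < \<bar>S l \<omega>\<bar>" using LeastI_ex[OF ex] by (auto simp: l_def)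
    have less: "\<bar>S k \<omega>\<bar> \<le> \<epsilon>" if "k < l" for k
      using not_less_Least[of k "\<lambda>l. l \<le> n \<and> \<epsilon> < \<bar>S l \<omega>\<bar>"] that l by (auto simp: l_def)
    show "\<omega> \<in> {\<omega>\<in>space M. \<exists>i<n. c < \<bar>\<beta> i \<omega>\<bar>} \<union> {\<omega>\<in>space M. \<epsilon>\<^sup>2 \<le> (T \<omega>)\<^sup>2}"
    proof (cases "\<exists>i<n. c < \<bar>\<beta> i \<omega>\<bar>")
      case False
      then have bc: "\<bar>\<beta> i \<omega>\<bar> \<le> c" if "i < n" for i using that by auto
      have "T \<omega> = (\<Sum>i<n. if i < l then \<beta> i \<omega> * \<zeta> i \<omega> else 0)"
        unfolding T_def
      proof (rule sum.cong[OF refl])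
        fix i assume "i \<in> {..<n}"
        then show "\<beta>' i \<omega> * \<zeta> i \<omega> = (if i < l then \<beta> i \<omega> * \<zeta> i \<omega> else 0)"
          using bc[of i] less[of _] l by (cases "i < l") (auto simp: \<beta>'_def not_less not_le dest!: bspec[where x=l])
      qed
      also have "\<dots> = sum (\<lambda>i. \<beta> i \<omega> * \<zeta> i \<omega>) ({..<n} \<inter> {i. i < l})"
        by (subst sum.inter_restrict) auto
      also have "{..<n} \<inter> {i. i < l} = {..<l}" using l by auto
      finally have "T \<omega> = S l \<omega>" by (simp add: S_def)
      with l \<epsilon> have "\<epsilon>\<^sup>2 \<le> (T \<omega>)\<^sup>2" by (simp add: abs_le_square_iff[symmetric])
      with sp show ?thesis by auto
    qed (use sp in auto)
  qed
  then have "prob {\<omega>\<in>space M. \<exists>l\<le>n. \<epsilon> < \<bar>S l \<omega>\<bar>}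
      \<le> prob ({\<omega>\<in>space M. \<exists>i<n. c < \<bar>\<beta> i \<omega>\<bar>} \<union> {\<omega>\<in>space M. \<epsilon>\<^sup>2 \<le> (T \<omega>)\<^sup>2})"
    by (intro finite_measure_mono) (use A in auto)
  also have "\<dots> \<le> prob {\<omega>\<in>space M. \<exists>i<n. c < \<bar>\<beta> i \<omega>\<bar>} + prob {\<omega>\<in>space M. \<epsilon>\<^sup>2 \<le> (T \<omega>)\<^sup>2}"
    by (intro measure_subadditive) (use A in auto)
  also have "prob {\<omega>\<in>space M. \<epsilon>\<^sup>2 \<le> (T \<omega>)\<^sup>2} \<le> expectation (\<lambda>\<omega>. (T \<omega>)\<^sup>2) / \<epsilon>\<^sup>2"
    by (rule integral_Markov_inequality_measure[where A="space M"]) (use T \<epsilon> in auto)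
  also have "\<dots> \<le> c\<^sup>2 * (\<Sum>i<n. v i) / \<epsilon>\<^sup>2"
    by (rule divide_right_mono[OF T(3)]) simp
  finally show ?thesis by (simp add: S_def)
qed

subsection \<open>Wiener processes relative to an enlarged filtration\<close>

text \<open>The filtration is a parameter and not the one generated by \<open>W\<close>: it is to
  contain further information independent of the noise. Independence is required of real functions
  \<open>g\<close> and \<open>h\<close> rather than of algebras, the form in which the estimates for
  martingale differences consume it.\<close>

locale wiener_filtration = prob_space M for M :: "'a measure" +
  fixes T :: real and G :: "real \<Rightarrow> 'a measure" and R :: "real^'m^'m" and W :: "real \<Rightarrow> 'a \<Rightarrow> real^'m"
  assumes subalgebra_G: "\<And>s t. 0 \<le> s \<Longrightarrow> s \<le> t \<Longrightarrow> t \<le> T \<Longrightarrow> subalgebra (G t) (G s)"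
    and subalgebra_M: "\<And>t. 0 \<le> t \<Longrightarrow> t \<le> T \<Longrightarrow> subalgebra M (G t)"
    and W_measurable_G: "\<And>t. 0 \<le> t \<Longrightarrow> t \<le> T \<Longrightarrow> W t \<in> borel_measurable (G t)"
    and W_continuous: "\<And>\<omega>. \<omega> \<in> space M \<Longrightarrow> continuous_on {0..T} (\<lambda>t. W t \<omega>)"
    and increment_indep: "\<And>s t (g :: 'a \<Rightarrow> real) (h :: real^'m \<Rightarrow> real). 0 \<le> s \<Longrightarrow> s < t \<Longrightarrow> t \<le> T \<Longrightarrow>
      g \<in> borel_measurable (G s) \<Longrightarrow> h \<in> borel_measurable borel \<Longrightarrow>
      indep_var borel g borel (\<lambda>\<omega>. h (W t \<omega> - W s \<omega>))"
    and increment_normal: "\<And>s t c. 0 \<le> s \<Longrightarrow> s < t \<Longrightarrow> t \<le> T \<Longrightarrow> c \<noteq> 0 \<Longrightarrow>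
      distributed M lborel (\<lambda>\<omega>. c \<bullet> (W t \<omega> - W s \<omega>)) (normal_density 0 (sqrt ((t - s) * (c \<bullet> (R *v c)))))"
    and R_pos_def: "pos_def_matrix R"
begin

lemma measurable_G_mono:
  "f \<in> measurable (G s) N \<Longrightarrow> 0 \<le> s \<Longrightarrow> s \<le> t \<Longrightarrow> t \<le> T \<Longrightarrow> f \<in> measurable (G t) N"
  using measurable_from_subalg[OF subalgebra_G] by blast

lemma measurable_G_M:
  "f \<in> measurable (G s) N \<Longrightarrow> 0 \<le> s \<Longrightarrow> s \<le> T \<Longrightarrow> f \<in> measurable M N"
  using measurable_from_subalg[OF subalgebra_M] by blast

lemma W_measurable: "0 \<le> t \<Longrightarrow> t \<le> T \<Longrightarrow> W t \<in> borel_measurable M"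
  using W_measurable_G measurable_G_M by blast

text \<open>Gaussian moments of one-dimensional projections. The direction \<open>c = 0\<close> is
  settled separately, since the projection then vanishes and has no normal density.\<close>

lemma increment_linear:
  assumes st: "0 \<le> s" "s < t" "t \<le> T"
  shows "integrable M (\<lambda>\<omega>. (c \<bullet> (W t \<omega> - W s \<omega>))\<^sup>2)"
    "expectation (\<lambda>\<omega>. c \<bullet> (W t \<omega> - W s \<omega>)) = 0"
    "expectation (\<lambda>\<omega>. (c \<bullet> (W t \<omega> - W s \<omega>))\<^sup>2) = (t - s) * (c \<bullet> (R *v c))"
    "integrable M (\<lambda>\<omega>. (c \<bullet> (W t \<omega> - W s \<omega>))^4)"
    "expectation (\<lambda>\<omega>. (c \<bullet> (W t \<omega> - W s \<omega>))^4) = 3 * ((t - s) * (c \<bullet> (R *v c)))\<^sup>2"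
proof -
  define \<sigma> where "\<sigma> = sqrt ((t - s) * (c \<bullet> (R *v c)))"
  have all: "integrable M (\<lambda>\<omega>. (c \<bullet> (W t \<omega> - W s \<omega>))\<^sup>2) \<and>
    expectation (\<lambda>\<omega>. c \<bullet> (W t \<omega> - W s \<omega>)) = 0 \<and>
    expectation (\<lambda>\<omega>. (c \<bullet> (W t \<omega> - W s \<omega>))\<^sup>2) = (t - s) * (c \<bullet> (R *v c)) \<and>
    integrable M (\<lambda>\<omega>. (c \<bullet> (W t \<omega> - W s \<omega>))^4) \<and>
    expectation (\<lambda>\<omega>. (c \<bullet> (W t \<omega> - W s \<omega>))^4) = 3 * ((t - s) * (c \<bullet> (R *v c)))\<^sup>2"
  proof (cases "c = 0")
    case False
    then have "0 < c \<bullet> (R *v c)" using R_pos_def by (auto simp: pos_def_matrix_def)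
    then have pos: "0 < (t - s) * (c \<bullet> (R *v c))" using st by simp
    then have \<sigma>: "0 < \<sigma>" "\<sigma>\<^sup>2 = (t - s) * (c \<bullet> (R *v c))" by (auto simp: \<sigma>_def)
    have D: "distributed M lborel (\<lambda>\<omega>. c \<bullet> (W t \<omega> - W s \<omega>)) (normal_density 0 \<sigma>)"
      unfolding \<sigma>_def by (rule increment_normal[OF st False])
    have mom: "integrable M (\<lambda>\<omega>. (c \<bullet> (W t \<omega> - W s \<omega>))^k) \<and>
        expectation (\<lambda>\<omega>. (c \<bullet> (W t \<omega> - W s \<omega>))^k) = m"
      if "has_bochner_integral lborel (\<lambda>x. normal_density 0 \<sigma> x * (x - 0)^k) m" for k m
    proof -
      have p: "(\<lambda>x. x^k) \<in> borel_measurable (lborel :: real measure)" by simp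
      show ?thesis
        using that distributed_integrable[OF D p] distributed_integral[OF D p]
        by (auto simp: has_bochner_integral_iff)
    qed
    \<comment> \<open>The right-hand side is the fourth moment of a centred normal variable, three
      times the square of its variance, recovered from the general formula for even moments.\<close>
    have eq4: "fact (2 * 2) / ((2 / \<sigma>\<^sup>2)^2 * fact 2) = 3 * (\<sigma>\<^sup>2)\<^sup>2"
      using \<sigma>(1) by (simp add: fact_numeral field_simps power2_eq_square)
    note eq4 = eq4[unfolded \<sigma>(2)]
    have eq2: "fact (2 * 1) / ((2 / \<sigma>\<^sup>2)^1 * fact 1) = \<sigma>\<^sup>2"
      using \<sigma>(1) by (simp add: field_simps)
    show ?thesis
      using mom[OF normal_moment_odd[OF \<sigma>(1), of 0 0]] mom[OF normal_moment_even[OF \<sigma>(1), of 0 1]]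
        mom[OF normal_moment_even[OF \<sigma>(1), of 0 2]] unfolding eq2 \<sigma>(2) eq4 by simp
  qed simp
  then show "integrable M (\<lambda>\<omega>. (c \<bullet> (W t \<omega> - W s \<omega>))\<^sup>2)"
    "expectation (\<lambda>\<omega>. c \<bullet> (W t \<omega> - W s \<omega>)) = 0"
    "expectation (\<lambda>\<omega>. (c \<bullet> (W t \<omega> - W s \<omega>))\<^sup>2) = (t - s) * (c \<bullet> (R *v c))"
    "integrable M (\<lambda>\<omega>. (c \<bullet> (W t \<omega> - W s \<omega>))^4)"
    "expectation (\<lambda>\<omega>. (c \<bullet> (W t \<omega> - W s \<omega>))^4) = 3 * ((t - s) * (c \<bullet> (R *v c)))\<^sup>2"
    by blast+
qed

text \<open>With variance \<open>m\<close> the fourth moment is \<open>3 * m\<^sup>2\<close>, so the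
  centred square has variance \<open>3 * m\<^sup>2 - 2 * m\<^sup>2 + m\<^sup>2\<close>, quadratic in
  the step length. This is why sums of these terms are small even with coefficients that are merely
  bounded along each trajectory.\<close>

lemma increment_quadratic:
  fixes c
  assumes st: "0 \<le> s" "s < t" "t \<le> T"
  defines "\<zeta> \<equiv> \<lambda>\<omega>. (c \<bullet> (W t \<omega> - W s \<omega>))\<^sup>2 - (t - s) * (c \<bullet> (R *v c))"
  shows "integrable M (\<lambda>\<omega>. (\<zeta> \<omega>)\<^sup>2)" "expectation \<zeta> = 0"
    "expectation (\<lambda>\<omega>. (\<zeta> \<omega>)\<^sup>2) = 2 * ((t - s) * (c \<bullet> (R *v c)))\<^sup>2"
proof -
  define m where "m = (t - s) * (c \<bullet> (R *v c))"
  note L = increment_linear[OF st, of c, folded m_def]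
  have eq: "(\<zeta> \<omega>)\<^sup>2 = (c \<bullet> (W t \<omega> - W s \<omega>))^4 - 2 * m * (c \<bullet> (W t \<omega> - W s \<omega>))\<^sup>2 + m\<^sup>2" for \<omega>
    unfolding \<zeta>_def m_def[symmetric] by (simp add: power2_eq_square algebra_simps power4_eq_xxxx)
  show "integrable M (\<lambda>\<omega>. (\<zeta> \<omega>)\<^sup>2)" unfolding eq using L by simp
  show "expectation \<zeta> = 0" unfolding \<zeta>_def m_def[symmetric] using L by (simp add: prob_space)
  show "expectation (\<lambda>\<omega>. (\<zeta> \<omega>)\<^sup>2) = 2 * ((t - s) * (c \<bullet> (R *v c)))\<^sup>2"
    unfolding eq m_def[symmetric] using L by (simp add: prob_space power2_eq_square)
qed

text \<open>The truncation level \<open>c n\<close> may vary with \<open>n\<close>: it has to be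
  high enough to be exceeded only with vanishing probability, and low enough to keep
  \<open>(c n)\<^sup>2\<close> times the total variance below \<open>\<eta>\<close>. The function
  \<open>q\<close> covers linear functionals of the increments as well as centred quadratic
  ones.\<close>

lemma martingale_sums_small:
  fixes \<rho> :: "nat \<Rightarrow> real list" and \<beta> :: "nat \<Rightarrow> nat \<Rightarrow> 'a \<Rightarrow> real"
    and q :: "real \<Rightarrow> real \<Rightarrow> real^'m \<Rightarrow> real" and v :: "real \<Rightarrow> real \<Rightarrow> real"
  assumes \<rho>: "\<And>n. sorted_wrt (<) (\<rho> n)" "\<And>n. set (\<rho> n) \<subseteq> {0..T}"
    and q: "\<And>s t. q s t \<in> borel_measurable borel"
      "\<And>s t. 0 \<le> s \<Longrightarrow> s < t \<Longrightarrow> t \<le> T \<Longrightarrow> integrable M (\<lambda>\<omega>. (q s t (W t \<omega> - W s \<omega>))\<^sup>2)"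
      "\<And>s t. 0 \<le> s \<Longrightarrow> s < t \<Longrightarrow> t \<le> T \<Longrightarrow> expectation (\<lambda>\<omega>. q s t (W t \<omega> - W s \<omega>)) = 0"
      "\<And>s t. 0 \<le> s \<Longrightarrow> s < t \<Longrightarrow> t \<le> T \<Longrightarrow> expectation (\<lambda>\<omega>. (q s t (W t \<omega> - W s \<omega>))\<^sup>2) \<le> v s t"
    and \<beta>: "\<And>n i. i < length (\<rho> n) - 1 \<Longrightarrow> \<beta> n i \<in> borel_measurable (G (\<rho> n ! i))"
    and small: "\<And>\<eta>::real. 0 < \<eta> \<Longrightarrow> \<exists>c::nat \<Rightarrow> real. (\<forall>n. 0 \<le> c n) \<and>
      (\<lambda>n. prob {\<omega>\<in>space M. \<exists>i<length (\<rho> n) - 1. c n < \<bar>\<beta> n i \<omega>\<bar>}) \<longlonglongrightarrow> 0 \<and>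
      (\<forall>\<^sub>F n in sequentially. (c n)\<^sup>2 * (\<Sum>i<length (\<rho> n) - 1. v (\<rho> n ! i) (\<rho> n ! Suc i)) \<le> \<eta>)"
    and \<epsilon>: "0 < \<epsilon>"
  shows "(\<lambda>n. prob {\<omega>\<in>space M. \<exists>l\<le>length (\<rho> n) - 1. \<epsilon> < \<bar>\<Sum>i<l. \<beta> n i \<omega> *
    q (\<rho> n ! i) (\<rho> n ! Suc i) (W (\<rho> n ! Suc i) \<omega> - W (\<rho> n ! i) \<omega>)\<bar>}) \<longlonglongrightarrow> 0"
    (is "?P \<longlonglongrightarrow> 0")
proof -
  have bound: "?P n \<le> prob {\<omega>\<in>space M. \<exists>i<length (\<rho> n) - 1. c < \<bar>\<beta> n i \<omega>\<bar>}
      + c\<^sup>2 * (\<Sum>i<length (\<rho> n) - 1. v (\<rho> n ! i) (\<rho> n ! Suc i)) / \<epsilon>\<^sup>2" if c: "0 \<le> c" for n c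
  proof (cases "\<rho> n = []")
    case False
    define r where "r i = \<rho> n ! i" for i
    have lt: "r i < r j" if "i < j" "j < length (\<rho> n)" for i j
      using \<rho>(1)[of n] that by (auto simp: r_def sorted_wrt_iff_nth_less)
    have le: "r i \<le> r j" if "i \<le> j" "j < length (\<rho> n)" for i j
      using lt[of i j] that by (cases "i = j") auto
    have mem: "0 \<le> r i" "r i \<le> T" if "i < length (\<rho> n)" for i
      using \<rho>(2)[of n] nth_mem[OF that] by (auto simp: r_def)
    have pos: "0 < length (\<rho> n)" using False by simp
    show ?thesis
    proof (rule maximal_inequality_truncated[where F="\<lambda>i. G (r i)"
          and \<zeta>="\<lambda>i \<omega>. q (\<rho> n ! i) (\<rho> n ! Suc i) (W (\<rho> n ! Suc i) \<omega> - W (\<rho> n ! i) \<omega>)"])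
      fix i j assume "i \<le> j" "j \<le> length (\<rho> n) - 1"
      then show "subalgebra (G (r j)) (G (r i))"
        using le[of i j] mem[of i] mem[of j] pos by (intro subalgebra_G) linarith+
    next
      show "subalgebra M (G (r (length (\<rho> n) - 1)))" using mem pos by (intro subalgebra_M) auto
    next
      fix i assume i: "i < length (\<rho> n) - 1"
      then have i': "0 \<le> r i" "r i < r (Suc i)" "r (Suc i) \<le> T" using mem lt by auto
      have [measurable]: "W (r (Suc i)) \<in> borel_measurable (G (r (Suc i)))"
        "W (r i) \<in> borel_measurable (G (r (Suc i)))"
        using i' W_measurable_G measurable_G_mono[of "W (r i)" "r i" borel "r (Suc i)"] by auto
      note q(1)[measurable]
      show "(\<lambda>\<omega>. q (\<rho> n ! i) (\<rho> n ! Suc i) (W (\<rho> n ! Suc i) \<omega> - W (\<rho> n ! i) \<omega>))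
          \<in> borel_measurable (G (r (Suc i)))"
        unfolding r_def[symmetric] by measurable
      show "\<beta> n i \<in> borel_measurable (G (r i))" unfolding r_def by (rule \<beta>[OF i])
      show "expectation (\<lambda>\<omega>. q (\<rho> n ! i) (\<rho> n ! Suc i) (W (\<rho> n ! Suc i) \<omega> - W (\<rho> n ! i) \<omega>)) = 0"
        "integrable M (\<lambda>\<omega>. (q (\<rho> n ! i) (\<rho> n ! Suc i) (W (\<rho> n ! Suc i) \<omega> - W (\<rho> n ! i) \<omega>))\<^sup>2)"
        "expectation (\<lambda>\<omega>. (q (\<rho> n ! i) (\<rho> n ! Suc i) (W (\<rho> n ! Suc i) \<omega> - W (\<rho> n ! i) \<omega>))\<^sup>2)
          \<le> v (\<rho> n ! i) (\<rho> n ! Suc i)"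
        unfolding r_def[symmetric] by (intro q i')+
      fix g :: "'a \<Rightarrow> real" assume "g \<in> borel_measurable (G (r i))"
      then show "indep_var borel g borel
          (\<lambda>\<omega>. q (\<rho> n ! i) (\<rho> n ! Suc i) (W (\<rho> n ! Suc i) \<omega> - W (\<rho> n ! i) \<omega>))"
        unfolding r_def[symmetric] by (intro increment_indep i' q(1))
    qed (use \<epsilon> c in auto)
  qed (use \<epsilon> in simp)
  show ?thesis
  proof (rule LIMSEQ_I)
    fix e :: real assume e: "0 < e"
    \<comment> \<open>Half of the tolerance \<open>e\<close> is left for the truncation; dividing
      this bound by \<open>\<epsilon>\<^sup>2\<close> yields the other half.\<close>
    then have "0 < e * \<epsilon>\<^sup>2 / 2" using \<epsilon> by simp
    from small[OF this] obtain c where c: "\<And>n. 0 \<le> c n"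
      "(\<lambda>n. prob {\<omega>\<in>space M. \<exists>i<length (\<rho> n) - 1. c n < \<bar>\<beta> n i \<omega>\<bar>}) \<longlonglongrightarrow> 0"
      "\<forall>\<^sub>F n in sequentially. (c n)\<^sup>2 * (\<Sum>i<length (\<rho> n) - 1. v (\<rho> n ! i) (\<rho> n ! Suc i)) \<le> e * \<epsilon>\<^sup>2 / 2"
      by blast
    have "\<forall>\<^sub>F n in sequentially. prob {\<omega>\<in>space M. \<exists>i<length (\<rho> n) - 1. c n < \<bar>\<beta> n i \<omega>\<bar>} < e / 2"
      using c(2) e by (intro order_tendstoD) auto
    with c(3) have "\<forall>\<^sub>F n in sequentially. norm (?P n - 0) < e"
    proof eventually_elim
      case (elim n)
      have "(c n)\<^sup>2 * (\<Sum>i<length (\<rho> n) - 1. v (\<rho> n ! i) (\<rho> n ! Suc i)) / \<epsilon>\<^sup>2 \<le> (e * \<epsilon>\<^sup>2 / 2) / \<epsilon>\<^sup>2"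
        by (rule divide_right_mono[OF elim(1)]) simp
      also have "\<dots> = e / 2" using \<epsilon> by simp
      finally have "?P n < e" using bound[OF c(1), of n n] elim(2) by linarith
      then show ?case by simp
    qed
    then show "\<exists>no. \<forall>n\<ge>no. norm (?P n - 0) < e" by (simp add: eventually_sequentially)
  qed
qed

end

subsection \<open>The stochastic integral of a continuous adapted process\<close>

text \<open>The time at which a left-endpoint sum over \<open>ts\<close> reads its integrand when
  the running time is \<open>s\<close>.\<close>

definition partition_floor :: "real list \<Rightarrow> real \<Rightarrow> real" where
  "partition_floor ts s = Max {p \<in> set ts. p \<le> s}"

lemma partition_floor:
  assumes "ts \<in> partitions p \<delta>" "0 \<le> s" "s \<le> p" "0 < \<delta>"
  shows "partition_floor ts s \<in> set ts" "partition_floor ts s \<le> s" "s - partition_floor ts s < \<delta>"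
    "0 \<le> partition_floor ts s"
proof -
  have ne: "{p \<in> set ts. p \<le> s} \<noteq> {}"
    using partition_nth_0[OF assms(1)] partition_length[OF assms(1)] assms(2) nth_mem[of 0 ts] by force
  have "partition_floor ts s \<in> {p \<in> set ts. p \<le> s}"
    unfolding partition_floor_def by (rule Max_in) (use ne in auto)
  then show m: "partition_floor ts s \<in> set ts" "partition_floor ts s \<le> s" by auto
  then show "0 \<le> partition_floor ts s"
    using partition_nth_mem[OF assms(1)] by (force simp: in_set_conv_nth)
  have ge: "x \<le> partition_floor ts s" if "x \<in> set ts" "x \<le> s" for x
    unfolding partition_floor_def by (rule Max_ge) (use that in auto)
  show "s - partition_floor ts s < \<delta>"
  proof (cases "s = 0")
    case True
    then show ?thesis using ge[of 0] partition_nth_0[OF assms(1)] partition_length[OF assms(1)] nth_mem[of 0 ts]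
      assms(4) by auto
  next
    case False
    obtain i where i: "i < length ts - 1" "ts ! i < s" "s \<le> ts ! Suc i"
      using partition_interval[OF assms(1), of s] False assms by auto
    have "ts ! i \<le> partition_floor ts s" using i by (intro ge) auto
    then show ?thesis using partition_step[OF assms(1) i(1)] i by linarith
  qed
qed

lemma partition_floor_eq:
  assumes "ts \<in> partitions p \<delta>" "i < length ts - 1" "ts ! i \<le> s" "s < ts ! Suc i"
  shows "partition_floor ts s = ts ! i"
  unfolding partition_floor_def
proof (rule Max_eqI)
  fix y assume "y \<in> {p \<in> set ts. p \<le> s}"
  then obtain j where j: "j < length ts" "y = ts ! j" "ts ! j \<le> s" by (auto simp: in_set_conv_nth)
  have "j \<le> i"
  proof (rule ccontr)
    assume "\<not> j \<le> i"
    then have "ts ! Suc i \<le> ts ! j" using j by (intro partition_nth_le[OF assms(1)]) auto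
    with j assms show False by simp
  qed
  then show "y \<le> ts ! i" using j assms by (auto intro: partition_nth_le[OF assms(1)])
qed (use assms in auto)

lemma mesh_seq_refine:
  assumes "mesh_seq t \<pi>"
  shows "\<exists>r. strict_mono r \<and> (\<forall>n. \<pi> (r n) \<in> partitions t (inverse (real (Suc n))))"
proof -
  have ex: "\<exists>n>m. \<pi> n \<in> partitions t (inverse (real (Suc k)))" for k m
  proof -
    obtain N where "\<And>n. N \<le> n \<Longrightarrow> \<pi> n \<in> partitions t (inverse (real (Suc k)))"
      using assms by (force simp: mesh_seq_def eventually_sequentially)
    then show ?thesis by (intro exI[of _ "max N (Suc m)"]) auto
  qed
  obtain r where r: "\<And>k. \<pi> (r k) \<in> partitions t (inverse (real (Suc k)))" "\<And>k. r k < r (Suc k)"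
    using dependent_nat_choice[of "\<lambda>k n. \<pi> n \<in> partitions t (inverse (real (Suc k)))" "\<lambda>_ m n. m < n"] ex
    by meson
  then show ?thesis by (intro exI[of _ r]) (auto simp: strict_mono_Suc_iff)
qed

lemma inverse_Suc_small: "0 < d \<Longrightarrow> \<forall>\<^sub>F n in sequentially. inverse (real (Suc n)) < d"
  by (rule order_tendstoD(2)[OF LIMSEQ_inverse_real_of_nat])

section \<open>Smallness of linear and quadratic sums, and comparison of sums over two
  partitions\<close>

context wiener_filtration
begin

text \<open>The coefficients tend to zero in probability, uniformly over the partition, while the
  total variance of the increments stays bounded: a small truncation level independent of
  \<open>n\<close> suffices.\<close>

lemma linear_sums_small:
  fixes \<rho> :: "nat \<Rightarrow> real list" and \<beta> :: "nat \<Rightarrow> nat \<Rightarrow> 'a \<Rightarrow> real"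
  assumes \<rho>: "\<And>n. sorted_wrt (<) (\<rho> n)" "\<And>n. set (\<rho> n) \<subseteq> {0..T}"
    and \<beta>: "\<And>n i. i < length (\<rho> n) - 1 \<Longrightarrow> \<beta> n i \<in> borel_measurable (G (\<rho> n ! i))"
    and small: "\<And>c. 0 < c \<Longrightarrow> (\<lambda>n. prob {\<omega>\<in>space M. \<exists>i<length (\<rho> n) - 1. c < \<bar>\<beta> n i \<omega>\<bar>}) \<longlonglongrightarrow> 0"
    and \<epsilon>: "0 < \<epsilon>"
  shows "(\<lambda>n. prob {\<omega>\<in>space M. \<exists>l\<le>length (\<rho> n) - 1. \<epsilon> < \<bar>\<Sum>i<l. \<beta> n i \<omega> *
    (u \<bullet> (W (\<rho> n ! Suc i) \<omega> - W (\<rho> n ! i) \<omega>))\<bar>}) \<longlonglongrightarrow> 0"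
proof (rule martingale_sums_small[OF \<rho>, where q="\<lambda>s t x. u \<bullet> x" and v="\<lambda>s t. (t - s) * (u \<bullet> (R *v u))"])
  have uRu: "0 \<le> u \<bullet> (R *v u)"
    using R_pos_def by (cases "u = 0") (auto simp: pos_def_matrix_def intro: less_imp_le)
  fix \<eta> :: real assume \<eta>: "0 < \<eta>"
  show "\<exists>c. (\<forall>n. 0 \<le> c n) \<and>
      (\<lambda>n. prob {\<omega>\<in>space M. \<exists>i<length (\<rho> n) - 1. c n < \<bar>\<beta> n i \<omega>\<bar>}) \<longlonglongrightarrow> 0 \<and>
      (\<forall>\<^sub>F n in sequentially. (c n)\<^sup>2 * (\<Sum>i<length (\<rho> n) - 1. (\<rho> n ! Suc i - \<rho> n ! i) * (u \<bullet> (R *v u))) \<le> \<eta>)"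
  \<comment> \<open>The total variance telescopes to at most
    \<open>\<bar>T\<bar> * (u \<bullet> (R *v u))\<close>; the added \<open>1\<close> keeps the
    quotient meaningful when this is zero.\<close>
  proof (intro exI[of _ "\<lambda>_. sqrt (\<eta> / (\<bar>T\<bar> * (u \<bullet> (R *v u)) + 1))"] conjI allI always_eventually)
    fix n
    let ?V = "\<Sum>i<length (\<rho> n) - 1. (\<rho> n ! Suc i - \<rho> n ! i) * (u \<bullet> (R *v u))"
    have "?V = (\<rho> n ! (length (\<rho> n) - 1) - \<rho> n ! 0) * (u \<bullet> (R *v u))"
      by (simp add: sum_distrib_right[symmetric] sum_lessThan_telescope)
    also have "\<dots> \<le> \<bar>T\<bar> * (u \<bullet> (R *v u)) + 1"
    proof (cases "\<rho> n = []")
      case False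
      then have "\<rho> n ! (length (\<rho> n) - 1) \<in> {0..T}" "\<rho> n ! 0 \<in> {0..T}"
        using \<rho>(2)[of n] by (auto simp: subset_iff)
      then have "\<rho> n ! (length (\<rho> n) - 1) - \<rho> n ! 0 \<le> \<bar>T\<bar>" by auto
      from mult_right_mono[OF this uRu] show ?thesis by simp
    qed (use uRu in auto)
    finally have V: "?V \<le> \<bar>T\<bar> * (u \<bullet> (R *v u)) + 1" .
    have p: "0 < \<bar>T\<bar> * (u \<bullet> (R *v u)) + 1" using uRu by (intro add_nonneg_pos) auto
    have "(sqrt (\<eta> / (\<bar>T\<bar> * (u \<bullet> (R *v u)) + 1)))\<^sup>2 * ?V \<le> (\<eta> / (\<bar>T\<bar> * (u \<bullet> (R *v u)) + 1)) * (\<bar>T\<bar> * (u \<bullet> (R *v u)) + 1)"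
      using V \<eta> p by (simp add: mult_left_mono del: times_divide_eq_left)
    also have "\<dots> = \<eta>" using p by simp
    finally show "(sqrt (\<eta> / (\<bar>T\<bar> * (u \<bullet> (R *v u)) + 1)))\<^sup>2 * ?V \<le> \<eta>" .
    show "0 \<le> sqrt (\<eta> / (\<bar>T\<bar> * (u \<bullet> (R *v u)) + 1))" using \<eta> p by simp
  next
    have p: "0 < \<bar>T\<bar> * (u \<bullet> (R *v u)) + 1" using uRu by (intro add_nonneg_pos) auto
    show "(\<lambda>n. prob {\<omega>\<in>space M. \<exists>i<length (\<rho> n) - 1. sqrt (\<eta> / (\<bar>T\<bar> * (u \<bullet> (R *v u)) + 1)) < \<bar>\<beta> n i \<omega>\<bar>}) \<longlonglongrightarrow> 0"
      by (rule small) (use \<eta> p in simp)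
  qed
qed (use increment_linear \<beta> \<epsilon> in auto)

text \<open>Here the coefficients need not vanish, but the total variance does, being of the order
  of the mesh. The truncation level can therefore tend to infinity and is eventually above the
  maximum of each continuous path.\<close>

lemma quadratic_sums_small:
  fixes \<rho> :: "nat \<Rightarrow> real list" and b :: "real \<Rightarrow> 'a \<Rightarrow> real"
  assumes \<rho>: "\<And>n. \<rho> n \<in> partitions t (inverse (real (Suc n)))" and t: "t \<le> T"
    and b: "\<And>s. 0 \<le> s \<Longrightarrow> s \<le> T \<Longrightarrow> b s \<in> borel_measurable (G s)"
      "\<And>\<omega>. \<omega> \<in> space M \<Longrightarrow> continuous_on {0..T} (\<lambda>s. b s \<omega>)"
    and \<epsilon>: "0 < \<epsilon>"
  shows "(\<lambda>n. prob {\<omega>\<in>space M. \<exists>l\<le>length (\<rho> n) - 1. \<epsilon> < \<bar>\<Sum>i<l. b (\<rho> n ! i) \<omega> *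
    ((u \<bullet> (W (\<rho> n ! Suc i) \<omega> - W (\<rho> n ! i) \<omega>))\<^sup>2 - (\<rho> n ! Suc i - \<rho> n ! i) * (u \<bullet> (R *v u)))\<bar>}) \<longlonglongrightarrow> 0"
proof (rule martingale_sums_small[where q="\<lambda>s t x. (u \<bullet> x)\<^sup>2 - (t - s) * (u \<bullet> (R *v u))"
      and v="\<lambda>s t. 2 * ((t - s) * (u \<bullet> (R *v u)))\<^sup>2"])
  have mem: "\<rho> n ! i \<in> {0..T}" if "i < length (\<rho> n)" for n i
    using partition_nth_mem[OF \<rho> that] t by auto
  show "sorted_wrt (<) (\<rho> n)" for n using \<rho>[of n] by (simp add: partitions_def)
  show "set (\<rho> n) \<subseteq> {0..T}" for n using mem by (force simp: in_set_conv_nth)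
  show bm: "b (\<rho> n ! i) \<in> borel_measurable (G (\<rho> n ! i))" if "i < length (\<rho> n) - 1" for n i
    using mem[of i n] that by (intro b) auto
  fix \<eta> :: real assume \<eta>: "0 < \<eta>"
  define k where "k = u \<bullet> (R *v u)"
  define V where "V n = (\<Sum>i<length (\<rho> n) - 1. 2 * ((\<rho> n ! Suc i - \<rho> n ! i) * k)\<^sup>2)" for n
  \<comment> \<open>Chosen so that \<open>(c n)\<^sup>2 * V n\<close> stays below
    \<open>\<eta>\<close> while \<open>c n\<close> tends to infinity; the summand
    \<open>inverse (real (Suc n))\<close> prevents division by zero.\<close>
  define c where "c n = sqrt (\<eta> / (V n + inverse (real (Suc n))))" for n
  have V0: "0 \<le> V n" for n by (simp add: V_def sum_nonneg)
  have "V n \<le> inverse (real (Suc n)) * (2 * k\<^sup>2 * t)" for n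
  proof -
    have "V n \<le> (\<Sum>i<length (\<rho> n) - 1. inverse (real (Suc n)) * (2 * k\<^sup>2) * (\<rho> n ! Suc i - \<rho> n ! i))"
      unfolding V_def
    proof (rule sum_mono)
      fix i assume i: "i \<in> {..<length (\<rho> n) - 1}"
      have d: "0 \<le> \<rho> n ! Suc i - \<rho> n ! i" "\<rho> n ! Suc i - \<rho> n ! i \<le> inverse (real (Suc n))"
        using partition_nth_le[OF \<rho>, of i "Suc i" n] partition_step[OF \<rho>, of i n] i by auto
      have "2 * ((\<rho> n ! Suc i - \<rho> n ! i) * k)\<^sup>2 = (\<rho> n ! Suc i - \<rho> n ! i) * ((2 * k\<^sup>2) * (\<rho> n ! Suc i - \<rho> n ! i))"
        by (simp add: power2_eq_square)
      also have "\<dots> \<le> inverse (real (Suc n)) * ((2 * k\<^sup>2) * (\<rho> n ! Suc i - \<rho> n ! i))"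
        using d by (intro mult_right_mono) auto
      finally show "2 * ((\<rho> n ! Suc i - \<rho> n ! i) * k)\<^sup>2 \<le> inverse (real (Suc n)) * (2 * k\<^sup>2) * (\<rho> n ! Suc i - \<rho> n ! i)"
        by (simp add: mult.assoc)
    qed
    also have "\<dots> = inverse (real (Suc n)) * (2 * k\<^sup>2 * t)"
      by (simp add: sum_distrib_left[symmetric] partition_sum_steps[OF \<rho>, simplified] mult.assoc)
    finally show ?thesis .
  qed
  moreover have "(\<lambda>n. inverse (real (Suc n)) * (2 * k\<^sup>2 * t)) \<longlonglongrightarrow> 0"
    by (rule tendsto_mult_left_zero[OF LIMSEQ_inverse_real_of_nat])
  ultimately have Vlim: "V \<longlonglongrightarrow> 0"
    using V0 by (intro tendsto_sandwich[of "\<lambda>_. 0" V sequentially "\<lambda>n. inverse (real (Suc n)) * (2 * k\<^sup>2 * t)"])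
      (auto intro!: always_eventually)
  have c_large: "\<forall>\<^sub>F n in sequentially. B < c n" for B
  proof -
    have "(\<lambda>n. V n + inverse (real (Suc n))) \<longlonglongrightarrow> 0 + 0"
      by (intro tendsto_add Vlim LIMSEQ_inverse_real_of_nat)
    then have "\<forall>\<^sub>F n in sequentially. V n + inverse (real (Suc n)) < \<eta> / (B\<^sup>2 + 1)"
      using \<eta> by (intro order_tendstoD(2)[of _ "0"]) (auto intro!: divide_pos_pos add_nonneg_pos)
    then show ?thesis
    proof eventually_elim
      case (elim n)
      have p: "0 < V n + inverse (real (Suc n))" using V0[of n] by (intro add_nonneg_pos) auto
      have "0 < B\<^sup>2 + 1" by (intro add_nonneg_pos) auto
      with elim p have "(B\<^sup>2 + 1) * (V n + inverse (real (Suc n))) < \<eta>"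
        by (simp add: pos_less_divide_eq mult.commute)
      then have "B\<^sup>2 + 1 < \<eta> / (V n + inverse (real (Suc n)))"
        using p by (simp add: pos_less_divide_eq)
      then have "B\<^sup>2 < \<eta> / (V n + inverse (real (Suc n)))" by simp
      then show ?case unfolding c_def by (rule real_less_rsqrt)
    qed
  qed
  show "\<exists>c. (\<forall>n. 0 \<le> c n) \<and>
      (\<lambda>n. prob {\<omega>\<in>space M. \<exists>i<length (\<rho> n) - 1. c n < \<bar>b (\<rho> n ! i) \<omega>\<bar>}) \<longlonglongrightarrow> 0 \<and>
      (\<forall>\<^sub>F n in sequentially. (c n)\<^sup>2 * (\<Sum>i<length (\<rho> n) - 1. 2 * ((\<rho> n ! Suc i - \<rho> n ! i) * (u \<bullet> (R *v u)))\<^sup>2) \<le> \<eta>)"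
  proof (intro exI[of _ c] conjI allI always_eventually)
    fix n
    have p: "0 < V n + inverse (real (Suc n))" using V0[of n] by (intro add_nonneg_pos) auto
    show "0 \<le> c n" unfolding c_def using \<eta> p by simp
    have "(c n)\<^sup>2 * V n \<le> \<eta> / (V n + inverse (real (Suc n))) * (V n + inverse (real (Suc n)))"
      unfolding c_def using \<eta> p V0[of n] by (simp add: mult_left_mono del: times_divide_eq_left)
    also have "\<dots> = \<eta>" using p by simp
    finally show "(c n)\<^sup>2 * (\<Sum>i<length (\<rho> n) - 1. 2 * ((\<rho> n ! Suc i - \<rho> n ! i) * (u \<bullet> (R *v u)))\<^sup>2) \<le> \<eta>"
      by (simp add: V_def k_def)
  next
    show "(\<lambda>n. prob {\<omega>\<in>space M. \<exists>i<length (\<rho> n) - 1. c n < \<bar>b (\<rho> n ! i) \<omega>\<bar>}) \<longlonglongrightarrow> 0"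
    proof (rule prob_tendsto_0_if_AE_eventually_not)
      fix n
      have [measurable]: "b (\<rho> n ! i) \<in> borel_measurable M" if "i < length (\<rho> n) - 1" for i
        using measurable_G_M[OF bm[OF that]] mem[of i n] that by auto
      have ex: "(\<exists>i<length (\<rho> n) - 1. P i) \<longleftrightarrow> (\<exists>i\<in>{..<length (\<rho> n) - 1}. P i)" for P by auto
      show "{\<omega>\<in>space M. \<exists>i<length (\<rho> n) - 1. c n < \<bar>b (\<rho> n ! i) \<omega>\<bar>} \<in> events"
        unfolding ex by measurable
    next
      show "AE \<omega> in M. \<forall>\<^sub>F n in sequentially. \<omega> \<notin> {\<omega>\<in>space M. \<exists>i<length (\<rho> n) - 1. c n < \<bar>b (\<rho> n ! i) \<omega>\<bar>}"
      proof (rule AE_I2)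
        fix \<omega> assume \<omega>: "\<omega> \<in> space M"
        have "bounded ((\<lambda>s. b s \<omega>) ` {0..T})"
          using b(2)[OF \<omega>] compact_continuous_image compact_imp_bounded by blast
        then obtain B where B: "\<forall>s\<in>{0..T}. \<bar>b s \<omega>\<bar> \<le> B" by (auto simp: bounded_iff)
        show "\<forall>\<^sub>F n in sequentially. \<omega> \<notin> {\<omega>\<in>space M. \<exists>i<length (\<rho> n) - 1. c n < \<bar>b (\<rho> n ! i) \<omega>\<bar>}"
          using c_large[of B]
        proof eventually_elim
          case (elim n)
          have "\<bar>b (\<rho> n ! i) \<omega>\<bar> < c n" if "i < length (\<rho> n) - 1" for i
          proof -
            have "\<rho> n ! i \<in> {0..T}" using that by (intro mem) auto
            with B have "\<bar>b (\<rho> n ! i) \<omega>\<bar> \<le> B" by blast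
            with elim show ?thesis by linarith
          qed
          then show ?case by (auto simp: not_less intro: less_imp_le)
        qed
      qed
    qed
  qed
qed (use increment_quadratic \<epsilon> in auto)

text \<open>The sum is stopped at \<open>s\<close>: an interval after \<open>s\<close> contributes
  nothing, the one containing \<open>s\<close> a partial increment. It is thus a continuous adapted
  process in \<open>s\<close>, and sums over different partitions can be compared at every
  time.\<close>

definition ito_sum :: "(real \<Rightarrow> 'a \<Rightarrow> real) \<Rightarrow> real^'m \<Rightarrow> real list \<Rightarrow> real \<Rightarrow> 'a \<Rightarrow> real" where
  "ito_sum b u ts s \<omega> = (\<Sum>i<length ts - 1. b (ts ! i) \<omega> * (u \<bullet> (W (min (ts ! Suc i) s) \<omega> - W (min (ts ! i) s) \<omega>)))"

text \<open>Without a partition point strictly between \<open>s\<close> and \<open>s'\<close>, both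
  times lie in the closure of one interval and only its term moves.\<close>

lemma ito_sum_step:
  assumes ts: "ts \<in> partitions p \<delta>" and s: "0 \<le> s" "s < s'" "s' \<le> p"
    and no: "\<And>x. x \<in> set ts \<Longrightarrow> \<not> (s < x \<and> x < s')"
  shows "ito_sum b u ts s' \<omega> - ito_sum b u ts s \<omega> = b (partition_floor ts s) \<omega> * (u \<bullet> (W s' \<omega> - W s \<omega>))"
proof -
  obtain k where k: "k < length ts - 1" "ts ! k < s'" "s' \<le> ts ! Suc k"
    using partition_interval[OF ts, of s'] s by auto
  have ks: "ts ! k \<le> s" using no[of "ts ! k"] k by auto
  have fl: "partition_floor ts s = ts ! k"
    by (rule partition_floor_eq[OF ts k(1) ks]) (use s k in auto)
  have "ito_sum b u ts s' \<omega> - ito_sum b u ts s \<omega>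
      = (\<Sum>i<length ts - 1. if i = k then b (ts ! k) \<omega> * (u \<bullet> (W s' \<omega> - W s \<omega>)) else 0)"
    unfolding ito_sum_def sum_subtractf[symmetric]
  proof (rule sum.cong[OF refl])
    fix i assume i: "i \<in> {..<length ts - 1}"
    consider "i < k" | "i = k" | "k < i" by linarith
    then show "b (ts ! i) \<omega> * (u \<bullet> (W (min (ts ! Suc i) s') \<omega> - W (min (ts ! i) s') \<omega>)) -
         b (ts ! i) \<omega> * (u \<bullet> (W (min (ts ! Suc i) s) \<omega> - W (min (ts ! i) s) \<omega>)) =
         (if i = k then b (ts ! k) \<omega> * (u \<bullet> (W s' \<omega> - W s \<omega>)) else 0)"
    proof cases
      case 1
      then have "ts ! Suc i \<le> ts ! k" "ts ! i \<le> ts ! k"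
        using k by (auto intro!: partition_nth_le[OF ts])
      then show ?thesis using 1 ks s by (simp add: min_def)
    next
      case 2
      then have "min (ts ! Suc i) s' = s'" "min (ts ! i) s' = ts ! i" "min (ts ! Suc i) s = s" "min (ts ! i) s = ts ! i"
        using k ks s by auto
      then show ?thesis using 2 by (simp add: right_diff_distrib[symmetric] inner_diff_right[symmetric])
    next
      case 3
      then have "ts ! Suc k \<le> ts ! i" "ts ! Suc k \<le> ts ! Suc i"
        using k i by (auto intro!: partition_nth_le[OF ts])
      then have "min (ts ! Suc i) s' = s'" "min (ts ! i) s' = s'" "min (ts ! Suc i) s = s" "min (ts ! i) s = s"
        using k s by auto
      then show ?thesis using 3 by simp
    qed
  qed
  also have "\<dots> = b (ts ! k) \<omega> * (u \<bullet> (W s' \<omega> - W s \<omega>))" using k by simp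
  finally show ?thesis by (simp add: fl)
qed

lemma ito_sum_0: "ts \<in> partitions p \<delta> \<Longrightarrow> ito_sum b u ts 0 \<omega> = 0"
  unfolding ito_sum_def
proof (intro sum.neutral ballI)
  fix i assume ts: "ts \<in> partitions p \<delta>" and "i \<in> {..<length ts - 1}"
  then have "min (ts ! Suc i) 0 = 0" "min (ts ! i) 0 = 0"
    using partition_nth_mem[OF ts, of i] partition_nth_mem[OF ts, of "Suc i"] by auto
  then show "b (ts ! i) \<omega> * (u \<bullet> (W (min (ts ! Suc i) 0) \<omega> - W (min (ts ! i) 0) \<omega>)) = 0" by simp
qed

text \<open>Links the comparison at arbitrary times to the plain left-endpoint sums, of which the
  stopped sum is an interpolation.\<close>

lemma ito_sum_partition:
  assumes ts: "ts \<in> partitions p \<delta>" and l: "l < length ts"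
  shows "ito_sum b u ts (ts ! l) \<omega> = (\<Sum>i<l. b (ts ! i) \<omega> * (u \<bullet> (W (ts ! Suc i) \<omega> - W (ts ! i) \<omega>)))"
  using l
proof (induction l)
  case 0
  then show ?case using ito_sum_0[OF ts] partition_nth_0[OF ts] by simp
next
  case (Suc l)
  have lt: "ts ! l < ts ! Suc l" using Suc.prems by (intro partition_nth_less[OF ts]) auto
  have "ito_sum b u ts (ts ! Suc l) \<omega> - ito_sum b u ts (ts ! l) \<omega>
      = b (partition_floor ts (ts ! l)) \<omega> * (u \<bullet> (W (ts ! Suc l) \<omega> - W (ts ! l) \<omega>))"
  proof (rule ito_sum_step[OF ts _ lt])
    show "0 \<le> ts ! l" "ts ! Suc l \<le> p"
      using partition_nth_mem[OF ts, of l] partition_nth_mem[OF ts, of "Suc l"] Suc.prems by auto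
    fix x assume "x \<in> set ts"
    then obtain j where j: "j < length ts" "x = ts ! j" by (auto simp: in_set_conv_nth)
    show "\<not> (ts ! l < x \<and> x < ts ! Suc l)"
    proof (cases "j \<le> l")
      case True
      then have "ts ! j \<le> ts ! l" using Suc.prems by (intro partition_nth_le[OF ts]) auto
      then show ?thesis using j by auto
    next
      case False
      then have "ts ! Suc l \<le> ts ! j" using j by (intro partition_nth_le[OF ts]) auto
      then show ?thesis using j by auto
    qed
  qed
  moreover have "partition_floor ts (ts ! l) = ts ! l"
    using Suc.prems lt by (intro partition_floor_eq[OF ts]) auto
  ultimately show ?case using Suc by simp
qed

lemma ito_sum_measurable_G:
  assumes ts: "ts \<in> partitions p \<delta>" and p: "p \<le> T" and s: "0 \<le> s" "s \<le> T"
    and b: "\<And>s. 0 \<le> s \<Longrightarrow> s \<le> T \<Longrightarrow> b s \<in> borel_measurable (G s)"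
  shows "ito_sum b u ts s \<in> borel_measurable (G s)"
  unfolding ito_sum_def[abs_def]
proof (rule borel_measurable_sum)
  fix i assume i: "i \<in> {..<length ts - 1}"
  have m: "ts ! i \<in> {0..T}" "ts ! Suc i \<in> {0..T}"
    using partition_nth_mem[OF ts, of i] partition_nth_mem[OF ts, of "Suc i"] p i by (auto simp: less_diff_conv)
  show "(\<lambda>\<omega>. b (ts ! i) \<omega> * (u \<bullet> (W (min (ts ! Suc i) s) \<omega> - W (min (ts ! i) s) \<omega>))) \<in> borel_measurable (G s)"
  proof (cases "ts ! i \<le> s")
    case True
    have [measurable]: "b (ts ! i) \<in> borel_measurable (G s)"
      using m True s by (intro measurable_G_mono[OF b]) auto
    have [measurable]: "W (min (ts ! Suc i) s) \<in> borel_measurable (G s)" "W (min (ts ! i) s) \<in> borel_measurable (G s)"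
      using m s by (auto intro!: measurable_G_mono[OF W_measurable_G])
    show ?thesis by measurable
  next
    case False
    then have "min (ts ! i) s = s" "min (ts ! Suc i) s = s"
      using partition_nth_le[OF ts, of i "Suc i"] i by (auto simp: less_diff_conv)
    then show ?thesis by simp
  qed
qed

lemma ito_sum_continuous:
  assumes ts: "ts \<in> partitions p \<delta>" and p: "p \<le> T" and \<omega>: "\<omega> \<in> space M"
  shows "continuous_on {0..T} (\<lambda>s. ito_sum b u ts s \<omega>)"
  unfolding ito_sum_def
proof (intro continuous_on_sum continuous_on_mult continuous_on_const continuous_on_inner continuous_on_diff)
  fix i assume i: "i \<in> {..<length ts - 1}"
  have m: "ts ! i \<in> {0..T}" "ts ! Suc i \<in> {0..T}"
    using partition_nth_mem[OF ts, of i] partition_nth_mem[OF ts, of "Suc i"] p i by (auto simp: less_diff_conv)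
  have W: "continuous_on {0..T} (\<lambda>s. W (min a s) \<omega>)" if "a \<in> {0..T}" for a
    by (rule continuous_on_compose2[OF W_continuous[OF \<omega>]]) (use that in \<open>auto intro!: continuous_intros\<close>)
  show "continuous_on {0..T} (\<lambda>s. W (min (ts ! Suc i) s) \<omega>)" "continuous_on {0..T} (\<lambda>s. W (min (ts ! i) s) \<omega>)"
    using W m by auto
qed

text \<open>On the union of both partitions and \<open>F n\<close>, the difference is one sum whose
  coefficients are differences of \<open>b\<close> at two times close to each other. These vanish by
  uniform continuity of the paths, so the linear estimate applies. The finite sets
  \<open>F n\<close> are arbitrary, which later allows passing to a countable dense set;
  \<open>p\<close> and \<open>q\<close> may differ because the reference partitions span all of
  \<open>{0..T}\<close>.\<close>

lemma ito_sum_difference_small: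
  fixes F :: "nat \<Rightarrow> real set"
  assumes P: "\<And>n. P n \<in> partitions p (inverse (real (Suc n)))" and p: "t \<le> p" "p \<le> T"
    and Q: "\<And>n. Q n \<in> partitions q (inverse (real (Suc n)))" and q: "t \<le> q" "q \<le> T"
    and F: "\<And>n. finite (F n)" "\<And>n. F n \<subseteq> {0..t}" and t: "0 \<le> t"
    and b: "\<And>s. 0 \<le> s \<Longrightarrow> s \<le> T \<Longrightarrow> b s \<in> borel_measurable (G s)"
      "\<And>\<omega>. \<omega> \<in> space M \<Longrightarrow> continuous_on {0..T} (\<lambda>s. b s \<omega>)"
    and \<epsilon>: "0 < \<epsilon>"
  shows "(\<lambda>n. prob {\<omega>\<in>space M. \<exists>s\<in>F n. \<epsilon> < \<bar>ito_sum b u (P n) s \<omega> - ito_sum b u (Q n) s \<omega>\<bar>}) \<longlonglongrightarrow> 0"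
proof -
  \<comment> \<open>Times are restricted to \<open>{0..t}\<close> because the partitions may extend
    beyond \<open>t\<close>; zero is inserted so that both sums start at zero on the common
    grid.\<close>
  define D where "D n = insert 0 (F n \<union> ((set (P n) \<union> set (Q n)) \<inter> {0..t}))" for n
  define \<rho> where "\<rho> n = sorted_list_of_set (D n)" for n
  have finD: "finite (D n)" for n using F by (auto simp: D_def)
  have set\<rho>: "set (\<rho> n) = D n" for n using finD by (simp add: \<rho>_def)
  have Dt: "D n \<subseteq> {0..t}" for n using F t by (auto simp: D_def)
  have sorted\<rho>: "sorted_wrt (<) (\<rho> n)" for n by (simp add: \<rho>_def)
  have \<rho>less: "\<rho> n ! i < \<rho> n ! j" if "i < j" "j < length (\<rho> n)" for n i j
    using sorted\<rho>[of n] that by (auto simp: sorted_wrt_iff_nth_less)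
  have \<rho>le: "\<rho> n ! i \<le> \<rho> n ! j" if "i \<le> j" "j < length (\<rho> n)" for n i j
    using \<rho>less[of i j n] that by (cases "i = j") auto
  have mem: "\<rho> n ! i \<in> {0..t}" if "i < length (\<rho> n)" for n i
    using nth_mem[OF that] Dt set\<rho> by blast
  have len: "0 < length (\<rho> n)" for n using set\<rho>[of n] by (auto simp: D_def)
  have \<rho>0: "\<rho> n ! 0 = 0" for n
  proof -
    have "0 \<in> set (\<rho> n)" by (simp add: set\<rho> D_def)
    then obtain j where "j < length (\<rho> n)" "\<rho> n ! j = 0" by (auto simp: in_set_conv_nth)
    with \<rho>le[of 0 j n] mem[of 0 n] len[of n] show ?thesis by auto
  qed
  define \<beta> where "\<beta> n i \<omega> = b (partition_floor (P n) (\<rho> n ! i)) \<omega> - b (partition_floor (Q n) (\<rho> n ! i)) \<omega>" for n i \<omega>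
  have diff: "ito_sum b u (P n) (\<rho> n ! l) \<omega> - ito_sum b u (Q n) (\<rho> n ! l) \<omega>
      = (\<Sum>i<l. \<beta> n i \<omega> * (u \<bullet> (W (\<rho> n ! Suc i) \<omega> - W (\<rho> n ! i) \<omega>)))" if "l < length (\<rho> n)" for n l \<omega>
    using that
  proof (induction l)
    case 0
    then show ?case using ito_sum_0[OF P] ito_sum_0[OF Q] by (simp add: \<rho>0)
  next
    case (Suc l)
    have lt: "\<rho> n ! l < \<rho> n ! Suc l" using Suc.prems by (intro \<rho>less) auto
    have m: "0 \<le> \<rho> n ! l" "\<rho> n ! Suc l \<le> t" using mem[of l n] mem[of "Suc l" n] Suc.prems by auto
    have no: "\<not> (\<rho> n ! l < x \<and> x < \<rho> n ! Suc l)" if "x \<in> set (P n) \<union> set (Q n)" for x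
    proof
      assume x: "\<rho> n ! l < x \<and> x < \<rho> n ! Suc l"
      then have "x \<in> set (\<rho> n)" using m that by (auto simp: set\<rho> D_def)
      then obtain j where j: "j < length (\<rho> n)" "x = \<rho> n ! j" by (auto simp: in_set_conv_nth)
      show False using \<rho>le[of j l n] \<rho>le[of "Suc l" j n] j x Suc.prems by (cases "j \<le> l") auto
    qed
    have "ito_sum b u (P n) (\<rho> n ! Suc l) \<omega> - ito_sum b u (P n) (\<rho> n ! l) \<omega>
        = b (partition_floor (P n) (\<rho> n ! l)) \<omega> * (u \<bullet> (W (\<rho> n ! Suc l) \<omega> - W (\<rho> n ! l) \<omega>))"
      using no m p by (intro ito_sum_step[OF P _ lt]) auto
    moreover have "ito_sum b u (Q n) (\<rho> n ! Suc l) \<omega> - ito_sum b u (Q n) (\<rho> n ! l) \<omega>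
        = b (partition_floor (Q n) (\<rho> n ! l)) \<omega> * (u \<bullet> (W (\<rho> n ! Suc l) \<omega> - W (\<rho> n ! l) \<omega>))"
      using no m q by (intro ito_sum_step[OF Q _ lt]) auto
    ultimately show ?case using Suc by (simp add: \<beta>_def left_diff_distrib)
  qed
  have fl: "partition_floor (P n) s \<in> {0..T}" "partition_floor (P n) s \<le> s"
      "s - partition_floor (P n) s < inverse (real (Suc n))"
      "partition_floor (Q n) s \<in> {0..T}" "partition_floor (Q n) s \<le> s"
      "s - partition_floor (Q n) s < inverse (real (Suc n))" if "s \<in> {0..t}" for n s
    using partition_floor[OF P, of s n] partition_floor[OF Q, of s n] that p q by auto
  have \<beta>m: "\<beta> n i \<in> borel_measurable (G (\<rho> n ! i))" if "i < length (\<rho> n) - 1" for n i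
  proof -
    have "\<rho> n ! i \<in> {0..t}" using that by (intro mem) auto
    then show ?thesis
      unfolding \<beta>_def[abs_def] using fl[of "\<rho> n ! i" n] p
      by (intro borel_measurable_diff measurable_G_mono[OF b(1)]) auto
  qed
  have \<rho>T: "set (\<rho> n) \<subseteq> {0..T}" for n using Dt[of n] p unfolding set\<rho> by auto
  have \<beta>M: "\<beta> n i \<in> borel_measurable M" if "i < length (\<rho> n) - 1" for n i
    using measurable_G_M[OF \<beta>m[OF that]] mem[of i n] that p by (auto simp: less_diff_conv)
  \<comment> \<open>Uniform continuity of each path makes the coefficients small once the mesh is;
    the probability of a large one then vanishes by dominated convergence.\<close>
  have small: "(\<lambda>n. prob {\<omega>\<in>space M. \<exists>i<length (\<rho> n) - 1. c < \<bar>\<beta> n i \<omega>\<bar>}) \<longlonglongrightarrow> 0" if c: "0 < c" for c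
  proof (rule prob_tendsto_0_if_AE_eventually_not)
    fix n
    note \<beta>M[measurable]
    have ex: "(\<exists>i<length (\<rho> n) - 1. P i) \<longleftrightarrow> (\<exists>i\<in>{..<length (\<rho> n) - 1}. P i)" for P by auto
    show "{\<omega>\<in>space M. \<exists>i<length (\<rho> n) - 1. c < \<bar>\<beta> n i \<omega>\<bar>} \<in> events"
      unfolding ex by measurable
  next
    show "AE \<omega> in M. \<forall>\<^sub>F n in sequentially. \<omega> \<notin> {\<omega>\<in>space M. \<exists>i<length (\<rho> n) - 1. c < \<bar>\<beta> n i \<omega>\<bar>}"
    proof (rule AE_I2)
      fix \<omega> assume \<omega>: "\<omega> \<in> space M"
      have "uniformly_continuous_on {0..T} (\<lambda>s. b s \<omega>)"
        using b(2)[OF \<omega>] by (intro compact_uniformly_continuous) auto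
      then obtain d where d: "0 < d" "\<And>s s'. s \<in> {0..T} \<Longrightarrow> s' \<in> {0..T} \<Longrightarrow> \<bar>s' - s\<bar> < d \<Longrightarrow> \<bar>b s' \<omega> - b s \<omega>\<bar> < c"
        using c unfolding uniformly_continuous_on_def dist_real_def by metis
      show "\<forall>\<^sub>F n in sequentially. \<omega> \<notin> {\<omega>\<in>space M. \<exists>i<length (\<rho> n) - 1. c < \<bar>\<beta> n i \<omega>\<bar>}"
        using inverse_Suc_small[OF d(1)]
      proof eventually_elim
        case (elim n)
        have "\<bar>\<beta> n i \<omega>\<bar> < c" if "i < length (\<rho> n) - 1" for i
        proof -
          have m: "\<rho> n ! i \<in> {0..t}" using mem[of i n] that by auto
          have "\<bar>partition_floor (P n) (\<rho> n ! i) - partition_floor (Q n) (\<rho> n ! i)\<bar> < d"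
            using fl[OF m, of n] elim by linarith
          then show ?thesis unfolding \<beta>_def using fl[OF m, of n] by (intro d) auto
        qed
        then show ?case by (auto simp: not_less intro: less_imp_le)
      qed
    qed
  qed
  have lim: "(\<lambda>n. prob {\<omega>\<in>space M. \<exists>l\<le>length (\<rho> n) - 1. \<epsilon> < \<bar>\<Sum>i<l. \<beta> n i \<omega> *
    (u \<bullet> (W (\<rho> n ! Suc i) \<omega> - W (\<rho> n ! i) \<omega>))\<bar>}) \<longlonglongrightarrow> 0"
    by (rule linear_sums_small[OF sorted\<rho> \<rho>T \<beta>m small \<epsilon>])
  show ?thesis
  proof (rule tendsto_sandwich[OF _ _ tendsto_const lim]; intro always_eventually allI)
    fix n
    have ex: "(\<exists>l\<le>length (\<rho> n) - 1. P l) \<longleftrightarrow> (\<exists>l\<in>{..length (\<rho> n) - 1}. P l)" for P by auto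
    have WM: "W (\<rho> n ! i) \<in> borel_measurable M" if "i < length (\<rho> n)" for i
      using mem[OF that] p by (intro W_measurable) auto
    have sm: "(\<lambda>\<omega>. \<Sum>i<l. \<beta> n i \<omega> * (u \<bullet> (W (\<rho> n ! Suc i) \<omega> - W (\<rho> n ! i) \<omega>))) \<in> borel_measurable M"
      if "l \<le> length (\<rho> n) - 1" for l
      by (intro borel_measurable_sum borel_measurable_times borel_measurable_inner borel_measurable_const
          borel_measurable_diff \<beta>M WM) (use that len[of n] in auto)
    show "prob {\<omega>\<in>space M. \<exists>s\<in>F n. \<epsilon> < \<bar>ito_sum b u (P n) s \<omega> - ito_sum b u (Q n) s \<omega>\<bar>}
       \<le> prob {\<omega>\<in>space M. \<exists>l\<le>length (\<rho> n) - 1. \<epsilon> < \<bar>\<Sum>i<l. \<beta> n i \<omega> * (u \<bullet> (W (\<rho> n ! Suc i) \<omega> - W (\<rho> n ! i) \<omega>))\<bar>}"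
    proof (rule finite_measure_mono)
      show "{\<omega>\<in>space M. \<exists>s\<in>F n. \<epsilon> < \<bar>ito_sum b u (P n) s \<omega> - ito_sum b u (Q n) s \<omega>\<bar>}
        \<subseteq> {\<omega>\<in>space M. \<exists>l\<le>length (\<rho> n) - 1. \<epsilon> < \<bar>\<Sum>i<l. \<beta> n i \<omega> * (u \<bullet> (W (\<rho> n ! Suc i) \<omega> - W (\<rho> n ! i) \<omega>))\<bar>}"
      proof safe
        fix \<omega> s assume s: "s \<in> F n" and gr: "\<epsilon> < \<bar>ito_sum b u (P n) s \<omega> - ito_sum b u (Q n) s \<omega>\<bar>"
        have "s \<in> set (\<rho> n)" using s by (simp add: set\<rho> D_def)
        then obtain l where l: "l < length (\<rho> n)" "s = \<rho> n ! l" by (auto simp: in_set_conv_nth)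
        with gr diff[OF l(1)] show "\<exists>l\<le>length (\<rho> n) - 1. \<epsilon> < \<bar>\<Sum>i<l. \<beta> n i \<omega> * (u \<bullet> (W (\<rho> n ! Suc i) \<omega> - W (\<rho> n ! i) \<omega>))\<bar>"
          by (intro exI[of _ l]) auto
      qed
      show "{\<omega>\<in>space M. \<exists>l\<le>length (\<rho> n) - 1. \<epsilon> < \<bar>\<Sum>i<l. \<beta> n i \<omega> * (u \<bullet> (W (\<rho> n ! Suc i) \<omega> - W (\<rho> n ! i) \<omega>))\<bar>} \<in> events"
        unfolding ex
      proof (rule sets.sets_Collect_finite_Ex)
        fix l assume "l \<in> {..length (\<rho> n) - 1}"
        then have [measurable]: "(\<lambda>\<omega>. \<Sum>i<l. \<beta> n i \<omega> * (u \<bullet> (W (\<rho> n ! Suc i) \<omega> - W (\<rho> n ! i) \<omega>))) \<in> borel_measurable M"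
          by (intro sm) auto
        show "{\<omega>\<in>space M. \<epsilon> < \<bar>\<Sum>i<l. \<beta> n i \<omega> * (u \<bullet> (W (\<rho> n ! Suc i) \<omega> - W (\<rho> n ! i) \<omega>))\<bar>} \<in> events"
          by measurable
      qed simp
    qed
  qed simp
qed

end

section \<open>Maxima over the points of a partition and the calculus of subsequence limits\<close>

definition partition_max :: "real list \<Rightarrow> (nat \<Rightarrow> real) \<Rightarrow> real" where
  "partition_max ts x = Max ((\<lambda>l. \<bar>x l\<bar>) ` {..<length ts})"

lemma partition_max_ge: "l < length ts \<Longrightarrow> \<bar>x l\<bar> \<le> partition_max ts x"
  unfolding partition_max_def by (rule Max_ge) auto

lemma partition_max_le: "ts \<noteq> [] \<Longrightarrow> (\<And>l. l < length ts \<Longrightarrow> \<bar>x l\<bar> \<le> e) \<Longrightarrow> partition_max ts x \<le> e"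
  unfolding partition_max_def by (subst Max_le_iff) auto

lemma partition_max_nonneg: "ts \<noteq> [] \<Longrightarrow> 0 \<le> partition_max ts x"
  using partition_max_ge[of 0 ts x] by auto

lemma partition_max_tendsto_0I:
  assumes ne: "\<And>n. \<pi> n \<noteq> []"
    and small: "\<And>e. 0 < e \<Longrightarrow> \<forall>\<^sub>F n in sequentially. \<forall>l<length (\<pi> n). \<bar>x n l\<bar> \<le> e"
  shows "(\<lambda>n. partition_max (\<pi> n) (x n)) \<longlonglongrightarrow> 0"
proof (rule order_tendstoI)
  fix e :: real assume "0 < e"
  then have "\<forall>\<^sub>F n in sequentially. \<forall>l<length (\<pi> n). \<bar>x n l\<bar> \<le> e / 2" by (intro small) simp
  then show "\<forall>\<^sub>F n in sequentially. partition_max (\<pi> n) (x n) < e"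
  proof eventually_elim
    case (elim n)
    then have "partition_max (\<pi> n) (x n) \<le> e / 2" using ne by (intro partition_max_le) auto
    with \<open>0 < e\<close> show ?case by simp
  qed
next
  fix e :: real assume e: "e < 0"
  show "\<forall>\<^sub>F n in sequentially. e < partition_max (\<pi> n) (x n)"
    by (intro always_eventually allI less_le_trans[OF e] partition_max_nonneg ne)
qed

lemma subseq_limitD_refine:
  assumes "subseq_limit M t S L" "mesh_seq t \<pi>"
  shows "\<exists>r. strict_mono r \<and> (\<forall>n. \<pi> (r n) \<in> partitions t (inverse (real (Suc n))))
    \<and> (AE \<omega> in M. (\<lambda>n. S (\<pi> (r n)) \<omega>) \<longlonglongrightarrow> L \<omega>)"
proof -
  obtain r where r: "strict_mono r" "\<And>n. \<pi> (r n) \<in> partitions t (inverse (real (Suc n)))"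
    using mesh_seq_refine[OF assms(2)] by blast
  obtain r' where r': "strict_mono r'" "AE \<omega> in M. (\<lambda>n. S (\<pi> (r (r' n))) \<omega>) \<longlonglongrightarrow> L \<omega>"
    using assms(1) mesh_seq_subseq[OF assms(2) r(1)] unfolding subseq_limit_def by blast
  have "\<pi> (r (r' n)) \<in> partitions t (inverse (real (Suc n)))" for n
  proof -
    have "inverse (real (Suc (r' n))) \<le> inverse (real (Suc n))"
      using seq_suble[OF r'(1), of n] by (intro le_imp_inverse_le) auto
    then show ?thesis using r(2)[of "r' n"] partitions_mono by blast
  qed
  then show ?thesis using r r' by (intro exI[of _ "\<lambda>n. r (r' n)"]) (auto simp: strict_mono_def)
qed

text \<open>A sequence of partitions with vanishing mesh can be thinned until the
  \<open>n\<close>-th mesh is below \<open>1 / (n + 1)\<close>, and a subsequence of a subsequence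
  is a subsequence; so an explicit rate may be assumed.\<close>

lemma subseq_limit_refineI:
  assumes "\<And>\<pi>. (\<And>n. \<pi> n \<in> partitions t (inverse (real (Suc n)))) \<Longrightarrow>
    \<exists>r. strict_mono r \<and> (AE \<omega> in M. (\<lambda>n. S (\<pi> (r n)) \<omega>) \<longlonglongrightarrow> L \<omega>)"
  shows "subseq_limit M t S L"
  unfolding subseq_limit_def
proof (intro allI impI)
  fix \<pi> assume \<pi>: "mesh_seq t \<pi>"
  obtain r where r: "strict_mono r" "\<And>n. \<pi> (r n) \<in> partitions t (inverse (real (Suc n)))"
    using mesh_seq_refine[OF \<pi>] by blast
  obtain r' where r': "strict_mono r'" "AE \<omega> in M. (\<lambda>n. S (\<pi> (r (r' n))) \<omega>) \<longlonglongrightarrow> L \<omega>"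
    using assms[of "\<lambda>n. \<pi> (r n)"] r(2) by blast
  then show "\<exists>r. strict_mono r \<and> (AE \<omega> in M. (\<lambda>n. S (\<pi> (r n)) \<omega>) \<longlonglongrightarrow> L \<omega>)"
    using r by (intro exI[of _ "\<lambda>n. r (r' n)"]) (auto simp: strict_mono_def)
qed

lemma subseq_limit_add:
  fixes S :: "real list \<Rightarrow> 'a \<Rightarrow> 'b::real_normed_vector"
  assumes "subseq_limit M t S L" "subseq_limit M t S' L'"
  shows "subseq_limit M t (\<lambda>ts \<omega>. S ts \<omega> + S' ts \<omega>) (\<lambda>\<omega>. L \<omega> + L' \<omega>)"
  unfolding subseq_limit_def
proof (intro allI impI)
  fix \<pi> assume \<pi>: "mesh_seq t \<pi>"
  obtain r where r: "strict_mono r" "AE \<omega> in M. (\<lambda>n. S (\<pi> (r n)) \<omega>) \<longlonglongrightarrow> L \<omega>"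
    using assms(1) \<pi> unfolding subseq_limit_def by blast
  obtain r' where r': "strict_mono r'" "AE \<omega> in M. (\<lambda>n. S' (\<pi> (r (r' n))) \<omega>) \<longlonglongrightarrow> L' \<omega>"
    using assms(2) mesh_seq_subseq[OF \<pi> r(1)] unfolding subseq_limit_def by blast
  have "AE \<omega> in M. (\<lambda>n. S (\<pi> (r (r' n))) \<omega> + S' (\<pi> (r (r' n))) \<omega>) \<longlonglongrightarrow> L \<omega> + L' \<omega>"
    using r(2) r'(2)
  proof eventually_elim
    case (elim \<omega>)
    then show ?case using LIMSEQ_subseq_LIMSEQ[OF elim(1) r'(1)]
      by (intro tendsto_add) (auto simp: comp_def)
  qed
  then show "\<exists>r. strict_mono r \<and> (AE \<omega> in M. (\<lambda>n. S (\<pi> (r n)) \<omega> + S' (\<pi> (r n)) \<omega>) \<longlonglongrightarrow> L \<omega> + L' \<omega>)"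
    using r r' by (intro exI[of _ "\<lambda>n. r (r' n)"]) (auto simp: strict_mono_def)
qed

lemma subseq_limit_sum_0:
  fixes S :: "'i \<Rightarrow> real list \<Rightarrow> 'a \<Rightarrow> 'b::real_normed_vector"
  assumes "finite I" "\<And>i. i \<in> I \<Longrightarrow> subseq_limit M t (S i) (\<lambda>_. 0)"
  shows "subseq_limit M t (\<lambda>ts \<omega>. \<Sum>i\<in>I. S i ts \<omega>) (\<lambda>_. 0)"
  using assms
proof (induction I rule: finite_induct)
  case empty
  show ?case by (auto simp: subseq_limit_def intro!: exI[of _ id] strict_mono_id)
next
  case (insert i I)
  then show ?case using subseq_limit_add[of M t "S i" "\<lambda>_. 0" "\<lambda>ts \<omega>. \<Sum>i\<in>I. S i ts \<omega>" "\<lambda>_. 0"] by simp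
qed

section \<open>Uniform limits of stochastic sums\<close>

context wiener_filtration
begin

text \<open>The sums over a reference sequence of partitions are Cauchy in probability uniformly in
  time; a fast subsequence converges uniformly for almost every sample point, by Borel-Cantelli and
  the Weierstrass test, and the limit inherits continuity. Sums over other partitions are close to
  the reference sums, hence to the same limit.\<close>

lemma ito_integral_exists:
  assumes T: "0 \<le> T"
    and b: "\<And>s. 0 \<le> s \<Longrightarrow> s \<le> T \<Longrightarrow> b s \<in> borel_measurable (G s)"
      "\<And>\<omega>. \<omega> \<in> space M \<Longrightarrow> continuous_on {0..T} (\<lambda>s. b s \<omega>)"
  shows "\<exists>N. (\<forall>s\<in>{0..T}. N s \<in> borel_measurable (G s)) \<and>
    (AE \<omega> in M. continuous_on {0..T} (\<lambda>s. N s \<omega>)) \<and>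
    (\<forall>t\<in>{0..T}. subseq_limit M t (\<lambda>ts \<omega>. partition_max ts (\<lambda>l.
       (\<Sum>i<l. b (ts ! i) \<omega> * (u \<bullet> (W (ts ! Suc i) \<omega> - W (ts ! i) \<omega>))) - N (ts ! l) \<omega>)) (\<lambda>_. 0))"
proof -
  obtain r0 where "\<And>n. uniform_partition T (r0 n) \<in> partitions T (inverse (real (Suc n)))"
    using mesh_seq_refine[OF mesh_seq_uniform[OF T]] by blast
  then obtain D where D: "\<And>n. D n \<in> partitions T (inverse (real (Suc n)))"
    by (meson that)
  have sub: "partitions p (inverse (real (Suc m))) \<subseteq> partitions p (inverse (real (Suc n)))" if "n \<le> m" for n m p
    using that by (intro partitions_mono le_imp_inverse_le) auto
  obtain Q where Q: "countable Q" "Q \<subseteq> {0..T}" "{0..T} \<subseteq> closure Q"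
    by (rule separable[of "{0..T}"])
  have Q0: "Q \<noteq> {}" using Q(3) T by auto
  define q where "q = from_nat_into Q"
  have rq: "range q = Q" unfolding q_def by (rule range_from_nat_into[OF Q0 Q(1)])
  have clQ: "closure Q = {0..T}"
    using Q closure_minimal[of Q "{0..T}"] by auto
  have qT: "q k \<in> {0..T}" for k using rq Q(2) by blast
  let ?J = "\<lambda>n. ito_sum b u (D n)"
  have JG: "?J n s \<in> borel_measurable (G s)" if "s \<in> {0..T}" for n s
    by (rule ito_sum_measurable_G[OF D order_refl _ _ b(1)]) (use that in auto)
  have JM: "?J n s \<in> borel_measurable M" if "s \<in> {0..T}" for n s
    using measurable_G_M[OF JG[OF that]] that by auto
  \<comment> \<open>The difference estimate speaks of sequences only. If this uniform statement
    failed, choosing bad indices \<open>n k\<close>, \<open>m k\<close> and bad finite sets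
    \<open>F k\<close> would produce a sequence contradicting it.\<close>
  have cauchy: "\<exists>n0. \<forall>n\<ge>n0. \<forall>m\<ge>n0. \<forall>F. finite F \<longrightarrow> F \<subseteq> {0..T} \<longrightarrow>
      prob {\<omega>\<in>space M. \<exists>s\<in>F. e < \<bar>?J n s \<omega> - ?J m s \<omega>\<bar>} \<le> e" if e: "0 < e" for e
  proof (rule ccontr)
    assume "\<not> ?thesis"
    then have "\<forall>k. \<exists>n m F. k \<le> n \<and> k \<le> m \<and> finite F \<and> F \<subseteq> {0..T} \<and>
        e < prob {\<omega>\<in>space M. \<exists>s\<in>F. e < \<bar>?J n s \<omega> - ?J m s \<omega>\<bar>}" by (auto simp: not_le)
    then obtain n m F where nmF: "\<And>k. k \<le> n k" "\<And>k. k \<le> m k" "\<And>k. finite (F k)" "\<And>k. F k \<subseteq> {0..T}"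
      "\<And>k. e < prob {\<omega>\<in>space M. \<exists>s\<in>F k. e < \<bar>?J (n k) s \<omega> - ?J (m k) s \<omega>\<bar>}" by meson
    have "D (n k) \<in> partitions T (inverse (real (Suc k)))" "D (m k) \<in> partitions T (inverse (real (Suc k)))" for k
      using subsetD[OF sub[OF nmF(1)] D] subsetD[OF sub[OF nmF(2)] D] .
    then have "(\<lambda>k. prob {\<omega>\<in>space M. \<exists>s\<in>F k. e < \<bar>?J (n k) s \<omega> - ?J (m k) s \<omega>\<bar>}) \<longlonglongrightarrow> 0"
      by (intro ito_sum_difference_small[where p=T and q=T and t=T, OF _ order_refl order_refl _ order_refl order_refl
            nmF(3) nmF(4) T b e])
    then have "e \<le> 0" by (rule LIMSEQ_le_const) (use nmF(5) in \<open>auto intro: less_imp_le\<close>)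
    with e show False by simp
  qed
  have A: "{\<omega>\<in>space M. \<exists>k. e < \<bar>?J n (q k) \<omega> - ?J m (q k) \<omega>\<bar>} \<in> events" for n m e
  proof -
    note JM[OF qT, measurable]
    show ?thesis by measurable
  qed
  have cauchy': "\<exists>n0. \<forall>n\<ge>n0. \<forall>m\<ge>n0.
      prob {\<omega>\<in>space M. \<exists>k. e < \<bar>?J n (q k) \<omega> - ?J m (q k) \<omega>\<bar>} \<le> e" if e: "0 < e" for e
  proof -
    from cauchy[OF e] obtain n0 where "\<forall>n\<ge>n0. \<forall>m\<ge>n0. \<forall>F. finite F \<longrightarrow> F \<subseteq> {0..T} \<longrightarrow>
      prob {\<omega>\<in>space M. \<exists>s\<in>F. e < \<bar>?J n s \<omega> - ?J m s \<omega>\<bar>} \<le> e" ..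
    note n0 = this[rule_format]
    have "prob {\<omega>\<in>space M. \<exists>k. e < \<bar>?J n (q k) \<omega> - ?J m (q k) \<omega>\<bar>} \<le> e" if nm: "n0 \<le> n" "n0 \<le> m" for n m
    proof -
      \<comment> \<open>The dense set is exhausted by finite pieces, so that continuity from below
        carries the bound for finite sets over to all of \<open>Q\<close>.\<close>
      define B where "B K = {\<omega>\<in>space M. \<exists>s\<in>q ` {..<K}. e < \<bar>?J n s \<omega> - ?J m s \<omega>\<bar>}" for K :: nat
      have eq: "{\<omega>\<in>space M. \<exists>k. e < \<bar>?J n (q k) \<omega> - ?J m (q k) \<omega>\<bar>} = (\<Union>K. B K)"
      proof (intro set_eqI iffI)
        fix \<omega> assume "\<omega> \<in> {\<omega>\<in>space M. \<exists>k. e < \<bar>?J n (q k) \<omega> - ?J m (q k) \<omega>\<bar>}"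
        then obtain k where "\<omega> \<in> space M" "e < \<bar>?J n (q k) \<omega> - ?J m (q k) \<omega>\<bar>" by blast
        then have "\<omega> \<in> B (Suc k)" unfolding B_def by blast
        then show "\<omega> \<in> (\<Union>K. B K)" by blast
      qed (auto simp: B_def)
      have "B K \<in> events" for K
      proof -
        have [measurable]: "?J n s \<in> borel_measurable M" "?J m s \<in> borel_measurable M" if "s \<in> q ` {..<K}" for s
          using JM that qT by blast+
        show ?thesis unfolding B_def by measurable
      qed
      moreover have "incseq B" unfolding incseq_def B_def by (fastforce intro: less_le_trans)
      ultimately have "(\<lambda>K. prob (B K)) \<longlonglongrightarrow> prob (\<Union>K. B K)"
        by (intro finite_Lim_measure_incseq) auto
      moreover have "prob (B K) \<le> e" for K
        unfolding B_def by (rule n0[OF nm]) (use qT in \<open>auto simp del: atLeastAtMost_iff\<close>)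
      ultimately show ?thesis unfolding eq by (intro LIMSEQ_le_const2) auto
    qed
    then show ?thesis by (intro exI[of _ n0] allI impI)
  qed
  define C where "C j n1 \<longleftrightarrow> (\<forall>n\<ge>n1. \<forall>m\<ge>n1.
      prob {\<omega>\<in>space M. \<exists>k. (1/2)^j < \<bar>?J n (q k) \<omega> - ?J m (q k) \<omega>\<bar>} \<le> (1/2)^j)" for j n1 :: nat
  have ex: "\<exists>n1>m0. C j n1" for j m0 :: nat
  proof -
    have "\<exists>n0. C j n0" unfolding C_def by (rule cauchy') simp
    then obtain n0 where "C j n0" ..
    then have "C j (max n0 (Suc m0))" by (simp add: C_def)
    then show ?thesis by (intro exI[of _ "max n0 (Suc m0)"]) simp
  qed
  obtain \<kappa> where \<kappa>: "\<And>j. C j (\<kappa> j)" "\<And>j. \<kappa> j < \<kappa> (Suc j)"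
    using dependent_nat_choice[of C "\<lambda>_ m n. m < n"] ex by meson
  have \<kappa>mono: "strict_mono \<kappa>" using \<kappa>(2) by (simp add: strict_mono_Suc_iff)
  have \<kappa>ge: "j \<le> \<kappa> j" for j by (rule seq_suble[OF \<kappa>mono])
  define I where "I j = ?J (\<kappa> j)" for j
  \<comment> \<open>As a \<open>lim\<close> of functions measurable with respect to
    \<open>G s\<close>, this is adapted without completing the filtration; sample points of
    divergence receive some value of \<open>lim\<close>.\<close>
  define N where "N s \<omega> = lim (\<lambda>j. I j s \<omega>)" for s \<omega>
  have NG: "N s \<in> borel_measurable (G s)" if "s \<in> {0..T}" for s
    unfolding N_def[abs_def] I_def by (intro borel_measurable_lim_metric JG that)
  let ?A = "\<lambda>j. {\<omega>\<in>space M. \<exists>k. (1/2)^j < \<bar>?J (\<kappa> j) (q k) \<omega> - ?J (\<kappa> (Suc j)) (q k) \<omega>\<bar>}"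
  have Aj: "prob (?A j) \<le> (1/2)^j" for j
    using \<kappa>(1)[unfolded C_def, rule_format, of j "\<kappa> j" "\<kappa> (Suc j)"] \<kappa>(2)[of j] by simp
  have "summable (\<lambda>j. prob (?A j))"
    by (rule summable_comparison_test[of _ "\<lambda>j. (1/2)^j"]) (use Aj in \<open>auto intro!: exI[of _ 0] summable_geometric\<close>)
  then have "AE \<omega> in M. \<forall>\<^sub>F j in sequentially. \<omega> \<in> space M - ?A j"
    by (intro borel_cantelli_AE1 A) (auto simp: emeasure_eq_measure)
  then have ul: "AE \<omega> in M. continuous_on {0..T} (\<lambda>s. N s \<omega>) \<and>
      uniform_limit {0..T} (\<lambda>j s. I j s \<omega>) (\<lambda>s. N s \<omega>) sequentially"
    using AE_space
  proof eventually_elim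
    case (elim \<omega>)
    note \<omega> = elim(2)
    have cont: "continuous_on {0..T} (\<lambda>s. I j s \<omega>)" for j
      unfolding I_def by (rule ito_sum_continuous[OF D order_refl \<omega>])
    have "\<forall>\<^sub>F j in sequentially. \<forall>s\<in>{0..T}. norm (I (Suc j) s \<omega> - I j s \<omega>) \<le> (1/2)^j"
      using elim(1)
    proof eventually_elim
      case (elim j)
      show ?case
      proof
        fix s assume s: "s \<in> {0..T}"
        show "norm (I (Suc j) s \<omega> - I j s \<omega>) \<le> (1/2)^j"
        \<comment> \<open>The bound is known on the dense set \<open>Q\<close> only; the left-hand
          side is continuous in \<open>s\<close>, so it extends to the closure
          \<open>{0..T}\<close>.\<close>
        proof (rule continuous_le_on_closure[where S=Q and f="\<lambda>s. norm (I (Suc j) s \<omega> - I j s \<omega>)"])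
          show "continuous_on (closure Q) (\<lambda>s. norm (I (Suc j) s \<omega> - I j s \<omega>))"
            unfolding clQ by (intro continuous_on_norm continuous_on_diff cont)
          show "s \<in> closure Q" using s clQ by simp
          fix x assume "x \<in> Q"
          then obtain k where "x = q k" using rq by blast
          then show "norm (I (Suc j) x \<omega> - I j x \<omega>) \<le> (1/2)^j"
            using elim \<omega> by (auto simp: I_def not_less abs_minus_commute)
        qed
      qed
    qed
    then have "uniform_limit {0..T} (\<lambda>n s. \<Sum>j<n. (I (Suc j) s \<omega> - I j s \<omega>))
        (\<lambda>s. suminf (\<lambda>j. I (Suc j) s \<omega> - I j s \<omega>)) sequentially"
      by (rule Weierstrass_m_test_ev) (auto intro: summable_geometric)
    then have "uniform_limit {0..T} (\<lambda>n s. I 0 s \<omega> + (\<Sum>j<n. (I (Suc j) s \<omega> - I j s \<omega>)))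
        (\<lambda>s. I 0 s \<omega> + suminf (\<lambda>j. I (Suc j) s \<omega> - I j s \<omega>)) sequentially"
      by (intro uniform_limit_add uniform_limit_const)
    then have u: "uniform_limit {0..T} (\<lambda>n s. I n s \<omega>)
        (\<lambda>s. I 0 s \<omega> + suminf (\<lambda>j. I (Suc j) s \<omega> - I j s \<omega>)) sequentially"
      by (simp add: sum_lessThan_telescope[of "\<lambda>j. I j _ \<omega>"])
    have "I 0 s \<omega> + suminf (\<lambda>j. I (Suc j) s \<omega> - I j s \<omega>) = N s \<omega>" if "s \<in> {0..T}" for s
      unfolding N_def using tendsto_uniform_limitI[OF u that] by (rule limI[symmetric])
    then have u: "uniform_limit {0..T} (\<lambda>j s. I j s \<omega>) (\<lambda>s. N s \<omega>) sequentially"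
      using u by (subst uniform_limit_cong'[OF _ ]) (auto elim: uniform_limit_cong'[THEN iffD1, rotated -1])
    moreover have "continuous_on {0..T} (\<lambda>s. N s \<omega>)"
      by (rule uniform_limit_theorem[OF _ u]) (use cont in auto)
    ultimately show ?case by blast
  qed
  have conv: "subseq_limit M t (\<lambda>ts \<omega>. partition_max ts (\<lambda>l.
       (\<Sum>i<l. b (ts ! i) \<omega> * (u \<bullet> (W (ts ! Suc i) \<omega> - W (ts ! i) \<omega>))) - N (ts ! l) \<omega>)) (\<lambda>_. 0)"
    if t: "t \<in> {0..T}" for t
  proof (rule subseq_limit_refineI)
    fix \<pi> assume \<pi>: "\<And>n. \<pi> n \<in> partitions t (inverse (real (Suc n)))"
    have \<pi>t: "s \<in> {0..t}" if "s \<in> set (\<pi> n)" for n s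
      using that partition_nth_mem[OF \<pi>[of n]] by (auto simp: in_set_conv_nth)
    \<comment> \<open>The sum over \<open>\<pi> n\<close> is compared with the reference sum of the
      same index, at the points of \<open>\<pi> n\<close> only; the reference sums themselves
      converge uniformly.\<close>
    let ?B = "\<lambda>k n. {\<omega>\<in>space M. \<exists>s\<in>set (\<pi> n). inverse (real (Suc k)) < \<bar>ito_sum b u (\<pi> n) s \<omega> - I n s \<omega>\<bar>}"
    have B: "?B k n \<in> events" for k n
    proof -
      have [measurable]: "ito_sum b u (\<pi> n) s \<in> borel_measurable M" "I n s \<in> borel_measurable M"
        if "s \<in> set (\<pi> n)" for s
        using \<pi>t[OF that] t measurable_G_M[OF ito_sum_measurable_G[OF \<pi>, of s b u n]] b(1) JM
        by (auto simp: I_def)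
      show ?thesis by measurable
    qed
    have "(\<lambda>n. prob (?B k n)) \<longlonglongrightarrow> 0" for k
      unfolding I_def
    proof (rule ito_sum_difference_small[where p=t and q=T and t=t, OF \<pi> order_refl _ _ _ order_refl _ _ _ b])
      show "D (\<kappa> n) \<in> partitions T (inverse (real (Suc n)))" for n
        by (rule subsetD[OF sub[OF \<kappa>ge] D])
      show "set (\<pi> n) \<subseteq> {0..t}" for n using \<pi>t by blast
    qed (use t in auto)
    from AE_subseq_of_prob_tendsto_0[where A="?B", OF B this]
    obtain r where "strict_mono r \<and> (AE \<omega> in M. \<forall>\<^sub>F n in sequentially. \<omega> \<notin> ?B n (r n))" ..
    note r = conjunct1[OF this] conjunct2[OF this]
    have "AE \<omega> in M. (\<lambda>n. partition_max (\<pi> (r n)) (\<lambda>l.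
       (\<Sum>i<l. b (\<pi> (r n) ! i) \<omega> * (u \<bullet> (W (\<pi> (r n) ! Suc i) \<omega> - W (\<pi> (r n) ! i) \<omega>))) - N (\<pi> (r n) ! l) \<omega>)) \<longlonglongrightarrow> 0"
      using r(2) ul AE_space
    proof eventually_elim
      case (elim \<omega>)
      show ?case
      proof (rule partition_max_tendsto_0I)
        show "\<pi> (r n) \<noteq> []" for n using partition_length[OF \<pi>] by auto
        fix e :: real assume e: "0 < e"
        have "uniform_limit {0..T} (\<lambda>j s. I j s \<omega>) (\<lambda>s. N s \<omega>) sequentially" using elim by blast
        then have "\<forall>\<^sub>F j in sequentially. \<forall>s\<in>{0..T}. dist (I j s \<omega>) (N s \<omega>) < e / 2"
          using e by (intro uniform_limitD) auto
        then have "\<forall>\<^sub>F n in sequentially. \<forall>s\<in>{0..T}. dist (I (r n) s \<omega>) (N s \<omega>) < e / 2"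
          using filterlim_subseq[OF r(1)] by (auto simp: filterlim_iff)
        moreover have "\<forall>\<^sub>F n in sequentially. inverse (real (Suc n)) < e / 2"
          using e by (intro inverse_Suc_small) auto
        ultimately show "\<forall>\<^sub>F n in sequentially. \<forall>l<length (\<pi> (r n)). \<bar>(\<Sum>i<l. b (\<pi> (r n) ! i) \<omega> *
            (u \<bullet> (W (\<pi> (r n) ! Suc i) \<omega> - W (\<pi> (r n) ! i) \<omega>))) - N (\<pi> (r n) ! l) \<omega>\<bar> \<le> e"
          using elim(1)
        proof eventually_elim
          case (elim n)
          show ?case
          proof (intro allI impI)
            fix l assume l: "l < length (\<pi> (r n))"
            then have s: "\<pi> (r n) ! l \<in> set (\<pi> (r n))" by simp
            have "\<bar>ito_sum b u (\<pi> (r n)) (\<pi> (r n) ! l) \<omega> - I (r n) (\<pi> (r n) ! l) \<omega>\<bar> \<le> inverse (real (Suc n))"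
              using elim(3) s \<open>\<omega> \<in> space M\<close> by (auto simp: not_less)
            moreover have "\<bar>I (r n) (\<pi> (r n) ! l) \<omega> - N (\<pi> (r n) ! l) \<omega>\<bar> < e / 2"
              using elim(1) \<pi>t[OF s] t by (auto simp: dist_real_def)
            ultimately show "\<bar>(\<Sum>i<l. b (\<pi> (r n) ! i) \<omega> *
                (u \<bullet> (W (\<pi> (r n) ! Suc i) \<omega> - W (\<pi> (r n) ! i) \<omega>))) - N (\<pi> (r n) ! l) \<omega>\<bar> \<le> e"
              using elim(2) unfolding ito_sum_partition[OF \<pi> l] by linarith
          qed
        qed
      qed
    qed
    with r(1) show "\<exists>r. strict_mono r \<and> (AE \<omega> in M. (\<lambda>n. partition_max (\<pi> (r n)) (\<lambda>l.
       (\<Sum>i<l. b (\<pi> (r n) ! i) \<omega> * (u \<bullet> (W (\<pi> (r n) ! Suc i) \<omega> - W (\<pi> (r n) ! i) \<omega>))) - N (\<pi> (r n) ! l) \<omega>)) \<longlonglongrightarrow> 0)"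
      by blast
  qed
  have "AE \<omega> in M. continuous_on {0..T} (\<lambda>s. N s \<omega>)"
    using ul by (rule eventually_mono) blast
  then show ?thesis
    using NG conv by (intro exI[of _ N] conjI ballI)
qed

text \<open>Convergence in probability for each tolerance becomes almost sure convergence along one
  subsequence, the tolerance being lowered along the diagonal.\<close>

lemma AE_subseq_partition_max:
  assumes \<pi>: "\<And>n. \<pi> n \<in> partitions t \<delta>"
    and meas: "\<And>n l. l < length (\<pi> n) \<Longrightarrow> x n l \<in> borel_measurable M"
    and lim: "\<And>e::real. 0 < e \<Longrightarrow> (\<lambda>n. prob {\<omega>\<in>space M. \<exists>l\<le>length (\<pi> n) - 1. e < \<bar>x n l \<omega>\<bar>}) \<longlonglongrightarrow> 0"
  shows "\<exists>r. strict_mono r \<and> (AE \<omega> in M. (\<lambda>n. partition_max (\<pi> (r n)) (\<lambda>l. x (r n) l \<omega>)) \<longlonglongrightarrow> 0)"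
proof -
  let ?A = "\<lambda>k n. {\<omega>\<in>space M. \<exists>l\<le>length (\<pi> n) - 1. inverse (real (Suc k)) < \<bar>x n l \<omega>\<bar>}"
  have A: "?A k n \<in> events" for k n
  proof -
    have ex: "(\<exists>l\<le>length (\<pi> n) - 1. P l) \<longleftrightarrow> (\<exists>l\<in>{..<length (\<pi> n)}. P l)" for P
    proof -
      have "l \<le> length (\<pi> n) - 1 \<longleftrightarrow> l \<in> {..<length (\<pi> n)}" for l
        using partition_length[OF \<pi>, of n] unfolding lessThan_iff by linarith
      then show ?thesis by auto
    qed
    note meas[measurable]
    show ?thesis unfolding ex by measurable
  qed
  have "(\<lambda>n. prob (?A k n)) \<longlonglongrightarrow> 0" for k by (rule lim) simp
  from AE_subseq_of_prob_tendsto_0[where A="?A", OF A this]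
  obtain r where "strict_mono r \<and> (AE \<omega> in M. \<forall>\<^sub>F n in sequentially. \<omega> \<notin> ?A n (r n))" ..
  note r = conjunct1[OF this] conjunct2[OF this]
  have "AE \<omega> in M. (\<lambda>n. partition_max (\<pi> (r n)) (\<lambda>l. x (r n) l \<omega>)) \<longlonglongrightarrow> 0"
    using r(2) AE_space
  proof eventually_elim
    case (elim \<omega>)
    show ?case
    proof (rule partition_max_tendsto_0I)
      show "\<pi> (r n) \<noteq> []" for n using partition_length[OF \<pi>] by auto
      fix e :: real assume e: "0 < e"
      show "\<forall>\<^sub>F n in sequentially. \<forall>l<length (\<pi> (r n)). \<bar>x (r n) l \<omega>\<bar> \<le> e"
        using elim(1) inverse_Suc_small[OF e]
      proof eventually_elim
        case (elim n)
        have "\<bar>x (r n) l \<omega>\<bar> \<le> inverse (real (Suc n))" if "l < length (\<pi> (r n))" for l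
        proof (rule ccontr)
          assume "\<not> ?thesis"
          then have "\<omega> \<in> ?A n (r n)" using that \<open>\<omega> \<in> space M\<close> by (auto intro!: exI[of _ l])
          with elim show False by blast
        qed
        with elim show ?case by fastforce
      qed
    qed
  qed
  with r show ?thesis by blast
qed

lemma subseq_limit_quadratic_sums:
  assumes t: "t \<in> {0..T}"
    and b: "\<And>s. 0 \<le> s \<Longrightarrow> s \<le> T \<Longrightarrow> b s \<in> borel_measurable (G s)"
      "\<And>\<omega>. \<omega> \<in> space M \<Longrightarrow> continuous_on {0..T} (\<lambda>s. b s \<omega>)"
  shows "subseq_limit M t (\<lambda>ts \<omega>. partition_max ts (\<lambda>l. \<Sum>i<l. b (ts ! i) \<omega> *
    ((u \<bullet> (W (ts ! Suc i) \<omega> - W (ts ! i) \<omega>))\<^sup>2 - (ts ! Suc i - ts ! i) * (u \<bullet> (R *v u))))) (\<lambda>_. 0)"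
proof (rule subseq_limit_refineI)
  fix \<pi> assume \<pi>: "\<And>n. \<pi> n \<in> partitions t (inverse (real (Suc n)))"
  have \<pi>1: "\<pi> n \<in> partitions t 1" for n
    using \<pi>[of n] partitions_mono[of "inverse (real (Suc n))" 1 t] by (auto simp: inverse_eq_divide)
  show "\<exists>r. strict_mono r \<and> (AE \<omega> in M. (\<lambda>n. partition_max (\<pi> (r n)) (\<lambda>l. \<Sum>i<l. b (\<pi> (r n) ! i) \<omega> *
    ((u \<bullet> (W (\<pi> (r n) ! Suc i) \<omega> - W (\<pi> (r n) ! i) \<omega>))\<^sup>2 - (\<pi> (r n) ! Suc i - \<pi> (r n) ! i) * (u \<bullet> (R *v u))))) \<longlonglongrightarrow> 0)"
  proof (rule AE_subseq_partition_max[OF \<pi>1])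
    fix n l assume l: "l < length (\<pi> n)"
    have bW: "b (\<pi> n ! i) \<in> borel_measurable M" "W (\<pi> n ! i) \<in> borel_measurable M" if "i < length (\<pi> n)" for i
      using partition_nth_mem[OF \<pi> that] t measurable_G_M[OF b(1), of "\<pi> n ! i"] W_measurable[of "\<pi> n ! i"] by auto
    show "(\<lambda>\<omega>. \<Sum>i<l. b (\<pi> n ! i) \<omega> *
      ((u \<bullet> (W (\<pi> n ! Suc i) \<omega> - W (\<pi> n ! i) \<omega>))\<^sup>2 - (\<pi> n ! Suc i - \<pi> n ! i) * (u \<bullet> (R *v u)))) \<in> borel_measurable M"
      by (intro borel_measurable_sum borel_measurable_times borel_measurable_inner borel_measurable_const
          borel_measurable_diff borel_measurable_power bW) (use l in auto)
  next
    fix e :: real assume "0 < e"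
    then show "(\<lambda>n. prob {\<omega>\<in>space M. \<exists>l\<le>length (\<pi> n) - 1. e < \<bar>\<Sum>i<l. b (\<pi> n ! i) \<omega> *
      ((u \<bullet> (W (\<pi> n ! Suc i) \<omega> - W (\<pi> n ! i) \<omega>))\<^sup>2 - (\<pi> n ! Suc i - \<pi> n ! i) * (u \<bullet> (R *v u)))\<bar>}) \<longlonglongrightarrow> 0"
      using t by (intro quadratic_sums_small[OF \<pi> _ b]) auto
  qed
qed

text \<open>The coefficients may depend on the whole partition, as the error of a partial sum does.
  Along a subsequence where they vanish uniformly almost surely they also vanish in probability, and
  the estimate for linear sums gives a further subsequence.\<close>

lemma subseq_limit_linear_sums:
  fixes \<beta> :: "real list \<Rightarrow> nat \<Rightarrow> 'a \<Rightarrow> real"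
  assumes t: "t \<in> {0..T}"
    and \<beta>: "\<And>ts i. ts \<in> partitions t 1 \<Longrightarrow> i < length ts \<Longrightarrow> \<beta> ts i \<in> borel_measurable (G (ts ! i))"
    and null: "subseq_limit M t (\<lambda>ts \<omega>. partition_max ts (\<lambda>i. \<beta> ts i \<omega>)) (\<lambda>_. 0)"
  shows "subseq_limit M t (\<lambda>ts \<omega>. partition_max ts (\<lambda>l. \<Sum>i<l. \<beta> ts i \<omega> *
    (u \<bullet> (W (ts ! Suc i) \<omega> - W (ts ! i) \<omega>)))) (\<lambda>_. 0)"
  unfolding subseq_limit_def
proof (intro allI impI)
  fix \<pi>' assume "mesh_seq t \<pi>'"
  from subseq_limitD_refine[OF null this] obtain r0 where r0: "strict_mono r0"
    "\<And>n. \<pi>' (r0 n) \<in> partitions t (inverse (real (Suc n)))"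
    "AE \<omega> in M. (\<lambda>n. partition_max (\<pi>' (r0 n)) (\<lambda>i. \<beta> (\<pi>' (r0 n)) i \<omega>)) \<longlonglongrightarrow> 0" by blast
  define \<pi> where "\<pi> n = \<pi>' (r0 n)" for n
  note \<pi> = r0(2)[folded \<pi>_def] and lim = r0(3)[folded \<pi>_def]
  have \<pi>1: "\<pi> n \<in> partitions t 1" for n
    using \<pi>[of n] partitions_mono[of "inverse (real (Suc n))" 1 t] by (auto simp: inverse_eq_divide)
  have mem: "\<pi> n ! i \<in> {0..T}" if "i < length (\<pi> n)" for n i
    using partition_nth_mem[OF \<pi> that] t by auto
  have \<beta>M: "\<beta> (\<pi> n) i \<in> borel_measurable M" if "i < length (\<pi> n)" for n i
    using measurable_G_M[OF \<beta>[OF \<pi>1 that]] mem[OF that] by auto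
  have "\<exists>r. strict_mono r \<and> (AE \<omega> in M. (\<lambda>n. partition_max (\<pi> (r n)) (\<lambda>l. \<Sum>i<l. \<beta> (\<pi> (r n)) i \<omega> *
    (u \<bullet> (W (\<pi> (r n) ! Suc i) \<omega> - W (\<pi> (r n) ! i) \<omega>)))) \<longlonglongrightarrow> 0)"
  proof (rule AE_subseq_partition_max[OF \<pi>1])
    fix n l assume l: "l < length (\<pi> n)"
    have WM: "W (\<pi> n ! i) \<in> borel_measurable M" if "i < length (\<pi> n)" for i
      using mem[OF that] W_measurable[of "\<pi> n ! i"] by auto
    show "(\<lambda>\<omega>. \<Sum>i<l. \<beta> (\<pi> n) i \<omega> * (u \<bullet> (W (\<pi> n ! Suc i) \<omega> - W (\<pi> n ! i) \<omega>))) \<in> borel_measurable M"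
      by (intro borel_measurable_sum borel_measurable_times borel_measurable_inner borel_measurable_const
          borel_measurable_diff \<beta>M WM) (use l in auto)
  next
    fix e :: real assume e: "0 < e"
    show "(\<lambda>n. prob {\<omega>\<in>space M. \<exists>l\<le>length (\<pi> n) - 1. e < \<bar>\<Sum>i<l. \<beta> (\<pi> n) i \<omega> *
      (u \<bullet> (W (\<pi> n ! Suc i) \<omega> - W (\<pi> n ! i) \<omega>))\<bar>}) \<longlonglongrightarrow> 0"
    proof (rule linear_sums_small[OF _ _ _ _ e])
      show "sorted_wrt (<) (\<pi> n)" for n using \<pi>[of n] by (simp add: partitions_def)
      show "set (\<pi> n) \<subseteq> {0..T}" for n using mem by (force simp: in_set_conv_nth)
      show "\<beta> (\<pi> n) i \<in> borel_measurable (G (\<pi> n ! i))" if "i < length (\<pi> n) - 1" for n i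
        using that by (intro \<beta> \<pi>1) auto
      fix c :: real assume c: "0 < c"
      show "(\<lambda>n. prob {\<omega>\<in>space M. \<exists>i<length (\<pi> n) - 1. c < \<bar>\<beta> (\<pi> n) i \<omega>\<bar>}) \<longlonglongrightarrow> 0"
      proof (rule prob_tendsto_0_if_AE_eventually_not)
        fix n
        have [measurable]: "\<beta> (\<pi> n) i \<in> borel_measurable M" if "i < length (\<pi> n) - 1" for i
          using that by (intro \<beta>M) auto
        have ex: "(\<exists>i<length (\<pi> n) - 1. P i) \<longleftrightarrow> (\<exists>i\<in>{..<length (\<pi> n) - 1}. P i)" for P by auto
        show "{\<omega>\<in>space M. \<exists>i<length (\<pi> n) - 1. c < \<bar>\<beta> (\<pi> n) i \<omega>\<bar>} \<in> events"
          unfolding ex by measurable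
      next
        show "AE \<omega> in M. \<forall>\<^sub>F n in sequentially. \<omega> \<notin> {\<omega>\<in>space M. \<exists>i<length (\<pi> n) - 1. c < \<bar>\<beta> (\<pi> n) i \<omega>\<bar>}"
          using lim
        proof eventually_elim
          case (elim \<omega>)
          then have "\<forall>\<^sub>F n in sequentially. partition_max (\<pi> n) (\<lambda>i. \<beta> (\<pi> n) i \<omega>) < c"
            using c by (intro order_tendstoD) auto
          then show ?case
          proof eventually_elim
            case (elim n)
            have "\<bar>\<beta> (\<pi> n) i \<omega>\<bar> \<le> c" if "i < length (\<pi> n) - 1" for i
            proof -
              have "i < length (\<pi> n)" using that by simp
              from partition_max_ge[OF this, of "\<lambda>i. \<beta> (\<pi> n) i \<omega>"] elim show ?thesis by simp
            qed
            then have "\<forall>i<length (\<pi> n) - 1. \<not> c < \<bar>\<beta> (\<pi> n) i \<omega>\<bar>" by (simp only: not_less) blast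
            then show ?case by blast
          qed
        qed
      qed
    qed
  qed
  then obtain r where "strict_mono r" "AE \<omega> in M. (\<lambda>n. partition_max (\<pi> (r n)) (\<lambda>l. \<Sum>i<l. \<beta> (\<pi> (r n)) i \<omega> *
    (u \<bullet> (W (\<pi> (r n) ! Suc i) \<omega> - W (\<pi> (r n) ! i) \<omega>)))) \<longlonglongrightarrow> 0" by blast
  then show "\<exists>r. strict_mono r \<and> (AE \<omega> in M. (\<lambda>n. partition_max (\<pi>' (r n)) (\<lambda>l. \<Sum>i<l. \<beta> (\<pi>' (r n)) i \<omega> *
    (u \<bullet> (W (\<pi>' (r n) ! Suc i) \<omega> - W (\<pi>' (r n) ! i) \<omega>)))) \<longlonglongrightarrow> 0)"
    using r0(1) unfolding \<pi>_def by (intro exI[of _ "\<lambda>n. r0 (r n)"]) (auto simp: strict_mono_def)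
qed

end

subsection \<open>Riemann sums along partitions\<close>

lemma summation_by_parts:
  fixes a x :: "nat \<Rightarrow> real"
  shows "(\<Sum>i<n. a i * x i) = a n * (\<Sum>i<n. x i) - (\<Sum>i<n. (a (Suc i) - a i) * (\<Sum>j<Suc i. x j))"
  by (induction n) (simp_all add: algebra_simps)

text \<open>Abel summation: a bound on the partial sums of \<open>x\<close> and the variation of
  \<open>a\<close> control the sum of products. How \<open>a\<close> depends on \<open>x\<close>
  does not matter, which is what makes anticipating weights admissible.\<close>

lemma summation_by_parts_bound:
  fixes a x :: "nat \<Rightarrow> real"
  assumes "\<And>l. l \<le> n \<Longrightarrow> \<bar>\<Sum>i<l. x i\<bar> \<le> m"
  shows "\<bar>\<Sum>i<n. a i * x i\<bar> \<le> m * (\<bar>a n\<bar> + (\<Sum>i<n. \<bar>a (Suc i) - a i\<bar>))"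
proof -
  have "\<bar>\<Sum>i<n. (a (Suc i) - a i) * (\<Sum>j<Suc i. x j)\<bar> \<le> (\<Sum>i<n. \<bar>a (Suc i) - a i\<bar> * m)"
    by (rule order_trans[OF sum_abs sum_mono]) (use assms in \<open>auto simp: abs_mult simp del: sum.lessThan_Suc intro!: mult_left_mono\<close>)
  also have "\<dots> = m * (\<Sum>i<n. \<bar>a (Suc i) - a i\<bar>)" by (simp add: sum_distrib_left mult.commute)
  finally have "\<bar>\<Sum>i<n. (a (Suc i) - a i) * (\<Sum>j<Suc i. x j)\<bar> \<le> m * (\<Sum>i<n. \<bar>a (Suc i) - a i\<bar>)" .
  moreover have "\<bar>a n * (\<Sum>i<n. x i)\<bar> \<le> m * \<bar>a n\<bar>"
    using mult_right_mono[OF assms[of n] abs_ge_zero[of "a n"]] by (simp add: abs_mult mult.commute)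
  ultimately show ?thesis
    by (subst summation_by_parts, subst distrib_left) linarith
qed

definition oscillation :: "(real \<Rightarrow> 'b::real_normed_vector) \<Rightarrow> real \<Rightarrow> real \<Rightarrow> real" where
  "oscillation \<phi> a b = (SUP p\<in>{a..b} \<times> {a..b}. norm (\<phi> (fst p) - \<phi> (snd p)))"

definition oscillation_sum :: "(real \<Rightarrow> 'b::real_normed_vector) \<Rightarrow> real list \<Rightarrow> real" where
  "oscillation_sum \<phi> ts = (\<Sum>i<length ts - 1. oscillation \<phi> (ts ! i) (ts ! Suc i) * (ts ! Suc i - ts ! i))"

text \<open>Darboux's criterion for Riemann integrability, required along every sequence of
  partitions. One notion covers continuous paths and step paths and is stable under sums and
  products, so a single limit theorem for left-endpoint sums serves both. Measurability and
  boundedness provide integrability.\<close>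

definition riemann_path :: "real \<Rightarrow> (real \<Rightarrow> 'b::euclidean_space) \<Rightarrow> bool" where
  "riemann_path T \<phi> \<longleftrightarrow> \<phi> \<in> borel_measurable (lebesgue_on {0..T}) \<and> bounded (\<phi> ` {0..T}) \<and>
     (\<forall>t\<in>{0..T}. \<forall>\<pi>. mesh_seq t \<pi> \<longrightarrow> (\<lambda>n. oscillation_sum \<phi> (\<pi> n)) \<longlonglongrightarrow> 0)"

lemma riemann_path_bound:
  assumes "riemann_path T \<phi>"
  obtains B where "0 \<le> B" "\<And>s. s \<in> {0..T} \<Longrightarrow> norm (\<phi> s) \<le> B"
proof -
  obtain B where "0 < B" "\<forall>x\<in>\<phi> ` {0..T}. norm x \<le> B"
    using assms unfolding riemann_path_def bounded_pos by blast
  then show ?thesis by (intro that[of B]) auto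
qed

lemma oscillation_upper:
  assumes "bounded (\<phi> ` {0..T})" "0 \<le> a" "b \<le> T" "u \<in> {a..b}" "v \<in> {a..b}"
  shows "norm (\<phi> u - \<phi> v) \<le> oscillation \<phi> a b"
proof -
  obtain B where "\<forall>s\<in>{0..T}. norm (\<phi> s) \<le> B" using assms(1) unfolding bounded_iff by blast
  then have B: "\<And>s. s \<in> {0..T} \<Longrightarrow> norm (\<phi> s) \<le> B" by blast
  have "bdd_above ((\<lambda>p. norm (\<phi> (fst p) - \<phi> (snd p))) ` ({a..b} \<times> {a..b}))"
  proof (rule bdd_aboveI2)
    fix p assume "p \<in> {a..b} \<times> {a..b}"
    then have "norm (\<phi> (fst p)) \<le> B" "norm (\<phi> (snd p)) \<le> B" using assms(2,3) by (auto intro!: B)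
    then show "norm (\<phi> (fst p) - \<phi> (snd p)) \<le> B + B"
      using norm_triangle_ineq4[of "\<phi> (fst p)" "\<phi> (snd p)"] by linarith
  qed
  from cSUP_upper[OF _ this, of "(u, v)"] show ?thesis
    using assms unfolding oscillation_def by simp
qed

lemma oscillation_le:
  assumes "a \<le> b" "\<And>u v. u \<in> {a..b} \<Longrightarrow> v \<in> {a..b} \<Longrightarrow> norm (\<phi> u - \<phi> v) \<le> e"
  shows "oscillation \<phi> a b \<le> e"
  unfolding oscillation_def by (rule cSUP_least) (use assms in auto)

lemma oscillation_nonneg:
  assumes "bounded (\<phi> ` {0..T})" "0 \<le> a" "a \<le> b" "b \<le> T"
  shows "0 \<le> oscillation \<phi> a b"
  using oscillation_upper[OF assms(1,2,4), of a a] assms(3) by simp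

lemma partition_pairs:
  assumes "ts \<in> partitions t \<delta>" "i < length ts - 1"
  shows "0 \<le> ts ! i" "ts ! i < ts ! Suc i" "ts ! Suc i \<le> t" "ts ! Suc i - ts ! i < \<delta>"
  using partition_nth_mem[OF assms(1), of i] partition_nth_mem[OF assms(1), of "Suc i"]
    partition_nth_less[OF assms(1), of i "Suc i"] partition_step[OF assms] assms(2)
  by (auto simp: less_diff_conv)

lemma oscillation_sum_nonneg:
  assumes "bounded (\<phi> ` {0..T})" "ts \<in> partitions t \<delta>" "t \<le> T"
  shows "0 \<le> oscillation_sum \<phi> ts"
  unfolding oscillation_sum_def
proof (rule sum_nonneg)
  fix i assume "i \<in> {..<length ts - 1}"
  then show "0 \<le> oscillation \<phi> (ts ! i) (ts ! Suc i) * (ts ! Suc i - ts ! i)"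
    using partition_pairs[OF assms(2), of i] assms(3)
    by (intro mult_nonneg_nonneg oscillation_nonneg[OF assms(1)]) auto
qed

lemma mesh_seq_eventually: "mesh_seq t \<pi> \<Longrightarrow> \<forall>\<^sub>F n in sequentially. \<pi> n \<in> partitions t 1"
  by (auto simp: mesh_seq_def)

lemma oscillation_sum_tendstoI:
  assumes bd: "bounded (\<phi> ` {0..T})" and t: "t \<le> T" and \<pi>: "mesh_seq t \<pi>"
    and le: "\<forall>\<^sub>F n in sequentially. oscillation_sum \<phi> (\<pi> n) \<le> z n" and z: "z \<longlonglongrightarrow> 0"
  shows "(\<lambda>n. oscillation_sum \<phi> (\<pi> n)) \<longlonglongrightarrow> 0"
proof (rule tendsto_sandwich[OF _ le tendsto_const z])
  show "\<forall>\<^sub>F n in sequentially. 0 \<le> oscillation_sum \<phi> (\<pi> n)"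
    using mesh_seq_eventually[OF \<pi>] by (rule eventually_mono) (rule oscillation_sum_nonneg[OF bd _ t])
qed

lemma riemann_path_continuous:
  fixes \<phi> :: "real \<Rightarrow> 'b::euclidean_space"
  assumes c: "continuous_on {0..T} \<phi>"
  shows "riemann_path T \<phi>"
  unfolding riemann_path_def
proof (intro conjI ballI allI impI)
  show "\<phi> \<in> borel_measurable (lebesgue_on {0..T})"
    by (rule continuous_imp_measurable_on_sets_lebesgue[OF c]) auto
  show bd: "bounded (\<phi> ` {0..T})"
    using c compact_continuous_image compact_imp_bounded by blast
  fix t \<pi> assume t: "t \<in> {0..T}" and \<pi>: "mesh_seq t \<pi>"
  show "(\<lambda>n. oscillation_sum \<phi> (\<pi> n)) \<longlonglongrightarrow> 0"
  proof (rule LIMSEQ_I)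
    fix e :: real assume e: "0 < e"
    have e': "0 < e / (t + 1)" using t e by auto
    have "uniformly_continuous_on {0..T} \<phi>" using c by (intro compact_uniformly_continuous) auto
    then obtain d where d: "0 < d"
      "\<And>u v. u \<in> {0..T} \<Longrightarrow> v \<in> {0..T} \<Longrightarrow> dist v u < d \<Longrightarrow> dist (\<phi> v) (\<phi> u) < e / (t + 1)"
      using e' unfolding uniformly_continuous_on_def by metis
    have "\<forall>\<^sub>F n in sequentially. \<pi> n \<in> partitions t d" using \<pi> d by (auto simp: mesh_seq_def)
    then have "\<forall>\<^sub>F n in sequentially. norm (oscillation_sum \<phi> (\<pi> n) - 0) < e"
    proof eventually_elim
      case (elim n)
      have "oscillation_sum \<phi> (\<pi> n) \<le> (\<Sum>i<length (\<pi> n) - 1. e / (t + 1) * (\<pi> n ! Suc i - \<pi> n ! i))"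
        unfolding oscillation_sum_def
      proof (intro sum_mono mult_right_mono)
        fix i assume "i \<in> {..<length (\<pi> n) - 1}"
        then have i: "0 \<le> \<pi> n ! i" "\<pi> n ! i < \<pi> n ! Suc i" "\<pi> n ! Suc i \<le> T" "\<pi> n ! Suc i - \<pi> n ! i < d"
          using partition_pairs[OF elim, of i] t by auto
        show "oscillation \<phi> (\<pi> n ! i) (\<pi> n ! Suc i) \<le> e / (t + 1)"
        proof (rule oscillation_le)
          fix u v assume "u \<in> {\<pi> n ! i..\<pi> n ! Suc i}" "v \<in> {\<pi> n ! i..\<pi> n ! Suc i}"
          then show "norm (\<phi> u - \<phi> v) \<le> e / (t + 1)"
            using i d(2)[of v u] by (auto simp: dist_norm intro!: less_imp_le)
        qed (use i in auto)
        show "0 \<le> \<pi> n ! Suc i - \<pi> n ! i" using i by simp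
      qed
      also have "\<dots> = e / (t + 1) * t"
        by (simp only: sum_distrib_left[symmetric] partition_sum_steps[OF elim])
      also have "\<dots> < e" using t e by (simp add: field_simps)
      finally show ?case using oscillation_sum_nonneg[OF bd elim] t by auto
    qed
    then show "\<exists>no. \<forall>n\<ge>no. norm (oscillation_sum \<phi> (\<pi> n) - 0) < e" by (simp add: eventually_sequentially)
  qed
qed

lemma riemann_path_bilinear:
  fixes \<phi> :: "real \<Rightarrow> 'b::euclidean_space" and \<psi> :: "real \<Rightarrow> 'c::euclidean_space"
    and b :: "'b \<Rightarrow> 'c \<Rightarrow> 'e::euclidean_space"
  assumes b: "bounded_bilinear b" and \<phi>: "riemann_path T \<phi>" and \<psi>: "riemann_path T \<psi>"
  shows "riemann_path T (\<lambda>s. b (\<phi> s) (\<psi> s))"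
proof -
  interpret bounded_bilinear b by fact
  from nonneg_bounded obtain K where K': "0 \<le> K \<and> (\<forall>x y. norm (b x y) \<le> norm x * norm y * K)" ..
  note K = conjunct1[OF K'] conjunct2[OF K', rule_format]
  obtain B where B: "0 \<le> B" "\<And>s. s \<in> {0..T} \<Longrightarrow> norm (\<phi> s) \<le> B"
    using riemann_path_bound[OF \<phi>] by blast
  obtain C where C: "0 \<le> C" "\<And>s. s \<in> {0..T} \<Longrightarrow> norm (\<psi> s) \<le> C"
    using riemann_path_bound[OF \<psi>] by blast
  note bds = \<phi>[unfolded riemann_path_def, THEN conjunct2, THEN conjunct1] \<psi>[unfolded riemann_path_def, THEN conjunct2, THEN conjunct1]
  have bd: "bounded ((\<lambda>s. b (\<phi> s) (\<psi> s)) ` {0..T})"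
    unfolding bounded_iff
  proof (intro exI[of _ "B * C * K"] ballI, safe)
    fix s assume s: "s \<in> {0..T}"
    show "norm (b (\<phi> s) (\<psi> s)) \<le> B * C * K"
      by (rule order_trans[OF K(2)]) (use B(1) C(1) B(2)[OF s] C(2)[OF s] K(1) in \<open>auto intro!: mult_mono\<close>)
  qed
  show ?thesis unfolding riemann_path_def
  proof (intro conjI bd ballI allI impI)
    have "continuous_on UNIV (\<lambda>x. b (fst x) (snd x))"
      by (intro continuous_on continuous_on_fst continuous_on_snd continuous_on_id)
    from borel_measurable_continuous_Pair[OF _ _ this] \<phi> \<psi>
    show "(\<lambda>s. b (\<phi> s) (\<psi> s)) \<in> borel_measurable (lebesgue_on {0..T})"
      by (auto simp: riemann_path_def)
    fix t \<pi> assume t: "t \<in> {0..T}" and \<pi>: "mesh_seq t \<pi>"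
    show "(\<lambda>n. oscillation_sum (\<lambda>s. b (\<phi> s) (\<psi> s)) (\<pi> n)) \<longlonglongrightarrow> 0"
    proof (rule oscillation_sum_tendstoI[OF bd _ \<pi>])
      show "t \<le> T" using t by simp
      let ?z = "\<lambda>n. K * (B * oscillation_sum \<psi> (\<pi> n) + C * oscillation_sum \<phi> (\<pi> n))"
      have "?z \<longlonglongrightarrow> K * (B * 0 + C * 0)"
        using \<phi> \<psi> t \<pi> by (intro tendsto_intros) (auto simp: riemann_path_def)
      then show "?z \<longlonglongrightarrow> 0" by simp
      show "\<forall>\<^sub>F n in sequentially. oscillation_sum (\<lambda>s. b (\<phi> s) (\<psi> s)) (\<pi> n) \<le> ?z n"
        using mesh_seq_eventually[OF \<pi>]
      proof eventually_elim
        case (elim n)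
        let ?o = "\<lambda>f i. oscillation f (\<pi> n ! i) (\<pi> n ! Suc i)"
        have "oscillation_sum (\<lambda>s. b (\<phi> s) (\<psi> s)) (\<pi> n)
          \<le> (\<Sum>i<length (\<pi> n) - 1. K * (B * ?o \<psi> i + C * ?o \<phi> i) * (\<pi> n ! Suc i - \<pi> n ! i))"
          unfolding oscillation_sum_def
        proof (intro sum_mono mult_right_mono)
          fix i assume "i \<in> {..<length (\<pi> n) - 1}"
          then have i: "0 \<le> \<pi> n ! i" "\<pi> n ! i < \<pi> n ! Suc i" "\<pi> n ! Suc i \<le> T"
            using partition_pairs[OF elim, of i] t by auto
          show "0 \<le> \<pi> n ! Suc i - \<pi> n ! i" using i by simp
          show "oscillation (\<lambda>s. b (\<phi> s) (\<psi> s)) (\<pi> n ! i) (\<pi> n ! Suc i) \<le> K * (B * ?o \<psi> i + C * ?o \<phi> i)"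
          proof (rule oscillation_le)
            fix u v assume uv: "u \<in> {\<pi> n ! i..\<pi> n ! Suc i}" "v \<in> {\<pi> n ! i..\<pi> n ! Suc i}"
            then have uvT: "u \<in> {0..T}" "v \<in> {0..T}" using i by auto
            have "b (\<phi> u) (\<psi> u) - b (\<phi> v) (\<psi> v) = b (\<phi> u) (\<psi> u - \<psi> v) + b (\<phi> u - \<phi> v) (\<psi> v)"
              by (simp add: diff_left diff_right)
            then have "norm (b (\<phi> u) (\<psi> u) - b (\<phi> v) (\<psi> v))
                \<le> norm (\<phi> u) * norm (\<psi> u - \<psi> v) * K + norm (\<phi> u - \<phi> v) * norm (\<psi> v) * K"
              using norm_triangle_ineq[of "b (\<phi> u) (\<psi> u - \<psi> v)" "b (\<phi> u - \<phi> v) (\<psi> v)"]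
                K(2)[of "\<phi> u" "\<psi> u - \<psi> v"] K(2)[of "\<phi> u - \<phi> v" "\<psi> v"] by simp
            also have "\<dots> \<le> B * ?o \<psi> i * K + ?o \<phi> i * C * K"
              using B C K uvT oscillation_upper[OF bds(1) i(1,3) uv] oscillation_upper[OF bds(2) i(1,3) uv]
              by (intro add_mono mult_right_mono mult_mono) (auto intro: order_trans[OF norm_ge_zero])
            finally show "norm (b (\<phi> u) (\<psi> u) - b (\<phi> v) (\<psi> v)) \<le> K * (B * ?o \<psi> i + C * ?o \<phi> i)"
              by (simp add: algebra_simps)
          qed (use i in auto)
        qed
        also have "\<dots> = ?z n"
          by (simp add: oscillation_sum_def sum_distrib_left sum.distrib[symmetric] algebra_simps)
        finally show ?case .
      qed
    qed
  qed
qed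

text \<open>Treated as a product with the constant path \<open>1\<close>, so that the estimate for
  bilinear maps is reused.\<close>

lemma riemann_path_linear:
  fixes \<phi> :: "real \<Rightarrow> 'b::euclidean_space" and f :: "'b \<Rightarrow> 'c::euclidean_space"
  assumes f: "linear f" and \<phi>: "riemann_path T \<phi>"
  shows "riemann_path T (\<lambda>s. f (\<phi> s))"
proof -
  interpret f: bounded_linear f using f by (simp add: linear_conv_bounded_linear)
  have "bounded_bilinear (\<lambda>(r::real) x. r *\<^sub>R f x)"
    by (rule bounded_bilinear.comp[OF bounded_bilinear_scaleR bounded_linear_ident f.bounded_linear_axioms])
  from riemann_path_bilinear[OF this riemann_path_continuous[of T "\<lambda>_. 1"] \<phi>]
  show ?thesis by simp
qed

lemma riemann_path_add:
  fixes \<phi> \<psi> :: "real \<Rightarrow> 'b::euclidean_space"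
  assumes \<phi>: "riemann_path T \<phi>" and \<psi>: "riemann_path T \<psi>"
  shows "riemann_path T (\<lambda>s. \<phi> s + \<psi> s)"
proof -
  note bds = \<phi>[unfolded riemann_path_def, THEN conjunct2, THEN conjunct1] \<psi>[unfolded riemann_path_def, THEN conjunct2, THEN conjunct1]
  have bd: "bounded ((\<lambda>s. \<phi> s + \<psi> s) ` {0..T})" by (rule bounded_plus_comp[OF bds])
  show ?thesis unfolding riemann_path_def
  proof (intro conjI bd ballI allI impI)
    show "(\<lambda>s. \<phi> s + \<psi> s) \<in> borel_measurable (lebesgue_on {0..T})"
      using \<phi> \<psi> by (auto simp: riemann_path_def)
    fix t \<pi> assume t: "t \<in> {0..T}" and \<pi>: "mesh_seq t \<pi>"
    show "(\<lambda>n. oscillation_sum (\<lambda>s. \<phi> s + \<psi> s) (\<pi> n)) \<longlonglongrightarrow> 0"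
    proof (rule oscillation_sum_tendstoI[OF bd _ \<pi>])
      show "t \<le> T" using t by simp
      show "(\<lambda>n. oscillation_sum \<phi> (\<pi> n) + oscillation_sum \<psi> (\<pi> n)) \<longlonglongrightarrow> 0"
        using \<phi> \<psi> t \<pi> by (intro tendsto_add_zero) (auto simp: riemann_path_def)
      show "\<forall>\<^sub>F n in sequentially. oscillation_sum (\<lambda>s. \<phi> s + \<psi> s) (\<pi> n)
          \<le> oscillation_sum \<phi> (\<pi> n) + oscillation_sum \<psi> (\<pi> n)"
        using mesh_seq_eventually[OF \<pi>]
      proof eventually_elim
        case (elim n)
        show ?case
          unfolding oscillation_sum_def sum.distrib[symmetric] distrib_right[symmetric]
        proof (intro sum_mono mult_right_mono)
          fix i assume "i \<in> {..<length (\<pi> n) - 1}"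
          then have i: "0 \<le> \<pi> n ! i" "\<pi> n ! i < \<pi> n ! Suc i" "\<pi> n ! Suc i \<le> T"
            using partition_pairs[OF elim, of i] t by auto
          show "0 \<le> \<pi> n ! Suc i - \<pi> n ! i" using i by simp
          show "oscillation (\<lambda>s. \<phi> s + \<psi> s) (\<pi> n ! i) (\<pi> n ! Suc i)
            \<le> oscillation \<phi> (\<pi> n ! i) (\<pi> n ! Suc i) + oscillation \<psi> (\<pi> n ! i) (\<pi> n ! Suc i)"
          proof (rule oscillation_le)
            fix u v assume uv: "u \<in> {\<pi> n ! i..\<pi> n ! Suc i}" "v \<in> {\<pi> n ! i..\<pi> n ! Suc i}"
            have "norm (\<phi> u + \<psi> u - (\<phi> v + \<psi> v)) \<le> norm (\<phi> u - \<phi> v) + norm (\<psi> u - \<psi> v)"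
              by (rule norm_diff_triangle_ineq)
            then show "norm (\<phi> u + \<psi> u - (\<phi> v + \<psi> v)) \<le>
                oscillation \<phi> (\<pi> n ! i) (\<pi> n ! Suc i) + oscillation \<psi> (\<pi> n ! i) (\<pi> n ! Suc i)"
              using oscillation_upper[OF bds(1) i(1,3) uv] oscillation_upper[OF bds(2) i(1,3) uv] by linarith
          qed (use i in auto)
        qed
      qed
    qed
  qed
qed

lemma riemann_path_integrable:
  fixes \<phi> :: "real \<Rightarrow> 'b::euclidean_space"
  assumes \<phi>: "riemann_path T \<phi>" and ab: "0 \<le> a" "b \<le> T"
  shows "\<phi> integrable_on {a..b}"
proof -
  obtain B where B: "0 \<le> B" "\<And>s. s \<in> {0..T} \<Longrightarrow> norm (\<phi> s) \<le> B"
    using riemann_path_bound[OF \<phi>] by blast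
  have "\<phi> integrable_on {0..T}"
    by (rule measurable_bounded_by_integrable_imp_integrable[of _ _ "\<lambda>_. B"])
      (use \<phi> B in \<open>auto simp: riemann_path_def\<close>)
  then show ?thesis using integrable_subinterval_real[of \<phi> 0 T a b] ab by auto
qed

lemma partition_integral:
  fixes \<phi> :: "real \<Rightarrow> 'b::euclidean_space"
  assumes ts: "ts \<in> partitions t \<delta>" and int: "\<phi> integrable_on {0..t}" and l: "l < length ts"
  shows "integral {0..ts ! l} \<phi> = (\<Sum>i<l. integral {ts ! i..ts ! Suc i} \<phi>)"
  using l
proof (induction l)
  case 0
  then show ?case using partition_nth_0[OF ts] by simp
next
  case (Suc l)
  have l: "0 \<le> ts ! l" "ts ! l < ts ! Suc l" "ts ! Suc l \<le> t"
    using partition_pairs[OF ts, of l] Suc.prems by auto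
  have "integral {0..ts ! l} \<phi> + integral {ts ! l..ts ! Suc l} \<phi> = integral {0..ts ! Suc l} \<phi>"
    using l by (intro Henstock_Kurzweil_Integration.integral_combine integrable_subinterval_real[OF int]) auto
  then show ?case using Suc by simp
qed

lemma norm_integral_le:
  fixes f :: "real \<Rightarrow> 'b::euclidean_space"
  assumes "a \<le> b" "f integrable_on {a..b}" "\<And>s. s \<in> {a..b} \<Longrightarrow> norm (f s) \<le> c"
  shows "norm (integral {a..b} f) \<le> c * (b - a)"
proof -
  have "norm (integral {a..b} f) \<le> integral {a..b} (\<lambda>_. c)"
    by (rule integral_norm_bound_integral) (use assms in auto)
  then show ?thesis using assms(1) by (simp add: mult.commute)
qed

text \<open>Only \<open>\<phi>\<close> is frozen at the left endpoint, while \<open>g\<close> is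
  integrated exactly. The error on an interval is at most the bound of \<open>g\<close> times the
  oscillation of \<open>\<phi>\<close> times the length.\<close>

lemma riemann_sum_tendsto:
  fixes \<phi> g :: "real \<Rightarrow> 'b::euclidean_space"
  assumes \<phi>: "riemann_path T \<phi>" and g: "riemann_path T g" and t: "t \<in> {0..T}" and \<pi>: "mesh_seq t \<pi>"
  shows "(\<lambda>n. \<Sum>i<length (\<pi> n) - 1. \<phi> (\<pi> n ! i) \<bullet> integral {\<pi> n ! i..\<pi> n ! Suc i} g)
    \<longlonglongrightarrow> integral {0..t} (\<lambda>s. \<phi> s \<bullet> g s)"
proof -
  obtain C where C: "0 \<le> C" "\<And>s. s \<in> {0..T} \<Longrightarrow> norm (g s) \<le> C"
    using riemann_path_bound[OF g] by blast
  have bd: "bounded (\<phi> ` {0..T})" using \<phi> by (simp add: riemann_path_def)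
  have \<phi>g: "riemann_path T (\<lambda>s. \<phi> s \<bullet> g s)"
    by (rule riemann_path_bilinear[OF bounded_bilinear_inner \<phi> g])
  let ?S = "\<lambda>n. \<Sum>i<length (\<pi> n) - 1. \<phi> (\<pi> n ! i) \<bullet> integral {\<pi> n ! i..\<pi> n ! Suc i} g"
  have lim: "(\<lambda>n. C * oscillation_sum \<phi> (\<pi> n)) \<longlonglongrightarrow> 0"
    using \<phi> t \<pi> by (intro tendsto_mult_right_zero) (auto simp: riemann_path_def)
  have "\<forall>\<^sub>F n in sequentially. norm (?S n - integral {0..t} (\<lambda>s. \<phi> s \<bullet> g s)) \<le> C * oscillation_sum \<phi> (\<pi> n)"
    using mesh_seq_eventually[OF \<pi>]
  proof eventually_elim
    case (elim n)
    have "length (\<pi> n) - 1 < length (\<pi> n)" using partition_length[OF elim] by simp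
    from partition_integral[OF elim riemann_path_integrable[OF \<phi>g] this] t
    have eq: "integral {0..t} (\<lambda>s. \<phi> s \<bullet> g s)
      = (\<Sum>i<length (\<pi> n) - 1. integral {\<pi> n ! i..\<pi> n ! Suc i} (\<lambda>s. \<phi> s \<bullet> g s))"
      using partition_nth_last[OF elim] by auto
    have "norm (?S n - integral {0..t} (\<lambda>s. \<phi> s \<bullet> g s))
      \<le> (\<Sum>i<length (\<pi> n) - 1. norm (\<phi> (\<pi> n ! i) \<bullet> integral {\<pi> n ! i..\<pi> n ! Suc i} g
            - integral {\<pi> n ! i..\<pi> n ! Suc i} (\<lambda>s. \<phi> s \<bullet> g s)))"
      unfolding eq sum_subtractf[symmetric] by (rule norm_sum)
    also have "\<dots> \<le> (\<Sum>i<length (\<pi> n) - 1. C * (oscillation \<phi> (\<pi> n ! i) (\<pi> n ! Suc i) * (\<pi> n ! Suc i - \<pi> n ! i)))"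
    proof (rule sum_mono)
      fix i assume "i \<in> {..<length (\<pi> n) - 1}"
      then have i: "0 \<le> \<pi> n ! i" "\<pi> n ! i < \<pi> n ! Suc i" "\<pi> n ! Suc i \<le> T"
        using partition_pairs[OF elim, of i] t by auto
      have intg: "g integrable_on {\<pi> n ! i..\<pi> n ! Suc i}" by (rule riemann_path_integrable[OF g i(1,3)])
      have int\<phi>g: "(\<lambda>s. \<phi> s \<bullet> g s) integrable_on {\<pi> n ! i..\<pi> n ! Suc i}"
        by (rule riemann_path_integrable[OF \<phi>g i(1,3)])
      have intc: "(\<lambda>s. \<phi> (\<pi> n ! i) \<bullet> g s) integrable_on {\<pi> n ! i..\<pi> n ! Suc i}"
        using integrable_linear[OF intg bounded_linear_inner_right[of "\<phi> (\<pi> n ! i)"]] by (simp add: comp_def)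
      have "\<phi> (\<pi> n ! i) \<bullet> integral {\<pi> n ! i..\<pi> n ! Suc i} g = integral {\<pi> n ! i..\<pi> n ! Suc i} (\<lambda>s. \<phi> (\<pi> n ! i) \<bullet> g s)"
        using integral_linear[OF intg bounded_linear_inner_right[of "\<phi> (\<pi> n ! i)"]] by (simp add: comp_def)
      then have "\<phi> (\<pi> n ! i) \<bullet> integral {\<pi> n ! i..\<pi> n ! Suc i} g
            - integral {\<pi> n ! i..\<pi> n ! Suc i} (\<lambda>s. \<phi> s \<bullet> g s)
          = integral {\<pi> n ! i..\<pi> n ! Suc i} (\<lambda>s. (\<phi> (\<pi> n ! i) - \<phi> s) \<bullet> g s)"
        by (simp add: integral_diff[OF intc int\<phi>g, symmetric] inner_diff_left)
      also have "norm \<dots> \<le> (oscillation \<phi> (\<pi> n ! i) (\<pi> n ! Suc i) * C) * (\<pi> n ! Suc i - \<pi> n ! i)"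
      proof (rule norm_integral_le)
        show "(\<lambda>s. (\<phi> (\<pi> n ! i) - \<phi> s) \<bullet> g s) integrable_on {\<pi> n ! i..\<pi> n ! Suc i}"
          using integrable_diff[OF intc int\<phi>g] by (simp add: inner_diff_left)
      next
        fix s assume s: "s \<in> {\<pi> n ! i..\<pi> n ! Suc i}"
        have "norm ((\<phi> (\<pi> n ! i) - \<phi> s) \<bullet> g s) \<le> norm (\<phi> (\<pi> n ! i) - \<phi> s) * norm (g s)"
          by (simp add: Cauchy_Schwarz_ineq2)
        also have "\<dots> \<le> oscillation \<phi> (\<pi> n ! i) (\<pi> n ! Suc i) * C"
          using oscillation_upper[OF bd i(1,3), of "\<pi> n ! i" s] s i C
          by (intro mult_mono) (auto intro: order_trans[OF norm_ge_zero])
        finally show "norm ((\<phi> (\<pi> n ! i) - \<phi> s) \<bullet> g s) \<le> oscillation \<phi> (\<pi> n ! i) (\<pi> n ! Suc i) * C" .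
      qed (use i in simp)
      finally show "norm (\<phi> (\<pi> n ! i) \<bullet> integral {\<pi> n ! i..\<pi> n ! Suc i} g
            - integral {\<pi> n ! i..\<pi> n ! Suc i} (\<lambda>s. \<phi> s \<bullet> g s))
          \<le> C * (oscillation \<phi> (\<pi> n ! i) (\<pi> n ! Suc i) * (\<pi> n ! Suc i - \<pi> n ! i))"
        by (simp add: algebra_simps)
    qed
    also have "\<dots> = C * oscillation_sum \<phi> (\<pi> n)" by (simp add: oscillation_sum_def sum_distrib_left)
    finally show ?case .
  qed
  from Lim_null_comparison[OF this lim] show ?thesis by (simp add: LIM_zero_iff)
qed

subsection \<open>Step paths\<close>

text \<open>Summing over \<open>\<tau> \<le> s\<close> makes the path right-continuous, and
  \<open>J \<subseteq> {0<..T}\<close> keeps the initial value out of the jumps. A jump size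
  \<open>h \<tau>\<close> may be zero.\<close>

definition step_path :: "real \<Rightarrow> (real \<Rightarrow> 'b::euclidean_space) \<Rightarrow> real set \<Rightarrow> (real \<Rightarrow> 'b) \<Rightarrow> bool" where
  "step_path T x J h \<longleftrightarrow> finite J \<and> J \<subseteq> {0<..T} \<and> (\<forall>s\<in>{0..T}. x s = x 0 + (\<Sum>\<tau>\<in>J \<inter> {..s}. h \<tau>))"

lemma step_path_increment:
  assumes x: "step_path T x J h" and uv: "0 \<le> u" "u \<le> v" "v \<le> T"
  shows "x v - x u = (\<Sum>\<tau>\<in>J \<inter> {u<..v}. h \<tau>)"
proof -
  have fin: "finite J" using x by (simp add: step_path_def)
  have "x v - x u = (\<Sum>\<tau>\<in>J \<inter> {..v}. h \<tau>) - (\<Sum>\<tau>\<in>J \<inter> {..u}. h \<tau>)"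
  proof -
    have "\<forall>s\<in>{0..T}. x s = x 0 + (\<Sum>\<tau>\<in>J \<inter> {..s}. h \<tau>)" using x unfolding step_path_def by blast
    moreover have "v \<in> {0..T}" "u \<in> {0..T}" using uv by auto
    ultimately have "x v = x 0 + (\<Sum>\<tau>\<in>J \<inter> {..v}. h \<tau>)" "x u = x 0 + (\<Sum>\<tau>\<in>J \<inter> {..u}. h \<tau>)"
      by blast+
    then show ?thesis by (simp only: add_diff_cancel_left)
  qed
  also have "\<dots> = (\<Sum>\<tau>\<in>J \<inter> {..v} - J \<inter> {..u}. h \<tau>)"
    using fin uv by (intro sum_diff[symmetric]) auto
  also have "J \<inter> {..v} - J \<inter> {..u} = J \<inter> {u<..v}" using uv by auto
  finally show ?thesis .
qed

lemma partition_jump_sum: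
  fixes f :: "real \<Rightarrow> 'c::comm_monoid_add"
  assumes ts: "ts \<in> partitions t \<delta>" and J: "finite J" and l: "l < length ts"
  shows "(\<Sum>i<l. \<Sum>\<tau>\<in>J \<inter> {ts ! i<..ts ! Suc i}. f \<tau>) = (\<Sum>\<tau>\<in>J \<inter> {0<..ts ! l}. f \<tau>)"
  using l
proof (induction l)
  case 0
  then show ?case using partition_nth_0[OF ts] by simp
next
  case (Suc l)
  have l: "0 \<le> ts ! l" "ts ! l < ts ! Suc l"
    using partition_pairs[OF ts, of l] Suc.prems by auto
  have "J \<inter> {0<..ts ! Suc l} = (J \<inter> {0<..ts ! l}) \<union> (J \<inter> {ts ! l<..ts ! Suc l})"
    using l by auto
  then have "(\<Sum>\<tau>\<in>J \<inter> {0<..ts ! Suc l}. f \<tau>) = (\<Sum>\<tau>\<in>J \<inter> {0<..ts ! l}. f \<tau>) + (\<Sum>\<tau>\<in>J \<inter> {ts ! l<..ts ! Suc l}. f \<tau>)"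
    using J by (simp add: sum.union_disjoint[of "J \<inter> {0<..ts ! l}" "J \<inter> {ts ! l<..ts ! Suc l}"] disjoint_iff)
  then show ?case using Suc by simp
qed

lemma step_path_variation:
  assumes x: "step_path T x J h" and t: "t \<le> T" and ts: "ts \<in> partitions t \<delta>"
  shows "(\<Sum>i<length ts - 1. norm (x (ts ! Suc i) - x (ts ! i))) \<le> (\<Sum>\<tau>\<in>J. norm (h \<tau>))"
proof -
  have fin: "finite J" using x by (simp add: step_path_def)
  have "(\<Sum>i<length ts - 1. norm (x (ts ! Suc i) - x (ts ! i)))
      \<le> (\<Sum>i<length ts - 1. \<Sum>\<tau>\<in>J \<inter> {ts ! i<..ts ! Suc i}. norm (h \<tau>))"
  proof (rule sum_mono)
    fix i assume "i \<in> {..<length ts - 1}"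
    then show "norm (x (ts ! Suc i) - x (ts ! i)) \<le> (\<Sum>\<tau>\<in>J \<inter> {ts ! i<..ts ! Suc i}. norm (h \<tau>))"
      using partition_pairs[OF ts, of i] t by (subst step_path_increment[OF x]) (auto intro: norm_sum)
  qed
  also have "\<dots> = (\<Sum>\<tau>\<in>J \<inter> {0<..ts ! (length ts - 1)}. norm (h \<tau>))"
    using partition_length[OF ts] by (intro partition_jump_sum[OF ts fin]) auto
  also have "\<dots> \<le> (\<Sum>\<tau>\<in>J. norm (h \<tau>))" using fin by (intro sum_mono2) auto
  finally show ?thesis .
qed

text \<open>On each interval the oscillation is at most the sum of the jump sizes inside it, so the
  oscillation sum is at most the total jump size times the mesh.\<close>

lemma riemann_path_step:
  fixes x :: "real \<Rightarrow> 'b::euclidean_space"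
  assumes x: "step_path T x J h"
  shows "riemann_path T x"
  unfolding riemann_path_def
proof (intro conjI ballI allI impI)
  have fin: "finite J" using x by (simp add: step_path_def)
  have eq: "x s = x 0 + (\<Sum>\<tau>\<in>J. if \<tau> \<le> s then h \<tau> else 0)" if "s \<in> {0..T}" for s
  proof -
    have "(\<Sum>\<tau>\<in>J \<inter> {..s}. h \<tau>) = (\<Sum>\<tau>\<in>J. if \<tau> \<in> {..s} then h \<tau> else 0)"
      using fin by (rule sum.inter_restrict)
    moreover have "x s = x 0 + (\<Sum>\<tau>\<in>J \<inter> {..s}. h \<tau>)" using x that unfolding step_path_def by blast
    ultimately show ?thesis by (simp only: atMost_iff)
  qed
  have [measurable]: "(\<lambda>s::real. s) \<in> borel_measurable (lebesgue_on {0..T})"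
    by (rule continuous_imp_measurable_on_sets_lebesgue) (auto intro: continuous_intros)
  have "(\<lambda>s. x 0 + (\<Sum>\<tau>\<in>J. if \<tau> \<le> s then h \<tau> else 0)) \<in> borel_measurable (lebesgue_on {0..T})"
    by measurable
  then show "x \<in> borel_measurable (lebesgue_on {0..T})"
    by (subst measurable_cong[OF eq]) (simp_all add: space_restrict_space)
  show bd: "bounded (x ` {0..T})"
    unfolding bounded_iff
  proof (intro exI[of _ "norm (x 0) + (\<Sum>\<tau>\<in>J. norm (h \<tau>))"] ballI, safe)
    fix s assume s: "s \<in> {0..T}"
    have "norm (\<Sum>\<tau>\<in>J. if \<tau> \<le> s then h \<tau> else 0) \<le> (\<Sum>\<tau>\<in>J. norm (h \<tau>))"
      by (rule order_trans[OF norm_sum sum_mono]) auto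
    then show "norm (x s) \<le> norm (x 0) + (\<Sum>\<tau>\<in>J. norm (h \<tau>))"
      unfolding eq[OF s] using norm_triangle_ineq[of "x 0" "\<Sum>\<tau>\<in>J. if \<tau> \<le> s then h \<tau> else 0"] by linarith
  qed
  fix t \<pi> assume t: "t \<in> {0..T}" and \<pi>: "mesh_seq t \<pi>"
  define C where "C = (\<Sum>\<tau>\<in>J. norm (h \<tau>))"
  have C: "0 \<le> C" by (simp add: C_def sum_nonneg)
  show "(\<lambda>n. oscillation_sum x (\<pi> n)) \<longlonglongrightarrow> 0"
  proof (rule LIMSEQ_I)
    fix e :: real assume e: "0 < e"
    have "0 < e / (C + 1)" using e C by auto
    then have "\<forall>\<^sub>F n in sequentially. \<pi> n \<in> partitions t (e / (C + 1))" using \<pi> by (auto simp: mesh_seq_def)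
    then have "\<forall>\<^sub>F n in sequentially. norm (oscillation_sum x (\<pi> n) - 0) < e"
    proof eventually_elim
      case (elim n)
      have "oscillation_sum x (\<pi> n) \<le> (\<Sum>i<length (\<pi> n) - 1. (\<Sum>\<tau>\<in>J \<inter> {\<pi> n ! i<..\<pi> n ! Suc i}. norm (h \<tau>)) * (e / (C + 1)))"
        unfolding oscillation_sum_def
      proof (intro sum_mono mult_mono)
        fix i assume "i \<in> {..<length (\<pi> n) - 1}"
        then have i: "0 \<le> \<pi> n ! i" "\<pi> n ! i < \<pi> n ! Suc i" "\<pi> n ! Suc i \<le> T" "\<pi> n ! Suc i - \<pi> n ! i < e / (C + 1)"
          using partition_pairs[OF elim, of i] t by auto
        let ?m = "\<Sum>\<tau>\<in>J \<inter> {\<pi> n ! i<..\<pi> n ! Suc i}. norm (h \<tau>)"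
        have le: "norm (x v - x u) \<le> ?m" if "u \<in> {\<pi> n ! i..\<pi> n ! Suc i}" "v \<in> {\<pi> n ! i..\<pi> n ! Suc i}" "u \<le> v" for u v
        proof -
          have "x v - x u = (\<Sum>\<tau>\<in>J \<inter> {u<..v}. h \<tau>)" using that i by (intro step_path_increment[OF x]) auto
          then have "norm (x v - x u) \<le> (\<Sum>\<tau>\<in>J \<inter> {u<..v}. norm (h \<tau>))" by (simp add: norm_sum)
          also have "\<dots> \<le> ?m" using fin that by (intro sum_mono2) auto
          finally show ?thesis .
        qed
        show "oscillation x (\<pi> n ! i) (\<pi> n ! Suc i) \<le> ?m"
        proof (rule oscillation_le)
          fix u v assume "u \<in> {\<pi> n ! i..\<pi> n ! Suc i}" "v \<in> {\<pi> n ! i..\<pi> n ! Suc i}"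
          then show "norm (x u - x v) \<le> ?m"
            using le[of u v] le[of v u] by (cases "u \<le> v") (auto simp: norm_minus_commute)
        qed (use i in auto)
        show "\<pi> n ! Suc i - \<pi> n ! i \<le> e / (C + 1)" "0 \<le> \<pi> n ! Suc i - \<pi> n ! i" "0 \<le> ?m"
          using i by (auto simp: sum_nonneg)
      qed
      also have "\<dots> = (\<Sum>\<tau>\<in>J \<inter> {0<..\<pi> n ! (length (\<pi> n) - 1)}. norm (h \<tau>)) * (e / (C + 1))"
        unfolding sum_distrib_right[symmetric]
        using partition_length[OF elim] by (subst partition_jump_sum[OF elim fin]) auto
      also have "\<dots> \<le> C * (e / (C + 1))"
        unfolding C_def[symmetric] using fin e C by (intro mult_right_mono) (auto simp: C_def intro!: sum_mono2)
      also have "\<dots> < e" using e C by (simp add: field_simps)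
      finally show ?case using oscillation_sum_nonneg[OF bd elim] t by auto
    qed
    then show "\<exists>no. \<forall>n\<ge>no. norm (oscillation_sum x (\<pi> n) - 0) < e" by (simp add: eventually_sequentially)
  qed
qed

section \<open>Sums over the increments of a step path\<close>

definition jump_index :: "real list \<Rightarrow> real \<Rightarrow> nat" where
  "jump_index ts \<tau> = (SOME i. i < length ts - 1 \<and> ts ! i < \<tau> \<and> \<tau> \<le> ts ! Suc i)"

lemma jump_index:
  assumes "ts \<in> partitions t \<delta>" "0 < \<tau>" "\<tau> \<le> t"
  shows "jump_index ts \<tau> < length ts - 1" "ts ! jump_index ts \<tau> < \<tau>" "\<tau> \<le> ts ! Suc (jump_index ts \<tau>)"
proof -
  have "\<exists>i. i < length ts - 1 \<and> ts ! i < \<tau> \<and> \<tau> \<le> ts ! Suc i"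
    using partition_interval[OF assms] by blast
  from someI_ex[OF this] show "jump_index ts \<tau> < length ts - 1" "ts ! jump_index ts \<tau> < \<tau>" "\<tau> \<le> ts ! Suc (jump_index ts \<tau>)"
    unfolding jump_index_def by blast+
qed

lemma jump_index_eq:
  assumes ts: "ts \<in> partitions t \<delta>" and i: "i < length ts - 1" "ts ! i < \<tau>" "\<tau> \<le> ts ! Suc i"
  shows "jump_index ts \<tau> = i"
proof -
  have \<tau>: "0 < \<tau>" "\<tau> \<le> t" using partition_pairs[OF ts i(1)] i by auto
  note k = jump_index[OF ts \<tau>]
  have "\<not> jump_index ts \<tau> < i"
    using partition_nth_le[OF ts, of "Suc (jump_index ts \<tau>)" i] k i by (auto simp: less_diff_conv)
  moreover have "\<not> i < jump_index ts \<tau>"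
    using partition_nth_le[OF ts, of "Suc i" "jump_index ts \<tau>"] k i by (auto simp: less_diff_conv)
  ultimately show ?thesis by simp
qed

text \<open>The left endpoint of the interval containing \<open>\<tau>\<close> is strictly before
  \<open>\<tau>\<close>, so in the limit a left-endpoint sum sees the path just before the
  jump.\<close>

lemma jump_index_at_left:
  assumes \<pi>: "mesh_seq t \<pi>" and \<tau>: "0 < \<tau>" "\<tau> \<le> t"
  shows "filterlim (\<lambda>n. \<pi> n ! jump_index (\<pi> n) \<tau>) (at_left \<tau>) sequentially"
  unfolding filterlim_at
proof
  show "\<forall>\<^sub>F n in sequentially. \<pi> n ! jump_index (\<pi> n) \<tau> \<in> {..<\<tau>} \<and> \<pi> n ! jump_index (\<pi> n) \<tau> \<noteq> \<tau>"
    using mesh_seq_eventually[OF \<pi>] by (rule eventually_mono) (use jump_index \<tau> in fastforce)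
  show "(\<lambda>n. \<pi> n ! jump_index (\<pi> n) \<tau>) \<longlonglongrightarrow> \<tau>"
  proof (rule tendstoI)
    fix e :: real assume "0 < e"
    then have "\<forall>\<^sub>F n in sequentially. \<pi> n \<in> partitions t e" using \<pi> by (simp add: mesh_seq_def)
    then show "\<forall>\<^sub>F n in sequentially. dist (\<pi> n ! jump_index (\<pi> n) \<tau>) \<tau> < e"
    proof eventually_elim
      case (elim n)
      show ?case using jump_index[OF elim \<tau>] partition_step[OF elim jump_index(1)[OF elim \<tau>]]
        by (auto simp: dist_real_def)
    qed
  qed
qed

lemma finite_separated:
  fixes J :: "real set"
  assumes "finite J"
  obtains d where "0 < d" "\<And>\<sigma> \<tau>. \<sigma> \<in> J \<Longrightarrow> \<tau> \<in> J \<Longrightarrow> \<bar>\<sigma> - \<tau>\<bar> < d \<Longrightarrow> \<sigma> = \<tau>"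
proof -
  let ?D = "(\<lambda>p. \<bar>fst p - snd p\<bar>) ` (J \<times> J) - {0}"
  have fin: "finite ?D" using assms by auto
  show ?thesis
  proof (cases "?D = {}")
    case True
    then have "\<sigma> = \<tau>" if "\<sigma> \<in> J" "\<tau> \<in> J" for \<sigma> \<tau> using that by force
    then show ?thesis by (intro that[of 1]) auto
  next
    case False
    show ?thesis
    proof (rule that[of "Min ?D"])
      show "0 < Min ?D" using Min_in[OF fin False] by auto
      fix \<sigma> \<tau> assume st: "\<sigma> \<in> J" "\<tau> \<in> J" "\<bar>\<sigma> - \<tau>\<bar> < Min ?D"
      show "\<sigma> = \<tau>"
      proof (rule ccontr)
        assume "\<sigma> \<noteq> \<tau>"
        then have "\<bar>\<sigma> - \<tau>\<bar> \<in> ?D" using st by force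
        from Min_le[OF fin this] st show False by simp
      qed
    qed
  qed
qed

text \<open>Once the mesh is below the least distance between two jumps, an interval contains at
  most one of them and the increment over it is exactly the jump size. \<open>F\<close> may be
  nonlinear, so squares and outer products are covered; \<open>F n i 0 = 0\<close> disposes of the
  intervals without a jump.\<close>

lemma step_path_jump_sum:
  fixes F :: "nat \<Rightarrow> nat \<Rightarrow> 'b::euclidean_space \<Rightarrow> 'c::comm_monoid_add"
  assumes x: "step_path T x J h" and t: "t \<in> {0..T}" and \<pi>: "mesh_seq t \<pi>" and F0: "\<And>n i. F n i 0 = 0"
  shows "\<forall>\<^sub>F n in sequentially. (\<Sum>i<length (\<pi> n) - 1. F n i (x (\<pi> n ! Suc i) - x (\<pi> n ! i)))
    = (\<Sum>\<tau>\<in>J \<inter> {..t}. F n (jump_index (\<pi> n) \<tau>) (h \<tau>))"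
proof -
  have fin: "finite J" and Jpos: "J \<subseteq> {0<..T}" using x by (auto simp: step_path_def)
  obtain d where d: "0 < d" "\<And>\<sigma> \<tau>. \<sigma> \<in> J \<Longrightarrow> \<tau> \<in> J \<Longrightarrow> \<bar>\<sigma> - \<tau>\<bar> < d \<Longrightarrow> \<sigma> = \<tau>"
    using finite_separated[OF fin] by blast
  have "\<forall>\<^sub>F n in sequentially. \<pi> n \<in> partitions t d" using \<pi> d by (simp add: mesh_seq_def)
  then show ?thesis
  proof eventually_elim
    case (elim n)
    have "(\<Sum>i<length (\<pi> n) - 1. F n i (x (\<pi> n ! Suc i) - x (\<pi> n ! i)))
        = (\<Sum>i<length (\<pi> n) - 1. \<Sum>\<tau>\<in>J \<inter> {\<pi> n ! i<..\<pi> n ! Suc i}. F n (jump_index (\<pi> n) \<tau>) (h \<tau>))"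
    proof (rule sum.cong[OF refl])
      fix i assume "i \<in> {..<length (\<pi> n) - 1}"
      then have len: "i < length (\<pi> n) - 1" by simp
      note i = partition_pairs[OF elim len]
      let ?K = "J \<inter> {\<pi> n ! i<..\<pi> n ! Suc i}"
      have inc: "x (\<pi> n ! Suc i) - x (\<pi> n ! i) = (\<Sum>\<tau>\<in>?K. h \<tau>)"
        using i t by (intro step_path_increment[OF x]) auto
      show "F n i (x (\<pi> n ! Suc i) - x (\<pi> n ! i)) = (\<Sum>\<tau>\<in>?K. F n (jump_index (\<pi> n) \<tau>) (h \<tau>))"
      proof (cases "?K = {}")
        case True
        then show ?thesis unfolding inc by (simp only: True sum.empty F0)
      next
        case False
        then obtain \<tau> where \<tau>: "\<tau> \<in> ?K" by blast
        have "\<sigma> = \<tau>" if "\<sigma> \<in> ?K" for \<sigma>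
          using that \<tau> i by (intro d(2)) auto
        then have K: "?K = {\<tau>}" using \<tau> by blast
        have "jump_index (\<pi> n) \<tau> = i" using \<tau> by (intro jump_index_eq[OF elim len]) auto
        then show ?thesis unfolding inc by (simp only: K) simp
      qed
    qed
    also have "\<dots> = (\<Sum>\<tau>\<in>J \<inter> {0<..\<pi> n ! (length (\<pi> n) - 1)}. F n (jump_index (\<pi> n) \<tau>) (h \<tau>))"
      using partition_length[OF elim] by (intro partition_jump_sum[OF elim fin]) auto
    also have "J \<inter> {0<..\<pi> n ! (length (\<pi> n) - 1)} = J \<inter> {..t}"
      using partition_nth_last[OF elim] Jpos by auto
    finally show ?case .
  qed
qed

lemma step_path_sum_tendsto:
  fixes F :: "nat \<Rightarrow> nat \<Rightarrow> 'b::euclidean_space \<Rightarrow> 'c::real_normed_vector"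
  assumes x: "step_path T x J h" and t: "t \<in> {0..T}" and \<pi>: "mesh_seq t \<pi>" and F0: "\<And>n i. F n i 0 = 0"
    and lim: "\<And>\<tau>. \<tau> \<in> J \<Longrightarrow> \<tau> \<le> t \<Longrightarrow> (\<lambda>n. F n (jump_index (\<pi> n) \<tau>) (h \<tau>)) \<longlonglongrightarrow> L \<tau>"
  shows "(\<lambda>n. \<Sum>i<length (\<pi> n) - 1. F n i (x (\<pi> n ! Suc i) - x (\<pi> n ! i))) \<longlonglongrightarrow> (\<Sum>\<tau>\<in>J \<inter> {..t}. L \<tau>)"
proof -
  have "(\<lambda>n. \<Sum>\<tau>\<in>J \<inter> {..t}. F n (jump_index (\<pi> n) \<tau>) (h \<tau>)) \<longlonglongrightarrow> (\<Sum>\<tau>\<in>J \<inter> {..t}. L \<tau>)"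
    by (intro tendsto_sum lim) auto
  then show ?thesis
    by (rule Lim_transform_eventually)
      (use step_path_jump_sum[where F=F, OF x t \<pi> F0] in \<open>auto elim: eventually_mono\<close>)
qed

text \<open>The path is locally constant on punctured one-sided neighbourhoods, so compactness of the time
  interval leaves finitely many jumps.\<close>

lemma step_path_cadlag:
  fixes x :: "real \<Rightarrow> 'b::euclidean_space"
  assumes T: "0 \<le> T" and cad: "cadlag_on T x" and fin: "finite V" and V: "\<And>s. s \<in> {0..T} \<Longrightarrow> x s \<in> V"
  shows "\<exists>J h. step_path T x J h"
proof -
  define P where "P a b \<longleftrightarrow> (0 \<le> a \<and> a \<le> b \<and> b \<le> T \<longrightarrow>
    (\<exists>J h. finite J \<and> J \<subseteq> {a<..b} \<and> (\<forall>s\<in>{a..b}. x s = x a + (\<Sum>\<tau>\<in>J \<inter> {..s}. h \<tau>))))" for a b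
  \<comment> \<open>The least distance between distinct values in the finite set \<open>V\<close>:
    values closer than \<open>d\<close> coincide, so one-sided limits turn into one-sided
    constancy.\<close>
  obtain d where d: "0 < d" "\<And>u v. u \<in> V \<Longrightarrow> v \<in> V \<Longrightarrow> dist u v < d \<Longrightarrow> u = v"
  proof (cases "\<exists>u\<in>V. \<exists>v\<in>V. u \<noteq> v")
    case False
    then show ?thesis by (intro that[of 1]) auto
  next
    case True
    let ?D = "(\<lambda>p. dist (fst p) (snd p)) ` (V \<times> V) - {0}"
    have finD: "finite ?D" using fin by auto
    have ne: "?D \<noteq> {}" using True by force
    show ?thesis
    proof (rule that[of "Min ?D"])
      have "Min ?D \<in> ?D" by (rule Min_in[OF finD ne])
      then show "0 < Min ?D" by auto
      fix u v assume uv: "u \<in> V" "v \<in> V" "dist u v < Min ?D"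
      show "u = v"
      proof (rule ccontr)
        assume "u \<noteq> v"
        then have "dist u v \<in> ?D" using uv by force
        from Min_le[OF finD this] uv show False by simp
      qed
    qed
  qed
  have right: "\<exists>e>0. \<forall>s\<in>{r..T}. s < r + e \<longrightarrow> x s = x r" if r: "r \<in> {0..T}" for r
  proof (cases "r = T")
    case True
    then show ?thesis by (intro exI[of _ 1]) auto
  next
    case False
    then have "(x \<longlongrightarrow> x r) (at_right r)" using cad r by (auto simp: cadlag_on_def)
    then have "\<forall>\<^sub>F s in at_right r. dist (x s) (x r) < d" using d by (intro tendstoD)
    then obtain b where b: "b > r" "\<And>s. r < s \<Longrightarrow> s < b \<Longrightarrow> dist (x s) (x r) < d"
      by (auto simp: eventually_at_right_field)
    show ?thesis
    proof (intro exI[of _ "b - r"] conjI ballI impI)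
      fix s assume s: "s \<in> {r..T}" "s < r + (b - r)"
      show "x s = x r"
        using s b(2)[of s] r by (cases "s = r") (auto intro!: d(2) V)
    qed (use b in auto)
  qed
  have left: "\<exists>e>0. \<forall>s\<in>{0..T}. \<forall>s'\<in>{0..T}. r - e < s \<and> s < r \<and> r - e < s' \<and> s' < r \<longrightarrow> x s = x s'"
    if r: "r \<in> {0..T}" for r
  proof (cases "r = 0")
    case True
    then show ?thesis by (intro exI[of _ 1]) auto
  next
    case False
    then have "r \<in> {0<..T}" using r by auto
    then obtain l where "(x \<longlongrightarrow> l) (at_left r)" using cad unfolding cadlag_on_def by blast
    then have "\<forall>\<^sub>F s in at_left r. dist (x s) l < d / 2" using d by (intro tendstoD) auto
    then obtain b where b: "b < r" "\<And>s. b < s \<Longrightarrow> s < r \<Longrightarrow> dist (x s) l < d / 2"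
      by (auto simp: eventually_at_left_field)
    show ?thesis
    proof (intro exI[of _ "r - b"] conjI ballI impI)
      fix s s' assume s: "s \<in> {0..T}" "s' \<in> {0..T}" "r - (r - b) < s \<and> s < r \<and> r - (r - b) < s' \<and> s' < r"
      have "dist (x s) (x s') < d"
        using dist_triangle_half_l[of "x s" l d "x s'"] b(2)[of s] b(2)[of s'] s by auto
      then show "x s = x s'" using s by (intro d(2) V) auto
    qed (use b in auto)
  qed
  have "P 0 T"
    using T
  proof (induction rule: Bolzano)
    case (trans a b c)
    show ?case unfolding P_def
    proof
      assume abc: "0 \<le> a \<and> a \<le> c \<and> c \<le> T"
      obtain J1 h1 where 1: "finite J1" "J1 \<subseteq> {a<..b}" "\<And>s. s \<in> {a..b} \<Longrightarrow> x s = x a + (\<Sum>\<tau>\<in>J1 \<inter> {..s}. h1 \<tau>)"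
      proof -
        have "0 \<le> a \<and> a \<le> b \<and> b \<le> T" using trans(3,4) abc by auto
        from trans(1)[unfolded P_def, rule_format, OF this] that show thesis by blast
      qed
      obtain J2 h2 where 2: "finite J2" "J2 \<subseteq> {b<..c}" "\<And>s. s \<in> {b..c} \<Longrightarrow> x s = x b + (\<Sum>\<tau>\<in>J2 \<inter> {..s}. h2 \<tau>)"
      proof -
        have "0 \<le> b \<and> b \<le> c \<and> c \<le> T" using trans(3,4) abc by auto
        from trans(2)[unfolded P_def, rule_format, OF this] that show thesis by blast
      qed
      \<comment> \<open>The two sets of jumps lie in \<open>{a<..b}\<close> and
        \<open>{b<..c}\<close>, so comparing with \<open>b\<close> tells which size function
        applies.\<close>
      define h where "h \<tau> = (if \<tau> \<le> b then h1 \<tau> else h2 \<tau>)" for \<tau>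
      show "\<exists>J h. finite J \<and> J \<subseteq> {a<..c} \<and> (\<forall>s\<in>{a..c}. x s = x a + (\<Sum>\<tau>\<in>J \<inter> {..s}. h \<tau>))"
      proof (intro exI[of _ "J1 \<union> J2"] exI[of _ h] conjI ballI)
        show "finite (J1 \<union> J2)" using 1(1) 2(1) by auto
        show "J1 \<union> J2 \<subseteq> {a<..c}" using 1(2) 2(2) trans(3,4) by force
        fix s assume s: "s \<in> {a..c}"
        have e1: "(\<Sum>\<tau>\<in>J1 \<inter> {..r}. h \<tau>) = (\<Sum>\<tau>\<in>J1 \<inter> {..r}. h1 \<tau>)" for r
          using 1(2) by (intro sum.cong) (auto simp: h_def)
        have e2: "(\<Sum>\<tau>\<in>J2 \<inter> {..s}. h \<tau>) = (\<Sum>\<tau>\<in>J2 \<inter> {..s}. h2 \<tau>)"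
          using 2(2) by (intro sum.cong) (auto simp: h_def)
        have un: "(\<Sum>\<tau>\<in>(J1 \<union> J2) \<inter> {..s}. h \<tau>) = (\<Sum>\<tau>\<in>J1 \<inter> {..s}. h \<tau>) + (\<Sum>\<tau>\<in>J2 \<inter> {..s}. h \<tau>)"
          unfolding Int_Un_distrib2 using 1(1,2) 2(1,2) by (intro sum.union_disjoint) force+
        show "x s = x a + (\<Sum>\<tau>\<in>(J1 \<union> J2) \<inter> {..s}. h \<tau>)"
        proof (cases "s \<le> b")
          case True
          then have J2: "J2 \<inter> {..s} = {}" using 2(2) by auto
          have "x s = x a + (\<Sum>\<tau>\<in>J1 \<inter> {..s}. h1 \<tau>)" using s True by (intro 1(3)) auto
          then show ?thesis unfolding un e1 J2 by (simp only: sum.empty add_0_right)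
        next
          case False
          then have J1: "J1 \<inter> {..s} = J1 \<inter> {..b}" using 1(2) by auto
          have "x b = x a + (\<Sum>\<tau>\<in>J1 \<inter> {..b}. h1 \<tau>)" using trans(3,4) by (intro 1(3)) auto
          moreover have "x s = x b + (\<Sum>\<tau>\<in>J2 \<inter> {..s}. h2 \<tau>)" using s False by (intro 2(3)) auto
          ultimately show ?thesis unfolding un J1 e1 e2 by (simp only: add.assoc)
        qed
      qed
    qed
  next
    case (local r)
    then have r: "r \<in> {0..T}" by simp
    obtain e1 where e1: "0 < e1" "\<And>s. s \<in> {r..T} \<Longrightarrow> s < r + e1 \<Longrightarrow> x s = x r" using right[OF r] by blast
    obtain e2 where e2: "0 < e2" "\<And>s s'. s \<in> {0..T} \<Longrightarrow> s' \<in> {0..T} \<Longrightarrow> r - e2 < s \<Longrightarrow> s < r \<Longrightarrow>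
      r - e2 < s' \<Longrightarrow> s' < r \<Longrightarrow> x s = x s'" using left[OF r] by blast
    show ?case
    proof (intro exI[of _ "min e1 e2"] conjI allI impI)
      show "0 < min e1 e2" using e1 e2 by simp
      fix a b assume ab: "a \<le> r \<and> r \<le> b \<and> b - a < min e1 e2"
      show "P a b" unfolding P_def
      proof
        assume abT: "0 \<le> a \<and> a \<le> b \<and> b \<le> T"
        show "\<exists>J h. finite J \<and> J \<subseteq> {a<..b} \<and> (\<forall>s\<in>{a..b}. x s = x a + (\<Sum>\<tau>\<in>J \<inter> {..s}. h \<tau>))"
        proof (cases "a = r")
          case True
          show ?thesis
          proof (intro exI[of _ "{}"] exI conjI ballI)
            fix s assume "s \<in> {a..b}"
            then have "x s = x r" using True ab abT by (intro e1(2)) auto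
            then show "x s = x a + (\<Sum>\<tau>\<in>{} \<inter> {..s}. 0)" using True by simp
          qed auto
        next
          case False
          show ?thesis
          \<comment> \<open>With \<open>a < r\<close> the path is constant on the part before
            \<open>r\<close> and on the part from \<open>r\<close> on, so \<open>r\<close> is the
            only possible jump and its size is \<open>x r - x a\<close>, possibly zero.\<close>
          proof (intro exI[of _ "{r}"] exI[of _ "\<lambda>_. x r - x a"] conjI ballI)
            show "{r} \<subseteq> {a<..b}" using False ab by auto
            fix s assume s: "s \<in> {a..b}"
            show "x s = x a + (\<Sum>\<tau>\<in>{r} \<inter> {..s}. x r - x a)"
            proof (cases "r \<le> s")
              case True
              then have "x s = x r" using s ab abT by (intro e1(2)) auto
              then show ?thesis using True by simp
            next
              case F: False
              then have "x s = x a" using s ab abT False by (intro e2(2)) auto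
              then show ?thesis using F by simp
            qed
          qed simp
        qed
      qed
    qed
  qed
  then have "\<exists>J h. finite J \<and> J \<subseteq> {0<..T} \<and> (\<forall>s\<in>{0..T}. x s = x 0 + (\<Sum>\<tau>\<in>J \<inter> {..s}. h \<tau>))"
    unfolding P_def using T by blast
  then show ?thesis unfolding step_path_def .
qed

subsection \<open>Pathwise integration by parts\<close>

definition increment_sum :: "(real \<Rightarrow> real^'m^'e) \<Rightarrow> (real \<Rightarrow> real^'m) \<Rightarrow> real list \<Rightarrow> nat \<Rightarrow> real^'e" where
  "increment_sum k w ts l = (\<Sum>i<l. k (ts ! i) *v (w (ts ! Suc i) - w (ts ! i)))"

text \<open>One step of the quadratic covariation of components \<open>p\<close> and
  \<open>q\<close> of the integral of \<open>k\<close>, minus its compensator, whose density is the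
  matrix \<open>k ** R ** transpose k\<close>.\<close>

definition covariation_term ::
    "(real \<Rightarrow> real^'m^'e) \<Rightarrow> (real \<Rightarrow> real^'m) \<Rightarrow> real^'m^'m \<Rightarrow> 'e \<Rightarrow> 'e \<Rightarrow> real list \<Rightarrow> nat \<Rightarrow> real" where
  "covariation_term k w R p q ts i =
     (k (ts ! i) *v (w (ts ! Suc i) - w (ts ! i))) $ p * (k (ts ! i) *v (w (ts ! Suc i) - w (ts ! i))) $ q
     - (k (ts ! i) ** R ** transpose (k (ts ! i))) $ p $ q * (ts ! Suc i - ts ! i)"

text \<open>The last clause does not follow from the first: it weights the increments of
  \<open>w\<close>, which need not have bounded variation, by the approximation error at their left
  endpoint. None of the clauses mentions \<open>y\<close>, and all are uniform over the points of
  the partition, which is what Abel summation requires.\<close>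

definition ito_approximates ::
    "(real \<Rightarrow> real^'m^'e) \<Rightarrow> (real \<Rightarrow> real^'m) \<Rightarrow> (real \<Rightarrow> real^'e) \<Rightarrow> real^'m^'m \<Rightarrow> (nat \<Rightarrow> real list) \<Rightarrow> bool" where
  "ito_approximates k w N R \<pi> \<longleftrightarrow>
     (\<lambda>n. partition_max (\<pi> n) (\<lambda>l. norm (increment_sum k w (\<pi> n) l - N (\<pi> n ! l)))) \<longlonglongrightarrow> 0 \<and>
     (\<forall>p q. (\<lambda>n. partition_max (\<pi> n) (\<lambda>l. \<Sum>i<l. covariation_term k w R p q (\<pi> n) i)) \<longlonglongrightarrow> 0) \<and>
     (\<forall>p q. (\<lambda>n. partition_max (\<pi> n) (\<lambda>l. \<Sum>i<l. (increment_sum k w (\<pi> n) i - N (\<pi> n ! i)) $ p *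
        (k (\<pi> n ! i) *v (w (\<pi> n ! Suc i) - w (\<pi> n ! i))) $ q)) \<longlonglongrightarrow> 0)"

text \<open>A single trajectory. \<open>N\<close> plays the role of the stochastic integral of \<open>k\<close> against \<open>w\<close>; since \<open>y\<close> is
  continuously differentiable, the integral of \<open>u = k\<^sup>T y\<close> against \<open>w\<close> is obtained from \<open>N\<close> by parts,
  so \<open>y\<close> may depend on the whole trajectory.\<close>

locale ito_path =
  fixes T :: real and y y' :: "real \<Rightarrow> real^'e" and k :: "real \<Rightarrow> real^'m^'e" and w :: "real \<Rightarrow> real^'m"
    and N :: "real \<Rightarrow> real^'e" and R :: "real^'m^'m"
  assumes y_deriv: "\<And>s. s \<in> {0..T} \<Longrightarrow> (y has_vector_derivative y' s) (at s within {0..T})"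
    and y'_cont: "continuous_on {0..T} y'" and k_cont: "continuous_on {0..T} k"
    and w_cont: "continuous_on {0..T} w" and N_cont: "continuous_on {0..T} N"
begin

definition u :: "real \<Rightarrow> real^'m" where "u s = transpose (k s) *v y s"

abbreviation nsum :: "real list \<Rightarrow> nat \<Rightarrow> real^'e" where "nsum \<equiv> increment_sum k w"

definition isum :: "real list \<Rightarrow> nat \<Rightarrow> real" where
  "isum ts l = (\<Sum>i<l. u (ts ! i) \<bullet> (w (ts ! Suc i) - w (ts ! i)))"

definition I :: "real \<Rightarrow> real" where
  "I t = y t \<bullet> N t - integral {0..t} (\<lambda>s. N s \<bullet> y' s)"

abbreviation approximates :: "(nat \<Rightarrow> real list) \<Rightarrow> bool" where
  "approximates \<equiv> ito_approximates k w N R"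

lemma y_cont: "continuous_on {0..T} y"
  unfolding continuous_on_eq_continuous_within by (blast intro: has_vector_derivative_continuous y_deriv)

lemma u_cont: "continuous_on {0..T} u"
proof -
  have "continuous_on {0..T} (\<lambda>s. transpose (k s))"
    unfolding transpose_def by (intro continuous_on_vec_lambda continuous_on_component k_cont)
  then show ?thesis
    unfolding u_def[abs_def] matrix_vector_mult_def
    by (intro continuous_on_vec_lambda continuous_on_sum continuous_on_mult continuous_on_component y_cont)
qed

lemma u_inner: "u s \<bullet> x = y s \<bullet> (k s *v x)"
  by (simp add: u_def transpose_matrix_vector dot_lmul_matrix)

lemma y_increment:
  assumes "0 \<le> a" "a \<le> b" "b \<le> T"
  shows "y b - y a = integral {a..b} y'" "y' integrable_on {a..b}"
proof -
  have "(y' has_integral (y b - y a)) {a..b}"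
    using assms by (intro fundamental_theorem_of_calculus has_vector_derivative_within_subset[OF y_deriv]) auto
  then show "y b - y a = integral {a..b} y'" "y' integrable_on {a..b}"
    by (auto simp: integral_unique)
qed

lemma y'_bound:
  obtains C where "0 \<le> C" "\<And>s. s \<in> {0..T} \<Longrightarrow> norm (y' s) \<le> C"
  using riemann_path_bound[OF riemann_path_continuous[OF y'_cont]] by blast

lemma y_lipschitz:
  obtains C where "0 \<le> C" "\<And>a b. 0 \<le> a \<Longrightarrow> a \<le> b \<Longrightarrow> b \<le> T \<Longrightarrow> norm (y b - y a) \<le> C * (b - a)"
proof -
  obtain C where C: "0 \<le> C" "\<And>s. s \<in> {0..T} \<Longrightarrow> norm (y' s) \<le> C"
    using y'_bound by blast
  show ?thesis
  proof (rule that[OF C(1)])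
    fix a b assume ab: "0 \<le> a" "a \<le> b" "b \<le> T"
    show "norm (y b - y a) \<le> C * (b - a)"
      unfolding y_increment(1)[OF ab] using ab by (intro norm_integral_le y_increment C) auto
  qed
qed

lemma y_bound:
  obtains B where "0 \<le> B" "\<And>s. s \<in> {0..T} \<Longrightarrow> norm (y s) \<le> B"
  using riemann_path_bound[OF riemann_path_continuous[OF y_cont]] by blast

text \<open>An exact discrete integration by parts; taking \<open>nsum\<close> at the right endpoint
  absorbs the cross terms.\<close>

lemma isum_by_parts:
  "isum ts l = y (ts ! l) \<bullet> nsum ts l - (\<Sum>i<l. nsum ts (Suc i) \<bullet> (y (ts ! Suc i) - y (ts ! i)))"
proof (induction l)
  case (Suc l)
  have "isum ts (Suc l) = isum ts l + y (ts ! l) \<bullet> (nsum ts (Suc l) - nsum ts l)"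
    by (simp add: isum_def increment_sum_def u_inner)
  with Suc show ?case by (simp add: inner_diff_right inner_diff_left inner_commute)
qed (simp add: isum_def increment_sum_def)

text \<open>The defect of one step of discrete integration by parts against the integral in the
  definition of \<open>I\<close>.\<close>

definition parts_error :: "real list \<Rightarrow> nat \<Rightarrow> real" where
  "parts_error ts i = nsum ts (Suc i) \<bullet> (y (ts ! Suc i) - y (ts ! i))
     - integral {ts ! i..ts ! Suc i} (\<lambda>s. N s \<bullet> y' s)"

lemma Ny'_riemann: "riemann_path T (\<lambda>s. N s \<bullet> y' s)"
  by (intro riemann_path_continuous continuous_on_inner N_cont y'_cont)

text \<open>The error has two components with different remedies. The first is the approximation
  error of \<open>N\<close>, uniformly small but with no control of its variation; the second will
  be small in total variation.\<close>

lemma isum_error: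
  assumes ts: "ts \<in> partitions t \<delta>" and t: "t \<le> T" and l: "l < length ts"
  shows "isum ts l - I (ts ! l) = y (ts ! l) \<bullet> (nsum ts l - N (ts ! l)) - (\<Sum>i<l. parts_error ts i)"
proof -
  have "integral {0..ts ! l} (\<lambda>s. N s \<bullet> y' s) = (\<Sum>i<l. integral {ts ! i..ts ! Suc i} (\<lambda>s. N s \<bullet> y' s))"
    by (rule partition_integral[OF ts riemann_path_integrable[OF Ny'_riemann] l]) (use t in auto)
  then show ?thesis
    by (simp add: isum_by_parts I_def parts_error_def sum_subtractf inner_diff_right)
qed

lemma partition_last_less: "ts \<in> partitions t \<delta> \<Longrightarrow> length ts - 1 < length ts"
  using partition_length[of ts t \<delta>] by simp

text \<open>By the fundamental theorem a step defect is the integral of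
  \<open>(nsum - N) \<bullet> y'\<close>. It is at most the step length times a bound of
  \<open>y'\<close> times the sum of the uniform approximation error and the oscillation of
  \<open>N\<close>. The sum of absolute values vanishes, which is stronger than smallness of the
  sums.\<close>

lemma parts_error_variation:
  assumes t: "t \<in> {0..T}" and \<pi>: "mesh_seq t \<pi>" and approx: "approximates \<pi>"
  shows "(\<lambda>n. \<Sum>i<length (\<pi> n) - 1. \<bar>parts_error (\<pi> n) i\<bar>) \<longlonglongrightarrow> 0"
proof -
  obtain C where C: "0 \<le> C" "\<And>s. s \<in> {0..T} \<Longrightarrow> norm (y' s) \<le> C"
    using y'_bound by blast
  define m where "m n = partition_max (\<pi> n) (\<lambda>l. norm (nsum (\<pi> n) l - N (\<pi> n ! l)))" for n
  have m: "m \<longlonglongrightarrow> 0" using approx by (simp add: ito_approximates_def m_def[abs_def])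
  have RN: "riemann_path T N" by (rule riemann_path_continuous[OF N_cont])
  then have bdN: "bounded (N ` {0..T})" by (simp add: riemann_path_def)
  have "(\<lambda>n. C * (m n * t + oscillation_sum N (\<pi> n))) \<longlonglongrightarrow> C * (0 * t + 0)"
    using m RN t \<pi> by (intro tendsto_intros) (auto simp: riemann_path_def)
  then have lim: "(\<lambda>n. C * (m n * t + oscillation_sum N (\<pi> n))) \<longlonglongrightarrow> 0" by simp
  show ?thesis
  proof (rule tendsto_sandwich[OF _ _ tendsto_const lim])
    show "\<forall>\<^sub>F n in sequentially. 0 \<le> (\<Sum>i<length (\<pi> n) - 1. \<bar>parts_error (\<pi> n) i\<bar>)"
      by (intro always_eventually allI sum_nonneg) simp
    show "\<forall>\<^sub>F n in sequentially. (\<Sum>i<length (\<pi> n) - 1. \<bar>parts_error (\<pi> n) i\<bar>)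
        \<le> C * (m n * t + oscillation_sum N (\<pi> n))"
      using mesh_seq_eventually[OF \<pi>]
    proof eventually_elim
      case (elim n)
      let ?o = "\<lambda>i. oscillation N (\<pi> n ! i) (\<pi> n ! Suc i)"
      have "(\<Sum>i<length (\<pi> n) - 1. \<bar>parts_error (\<pi> n) i\<bar>)
          \<le> (\<Sum>i<length (\<pi> n) - 1. (m n + ?o i) * C * (\<pi> n ! Suc i - \<pi> n ! i))"
      proof (rule sum_mono)
        fix i assume "i \<in> {..<length (\<pi> n) - 1}"
        then have len: "i < length (\<pi> n) - 1" by simp
        then have i: "0 \<le> \<pi> n ! i" "\<pi> n ! i < \<pi> n ! Suc i" "\<pi> n ! Suc i \<le> T"
          using partition_pairs[OF elim, of i] t by auto
        have inty': "y' integrable_on {\<pi> n ! i..\<pi> n ! Suc i}" using i by (intro y_increment) auto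
        have intNy': "(\<lambda>s. N s \<bullet> y' s) integrable_on {\<pi> n ! i..\<pi> n ! Suc i}"
          by (rule riemann_path_integrable[OF Ny'_riemann i(1,3)])
        let ?n = "nsum (\<pi> n) (Suc i)"
        have intn: "(\<lambda>s. ?n \<bullet> y' s) integrable_on {\<pi> n ! i..\<pi> n ! Suc i}"
          using integrable_linear[OF inty' bounded_linear_inner_right[of ?n]] by (simp add: comp_def)
        have "?n \<bullet> (y (\<pi> n ! Suc i) - y (\<pi> n ! i)) = integral {\<pi> n ! i..\<pi> n ! Suc i} (\<lambda>s. ?n \<bullet> y' s)"
          using integral_linear[OF inty' bounded_linear_inner_right[of ?n]] i
          by (subst y_increment(1)) (auto simp: comp_def)
        then have "parts_error (\<pi> n) i = integral {\<pi> n ! i..\<pi> n ! Suc i} (\<lambda>s. (?n - N s) \<bullet> y' s)"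
          unfolding parts_error_def by (simp add: integral_diff[OF intn intNy', symmetric] inner_diff_left)
        moreover have "norm (integral {\<pi> n ! i..\<pi> n ! Suc i} (\<lambda>s. (?n - N s) \<bullet> y' s))
            \<le> ((m n + ?o i) * C) * (\<pi> n ! Suc i - \<pi> n ! i)"
        proof (rule norm_integral_le)
          show "(\<lambda>s. (?n - N s) \<bullet> y' s) integrable_on {\<pi> n ! i..\<pi> n ! Suc i}"
            using integrable_diff[OF intn intNy'] by (simp add: inner_diff_left)
          fix s assume s: "s \<in> {\<pi> n ! i..\<pi> n ! Suc i}"
          have "norm (?n - N s) \<le> norm (?n - N (\<pi> n ! Suc i)) + norm (N (\<pi> n ! Suc i) - N s)"
            using norm_triangle_ineq[of "?n - N (\<pi> n ! Suc i)" "N (\<pi> n ! Suc i) - N s"] by simp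
          also have "norm (?n - N (\<pi> n ! Suc i)) \<le> m n"
            using partition_max_ge[of "Suc i" "\<pi> n" "\<lambda>l. norm (nsum (\<pi> n) l - N (\<pi> n ! l))"] len
            by (simp add: m_def less_diff_conv)
          also have "norm (N (\<pi> n ! Suc i) - N s) \<le> ?o i"
            using oscillation_upper[OF bdN i(1,3), of "\<pi> n ! Suc i" s] s i by auto
          finally have le: "norm (?n - N s) \<le> m n + ?o i" by simp
          have "norm ((?n - N s) \<bullet> y' s) \<le> norm (?n - N s) * norm (y' s)" by (simp add: Cauchy_Schwarz_ineq2)
          also have "\<dots> \<le> (m n + ?o i) * C"
            using le C s i by (intro mult_mono) (auto intro: order_trans[OF norm_ge_zero])
          finally show "norm ((?n - N s) \<bullet> y' s) \<le> (m n + ?o i) * C" .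
        qed (use i in simp)
        ultimately show "\<bar>parts_error (\<pi> n) i\<bar> \<le> (m n + ?o i) * C * (\<pi> n ! Suc i - \<pi> n ! i)" by simp
      qed
      also have "\<dots> = C * (m n * (\<Sum>i<length (\<pi> n) - 1. \<pi> n ! Suc i - \<pi> n ! i) + oscillation_sum N (\<pi> n))"
        by (simp add: oscillation_sum_def sum_distrib_left sum.distrib[symmetric] algebra_simps del: One_nat_def)
      also have "\<dots> = C * (m n * t + oscillation_sum N (\<pi> n))" unfolding partition_sum_steps[OF elim] ..
      finally show ?case .
    qed
  qed
qed

lemma partition_max_error:
  assumes t: "t \<in> {0..T}" and \<pi>: "mesh_seq t \<pi>" and approx: "approximates \<pi>"
  shows "(\<lambda>n. partition_max (\<pi> n) (\<lambda>l. isum (\<pi> n) l - I (\<pi> n ! l))) \<longlonglongrightarrow> 0"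
proof -
  obtain B where B: "0 \<le> B" "\<And>s. s \<in> {0..T} \<Longrightarrow> norm (y s) \<le> B" using y_bound by blast
  define m where "m n = partition_max (\<pi> n) (\<lambda>l. norm (nsum (\<pi> n) l - N (\<pi> n ! l)))" for n
  have m: "m \<longlonglongrightarrow> 0" using approx by (simp add: ito_approximates_def m_def[abs_def])
  have "(\<lambda>n. B * m n + (\<Sum>i<length (\<pi> n) - 1. \<bar>parts_error (\<pi> n) i\<bar>)) \<longlonglongrightarrow> B * 0 + 0"
    by (intro tendsto_intros m parts_error_variation[OF assms])
  then have lim: "(\<lambda>n. B * m n + (\<Sum>i<length (\<pi> n) - 1. \<bar>parts_error (\<pi> n) i\<bar>)) \<longlonglongrightarrow> 0" by simp
  show ?thesis
  proof (rule tendsto_sandwich[OF _ _ tendsto_const lim])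
    show "\<forall>\<^sub>F n in sequentially. 0 \<le> partition_max (\<pi> n) (\<lambda>l. isum (\<pi> n) l - I (\<pi> n ! l))"
      using mesh_seq_eventually[OF \<pi>] by (rule eventually_mono) (use partition_length in \<open>auto intro: partition_max_nonneg\<close>)
    show "\<forall>\<^sub>F n in sequentially. partition_max (\<pi> n) (\<lambda>l. isum (\<pi> n) l - I (\<pi> n ! l))
        \<le> B * m n + (\<Sum>i<length (\<pi> n) - 1. \<bar>parts_error (\<pi> n) i\<bar>)"
      using mesh_seq_eventually[OF \<pi>]
    proof eventually_elim
      case (elim n)
      show ?case
      proof (rule partition_max_le)
        show "\<pi> n \<noteq> []" using partition_length[OF elim] by auto
        fix l assume l: "l < length (\<pi> n)"
        have "\<pi> n ! l \<in> {0..T}" using partition_nth_mem[OF elim l] t by auto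
        have "\<bar>y (\<pi> n ! l) \<bullet> (nsum (\<pi> n) l - N (\<pi> n ! l))\<bar> \<le> norm (y (\<pi> n ! l)) * norm (nsum (\<pi> n) l - N (\<pi> n ! l))"
          by (rule Cauchy_Schwarz_ineq2)
        also have "\<dots> \<le> B * m n"
          using partition_max_ge[OF l, of "\<lambda>l. norm (nsum (\<pi> n) l - N (\<pi> n ! l))"] B \<open>\<pi> n ! l \<in> {0..T}\<close>
          by (intro mult_mono) (auto simp: m_def)
        finally have 1: "\<bar>y (\<pi> n ! l) \<bullet> (nsum (\<pi> n) l - N (\<pi> n ! l))\<bar> \<le> B * m n" .
        have "\<bar>\<Sum>i<l. parts_error (\<pi> n) i\<bar> \<le> (\<Sum>i<l. \<bar>parts_error (\<pi> n) i\<bar>)" by (rule sum_abs)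
        also have "\<dots> \<le> (\<Sum>i<length (\<pi> n) - 1. \<bar>parts_error (\<pi> n) i\<bar>)" using l by (intro sum_mono2) auto
        finally show "\<bar>isum (\<pi> n) l - I (\<pi> n ! l)\<bar> \<le> B * m n + (\<Sum>i<length (\<pi> n) - 1. \<bar>parts_error (\<pi> n) i\<bar>)"
          using 1 t unfolding isum_error[OF elim _ l] by (subst isum_error[OF elim _ l]) auto
      qed
    qed
  qed
qed

lemma I_cont: "continuous_on {0..T} I"
  unfolding I_def[abs_def]
  by (intro continuous_on_diff continuous_on_inner y_cont N_cont indefinite_integral_continuous_1
      riemann_path_integrable[OF Ny'_riemann]) auto

lemma isum_tendsto:
  assumes t: "t \<in> {0..T}" and \<pi>: "mesh_seq t \<pi>" and approx: "approximates \<pi>"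
  shows "(\<lambda>n. isum (\<pi> n) (length (\<pi> n) - 1)) \<longlonglongrightarrow> I t"
proof -
  have "(\<lambda>n. isum (\<pi> n) (length (\<pi> n) - 1) - I t) \<longlonglongrightarrow> 0"
  proof (rule Lim_null_comparison[OF _ partition_max_error[OF assms]])
    show "\<forall>\<^sub>F n in sequentially. norm (isum (\<pi> n) (length (\<pi> n) - 1) - I t)
        \<le> partition_max (\<pi> n) (\<lambda>l. isum (\<pi> n) l - I (\<pi> n ! l))"
      using mesh_seq_eventually[OF \<pi>]
    proof eventually_elim
      case (elim n)
      show ?case
        using partition_max_ge[OF partition_last_less[OF elim], of "\<lambda>l. isum (\<pi> n) l - I (\<pi> n ! l)"]
          partition_nth_last[OF elim] by simp
    qed
  qed
  then show ?thesis by (simp add: LIM_zero_iff)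
qed

text \<open>Abel summation with the roles exchanged: the partial sums of \<open>u\<close> against
  \<open>w\<close> are uniformly close to \<open>I\<close> and so bounded, while the weights start
  at zero and have vanishing total variation.\<close>

lemma small_variation_sum_tendsto_0:
  fixes d :: "nat \<Rightarrow> nat \<Rightarrow> real"
  assumes t: "t \<in> {0..T}" and \<pi>: "mesh_seq t \<pi>" and approx: "approximates \<pi>"
    and d0: "\<And>n. d n 0 = 0" and dvar: "(\<lambda>n. \<Sum>i<length (\<pi> n) - 1. \<bar>d n (Suc i) - d n i\<bar>) \<longlonglongrightarrow> 0"
  shows "(\<lambda>n. \<Sum>i<length (\<pi> n) - 1. d n i * (u (\<pi> n ! i) \<bullet> (w (\<pi> n ! Suc i) - w (\<pi> n ! i)))) \<longlonglongrightarrow> 0"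
proof -
  obtain B where B: "0 \<le> B" "\<And>s. s \<in> {0..T} \<Longrightarrow> norm (I s) \<le> B"
    using riemann_path_bound[OF riemann_path_continuous[OF I_cont]] by blast
  \<comment> \<open>The bound below contains \<open>v n\<close> twice: since the weights start at
    zero, the last one is itself at most their total variation.\<close>
  define v where "v n = (\<Sum>i<length (\<pi> n) - 1. \<bar>d n (Suc i) - d n i\<bar>)" for n
  have "(\<lambda>n. (B + 1) * (v n + v n)) \<longlonglongrightarrow> (B + 1) * (0 + 0)"
    using dvar unfolding v_def[symmetric] by (intro tendsto_intros)
  then have lim: "(\<lambda>n. (B + 1) * (v n + v n)) \<longlonglongrightarrow> 0" by simp
  have "\<forall>\<^sub>F n in sequentially. partition_max (\<pi> n) (\<lambda>l. isum (\<pi> n) l - I (\<pi> n ! l)) < 1"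
    by (rule order_tendstoD(2)[OF partition_max_error[OF t \<pi> approx]]) simp
  then have "\<forall>\<^sub>F n in sequentially. norm (\<Sum>i<length (\<pi> n) - 1. d n i * (u (\<pi> n ! i) \<bullet> (w (\<pi> n ! Suc i) - w (\<pi> n ! i))))
      \<le> (B + 1) * (v n + v n)"
    using mesh_seq_eventually[OF \<pi>]
  proof eventually_elim
    case (elim n)
    have bound: "\<bar>\<Sum>i<l. u (\<pi> n ! i) \<bullet> (w (\<pi> n ! Suc i) - w (\<pi> n ! i))\<bar> \<le> B + 1" if "l \<le> length (\<pi> n) - 1" for l
    proof -
      have l: "l < length (\<pi> n)" using that partition_last_less[OF elim(2)] by simp
      have "\<pi> n ! l \<in> {0..T}" using partition_nth_mem[OF elim(2) l] t by auto
      then show ?thesis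
        using partition_max_ge[OF l, of "\<lambda>l. isum (\<pi> n) l - I (\<pi> n ! l)"] elim(1) B(2)[of "\<pi> n ! l"]
        unfolding isum_def by simp
    qed
    have "d n (length (\<pi> n) - 1) = (\<Sum>i<length (\<pi> n) - 1. d n (Suc i) - d n i)"
      by (simp only: sum_lessThan_telescope d0 diff_0_right)
    then have "\<bar>d n (length (\<pi> n) - 1)\<bar> \<le> v n" unfolding v_def by (simp only: sum_abs)
    then have "(B + 1) * (\<bar>d n (length (\<pi> n) - 1)\<bar> + v n) \<le> (B + 1) * (v n + v n)"
      using B by (intro mult_left_mono) auto
    then show ?case
      using summation_by_parts_bound[where a="d n" and n="length (\<pi> n) - 1", OF bound]
      unfolding v_def real_norm_def by linarith
  qed
  from Lim_null_comparison[OF this lim] show ?thesis .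
qed

text \<open>This is how the anticipating \<open>y\<close> leaves the sums: products of its
  components are Lipschitz in time, so Abel summation only needs the partial sums of
  \<open>x\<close> to vanish uniformly.\<close>

lemma lipschitz_sum_tendsto_0:
  fixes x :: "nat \<Rightarrow> nat \<Rightarrow> real"
  assumes t: "t \<in> {0..T}" and \<pi>: "mesh_seq t \<pi>"
    and x: "(\<lambda>n. partition_max (\<pi> n) (\<lambda>l. \<Sum>i<l. x n i)) \<longlonglongrightarrow> 0"
  shows "(\<lambda>n. \<Sum>i<length (\<pi> n) - 1. (y (\<pi> n ! i) $ p * y (\<pi> n ! i) $ q) * x n i) \<longlonglongrightarrow> 0"
proof -
  obtain B where B: "0 \<le> B" "\<And>s. s \<in> {0..T} \<Longrightarrow> norm (y s) \<le> B" using y_bound by blast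
  obtain C where C: "0 \<le> C" "\<And>a b. 0 \<le> a \<Longrightarrow> a \<le> b \<Longrightarrow> b \<le> T \<Longrightarrow> norm (y b - y a) \<le> C * (b - a)"
    using y_lipschitz by blast
  have comp: "\<bar>z $ r\<bar> \<le> norm z" for z :: "real^'e" and r by (rule component_le_norm_cart)
  let ?m = "\<lambda>n. partition_max (\<pi> n) (\<lambda>l. \<Sum>i<l. x n i)"
  \<comment> \<open>\<open>B * B\<close> bounds the last weight and \<open>2 * B * C * t\<close> the
    variation of the products, where \<open>C\<close> is the Lipschitz constant of
    \<open>y\<close>.\<close>
  have lim: "(\<lambda>n. ?m n * (B * B + 2 * B * C * t)) \<longlonglongrightarrow> 0"
    by (rule tendsto_mult_left_zero[OF x])
  have "\<forall>\<^sub>F n in sequentially. norm (\<Sum>i<length (\<pi> n) - 1. (y (\<pi> n ! i) $ p * y (\<pi> n ! i) $ q) * x n i)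
      \<le> ?m n * (B * B + 2 * B * C * t)"
    using mesh_seq_eventually[OF \<pi>]
  proof eventually_elim
    case (elim n)
    define a where "a i = y (\<pi> n ! i) $ p * y (\<pi> n ! i) $ q" for i
    have mem: "\<pi> n ! i \<in> {0..T}" if "i < length (\<pi> n)" for i using partition_nth_mem[OF elim that] t by auto
    have bound: "\<bar>\<Sum>i<l. x n i\<bar> \<le> ?m n" if "l \<le> length (\<pi> n) - 1" for l
      using that partition_last_less[OF elim] partition_max_ge[of l "\<pi> n" "\<lambda>l. \<Sum>i<l. x n i"] by simp
    have yB: "\<bar>y (\<pi> n ! i) $ r\<bar> \<le> B" if "i < length (\<pi> n)" for i r
      using comp[of "y (\<pi> n ! i)" r] B(2)[OF mem[OF that]] by linarith
    have "\<bar>a (length (\<pi> n) - 1)\<bar> \<le> B * B"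
      unfolding a_def abs_mult using yB partition_last_less[OF elim] B by (intro mult_mono) auto
    moreover have "(\<Sum>i<length (\<pi> n) - 1. \<bar>a (Suc i) - a i\<bar>) \<le> 2 * B * C * t"
    proof -
      have "(\<Sum>i<length (\<pi> n) - 1. \<bar>a (Suc i) - a i\<bar>) \<le> (\<Sum>i<length (\<pi> n) - 1. 2 * B * C * (\<pi> n ! Suc i - \<pi> n ! i))"
      proof (rule sum_mono)
        fix i assume "i \<in> {..<length (\<pi> n) - 1}"
        then have len: "i < length (\<pi> n) - 1" by simp
        note i = partition_pairs[OF elim len]
        have nd: "norm (y (\<pi> n ! Suc i) - y (\<pi> n ! i)) \<le> C * (\<pi> n ! Suc i - \<pi> n ! i)"
          using i t by (intro C) auto
        have d: "\<bar>y (\<pi> n ! Suc i) $ r - y (\<pi> n ! i) $ r\<bar> \<le> C * (\<pi> n ! Suc i - \<pi> n ! i)" for r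
          using comp[of "y (\<pi> n ! Suc i) - y (\<pi> n ! i)" r] nd by simp
        have "a (Suc i) - a i = y (\<pi> n ! Suc i) $ p * (y (\<pi> n ! Suc i) $ q - y (\<pi> n ! i) $ q)
            + (y (\<pi> n ! Suc i) $ p - y (\<pi> n ! i) $ p) * y (\<pi> n ! i) $ q"
          by (simp add: a_def algebra_simps)
        also have "\<bar>\<dots>\<bar> \<le> B * (C * (\<pi> n ! Suc i - \<pi> n ! i)) + (C * (\<pi> n ! Suc i - \<pi> n ! i)) * B"
          using yB[of "Suc i" p] yB[of i q] d len B C i
          by (intro order_trans[OF abs_triangle_ineq] add_mono) (auto simp: abs_mult less_diff_conv intro!: mult_mono)
        finally show "\<bar>a (Suc i) - a i\<bar> \<le> 2 * B * C * (\<pi> n ! Suc i - \<pi> n ! i)" by (simp add: algebra_simps)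
      qed
      then show ?thesis by (simp only: sum_distrib_left[symmetric] partition_sum_steps[OF elim])
    qed
    ultimately have "?m n * (\<bar>a (length (\<pi> n) - 1)\<bar> + (\<Sum>i<length (\<pi> n) - 1. \<bar>a (Suc i) - a i\<bar>))
        \<le> ?m n * (B * B + 2 * B * C * t)"
      using bound[of 0] by (intro mult_left_mono add_mono) auto
    then show ?case
      using summation_by_parts_bound[where a=a and n="length (\<pi> n) - 1", OF bound]
      unfolding a_def real_norm_def by linarith
  qed
  from Lim_null_comparison[OF this lim] show ?thesis .
qed

lemma inner_mult_inner:
  fixes a b c :: "real^'e"
  shows "(a \<bullet> b) * (a \<bullet> c) = (\<Sum>p\<in>UNIV. \<Sum>q\<in>UNIV. (a $ p * a $ q) * (b $ p * c $ q))"
  by (simp add: inner_vec_def sum_product mult_ac)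

text \<open>The component of the error with small variation is handled by boundedness of the sums
  against \<open>w\<close>; for the other one, \<open>y\<close> is taken out component by component
  and the last clause of \<open>ito_approximates\<close> applies.\<close>

lemma error_sum_tendsto_0:
  assumes t: "t \<in> {0..T}" and \<pi>: "mesh_seq t \<pi>" and approx: "approximates \<pi>"
  shows "(\<lambda>n. \<Sum>i<length (\<pi> n) - 1. (isum (\<pi> n) i - I (\<pi> n ! i)) *
    (u (\<pi> n ! i) \<bullet> (w (\<pi> n ! Suc i) - w (\<pi> n ! i)))) \<longlonglongrightarrow> 0"
proof -
  let ?x = "\<lambda>n i. u (\<pi> n ! i) \<bullet> (w (\<pi> n ! Suc i) - w (\<pi> n ! i))"
  let ?z = "\<lambda>n i. k (\<pi> n ! i) *v (w (\<pi> n ! Suc i) - w (\<pi> n ! i))"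
  have 1: "(\<lambda>n. \<Sum>i<length (\<pi> n) - 1. (\<Sum>j<i. parts_error (\<pi> n) j) * ?x n i) \<longlonglongrightarrow> 0"
    by (rule small_variation_sum_tendsto_0[OF assms]) (use parts_error_variation[OF assms] in auto)
  have "(\<lambda>n. \<Sum>p\<in>UNIV. \<Sum>q\<in>UNIV. \<Sum>i<length (\<pi> n) - 1. (y (\<pi> n ! i) $ p * y (\<pi> n ! i) $ q) *
      ((nsum (\<pi> n) i - N (\<pi> n ! i)) $ p * ?z n i $ q)) \<longlonglongrightarrow> (\<Sum>p\<in>(UNIV::'e set). \<Sum>q\<in>(UNIV::'e set). 0)"
    using approx by (intro tendsto_sum lipschitz_sum_tendsto_0[OF t \<pi>]) (auto simp: ito_approximates_def)
  then have 2: "(\<lambda>n. \<Sum>i<length (\<pi> n) - 1. (y (\<pi> n ! i) \<bullet> (nsum (\<pi> n) i - N (\<pi> n ! i))) * ?x n i) \<longlonglongrightarrow> 0"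
    unfolding u_inner inner_mult_inner by (simp add: sum.swap[where A="{..<_}"])
  have "(\<lambda>n. (\<Sum>i<length (\<pi> n) - 1. (y (\<pi> n ! i) \<bullet> (nsum (\<pi> n) i - N (\<pi> n ! i))) * ?x n i)
      - (\<Sum>i<length (\<pi> n) - 1. (\<Sum>j<i. parts_error (\<pi> n) j) * ?x n i)) \<longlonglongrightarrow> 0 - 0"
    by (rule tendsto_diff[OF 2 1])
  then have lim: "(\<lambda>n. (\<Sum>i<length (\<pi> n) - 1. (y (\<pi> n ! i) \<bullet> (nsum (\<pi> n) i - N (\<pi> n ! i))) * ?x n i)
      - (\<Sum>i<length (\<pi> n) - 1. (\<Sum>j<i. parts_error (\<pi> n) j) * ?x n i)) \<longlonglongrightarrow> 0" by simp
  show ?thesis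
  proof (rule Lim_transform_eventually[OF lim])
    show "\<forall>\<^sub>F n in sequentially. (\<Sum>i<length (\<pi> n) - 1. (y (\<pi> n ! i) \<bullet> (nsum (\<pi> n) i - N (\<pi> n ! i))) * ?x n i)
      - (\<Sum>i<length (\<pi> n) - 1. (\<Sum>j<i. parts_error (\<pi> n) j) * ?x n i)
      = (\<Sum>i<length (\<pi> n) - 1. (isum (\<pi> n) i - I (\<pi> n ! i)) * ?x n i)"
      using mesh_seq_eventually[OF \<pi>]
    proof eventually_elim
      case (elim n)
      show ?case unfolding sum_subtractf[symmetric]
      proof (rule sum.cong[OF refl])
        fix i assume "i \<in> {..<length (\<pi> n) - 1}"
        then have "i < length (\<pi> n)" by simp
        from isum_error[OF elim _ this] t
        show "(y (\<pi> n ! i) \<bullet> (nsum (\<pi> n) i - N (\<pi> n ! i))) * ?x n i - (\<Sum>j<i. parts_error (\<pi> n) j) * ?x n i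
            = (isum (\<pi> n) i - I (\<pi> n ! i)) * ?x n i" by (simp add: left_diff_distrib)
      qed
    qed
  qed
qed

text \<open>Expanding the square in components of \<open>y\<close> leaves covariation terms, which
  vanish after \<open>y\<close> is taken out, and the compensators, which form a Riemann sum of
  \<open>u \<bullet> (R *v u)\<close>.\<close>

lemma quadratic_variation:
  assumes t: "t \<in> {0..T}" and \<pi>: "mesh_seq t \<pi>" and approx: "approximates \<pi>"
  shows "(\<lambda>n. \<Sum>i<length (\<pi> n) - 1. (u (\<pi> n ! i) \<bullet> (w (\<pi> n ! Suc i) - w (\<pi> n ! i)))\<^sup>2)
    \<longlonglongrightarrow> integral {0..t} (\<lambda>s. u s \<bullet> (R *v u s))"
proof -
  let ?z = "\<lambda>n i. k (\<pi> n ! i) *v (w (\<pi> n ! Suc i) - w (\<pi> n ! i))"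
  have uRu: "u s \<bullet> (R *v u s) = (\<Sum>p\<in>UNIV. \<Sum>q\<in>UNIV. (y s $ p * y s $ q) * (k s ** R ** transpose (k s)) $ p $ q)" for s
  proof -
    have "u s \<bullet> (R *v u s) = y s \<bullet> ((k s ** R ** transpose (k s)) *v y s)"
      unfolding u_inner by (simp only: u_def matrix_vector_mul_assoc matrix_mul_assoc)
    then show ?thesis
      by (simp add: inner_vec_def matrix_vector_mult_def sum_distrib_left mult_ac)
  qed
  have "(\<lambda>n. \<Sum>p\<in>UNIV. \<Sum>q\<in>UNIV. \<Sum>i<length (\<pi> n) - 1. (y (\<pi> n ! i) $ p * y (\<pi> n ! i) $ q) *
      covariation_term k w R p q (\<pi> n) i) \<longlonglongrightarrow> (\<Sum>p\<in>(UNIV::'e set). \<Sum>q\<in>(UNIV::'e set). 0)"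
    using approx by (intro tendsto_sum lipschitz_sum_tendsto_0[OF t \<pi>]) (auto simp: ito_approximates_def)
  then have 1: "(\<lambda>n. \<Sum>i<length (\<pi> n) - 1. \<Sum>p\<in>UNIV. \<Sum>q\<in>UNIV. (y (\<pi> n ! i) $ p * y (\<pi> n ! i) $ q) *
      covariation_term k w R p q (\<pi> n) i) \<longlonglongrightarrow> 0"
    by (simp add: sum.swap[where A="{..<_}"])
  have c: "riemann_path T (\<lambda>s. u s \<bullet> (R *v u s))"
    by (intro riemann_path_continuous continuous_on_inner u_cont
        linear_continuous_on_compose[OF u_cont matrix_vector_mul_linear])
  have one: "riemann_path T (\<lambda>_. 1 :: real)" by (intro riemann_path_continuous continuous_on_const)
  \<comment> \<open>Integrals of the constant \<open>1\<close> stand for the step lengths, which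
    brings the compensators into the form of the general Riemann sums.\<close>
  have "(\<lambda>n. \<Sum>i<length (\<pi> n) - 1. (u (\<pi> n ! i) \<bullet> (R *v u (\<pi> n ! i))) \<bullet> integral {\<pi> n ! i..\<pi> n ! Suc i} (\<lambda>_. 1 :: real))
    \<longlonglongrightarrow> integral {0..t} (\<lambda>s. (u s \<bullet> (R *v u s)) \<bullet> 1)"
    by (rule riemann_sum_tendsto[OF c one t \<pi>])
  from tendsto_add[OF 1 this]
  have lim: "(\<lambda>n. (\<Sum>i<length (\<pi> n) - 1. \<Sum>p\<in>UNIV. \<Sum>q\<in>UNIV. (y (\<pi> n ! i) $ p * y (\<pi> n ! i) $ q) *
      covariation_term k w R p q (\<pi> n) i) + (\<Sum>i<length (\<pi> n) - 1. (u (\<pi> n ! i) \<bullet> (R *v u (\<pi> n ! i))) \<bullet>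
        integral {\<pi> n ! i..\<pi> n ! Suc i} (\<lambda>_. 1 :: real)))
    \<longlonglongrightarrow> integral {0..t} (\<lambda>s. u s \<bullet> (R *v u s))" by simp
  show ?thesis
  proof (rule Lim_transform_eventually[OF lim])
    show "\<forall>\<^sub>F n in sequentially. (\<Sum>i<length (\<pi> n) - 1. \<Sum>p\<in>UNIV. \<Sum>q\<in>UNIV. (y (\<pi> n ! i) $ p * y (\<pi> n ! i) $ q) *
      covariation_term k w R p q (\<pi> n) i) + (\<Sum>i<length (\<pi> n) - 1. (u (\<pi> n ! i) \<bullet> (R *v u (\<pi> n ! i))) \<bullet>
        integral {\<pi> n ! i..\<pi> n ! Suc i} (\<lambda>_. 1 :: real))
      = (\<Sum>i<length (\<pi> n) - 1. (u (\<pi> n ! i) \<bullet> (w (\<pi> n ! Suc i) - w (\<pi> n ! i)))\<^sup>2)"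
      using mesh_seq_eventually[OF \<pi>]
    proof eventually_elim
      case (elim n)
      show ?case unfolding sum.distrib[symmetric]
      proof (rule sum.cong[OF refl])
        fix i assume "i \<in> {..<length (\<pi> n) - 1}"
        then have len: "i < length (\<pi> n) - 1" by simp
        let ?c = "\<lambda>p q. (k (\<pi> n ! i) ** R ** transpose (k (\<pi> n ! i))) $ p $ q"
        let ?d = "\<pi> n ! Suc i - \<pi> n ! i"
        have int: "integral {\<pi> n ! i..\<pi> n ! Suc i} (\<lambda>_. 1 :: real) = ?d"
          using partition_pairs[OF elim len] by simp
        have "(u (\<pi> n ! i) \<bullet> (w (\<pi> n ! Suc i) - w (\<pi> n ! i)))\<^sup>2
            = (\<Sum>p\<in>UNIV. \<Sum>q\<in>UNIV. (y (\<pi> n ! i) $ p * y (\<pi> n ! i) $ q) * (?z n i $ p * ?z n i $ q))"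
          unfolding power2_eq_square u_inner inner_mult_inner ..
        also have "\<dots> = (\<Sum>p\<in>UNIV. \<Sum>q\<in>UNIV. (y (\<pi> n ! i) $ p * y (\<pi> n ! i) $ q) * covariation_term k w R p q (\<pi> n) i)
            + (\<Sum>p\<in>UNIV. \<Sum>q\<in>UNIV. (y (\<pi> n ! i) $ p * y (\<pi> n ! i) $ q) * ?c p q) * ?d"
          unfolding sum_distrib_right sum.distrib[symmetric] covariation_term_def
          by (intro sum.cong refl) (simp add: algebra_simps)
        finally show "(\<Sum>p\<in>UNIV. \<Sum>q\<in>UNIV. (y (\<pi> n ! i) $ p * y (\<pi> n ! i) $ q) * covariation_term k w R p q (\<pi> n) i)
            + (u (\<pi> n ! i) \<bullet> (R *v u (\<pi> n ! i))) \<bullet> integral {\<pi> n ! i..\<pi> n ! Suc i} (\<lambda>_. 1 :: real)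
            = (u (\<pi> n ! i) \<bullet> (w (\<pi> n ! Suc i) - w (\<pi> n ! i)))\<^sup>2"
          unfolding int uRu by simp
      qed
    qed
  qed
qed

end

text \<open>A trajectory of the filtering model: \<open>Q\<close> is the integral of \<open>Y\<close> against the martingale part \<open>B\<close> of
  the step path \<open>X\<close>, obtained from the backward equation by parts.\<close>

locale filtering_path = ito_path T y y' k w N R
  for T :: real and y y' :: "real \<Rightarrow> real^'e" and k :: "real \<Rightarrow> real^'m^'e" and w :: "real \<Rightarrow> real^'m"
    and N :: "real \<Rightarrow> real^'e" and R :: "real^'m^'m" +
  fixes A :: "real^'d^'d" and H :: "real^'m^'d" and X Y :: "real \<Rightarrow> real^'d" and J :: "real set"
    and h :: "real \<Rightarrow> real^'d" and E0 :: real
  assumes X_step: "step_path T X J h"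
    and Y_deriv: "\<And>s. s \<in> {0..T} \<Longrightarrow> (Y has_vector_derivative - (A *v Y s) - H *v u s) (at s within {0..T})"
begin

definition Y' :: "real \<Rightarrow> real^'d" where "Y' s = - (A *v Y s) - H *v u s"

definition B :: "real \<Rightarrow> real^'d" where "B t = X t - integral {0..t} (\<lambda>s. transpose A *v X s)"

definition Q :: "real \<Rightarrow> real" where
  "Q t = Y t \<bullet> X t - Y 0 \<bullet> X 0 + integral {0..t} (\<lambda>s. u s \<bullet> (transpose H *v X s))"

definition E :: "real \<Rightarrow> real" where "E t = E0 + I t + Q t"

abbreviation dW :: "real list \<Rightarrow> nat \<Rightarrow> real" where
  "dW ts i \<equiv> u (ts ! i) \<bullet> (w (ts ! Suc i) - w (ts ! i))"

abbreviation dB :: "real list \<Rightarrow> nat \<Rightarrow> real" where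
  "dB ts i \<equiv> Y (ts ! i) \<bullet> (B (ts ! Suc i) - B (ts ! i))"

definition jsum :: "real list \<Rightarrow> nat \<Rightarrow> real" where "jsum ts l = (\<Sum>i<l. dB ts i)"

lemma Y_cont: "continuous_on {0..T} Y"
  unfolding continuous_on_eq_continuous_within by (blast intro: has_vector_derivative_continuous Y_deriv)

lemma Y'_cont: "continuous_on {0..T} Y'"
  unfolding Y'_def[abs_def]
  by (intro continuous_on_diff continuous_on_minus linear_continuous_on_compose[OF _ matrix_vector_mul_linear]
      Y_cont u_cont)

lemma X_riemann: "riemann_path T X" by (rule riemann_path_step[OF X_step])
lemma AX_riemann: "riemann_path T (\<lambda>s. transpose A *v X s)"
  by (rule riemann_path_linear[OF matrix_vector_mul_linear X_riemann])
lemma HX_riemann: "riemann_path T (\<lambda>s. transpose H *v X s)"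
  by (rule riemann_path_linear[OF matrix_vector_mul_linear X_riemann])
lemma uHX_riemann: "riemann_path T (\<lambda>s. u s \<bullet> (transpose H *v X s))"
  by (rule riemann_path_bilinear[OF bounded_bilinear_inner riemann_path_continuous[OF u_cont] HX_riemann])

lemma inner_transpose: "v \<bullet> (transpose M *v x) = (M *v v) \<bullet> x" for M :: "real^'a^'b"
  unfolding transpose_matrix_vector inner_commute[of v] dot_lmul_matrix by (rule inner_commute)

lemma Q_0: "Q 0 = 0" by (simp add: Q_def)

lemma Q_increment:
  assumes "0 \<le> a" "a \<le> b" "b \<le> T"
  shows "Q b - Q a = Y b \<bullet> X b - Y a \<bullet> X a + integral {a..b} (\<lambda>s. u s \<bullet> (transpose H *v X s))"
proof -
  have "integral {0..a} (\<lambda>s. u s \<bullet> (transpose H *v X s)) + integral {a..b} (\<lambda>s. u s \<bullet> (transpose H *v X s))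
      = integral {0..b} (\<lambda>s. u s \<bullet> (transpose H *v X s))"
    using assms by (intro Henstock_Kurzweil_Integration.integral_combine riemann_path_integrable[OF uHX_riemann]) auto
  then show ?thesis by (simp add: Q_def)
qed

lemma B_increment:
  assumes "0 \<le> a" "a \<le> b" "b \<le> T"
  shows "B b - B a = X b - X a - integral {a..b} (\<lambda>s. transpose A *v X s)"
proof -
  have "integral {0..a} (\<lambda>s. transpose A *v X s) + integral {a..b} (\<lambda>s. transpose A *v X s)
      = integral {0..b} (\<lambda>s. transpose A *v X s)"
    using assms by (intro Henstock_Kurzweil_Integration.integral_combine riemann_path_integrable[OF AX_riemann]) auto
  then show ?thesis by (simp add: B_def algebra_simps)
qed

text \<open>The increment of \<open>Y \<bullet> X\<close> splits with \<open>Y\<close> at the left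
  and \<open>X\<close> at the right endpoint, which explains the two differences in the integrand.
  The terms with \<open>A\<close> cancel by adjointness, and the one with \<open>H\<close> accounts
  for the correction in \<open>Q\<close>.\<close>

lemma dB_minus_Q_increment:
  assumes ab: "0 \<le> a" "a \<le> b" "b \<le> T"
  shows "Y a \<bullet> (B b - B a) - (Q b - Q a)
    = integral {a..b} (\<lambda>s. (X s - X b) \<bullet> Y' s + (Y s - Y a) \<bullet> (transpose A *v X s))"
proof -
  have RY': "riemann_path T Y'" by (rule riemann_path_continuous[OF Y'_cont])
  have RY: "riemann_path T Y" by (rule riemann_path_continuous[OF Y_cont])
  have iY': "Y' integrable_on {a..b}" by (rule riemann_path_integrable[OF RY' ab(1,3)])
  have iAX: "(\<lambda>s. transpose A *v X s) integrable_on {a..b}" by (rule riemann_path_integrable[OF AX_riemann ab(1,3)])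
  have iu: "(\<lambda>s. u s \<bullet> (transpose H *v X s)) integrable_on {a..b}"
    by (rule riemann_path_integrable[OF uHX_riemann ab(1,3)])
  have iXb: "(\<lambda>s. X b \<bullet> Y' s) integrable_on {a..b}"
    using integrable_linear[OF iY' bounded_linear_inner_right[of "X b"]] by (simp add: comp_def)
  have iYa: "(\<lambda>s. Y a \<bullet> (transpose A *v X s)) integrable_on {a..b}"
    using integrable_linear[OF iAX bounded_linear_inner_right[of "Y a"]] by (simp add: comp_def)
  have "(Y' has_integral (Y b - Y a)) {a..b}"
    unfolding Y'_def[abs_def] using ab
    by (intro fundamental_theorem_of_calculus has_vector_derivative_within_subset[OF Y_deriv]) auto
  then have Yab: "Y b - Y a = integral {a..b} Y'" by (simp add: integral_unique)
  have 1: "X b \<bullet> (Y b - Y a) = integral {a..b} (\<lambda>s. X b \<bullet> Y' s)"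
    unfolding Yab using integral_linear[OF iY' bounded_linear_inner_right[of "X b"]] by (simp add: comp_def)
  have 2: "Y a \<bullet> integral {a..b} (\<lambda>s. transpose A *v X s) = integral {a..b} (\<lambda>s. Y a \<bullet> (transpose A *v X s))"
    using integral_linear[OF iAX bounded_linear_inner_right[of "Y a"]] by (simp add: comp_def)
  have pw: "(X s - X b) \<bullet> Y' s + (Y s - Y a) \<bullet> (transpose A *v X s)
      = - (X b \<bullet> Y' s) - Y a \<bullet> (transpose A *v X s) - u s \<bullet> (transpose H *v X s)" for s
    unfolding Y'_def inner_transpose inner_commute[of "X s - X b"]
    by (simp add: inner_diff_left inner_diff_right inner_minus_left inner_commute[of "X b"] inner_transpose matrix_vector_mult_diff_distrib
        del: transpose_matrix_vector)
  have "Y a \<bullet> (B b - B a) - (Q b - Q a) = - (X b \<bullet> (Y b - Y a))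
      - Y a \<bullet> integral {a..b} (\<lambda>s. transpose A *v X s) - integral {a..b} (\<lambda>s. u s \<bullet> (transpose H *v X s))"
    unfolding B_increment[OF ab] Q_increment[OF ab] by (simp add: inner_diff_left inner_diff_right inner_commute)
  also have "\<dots> = integral {a..b} (\<lambda>s. - (X b \<bullet> Y' s) - Y a \<bullet> (transpose A *v X s) - u s \<bullet> (transpose H *v X s))"
    unfolding 1 2 using iXb iYa iu
    by (simp add: integral_diff integral_neg integrable_diff integrable_neg)
  finally show ?thesis unfolding pw .
qed

text \<open>Each summand is an integral of differences of \<open>X\<close> and \<open>Y\<close>
  against bounded functions, so the bound is a combination of their oscillation sums. The total
  variation is estimated, and not only the sum, because these errors reappear as weights in sums
  against \<open>w\<close>.\<close>

lemma Q_error_variation: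
  assumes t: "t \<in> {0..T}" and \<pi>: "mesh_seq t \<pi>"
  shows "(\<lambda>n. \<Sum>i<length (\<pi> n) - 1. \<bar>dB (\<pi> n) i - (Q (\<pi> n ! Suc i) - Q (\<pi> n ! i))\<bar>) \<longlonglongrightarrow> 0"
proof -
  have RY': "riemann_path T Y'" by (rule riemann_path_continuous[OF Y'_cont])
  have RY: "riemann_path T Y" by (rule riemann_path_continuous[OF Y_cont])
  obtain C where C: "0 \<le> C" "\<And>s. s \<in> {0..T} \<Longrightarrow> norm (Y' s) \<le> C"
    using riemann_path_bound[OF RY'] by blast
  obtain D where D: "0 \<le> D" "\<And>s. s \<in> {0..T} \<Longrightarrow> norm (transpose A *v X s) \<le> D"
    using riemann_path_bound[OF AX_riemann] by blast
  have bds: "bounded (X ` {0..T})" "bounded (Y ` {0..T})" using X_riemann RY by (auto simp: riemann_path_def)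
  have "(\<lambda>n. C * oscillation_sum X (\<pi> n) + D * oscillation_sum Y (\<pi> n)) \<longlonglongrightarrow> C * 0 + D * 0"
    using X_riemann RY t \<pi> by (intro tendsto_intros) (auto simp: riemann_path_def)
  then have lim: "(\<lambda>n. C * oscillation_sum X (\<pi> n) + D * oscillation_sum Y (\<pi> n)) \<longlonglongrightarrow> 0" by simp
  show ?thesis
  proof (rule tendsto_sandwich[OF _ _ tendsto_const lim])
    show "\<forall>\<^sub>F n in sequentially. 0 \<le> (\<Sum>i<length (\<pi> n) - 1. \<bar>dB (\<pi> n) i - (Q (\<pi> n ! Suc i) - Q (\<pi> n ! i))\<bar>)"
      by (intro always_eventually allI sum_nonneg) simp
    show "\<forall>\<^sub>F n in sequentially. (\<Sum>i<length (\<pi> n) - 1. \<bar>dB (\<pi> n) i - (Q (\<pi> n ! Suc i) - Q (\<pi> n ! i))\<bar>)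
        \<le> C * oscillation_sum X (\<pi> n) + D * oscillation_sum Y (\<pi> n)"
      using mesh_seq_eventually[OF \<pi>]
    proof eventually_elim
      case (elim n)
      let ?o = "\<lambda>f i. oscillation f (\<pi> n ! i) (\<pi> n ! Suc i)"
      have "(\<Sum>i<length (\<pi> n) - 1. \<bar>dB (\<pi> n) i - (Q (\<pi> n ! Suc i) - Q (\<pi> n ! i))\<bar>)
          \<le> (\<Sum>i<length (\<pi> n) - 1. (?o X i * C + ?o Y i * D) * (\<pi> n ! Suc i - \<pi> n ! i))"
      proof (rule sum_mono)
        fix i assume "i \<in> {..<length (\<pi> n) - 1}"
        then have i: "0 \<le> \<pi> n ! i" "\<pi> n ! i < \<pi> n ! Suc i" "\<pi> n ! Suc i \<le> T"
          using partition_pairs[OF elim, of i] t by auto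
        let ?a = "\<pi> n ! i" and ?b = "\<pi> n ! Suc i"
        have Rdiff: "riemann_path T (\<lambda>s. X s + - X ?b)" "riemann_path T (\<lambda>s. Y s + - Y ?a)"
          by (intro riemann_path_add X_riemann RY riemann_path_continuous continuous_on_const)+
        have R: "riemann_path T (\<lambda>s. (X s + - X ?b) \<bullet> Y' s + (Y s + - Y ?a) \<bullet> (transpose A *v X s))"
          by (intro riemann_path_add riemann_path_bilinear[OF bounded_bilinear_inner] Rdiff RY' AX_riemann)
        have "norm (integral {?a..?b} (\<lambda>s. (X s - X ?b) \<bullet> Y' s + (Y s - Y ?a) \<bullet> (transpose A *v X s)))
            \<le> (?o X i * C + ?o Y i * D) * (?b - ?a)"
        proof (rule norm_integral_le)
          show "(\<lambda>s. (X s - X ?b) \<bullet> Y' s + (Y s - Y ?a) \<bullet> (transpose A *v X s)) integrable_on {?a..?b}"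
            using riemann_path_integrable[OF R i(1,3)] by simp
          fix s assume s: "s \<in> {?a..?b}"
          have "norm ((X s - X ?b) \<bullet> Y' s + (Y s - Y ?a) \<bullet> (transpose A *v X s))
              \<le> norm (X s - X ?b) * norm (Y' s) + norm (Y s - Y ?a) * norm (transpose A *v X s)"
            using Cauchy_Schwarz_ineq2[of "X s - X ?b" "Y' s"] Cauchy_Schwarz_ineq2[of "Y s - Y ?a" "transpose A *v X s"]
            by simp
          also have "\<dots> \<le> ?o X i * C + ?o Y i * D"
            using oscillation_upper[OF bds(1) i(1,3), of s ?b] oscillation_upper[OF bds(2) i(1,3), of s ?a] s i C D
            by (intro add_mono mult_mono) (auto intro: order_trans[OF norm_ge_zero])
          finally show "norm ((X s - X ?b) \<bullet> Y' s + (Y s - Y ?a) \<bullet> (transpose A *v X s)) \<le> ?o X i * C + ?o Y i * D" .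
        qed (use i in simp)
        then show "\<bar>dB (\<pi> n) i - (Q ?b - Q ?a)\<bar> \<le> (?o X i * C + ?o Y i * D) * (?b - ?a)"
          using i by (subst dB_minus_Q_increment) auto
      qed
      also have "\<dots> = C * oscillation_sum X (\<pi> n) + D * oscillation_sum Y (\<pi> n)"
        by (simp add: oscillation_sum_def sum_distrib_left sum.distrib[symmetric] algebra_simps del: One_nat_def)
      finally show ?case .
    qed
  qed
qed

lemma jsum_error:
  assumes ts: "ts \<in> partitions t \<delta>" and l: "l < length ts"
  shows "jsum ts l - Q (ts ! l) = (\<Sum>i<l. dB ts i - (Q (ts ! Suc i) - Q (ts ! i)))"
  using sum_lessThan_telescope[of "\<lambda>i. Q (ts ! i)" l] partition_nth_0[OF ts]
  by (simp add: jsum_def sum_subtractf Q_0)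

lemma jsum_tendsto:
  assumes t: "t \<in> {0..T}" and \<pi>: "mesh_seq t \<pi>"
  shows "(\<lambda>n. jsum (\<pi> n) (length (\<pi> n) - 1)) \<longlonglongrightarrow> Q t"
proof -
  have "(\<lambda>n. jsum (\<pi> n) (length (\<pi> n) - 1) - Q t) \<longlonglongrightarrow> 0"
  proof (rule Lim_null_comparison[OF _ Q_error_variation[OF assms]])
    show "\<forall>\<^sub>F n in sequentially. norm (jsum (\<pi> n) (length (\<pi> n) - 1) - Q t)
        \<le> (\<Sum>i<length (\<pi> n) - 1. \<bar>dB (\<pi> n) i - (Q (\<pi> n ! Suc i) - Q (\<pi> n ! i))\<bar>)"
      using mesh_seq_eventually[OF \<pi>]
    proof eventually_elim
      case (elim n)
      show ?case
        using jsum_error[OF elim partition_last_less[OF elim]] unfolding partition_nth_last[OF elim]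
        by (simp only: real_norm_def sum_abs)
    qed
  qed
  then show ?thesis by (simp add: LIM_zero_iff)
qed

text \<open>Finitely many jumps plus a drift with bounded integrand. Against \<open>B\<close>,
  unlike against \<open>w\<close>, uniformly small weights therefore give small sums.\<close>

lemma dB_variation_bounded:
  obtains C where "0 \<le> C" "\<And>t ts \<delta>. t \<in> {0..T} \<Longrightarrow> ts \<in> partitions t \<delta> \<Longrightarrow> (\<Sum>i<length ts - 1. \<bar>dB ts i\<bar>) \<le> C"
proof -
  obtain K where K: "0 \<le> K" "\<And>s. s \<in> {0..T} \<Longrightarrow> norm (Y s) \<le> K"
    using riemann_path_bound[OF riemann_path_continuous[OF Y_cont]] by blast
  obtain D where D: "0 \<le> D" "\<And>s. s \<in> {0..T} \<Longrightarrow> norm (transpose A *v X s) \<le> D"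
    using riemann_path_bound[OF AX_riemann] by blast
  show ?thesis
  proof (rule that[of "K * ((\<Sum>\<tau>\<in>J. norm (h \<tau>)) + D * \<bar>T\<bar>)"])
    show "0 \<le> K * ((\<Sum>\<tau>\<in>J. norm (h \<tau>)) + D * \<bar>T\<bar>)" using K D by (auto simp: sum_nonneg)
    fix t ts \<delta> assume t: "t \<in> {0..T}" and ts: "ts \<in> partitions t \<delta>"
    have "(\<Sum>i<length ts - 1. \<bar>dB ts i\<bar>)
        \<le> (\<Sum>i<length ts - 1. K * (norm (X (ts ! Suc i) - X (ts ! i)) + D * (ts ! Suc i - ts ! i)))"
    proof (rule sum_mono)
      fix i assume "i \<in> {..<length ts - 1}"
      then have i: "0 \<le> ts ! i" "ts ! i < ts ! Suc i" "ts ! Suc i \<le> T"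
        using partition_pairs[OF ts, of i] t by auto
      have "norm (integral {ts ! i..ts ! Suc i} (\<lambda>s. transpose A *v X s)) \<le> D * (ts ! Suc i - ts ! i)"
        using i D by (intro norm_integral_le riemann_path_integrable[OF AX_riemann]) auto
      then have "norm (B (ts ! Suc i) - B (ts ! i)) \<le> norm (X (ts ! Suc i) - X (ts ! i)) + D * (ts ! Suc i - ts ! i)"
        using i norm_triangle_ineq4[of "X (ts ! Suc i) - X (ts ! i)" "integral {ts ! i..ts ! Suc i} (\<lambda>s. transpose A *v X s)"]
        by (subst B_increment) auto
      then show "\<bar>dB ts i\<bar> \<le> K * (norm (X (ts ! Suc i) - X (ts ! i)) + D * (ts ! Suc i - ts ! i))"
        using K i by (intro order_trans[OF Cauchy_Schwarz_ineq2] mult_mono) auto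
    qed
    also have "\<dots> = K * ((\<Sum>i<length ts - 1. norm (X (ts ! Suc i) - X (ts ! i))) + D * t)"
      by (simp only: sum_distrib_left[symmetric] sum.distrib partition_sum_steps[OF ts])
    also have "\<dots> \<le> K * ((\<Sum>\<tau>\<in>J. norm (h \<tau>)) + D * \<bar>T\<bar>)"
      using step_path_variation[OF X_step _ ts] t K D by (intro mult_left_mono add_mono) auto
    finally show "(\<Sum>i<length ts - 1. \<bar>dB ts i\<bar>) \<le> K * ((\<Sum>\<tau>\<in>J. norm (h \<tau>)) + D * \<bar>T\<bar>)" .
  qed
qed

lemma sum_dB_tendsto_0:
  assumes t: "t \<in> {0..T}" and \<pi>: "mesh_seq t \<pi>" and z: "z \<longlonglongrightarrow> (0::real)"
    and c: "\<forall>\<^sub>F n in sequentially. \<forall>i<length (\<pi> n) - 1. \<bar>c n i\<bar> \<le> z n"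
  shows "(\<lambda>n. \<Sum>i<length (\<pi> n) - 1. c n i * dB (\<pi> n) i) \<longlonglongrightarrow> 0"
proof -
  obtain C where C: "0 \<le> C" "\<And>t ts \<delta>. t \<in> {0..T} \<Longrightarrow> ts \<in> partitions t \<delta> \<Longrightarrow> (\<Sum>i<length ts - 1. \<bar>dB ts i\<bar>) \<le> C"
    using dB_variation_bounded by blast
  have lim: "(\<lambda>n. \<bar>z n\<bar> * C) \<longlonglongrightarrow> 0" using z by (intro tendsto_mult_left_zero tendsto_rabs_zero)
  have "\<forall>\<^sub>F n in sequentially. norm (\<Sum>i<length (\<pi> n) - 1. c n i * dB (\<pi> n) i) \<le> \<bar>z n\<bar> * C"
    using mesh_seq_eventually[OF \<pi>] c
  proof eventually_elim
    case (elim n)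
    have "norm (\<Sum>i<length (\<pi> n) - 1. c n i * dB (\<pi> n) i) \<le> (\<Sum>i<length (\<pi> n) - 1. \<bar>z n\<bar> * \<bar>dB (\<pi> n) i\<bar>)"
      unfolding real_norm_def
      by (rule order_trans[OF sum_abs sum_mono]) (use elim(2) in \<open>force simp: abs_mult intro!: mult_right_mono\<close>)
    also have "\<dots> \<le> \<bar>z n\<bar> * C"
      unfolding sum_distrib_left[symmetric] using C(2)[OF t elim(1)] by (intro mult_left_mono) auto
    finally show ?case .
  qed
  from Lim_null_comparison[OF this lim] show ?thesis .
qed

section \<open>Jump contributions and sums weighted by the error process\<close>

lemma X_left_limit:
  assumes t: "t \<in> {0..T}" and \<pi>: "mesh_seq t \<pi>" and \<tau>: "\<tau> \<in> J" "\<tau> \<le> t"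
  shows "(\<lambda>n. X (\<pi> n ! jump_index (\<pi> n) \<tau>)) \<longlonglongrightarrow> X \<tau> - h \<tau>"
proof -
  have fin: "finite J" and \<tau>0: "0 < \<tau>" using X_step \<tau> by (auto simp: step_path_def)
  obtain d where d: "0 < d" "\<And>\<sigma> \<tau>. \<sigma> \<in> J \<Longrightarrow> \<tau> \<in> J \<Longrightarrow> \<bar>\<sigma> - \<tau>\<bar> < d \<Longrightarrow> \<sigma> = \<tau>"
    using finite_separated[OF fin] by blast
  have "\<forall>\<^sub>F n in sequentially. \<pi> n \<in> partitions t d" using \<pi> d by (simp add: mesh_seq_def)
  then have "\<forall>\<^sub>F n in sequentially. X (\<pi> n ! jump_index (\<pi> n) \<tau>) = X \<tau> - h \<tau>"
  proof eventually_elim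
    case (elim n)
    note j = jump_index[OF elim \<tau>0 \<tau>(2)]
    note p = partition_pairs[OF elim j(1)]
    let ?s = "\<pi> n ! jump_index (\<pi> n) \<tau>"
    have "X \<tau> - X ?s = (\<Sum>\<sigma>\<in>J \<inter> {?s<..\<tau>}. h \<sigma>)"
      using j p t \<tau> by (intro step_path_increment[OF X_step]) auto
    also have "J \<inter> {?s<..\<tau>} = {\<tau>}"
    proof -
      have "\<sigma> = \<tau>" if "\<sigma> \<in> J \<inter> {?s<..\<tau>}" for \<sigma>
        using that j p \<tau> by (intro d(2)) auto
      then show ?thesis using \<tau> j by auto
    qed
    finally show ?case by (simp add: algebra_simps)
  qed
  then show ?thesis by (rule tendsto_eventually)
qed

lemma continuous_left_limit:
  fixes \<phi> :: "real \<Rightarrow> 'b::t2_space"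
  assumes \<phi>: "continuous_on {0..T} \<phi>" and t: "t \<in> {0..T}" and \<pi>: "mesh_seq t \<pi>" and \<tau>: "\<tau> \<in> J" "\<tau> \<le> t"
  shows "(\<lambda>n. \<phi> (\<pi> n ! jump_index (\<pi> n) \<tau>)) \<longlonglongrightarrow> \<phi> \<tau>"
proof -
  have \<tau>0: "0 < \<tau>" using X_step \<tau> by (auto simp: step_path_def)
  have "filterlim (\<lambda>n. \<pi> n ! jump_index (\<pi> n) \<tau>) (at_left \<tau>) sequentially"
    by (rule jump_index_at_left[OF \<pi> \<tau>0 \<tau>(2)])
  then have "(\<lambda>n. \<pi> n ! jump_index (\<pi> n) \<tau>) \<longlonglongrightarrow> \<tau>" by (auto simp: filterlim_at)
  moreover have "\<forall>\<^sub>F n in sequentially. \<pi> n ! jump_index (\<pi> n) \<tau> \<in> {0..T}"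
    using mesh_seq_eventually[OF \<pi>]
  proof eventually_elim
    case (elim n)
    show ?case using partition_nth_mem[OF elim, of "jump_index (\<pi> n) \<tau>"] jump_index(1)[OF elim \<tau>0 \<tau>(2)] t
      by (auto simp: less_diff_conv)
  qed
  ultimately show ?thesis
    using \<tau>0 \<tau> t by (intro continuous_on_tendsto_compose[OF \<phi>]) auto
qed

text \<open>The error process jumps only through \<open>Y \<bullet> X\<close>; separating a
  continuous remainder makes its left limits computable.\<close>

lemma E_decomposition:
  obtains C where "continuous_on {0..T} C" "\<And>s. E s = C s + Y s \<bullet> X s"
proof (rule that)
  show "continuous_on {0..T} (\<lambda>s. E0 + I s - Y 0 \<bullet> X 0 + integral {0..s} (\<lambda>s. u s \<bullet> (transpose H *v X s)))"
    by (intro continuous_intros I_cont indefinite_integral_continuous_1 riemann_path_integrable[OF uHX_riemann]) auto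
  show "E s = E0 + I s - Y 0 \<bullet> X 0 + integral {0..s} (\<lambda>s. u s \<bullet> (transpose H *v X s)) + Y s \<bullet> X s" for s
    by (simp add: E_def Q_def)
qed

text \<open>The factor \<open>E \<tau> - Y \<tau> \<bullet> h \<tau>\<close> is the left limit of
  \<open>E\<close> at the jump, since a forward integral sees the integrand before the jump. The
  subtracted integral comes from the drift of \<open>B\<close>.\<close>

definition EB :: "real \<Rightarrow> real" where
  "EB t = (\<Sum>\<tau>\<in>J \<inter> {..t}. (E \<tau> - Y \<tau> \<bullet> h \<tau>) * (Y \<tau> \<bullet> h \<tau>))
     - integral {0..t} (\<lambda>s. (E s *\<^sub>R Y s) \<bullet> (transpose A *v X s))"

text \<open>The increment of \<open>B\<close> is split into that of the state, where only jumps
  contribute, and the drift, which gives a Riemann sum.\<close>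

lemma EY_dB_tendsto:
  assumes t: "t \<in> {0..T}" and \<pi>: "mesh_seq t \<pi>"
  shows "(\<lambda>n. \<Sum>i<length (\<pi> n) - 1. E (\<pi> n ! i) * dB (\<pi> n) i) \<longlonglongrightarrow> EB t"
proof -
  obtain C where C: "continuous_on {0..T} C" "\<And>s. E s = C s + Y s \<bullet> X s" using E_decomposition by blast
  have RY: "riemann_path T Y" by (rule riemann_path_continuous[OF Y_cont])
  have RE: "riemann_path T E"
    unfolding C(2)[abs_def]
    by (intro riemann_path_add riemann_path_continuous[OF C(1)] riemann_path_bilinear[OF bounded_bilinear_inner RY X_riemann])
  have REY: "riemann_path T (\<lambda>s. E s *\<^sub>R Y s)"
    by (rule riemann_path_bilinear[OF bounded_bilinear_scaleR RE RY])
  have 1: "(\<lambda>n. \<Sum>i<length (\<pi> n) - 1. (E (\<pi> n ! i) *\<^sub>R Y (\<pi> n ! i)) \<bullet> integral {\<pi> n ! i..\<pi> n ! Suc i} (\<lambda>s. transpose A *v X s))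
      \<longlonglongrightarrow> integral {0..t} (\<lambda>s. (E s *\<^sub>R Y s) \<bullet> (transpose A *v X s))"
    by (rule riemann_sum_tendsto[OF REY AX_riemann t \<pi>])
  have 2: "(\<lambda>n. \<Sum>i<length (\<pi> n) - 1. E (\<pi> n ! i) * (Y (\<pi> n ! i) \<bullet> (X (\<pi> n ! Suc i) - X (\<pi> n ! i))))
      \<longlonglongrightarrow> (\<Sum>\<tau>\<in>J \<inter> {..t}. (E \<tau> - Y \<tau> \<bullet> h \<tau>) * (Y \<tau> \<bullet> h \<tau>))"
  proof (rule step_path_sum_tendsto[where F="\<lambda>n i x. E (\<pi> n ! i) * (Y (\<pi> n ! i) \<bullet> x)", OF X_step t \<pi>])
    fix \<tau> assume \<tau>: "\<tau> \<in> J" "\<tau> \<le> t"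
    note Yl = continuous_left_limit[OF Y_cont t \<pi> \<tau>]
    have "(\<lambda>n. E (\<pi> n ! jump_index (\<pi> n) \<tau>) * (Y (\<pi> n ! jump_index (\<pi> n) \<tau>) \<bullet> h \<tau>))
        \<longlonglongrightarrow> (C \<tau> + Y \<tau> \<bullet> (X \<tau> - h \<tau>)) * (Y \<tau> \<bullet> h \<tau>)"
      unfolding C(2) by (intro tendsto_intros Yl continuous_left_limit[OF C(1) t \<pi> \<tau>] X_left_limit[OF t \<pi> \<tau>])
    then show "(\<lambda>n. E (\<pi> n ! jump_index (\<pi> n) \<tau>) * (Y (\<pi> n ! jump_index (\<pi> n) \<tau>) \<bullet> h \<tau>))
        \<longlonglongrightarrow> (E \<tau> - Y \<tau> \<bullet> h \<tau>) * (Y \<tau> \<bullet> h \<tau>)" by (simp add: C(2) inner_diff_right add_diff_eq)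
  qed simp
  show ?thesis
  proof (rule Lim_transform_eventually[OF tendsto_diff[OF 2 1, folded EB_def]])
    show "\<forall>\<^sub>F n in sequentially. (\<Sum>i<length (\<pi> n) - 1. E (\<pi> n ! i) * (Y (\<pi> n ! i) \<bullet> (X (\<pi> n ! Suc i) - X (\<pi> n ! i))))
      - (\<Sum>i<length (\<pi> n) - 1. (E (\<pi> n ! i) *\<^sub>R Y (\<pi> n ! i)) \<bullet> integral {\<pi> n ! i..\<pi> n ! Suc i} (\<lambda>s. transpose A *v X s))
      = (\<Sum>i<length (\<pi> n) - 1. E (\<pi> n ! i) * dB (\<pi> n) i)"
      using mesh_seq_eventually[OF \<pi>]
    proof eventually_elim
      case (elim n)
      show ?case unfolding sum_subtractf[symmetric]
      proof (rule sum.cong[OF refl])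
        fix i assume "i \<in> {..<length (\<pi> n) - 1}"
        then have i: "0 \<le> \<pi> n ! i" "\<pi> n ! i \<le> \<pi> n ! Suc i" "\<pi> n ! Suc i \<le> T"
          using partition_pairs[OF elim, of i] t by auto
        show "E (\<pi> n ! i) * (Y (\<pi> n ! i) \<bullet> (X (\<pi> n ! Suc i) - X (\<pi> n ! i)))
          - (E (\<pi> n ! i) *\<^sub>R Y (\<pi> n ! i)) \<bullet> integral {\<pi> n ! i..\<pi> n ! Suc i} (\<lambda>s. transpose A *v X s)
          = E (\<pi> n ! i) * dB (\<pi> n) i"
          unfolding B_increment[OF i] by (simp add: inner_diff_right right_diff_distrib)
      qed
    qed
  qed
qed

text \<open>With \<open>x\<close> the contribution of the state and \<open>a\<close> that of the
  drift, the square equals \<open>x\<^sup>2 - a * (x - a) - a * x\<close>. As \<open>a\<close> is of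
  the order of the step, the last two sums vanish and only the jumps remain.\<close>

lemma dB_square_tendsto:
  assumes t: "t \<in> {0..T}" and \<pi>: "mesh_seq t \<pi>"
  shows "(\<lambda>n. \<Sum>i<length (\<pi> n) - 1. (dB (\<pi> n) i)\<^sup>2) \<longlonglongrightarrow> (\<Sum>\<tau>\<in>J \<inter> {..t}. (Y \<tau> \<bullet> h \<tau>)\<^sup>2)"
proof -
  define a where "a n i = Y (\<pi> n ! i) \<bullet> integral {\<pi> n ! i..\<pi> n ! Suc i} (\<lambda>s. transpose A *v X s)" for n i
  define x where "x n i = Y (\<pi> n ! i) \<bullet> (X (\<pi> n ! Suc i) - X (\<pi> n ! i))" for n i
  obtain K where K: "0 \<le> K" "\<And>s. s \<in> {0..T} \<Longrightarrow> norm (Y s) \<le> K"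
    using riemann_path_bound[OF riemann_path_continuous[OF Y_cont]] by blast
  obtain D where D: "0 \<le> D" "\<And>s. s \<in> {0..T} \<Longrightarrow> norm (transpose A *v X s) \<le> D"
    using riemann_path_bound[OF AX_riemann] by blast
  have dB: "dB (\<pi> n) i = x n i - a n i" if "\<pi> n \<in> partitions t 1" "i < length (\<pi> n) - 1" for n i
    using partition_pairs[OF that] t unfolding x_def a_def by (subst B_increment) (auto simp: inner_diff_right)
  have 1: "(\<lambda>n. \<Sum>i<length (\<pi> n) - 1. (x n i)\<^sup>2) \<longlonglongrightarrow> (\<Sum>\<tau>\<in>J \<inter> {..t}. (Y \<tau> \<bullet> h \<tau>)\<^sup>2)"
    unfolding x_def
    by (rule step_path_sum_tendsto[where F="\<lambda>n i x. (Y (\<pi> n ! i) \<bullet> x)\<^sup>2", OF X_step t \<pi>])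
      (auto intro!: tendsto_intros continuous_left_limit[OF Y_cont t \<pi>])
  have 2: "(\<lambda>n. \<Sum>i<length (\<pi> n) - 1. (- a n i) * dB (\<pi> n) i) \<longlonglongrightarrow> 0"
  and 3: "(\<lambda>n. \<Sum>i<length (\<pi> n) - 1. a n i * x n i) \<longlonglongrightarrow> 0"
  proof -
    have small: "\<bar>a n i\<bar> \<le> K * D * (\<pi> n ! Suc i - \<pi> n ! i)"
      if "\<pi> n \<in> partitions t 1" "i < length (\<pi> n) - 1" for n i
    proof -
      note i = partition_pairs[OF that]
      have "norm (integral {\<pi> n ! i..\<pi> n ! Suc i} (\<lambda>s. transpose A *v X s)) \<le> D * (\<pi> n ! Suc i - \<pi> n ! i)"
        using i t D by (intro norm_integral_le riemann_path_integrable[OF AX_riemann]) auto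
      then have "\<bar>a n i\<bar> \<le> K * (D * (\<pi> n ! Suc i - \<pi> n ! i))"
        unfolding a_def using K i t by (intro order_trans[OF Cauchy_Schwarz_ineq2] mult_mono) auto
      then show ?thesis by simp
    qed
    show "(\<lambda>n. \<Sum>i<length (\<pi> n) - 1. (- a n i) * dB (\<pi> n) i) \<longlonglongrightarrow> 0"
    proof (rule LIMSEQ_I)
      fix r :: real assume r: "0 < r"
      obtain C where C: "0 \<le> C" "\<And>t ts \<delta>. t \<in> {0..T} \<Longrightarrow> ts \<in> partitions t \<delta> \<Longrightarrow> (\<Sum>i<length ts - 1. \<bar>dB ts i\<bar>) \<le> C"
        using dB_variation_bounded by blast
      \<comment> \<open>\<open>K * D\<close> bounds the drift contribution per unit of time and
        \<open>C\<close> the sum of the absolute values of the \<open>dB\<close>; the added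
        \<open>1\<close> avoids division by zero.\<close>
      have p: "0 < K * D * C + 1" using K D C by (simp add: add_nonneg_pos)
      have "0 < r / (K * D * C + 1)" using r p by simp
      then have "\<forall>\<^sub>F n in sequentially. \<pi> n \<in> partitions t (r / (K * D * C + 1))" using \<pi> by (simp add: mesh_seq_def)
      then have "\<forall>\<^sub>F n in sequentially. norm ((\<Sum>i<length (\<pi> n) - 1. (- a n i) * dB (\<pi> n) i) - 0) < r"
        using mesh_seq_eventually[OF \<pi>]
      proof eventually_elim
        case (elim n)
        have "norm (\<Sum>i<length (\<pi> n) - 1. (- a n i) * dB (\<pi> n) i)
            \<le> (\<Sum>i<length (\<pi> n) - 1. (K * D * (r / (K * D * C + 1))) * \<bar>dB (\<pi> n) i\<bar>)"
          unfolding real_norm_def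
        proof (rule order_trans[OF sum_abs sum_mono])
          fix i assume "i \<in> {..<length (\<pi> n) - 1}"
          then have len: "i < length (\<pi> n) - 1" by simp
          have "\<bar>a n i\<bar> \<le> K * D * (\<pi> n ! Suc i - \<pi> n ! i)" by (rule small[OF elim(2) len])
          also have "\<dots> \<le> K * D * (r / (K * D * C + 1))"
            using partition_pairs(4)[OF elim(1) len] K D by (intro mult_left_mono) auto
          finally show "\<bar>(- a n i) * dB (\<pi> n) i\<bar> \<le> (K * D * (r / (K * D * C + 1))) * \<bar>dB (\<pi> n) i\<bar>"
            unfolding abs_mult abs_minus_cancel by (rule mult_right_mono) simp
        qed
        also have "\<dots> \<le> (K * D * (r / (K * D * C + 1))) * C"
          unfolding sum_distrib_left[symmetric] using C(2)[OF t elim(2)] K D r p by (intro mult_left_mono) auto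
        also have "\<dots> = K * D * C * (r / (K * D * C + 1))" by (simp add: mult_ac)
        also have "\<dots> < r" using r p by (simp add: field_simps)
        finally show ?case by simp
      qed
      then show "\<exists>no. \<forall>n\<ge>no. norm ((\<Sum>i<length (\<pi> n) - 1. (- a n i) * dB (\<pi> n) i) - 0) < r"
        by (simp add: eventually_sequentially)
    qed
    have RX: "bounded (X ` {0..T})" using X_riemann by (simp add: riemann_path_def)
    have lim: "(\<lambda>n. K * D * K * oscillation_sum X (\<pi> n)) \<longlonglongrightarrow> 0"
      using X_riemann t \<pi> by (intro tendsto_mult_right_zero) (auto simp: riemann_path_def)
    have "\<forall>\<^sub>F n in sequentially. norm (\<Sum>i<length (\<pi> n) - 1. a n i * x n i) \<le> K * D * K * oscillation_sum X (\<pi> n)"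
      using mesh_seq_eventually[OF \<pi>]
    proof eventually_elim
      case (elim n)
      show ?case unfolding real_norm_def oscillation_sum_def sum_distrib_left
      proof (rule order_trans[OF sum_abs sum_mono])
        fix i assume "i \<in> {..<length (\<pi> n) - 1}"
        then have len: "i < length (\<pi> n) - 1" by simp
        have i: "0 \<le> \<pi> n ! i" "\<pi> n ! i \<le> \<pi> n ! Suc i" "\<pi> n ! Suc i \<le> T"
          using partition_pairs[OF elim len] t by auto
        have "\<bar>x n i\<bar> \<le> K * oscillation X (\<pi> n ! i) (\<pi> n ! Suc i)"
          unfolding x_def using K i oscillation_upper[OF RX i(1,3), of "\<pi> n ! Suc i" "\<pi> n ! i"]
          by (intro order_trans[OF Cauchy_Schwarz_ineq2] mult_mono) auto
        then have "\<bar>a n i * x n i\<bar> \<le> (K * D * (\<pi> n ! Suc i - \<pi> n ! i)) * (K * oscillation X (\<pi> n ! i) (\<pi> n ! Suc i))"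
          unfolding abs_mult using small[OF elim len] K D i by (intro mult_mono) auto
        then show "\<bar>a n i * x n i\<bar> \<le> K * D * K * (oscillation X (\<pi> n ! i) (\<pi> n ! Suc i) * (\<pi> n ! Suc i - \<pi> n ! i))"
          by (simp add: mult_ac)
      qed
    qed
    from Lim_null_comparison[OF this lim] show "(\<lambda>n. \<Sum>i<length (\<pi> n) - 1. a n i * x n i) \<longlonglongrightarrow> 0" .
  qed
  from tendsto_diff[OF tendsto_add[OF 1 2] 3]
  have lim: "(\<lambda>n. (\<Sum>i<length (\<pi> n) - 1. (x n i)\<^sup>2) + (\<Sum>i<length (\<pi> n) - 1. (- a n i) * dB (\<pi> n) i)
      - (\<Sum>i<length (\<pi> n) - 1. a n i * x n i)) \<longlonglongrightarrow> (\<Sum>\<tau>\<in>J \<inter> {..t}. (Y \<tau> \<bullet> h \<tau>)\<^sup>2)" by simp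
  show ?thesis
  proof (rule Lim_transform_eventually[OF lim])
    show "\<forall>\<^sub>F n in sequentially. (\<Sum>i<length (\<pi> n) - 1. (x n i)\<^sup>2) + (\<Sum>i<length (\<pi> n) - 1. (- a n i) * dB (\<pi> n) i)
      - (\<Sum>i<length (\<pi> n) - 1. a n i * x n i) = (\<Sum>i<length (\<pi> n) - 1. (dB (\<pi> n) i)\<^sup>2)"
      using mesh_seq_eventually[OF \<pi>]
    proof eventually_elim
      case (elim n)
      show ?case unfolding sum_subtractf[symmetric] sum.distrib[symmetric]
      proof (rule sum.cong[OF refl])
        fix i assume "i \<in> {..<length (\<pi> n) - 1}"
        then have d: "dB (\<pi> n) i = x n i - a n i" by (intro dB[OF elim]) simp
        show "(x n i)\<^sup>2 + - a n i * dB (\<pi> n) i - a n i * x n i = (dB (\<pi> n) i)\<^sup>2"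
          unfolding d by (simp add: power2_eq_square algebra_simps)
      qed
    qed
  qed
qed

text \<open>The path \<open>w\<close> is continuous and the terms \<open>dB\<close> are absolutely
  summable with a uniform bound, so the two have no covariation.\<close>

lemma dW_dB_tendsto_0:
  assumes t: "t \<in> {0..T}" and \<pi>: "mesh_seq t \<pi>"
  shows "(\<lambda>n. \<Sum>i<length (\<pi> n) - 1. dW (\<pi> n) i * dB (\<pi> n) i) \<longlonglongrightarrow> 0"
proof (rule LIMSEQ_I)
  fix r :: real assume r: "0 < r"
  obtain C where C: "0 \<le> C" "\<And>t ts \<delta>. t \<in> {0..T} \<Longrightarrow> ts \<in> partitions t \<delta> \<Longrightarrow> (\<Sum>i<length ts - 1. \<bar>dB ts i\<bar>) \<le> C"
    using dB_variation_bounded by blast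
  obtain K where K: "0 \<le> K" "\<And>s. s \<in> {0..T} \<Longrightarrow> norm (u s) \<le> K"
    using riemann_path_bound[OF riemann_path_continuous[OF u_cont]] by blast
  have p: "0 < K * C + 1" using K C by (simp add: add_nonneg_pos)
  have r': "0 < r / (K * C + 1)" using r p by simp
  have "uniformly_continuous_on {0..T} w" using w_cont by (intro compact_uniformly_continuous) auto
  then obtain d where d: "0 < d"
    "\<And>a b. a \<in> {0..T} \<Longrightarrow> b \<in> {0..T} \<Longrightarrow> dist b a < d \<Longrightarrow> dist (w b) (w a) < r / (K * C + 1)"
    using r' unfolding uniformly_continuous_on_def by metis
  have "\<forall>\<^sub>F n in sequentially. \<pi> n \<in> partitions t d" using \<pi> d by (simp add: mesh_seq_def)
  then have "\<forall>\<^sub>F n in sequentially. norm ((\<Sum>i<length (\<pi> n) - 1. dW (\<pi> n) i * dB (\<pi> n) i) - 0) < r"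
  proof eventually_elim
    case (elim n)
    have "norm (\<Sum>i<length (\<pi> n) - 1. dW (\<pi> n) i * dB (\<pi> n) i)
        \<le> (\<Sum>i<length (\<pi> n) - 1. (K * (r / (K * C + 1))) * \<bar>dB (\<pi> n) i\<bar>)"
      unfolding real_norm_def
    proof (rule order_trans[OF sum_abs sum_mono])
      fix i assume "i \<in> {..<length (\<pi> n) - 1}"
      then have i: "0 \<le> \<pi> n ! i" "\<pi> n ! i < \<pi> n ! Suc i" "\<pi> n ! Suc i \<le> T" "\<pi> n ! Suc i - \<pi> n ! i < d"
        using partition_pairs[OF elim, of i] t by auto
      have "norm (w (\<pi> n ! Suc i) - w (\<pi> n ! i)) \<le> r / (K * C + 1)"
        using d(2)[of "\<pi> n ! i" "\<pi> n ! Suc i"] i by (auto simp: dist_norm)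
      then have "\<bar>dW (\<pi> n) i\<bar> \<le> K * (r / (K * C + 1))"
        using K i r' by (intro order_trans[OF Cauchy_Schwarz_ineq2] mult_mono) auto
      then show "\<bar>dW (\<pi> n) i * dB (\<pi> n) i\<bar> \<le> (K * (r / (K * C + 1))) * \<bar>dB (\<pi> n) i\<bar>"
        unfolding abs_mult by (rule mult_right_mono) simp
    qed
    also have "\<dots> \<le> (K * (r / (K * C + 1))) * C"
      unfolding sum_distrib_left[symmetric]
      by (intro mult_left_mono C(2)[OF t elim] mult_nonneg_nonneg K(1) less_imp_le[OF r'])
    also have "\<dots> = K * C * (r / (K * C + 1))" by (simp add: mult_ac)
    also have "\<dots> < r" using r p by (simp add: field_simps)
    finally show ?case by simp
  qed
  then show "\<exists>no. \<forall>n\<ge>no. norm ((\<Sum>i<length (\<pi> n) - 1. dW (\<pi> n) i * dB (\<pi> n) i) - 0) < r"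
    by (simp add: eventually_sequentially)
qed

text \<open>The square formula for \<open>E\<close> solved for the sum against \<open>w\<close>. The
  initial square, \<open>EB\<close> and the two brackets enter with the opposite sign, so that
  adding the other terms of the objective leaves half of the square of \<open>E\<close>.\<close>

definition EW :: "real \<Rightarrow> real" where
  "EW t = ((E t)\<^sup>2 - E0\<^sup>2 - integral {0..t} (\<lambda>s. u s \<bullet> (R *v u s)) - (\<Sum>\<tau>\<in>J \<inter> {..t}. (Y \<tau> \<bullet> h \<tau>)\<^sup>2)) / 2 - EB t"

text \<open>The discretised error process \<open>P\<close> satisfies \<open>P\<^sub>l\<^sup>2 = P\<^sub>0\<^sup>2 + 2 \<Sum> P dP + \<Sum> (dP)\<^sup>2\<close> exactly, so the
  limit of the sums against \<open>w\<close> is found from the limits of all other terms.\<close>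

lemma EU_dW_tendsto:
  assumes t: "t \<in> {0..T}" and \<pi>: "mesh_seq t \<pi>" and approx: "approximates \<pi>"
  shows "(\<lambda>n. \<Sum>i<length (\<pi> n) - 1. E (\<pi> n ! i) * dW (\<pi> n) i) \<longlonglongrightarrow> EW t"
proof -
  define P where "P n l = E0 + isum (\<pi> n) l + jsum (\<pi> n) l" for n l
  let ?S = "\<lambda>f. \<lambda>n. \<Sum>i<length (\<pi> n) - 1. f n i"
  \<comment> \<open>The accumulated error of the sums against \<open>B\<close>; it starts at zero
    and has vanishing total variation, so it may be used as a weight against
    \<open>w\<close>.\<close>
  define q where "q n l = (\<Sum>i<l. dB (\<pi> n) i - (Q (\<pi> n ! Suc i) - Q (\<pi> n ! i)))" for n l
  have qvar: "(\<lambda>n. \<Sum>i<length (\<pi> n) - 1. \<bar>q n (Suc i) - q n i\<bar>) \<longlonglongrightarrow> 0"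
    using Q_error_variation[OF t \<pi>] by (simp add: q_def)
  have DW: "?S (\<lambda>n i. (isum (\<pi> n) i - I (\<pi> n ! i)) * dW (\<pi> n) i) \<longlonglongrightarrow> 0"
    by (rule error_sum_tendsto_0[OF t \<pi> approx])
  have DQ: "?S (\<lambda>n i. q n i * dW (\<pi> n) i) \<longlonglongrightarrow> 0"
    by (rule small_variation_sum_tendsto_0[OF t \<pi> approx _ qvar]) (simp add: q_def)
  \<comment> \<open>A bound, uniform over the partition, for the distance between the discretised
    and the true error process.\<close>
  define z where "z n = partition_max (\<pi> n) (\<lambda>l. isum (\<pi> n) l - I (\<pi> n ! l))
    + (\<Sum>i<length (\<pi> n) - 1. \<bar>dB (\<pi> n) i - (Q (\<pi> n ! Suc i) - Q (\<pi> n ! i))\<bar>)" for n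
  have z: "z \<longlonglongrightarrow> 0"
    unfolding z_def[abs_def] by (rule tendsto_add_zero[OF partition_max_error[OF t \<pi> approx] Q_error_variation[OF t \<pi>]])
  have PE: "P n i - E (\<pi> n ! i) = (isum (\<pi> n) i - I (\<pi> n ! i)) + q n i"
    if "\<pi> n \<in> partitions t 1" "i < length (\<pi> n)" for n i
    using jsum_error[OF that] by (simp add: P_def E_def q_def)
  have PB: "?S (\<lambda>n i. (P n i - E (\<pi> n ! i)) * dB (\<pi> n) i) \<longlonglongrightarrow> 0"
  proof (rule sum_dB_tendsto_0[OF t \<pi> z])
    show "\<forall>\<^sub>F n in sequentially. \<forall>i<length (\<pi> n) - 1. \<bar>P n i - E (\<pi> n ! i)\<bar> \<le> z n"
      using mesh_seq_eventually[OF \<pi>]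
    proof eventually_elim
      case (elim n)
      show ?case
      proof (intro allI impI)
        fix i assume "i < length (\<pi> n) - 1"
        then have i: "i < length (\<pi> n)" "i \<le> length (\<pi> n) - 1" by auto
        have "\<bar>q n i\<bar> \<le> (\<Sum>j<i. \<bar>dB (\<pi> n) j - (Q (\<pi> n ! Suc j) - Q (\<pi> n ! j))\<bar>)"
          unfolding q_def by (rule sum_abs)
        also have "\<dots> \<le> (\<Sum>i<length (\<pi> n) - 1. \<bar>dB (\<pi> n) i - (Q (\<pi> n ! Suc i) - Q (\<pi> n ! i))\<bar>)"
          using i(2) by (intro sum_mono2) auto
        finally have "\<bar>q n i\<bar> \<le> (\<Sum>i<length (\<pi> n) - 1. \<bar>dB (\<pi> n) i - (Q (\<pi> n ! Suc i) - Q (\<pi> n ! i))\<bar>)" .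
        then show "\<bar>P n i - E (\<pi> n ! i)\<bar> \<le> z n"
          unfolding PE[OF elim i(1)] z_def
          using partition_max_ge[OF i(1), of "\<lambda>l. isum (\<pi> n) l - I (\<pi> n ! l)"] by linarith
      qed
    qed
  qed
  have Plast: "(\<lambda>n. P n (length (\<pi> n) - 1)) \<longlonglongrightarrow> E t"
    unfolding P_def E_def by (intro tendsto_intros isum_tendsto[OF t \<pi> approx] jsum_tendsto[OF t \<pi>])
  \<comment> \<open>The limit of everything except the wanted sum: half of the difference of squares
    minus the three bracket sums, then the sums against \<open>B\<close>, then the two corrections
    for replacing \<open>P\<close> by \<open>E\<close> in the sums against \<open>w\<close>.\<close>
  have "(\<lambda>n. ((P n (length (\<pi> n) - 1))\<^sup>2 - E0\<^sup>2 - ?S (\<lambda>n i. (dW (\<pi> n) i)\<^sup>2) n - 2 * ?S (\<lambda>n i. dW (\<pi> n) i * dB (\<pi> n) i) n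
      - ?S (\<lambda>n i. (dB (\<pi> n) i)\<^sup>2) n) / 2
      - ?S (\<lambda>n i. (P n i - E (\<pi> n ! i)) * dB (\<pi> n) i) n - ?S (\<lambda>n i. E (\<pi> n ! i) * dB (\<pi> n) i) n
      - ?S (\<lambda>n i. (isum (\<pi> n) i - I (\<pi> n ! i)) * dW (\<pi> n) i) n - ?S (\<lambda>n i. q n i * dW (\<pi> n) i) n)
    \<longlonglongrightarrow> ((E t)\<^sup>2 - E0\<^sup>2 - integral {0..t} (\<lambda>s. u s \<bullet> (R *v u s)) - 2 * 0 - (\<Sum>\<tau>\<in>J \<inter> {..t}. (Y \<tau> \<bullet> h \<tau>)\<^sup>2)) / 2
      - 0 - EB t - 0 - 0"
    by (intro tendsto_intros Plast quadratic_variation[OF t \<pi> approx] dW_dB_tendsto_0[OF t \<pi>]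
        dB_square_tendsto[OF t \<pi>] PB EY_dB_tendsto[OF t \<pi>] DW DQ) auto
  then have lim: "(\<lambda>n. ((P n (length (\<pi> n) - 1))\<^sup>2 - E0\<^sup>2 - ?S (\<lambda>n i. (dW (\<pi> n) i)\<^sup>2) n - 2 * ?S (\<lambda>n i. dW (\<pi> n) i * dB (\<pi> n) i) n
      - ?S (\<lambda>n i. (dB (\<pi> n) i)\<^sup>2) n) / 2
      - ?S (\<lambda>n i. (P n i - E (\<pi> n ! i)) * dB (\<pi> n) i) n - ?S (\<lambda>n i. E (\<pi> n ! i) * dB (\<pi> n) i) n
      - ?S (\<lambda>n i. (isum (\<pi> n) i - I (\<pi> n ! i)) * dW (\<pi> n) i) n - ?S (\<lambda>n i. q n i * dW (\<pi> n) i) n) \<longlonglongrightarrow> EW t"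
    by (simp add: EW_def)
  show ?thesis
  proof (rule Lim_transform_eventually[OF lim])
    show "\<forall>\<^sub>F n in sequentially. ((P n (length (\<pi> n) - 1))\<^sup>2 - E0\<^sup>2 - ?S (\<lambda>n i. (dW (\<pi> n) i)\<^sup>2) n - 2 * ?S (\<lambda>n i. dW (\<pi> n) i * dB (\<pi> n) i) n
      - ?S (\<lambda>n i. (dB (\<pi> n) i)\<^sup>2) n) / 2
      - ?S (\<lambda>n i. (P n i - E (\<pi> n ! i)) * dB (\<pi> n) i) n - ?S (\<lambda>n i. E (\<pi> n ! i) * dB (\<pi> n) i) n
      - ?S (\<lambda>n i. (isum (\<pi> n) i - I (\<pi> n ! i)) * dW (\<pi> n) i) n - ?S (\<lambda>n i. q n i * dW (\<pi> n) i) n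
      = ?S (\<lambda>n i. E (\<pi> n ! i) * dW (\<pi> n) i) n"
      using mesh_seq_eventually[OF \<pi>]
    proof eventually_elim
      case (elim n)
      have "(P n (length (\<pi> n) - 1))\<^sup>2 - E0\<^sup>2 = (\<Sum>i<length (\<pi> n) - 1. (P n (Suc i))\<^sup>2 - (P n i)\<^sup>2)"
      proof -
        have "P n 0 = E0" by (simp add: P_def isum_def jsum_def)
        then show ?thesis by (simp only: sum_lessThan_telescope[of "\<lambda>i. (P n i)\<^sup>2"])
      qed
      also have "\<dots> = (\<Sum>i<length (\<pi> n) - 1. 2 * (P n i * (dW (\<pi> n) i + dB (\<pi> n) i)) + (dW (\<pi> n) i + dB (\<pi> n) i)\<^sup>2)"
        by (rule sum.cong[OF refl]) (simp add: P_def isum_def jsum_def power2_eq_square algebra_simps)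
      finally have 1: "((P n (length (\<pi> n) - 1))\<^sup>2 - E0\<^sup>2 - ?S (\<lambda>n i. (dW (\<pi> n) i)\<^sup>2) n - 2 * ?S (\<lambda>n i. dW (\<pi> n) i * dB (\<pi> n) i) n
          - ?S (\<lambda>n i. (dB (\<pi> n) i)\<^sup>2) n) / 2 = ?S (\<lambda>n i. P n i * dW (\<pi> n) i) n + ?S (\<lambda>n i. P n i * dB (\<pi> n) i) n"
        by (simp add: sum.distrib sum_distrib_left[symmetric] power2_sum distrib_left mult.assoc)
      have 2: "?S (\<lambda>n i. P n i * dB (\<pi> n) i) n
          = ?S (\<lambda>n i. (P n i - E (\<pi> n ! i)) * dB (\<pi> n) i) n + ?S (\<lambda>n i. E (\<pi> n ! i) * dB (\<pi> n) i) n"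
        unfolding sum.distrib[symmetric] by (rule sum.cong[OF refl]) (simp add: left_diff_distrib)
      have 3: "?S (\<lambda>n i. P n i * dW (\<pi> n) i) n = ?S (\<lambda>n i. E (\<pi> n ! i) * dW (\<pi> n) i) n
          + ?S (\<lambda>n i. (isum (\<pi> n) i - I (\<pi> n ! i)) * dW (\<pi> n) i) n + ?S (\<lambda>n i. q n i * dW (\<pi> n) i) n"
        unfolding sum.distrib[symmetric]
      proof (rule sum.cong[OF refl])
        fix i assume "i \<in> {..<length (\<pi> n) - 1}"
        then have "i < length (\<pi> n)" by simp
        from PE[OF elim this] have "P n i = E (\<pi> n ! i) + (isum (\<pi> n) i - I (\<pi> n ! i)) + q n i" by simp
        then show "P n i * dW (\<pi> n) i = E (\<pi> n ! i) * dW (\<pi> n) i + (isum (\<pi> n) i - I (\<pi> n ! i)) * dW (\<pi> n) i + q n i * dW (\<pi> n) i"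
          by (simp only: distrib_right)
      qed
      show ?case unfolding 1 2 3 by simp
    qed
  qed
qed

end

subsection \<open>The filtration generated by the state and the noise\<close>

lemma sets_generated_algebra:
  "sets (generated_algebra M I X) = sigma_sets (space M) {X s -` B \<inter> space M | s B. s \<in> I \<and> B \<in> sets borel}"
  unfolding generated_algebra_def by (rule sets_measure_of) auto

lemma space_generated_algebra [simp]: "space (generated_algebra M I X) = space M"
  unfolding generated_algebra_def by (rule space_measure_of) auto

lemma measurable_generated_algebra:
  fixes X :: "real \<Rightarrow> 'a \<Rightarrow> 'b::topological_space"
  shows "s \<in> I \<Longrightarrow> X s \<in> borel_measurable (generated_algebra M I X)"
  by (rule measurableI) (auto simp: sets_generated_algebra intro!: sigma_sets.Basic)

lemma sets_generated_algebra_subset: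
  assumes "space N = space M" "\<And>s. s \<in> I \<Longrightarrow> X s \<in> borel_measurable N"
  shows "sets (generated_algebra M I X) \<subseteq> sets N"
  unfolding sets_generated_algebra assms(1)[symmetric]
proof (rule sets.sigma_sets_subset, safe)
  fix s and B :: "'b set" assume "s \<in> I" "B \<in> sets borel"
  then show "X s -` B \<inter> space N \<in> sets N" using measurable_sets[OF assms(2)] by blast
qed

text \<open>As the state is independent of the noise, adjoining the whole trajectory of \<open>X\<close> keeps the
  increments of \<open>W\<close> independent of the past; \<open>X\<close> then behaves like a deterministic path.\<close>

definition enlarged_filtration ::
    "'a measure \<Rightarrow> real \<Rightarrow> (real \<Rightarrow> 'a \<Rightarrow> 'b::topological_space) \<Rightarrow> (real \<Rightarrow> 'a \<Rightarrow> 'c::topological_space) \<Rightarrow> real \<Rightarrow> 'a measure" where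
  "enlarged_filtration M T X W s = sigma (space M)
     (sets (generated_algebra M {0..T} X) \<union> sets (generated_algebra M {0..s} W))"

lemma generated_algebra_into_space: "sets (generated_algebra M I X) \<subseteq> Pow (space M)"
  using sets.sets_into_space[of _ "generated_algebra M I X"] by auto

lemma sets_enlarged_filtration:
  "sets (enlarged_filtration M T X W s) = sigma_sets (space M)
     (sets (generated_algebra M {0..T} X) \<union> sets (generated_algebra M {0..s} W))"
  unfolding enlarged_filtration_def
  using generated_algebra_into_space[of M "{0..T}" X] generated_algebra_into_space[of M "{0..s}" W]
  by (intro sets_measure_of) auto

lemma space_enlarged_filtration [simp]: "space (enlarged_filtration M T X W s) = space M"
  unfolding enlarged_filtration_def
  using generated_algebra_into_space[of M "{0..T}" X] generated_algebra_into_space[of M "{0..s}" W]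
  by (intro space_measure_of) auto

lemma measurable_enlarged_filtration:
  assumes "f \<in> borel_measurable (generated_algebra M {0..T} X) \<or> f \<in> borel_measurable (generated_algebra M {0..s} W)"
  shows "f \<in> borel_measurable (enlarged_filtration M T X W s)"
  using assms by (auto simp: measurable_def sets_enlarged_filtration intro!: sigma_sets.Basic)

lemma enlarged_filtration_subset:
  assumes "space N = space M" "sets (generated_algebra M {0..T} X) \<subseteq> sets N" "sets (generated_algebra M {0..s} W) \<subseteq> sets N"
  shows "sets (enlarged_filtration M T X W s) \<subseteq> sets N"
  unfolding sets_enlarged_filtration assms(1)[symmetric] using assms by (intro sets.sigma_sets_subset) auto

text \<open>Intersections of an event of the state with an event of the past of the noise form a
  class stable under intersection that generates the enlarged algebra. On it the probability
  factorises, by the independence of state and noise over the whole horizon and that of the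
  increment from the past of \<open>W\<close>.\<close>

lemma (in prob_space) increment_indep_enlarged:
  fixes X :: "real \<Rightarrow> 'a \<Rightarrow> 'b::topological_space" and W :: "real \<Rightarrow> 'a \<Rightarrow> 'c::euclidean_space"
    and g :: "'a \<Rightarrow> real" and h :: "'c \<Rightarrow> real"
  assumes XM: "\<And>s. s \<in> {0..T} \<Longrightarrow> X s \<in> borel_measurable M" and WM: "\<And>s. s \<in> {0..T} \<Longrightarrow> W s \<in> borel_measurable M"
    and indepXW: "indep_set (sets (generated_algebra M {0..T} X)) (sets (generated_algebra M {0..T} W))"
    and indepW: "indep_set (sets (generated_algebra M {0..s} W))
      (sets (vimage_algebra (space M) (\<lambda>\<omega>. W t \<omega> - W s \<omega>) borel))"
    and st: "0 \<le> s" "s < t" "t \<le> T"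
    and g: "g \<in> borel_measurable (enlarged_filtration M T X W s)" and h: "h \<in> borel_measurable borel"
  shows "indep_var borel g borel (\<lambda>\<omega>. h (W t \<omega> - W s \<omega>))"
proof -
  let ?X = "sets (generated_algebra M {0..T} X)" and ?W = "sets (generated_algebra M {0..s} W)"
    and ?WT = "sets (generated_algebra M {0..T} W)"
    and ?C = "sets (vimage_algebra (space M) (\<lambda>\<omega>. W t \<omega> - W s \<omega>) borel)"
  let ?D = "{a \<inter> b | a b. a \<in> ?X \<and> b \<in> ?W}"
  have XE: "?X \<subseteq> events" and WE: "?W \<subseteq> events" and WTE: "?WT \<subseteq> events"
    using sets_generated_algebra_subset[OF refl XM, of "{0..T}"] sets_generated_algebra_subset[OF refl WM, of "{0..s}"]
      sets_generated_algebra_subset[OF refl WM, of "{0..T}"] st by auto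
  have W_WT: "?W \<subseteq> ?WT"
    using st by (intro sets_generated_algebra_subset) (auto intro: measurable_generated_algebra)
  have C_WT: "?C \<subseteq> ?WT"
  proof -
    have [measurable]: "W t \<in> borel_measurable (generated_algebra M {0..T} W)" "W s \<in> borel_measurable (generated_algebra M {0..T} W)"
      using st by (auto intro: measurable_generated_algebra)
    have m: "(\<lambda>\<omega>. W t \<omega> - W s \<omega>) \<in> borel_measurable (generated_algebra M {0..T} W)" by measurable
    show ?thesis using measurable_sets[OF m] by (auto simp: sets_vimage_algebra2)
  qed
  have "indep_set ?D ?C"
  proof (rule indep_setI)
    show "?D \<subseteq> events" using XE WE by blast
    show "?C \<subseteq> events" using C_WT WTE by blast
    fix d c assume "d \<in> ?D" and c: "c \<in> ?C"
    then obtain a b where d: "d = a \<inter> b" and a: "a \<in> ?X" and b: "b \<in> ?W" by blast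
    \<comment> \<open>The past and the increment together still belong to the algebra of the noise
      up to \<open>T\<close>, so the state can be split off before the increment is.\<close>
    have "b \<inter> c \<in> ?WT" using b c W_WT C_WT by (intro sets.Int) auto
    then have "prob (a \<inter> (b \<inter> c)) = prob a * prob (b \<inter> c)"
      using indepXW a unfolding indep_sets2_eq by blast
    also have "prob (b \<inter> c) = prob b * prob c" using indepW b c unfolding indep_sets2_eq by blast
    also have "prob a * (prob b * prob c) = prob (a \<inter> b) * prob c"
      using indepXW a b W_WT unfolding indep_sets2_eq by (auto simp: subset_iff)
    finally show "prob (d \<inter> c) = prob d * prob c" by (simp add: d Int_assoc)
  qed
  moreover have "Int_stable ?D"
  proof (rule Int_stableI, safe)
    fix a b a' b' assume "a \<in> ?X" "b \<in> ?W" "a' \<in> ?X" "b' \<in> ?W"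
    then show "\<exists>a'' b''. a \<inter> b \<inter> (a' \<inter> b') = a'' \<inter> b'' \<and> a'' \<in> ?X \<and> b'' \<in> ?W"
      by (intro exI[of _ "a \<inter> a'"] exI[of _ "b \<inter> b'"]) auto
  qed
  moreover have "Int_stable ?C" by (rule sets.Int_stable)
  ultimately have ind: "indep_set (sigma_sets (space M) ?D) (sigma_sets (space M) ?C)"
    by (rule indep_set_sigma_sets)
  have GD: "sets (enlarged_filtration M T X W s) \<subseteq> sigma_sets (space M) ?D"
    unfolding sets_enlarged_filtration
  proof (rule sigma_sets_mono, safe)
    fix a assume a: "a \<in> ?X"
    have "a = a \<inter> space M" using a generated_algebra_into_space[of M "{0..T}" X] by auto
    moreover have "space M \<in> ?W" using sets.top[of "generated_algebra M {0..s} W"] by simp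
    ultimately have "a \<in> ?D" using a by blast
    then show "a \<in> sigma_sets (space M) ?D" by (rule sigma_sets.Basic)
  next
    fix b assume b: "b \<in> ?W"
    have "b = space M \<inter> b" using b generated_algebra_into_space[of M "{0..s}" W] by auto
    moreover have "space M \<in> ?X" using sets.top[of "generated_algebra M {0..T} X"] by simp
    ultimately have "b \<in> ?D" using b by blast
    then show "b \<in> sigma_sets (space M) ?D" by (rule sigma_sets.Basic)
  qed
  let ?\<zeta> = "\<lambda>\<omega>. h (W t \<omega> - W s \<omega>)"
  have sub: "sets (enlarged_filtration M T X W s) \<subseteq> events"
    by (rule enlarged_filtration_subset[OF refl XE WE])
  have gM: "g \<in> borel_measurable M"
    using g sub by (auto simp: measurable_def)
  have [measurable]: "W t \<in> borel_measurable M" "W s \<in> borel_measurable M" using WM st by auto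
  note h[measurable]
  have \<zeta>M: "?\<zeta> \<in> borel_measurable M" by measurable
  have 1: "sigma_sets (space M) {g -` B \<inter> space M | B. B \<in> sets borel} \<subseteq> sigma_sets (space M) ?D"
  proof (rule sigma_sets_mono, safe)
    fix B :: "real set" assume "B \<in> sets borel"
    then have "g -` B \<inter> space M \<in> sets (enlarged_filtration M T X W s)"
      using measurable_sets[OF g] by simp
    then show "g -` B \<inter> space M \<in> sigma_sets (space M) ?D" using GD by blast
  qed
  have 2: "sigma_sets (space M) {?\<zeta> -` B \<inter> space M | B. B \<in> sets borel} \<subseteq> sigma_sets (space M) ?C"
  proof (rule sigma_sets_mono, safe)
    fix B :: "real set" assume "B \<in> sets borel"
    then have hB: "h -` B \<in> sets borel" using measurable_sets[OF h] by simp
    have "?\<zeta> -` B \<inter> space M = (\<lambda>\<omega>. W t \<omega> - W s \<omega>) -` (h -` B) \<inter> space M" by auto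
    also have "\<dots> \<in> ?C" by (rule in_vimage_algebra[OF hB])
    finally show "?\<zeta> -` B \<inter> space M \<in> sigma_sets (space M) ?C" by (rule sigma_sets.Basic)
  qed
  from ind 1 2 have "indep_set (sigma_sets (space M) {g -` B \<inter> space M | B. B \<in> sets borel})
      (sigma_sets (space M) {?\<zeta> -` B \<inter> space M | B. B \<in> sets borel})"
    unfolding indep_sets2_eq by (meson subset_trans subsetD)
  then show ?thesis unfolding indep_var_eq using gM \<zeta>M by simp
qed

subsection \<open>Measurability of integrals and of solutions of linear differential equations\<close>

lemma borel_measurable_matrix_vector_mult [measurable]:
  fixes K :: "'a \<Rightarrow> real^'n^'m" and v :: "'a \<Rightarrow> real^'n"
  assumes "K \<in> borel_measurable N" "v \<in> borel_measurable N"
  shows "(\<lambda>\<omega>. K \<omega> *v v \<omega>) \<in> borel_measurable N"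
proof -
  have "continuous_on UNIV (\<lambda>x :: (real^'n^'m) \<times> (real^'n). fst x *v snd x)"
    unfolding matrix_vector_mult_def by (intro continuous_intros)
  from borel_measurable_continuous_Pair[OF assms this] show ?thesis .
qed

lemma borel_measurable_transpose [measurable]:
  fixes K :: "'a \<Rightarrow> real^'n^'m"
  assumes "K \<in> borel_measurable N"
  shows "(\<lambda>\<omega>. transpose (K \<omega>)) \<in> borel_measurable N"
proof -
  have "continuous_on UNIV (transpose :: real^'n^'m \<Rightarrow> real^'m^'n)"
    unfolding transpose_def[abs_def] by (intro continuous_intros)
  from borel_measurable_continuous_on[OF this assms] show ?thesis .
qed

text \<open>The integral is a limit of Riemann sums, for which measurability at each fixed time is
  enough; joint measurability in time and sample point does not come up.\<close>

lemma borel_measurable_riemann_integral: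
  fixes \<phi> :: "real \<Rightarrow> 'a \<Rightarrow> 'b::euclidean_space"
  assumes t: "t \<in> {0..T}" and m: "\<And>s. s \<in> {0..t} \<Longrightarrow> \<phi> s \<in> borel_measurable N"
    and p: "\<And>\<omega>. \<omega> \<in> space N \<Longrightarrow> riemann_path T (\<lambda>s. \<phi> s \<omega>)"
  shows "(\<lambda>\<omega>. integral {0..t} (\<lambda>s. \<phi> s \<omega>)) \<in> borel_measurable N"
proof (rule borel_measurable_euclidean_space[THEN iffD2, rule_format])
  fix b :: 'b assume "b \<in> Basis"
  have t0: "0 \<le> t" and tT: "t \<le> T" using t by auto
  obtain r where r: "strict_mono r" "\<And>n. uniform_partition t (r n) \<in> partitions t (inverse (real (Suc n)))"
    using mesh_seq_refine[OF mesh_seq_uniform[OF t0]] by blast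
  define \<pi> where "\<pi> n = uniform_partition t (r n)" for n
  have \<pi>: "mesh_seq t \<pi>" unfolding \<pi>_def by (rule mesh_seq_subseq[OF mesh_seq_uniform[OF t0] r(1)])
  show "(\<lambda>\<omega>. integral {0..t} (\<lambda>s. \<phi> s \<omega>) \<bullet> b) \<in> borel_measurable N"
  proof (rule borel_measurable_LIMSEQ_metric)
    fix n
    have "\<pi> n ! i \<in> {0..t}" if "i < length (\<pi> n) - 1" for i
      using that by (intro partition_nth_mem[OF r(2)[of n, folded \<pi>_def]]) simp
    \<comment> \<open>Integrating the constant \<open>b\<close> over a step gives its length times
      \<open>b\<close>, the shape in which convergence of Riemann sums is available.\<close>
    then show "(\<lambda>\<omega>. \<Sum>i<length (\<pi> n) - 1. \<phi> (\<pi> n ! i) \<omega> \<bullet> integral {\<pi> n ! i..\<pi> n ! Suc i} (\<lambda>_. b)) \<in> borel_measurable N"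
      by (intro borel_measurable_sum borel_measurable_inner m borel_measurable_const) simp
  next
    fix \<omega> assume \<omega>: "\<omega> \<in> space N"
    have "integral {0..t} (\<lambda>s. \<phi> s \<omega>) \<bullet> b = integral {0..t} (\<lambda>s. \<phi> s \<omega> \<bullet> b)"
      using integral_linear[OF riemann_path_integrable[OF p[OF \<omega>] order_refl tT] bounded_linear_inner_left[of b]]
      by (simp add: comp_def)
    then show "(\<lambda>n. \<Sum>i<length (\<pi> n) - 1. \<phi> (\<pi> n ! i) \<omega> \<bullet> integral {\<pi> n ! i..\<pi> n ! Suc i} (\<lambda>_. b))
        \<longlonglongrightarrow> integral {0..t} (\<lambda>s. \<phi> s \<omega>) \<bullet> b"
      using riemann_sum_tendsto[OF p[OF \<omega>] riemann_path_continuous[OF continuous_on_const] t \<pi>] by simp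
  qed
qed

text \<open>The solution is the limit of the explicit Euler scheme run backwards from the terminal value.\<close>

lemma backward_linear_ode_measurable:
  fixes Y :: "real \<Rightarrow> 'a \<Rightarrow> real^'d" and L :: "real \<Rightarrow> 'a \<Rightarrow> real^'d^'d" and v :: "real \<Rightarrow> 'a \<Rightarrow> real^'d"
  assumes Lm: "\<And>s. s \<in> {0..T} \<Longrightarrow> L s \<in> borel_measurable N" and vm: "\<And>s. s \<in> {0..T} \<Longrightarrow> v s \<in> borel_measurable N"
    and Lc: "\<And>\<omega>. \<omega> \<in> space N \<Longrightarrow> continuous_on {0..T} (\<lambda>s. L s \<omega>)"
    and vc: "\<And>\<omega>. \<omega> \<in> space N \<Longrightarrow> continuous_on {0..T} (\<lambda>s. v s \<omega>)"
    and YT: "\<And>\<omega>. \<omega> \<in> space N \<Longrightarrow> Y T \<omega> = f"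
    and Y: "\<And>\<omega> s. \<omega> \<in> space N \<Longrightarrow> s \<in> {0..T} \<Longrightarrow>
      ((\<lambda>s. Y s \<omega>) has_vector_derivative - (L s \<omega> *v Y s \<omega> + v s \<omega>)) (at s within {0..T})"
    and t: "t \<in> {0..T}"
  shows "Y t \<in> borel_measurable N"
proof -
  define \<Delta> where "\<Delta> n = (T - t) / real (Suc n)" for n
  \<comment> \<open>The grid runs downwards from \<open>T\<close> and reaches \<open>t\<close>
    exactly after \<open>Suc n\<close> steps.\<close>
  define s where "s n j = T - real j * \<Delta> n" for n j
  define e where "e n = rec_nat (\<lambda>\<omega>. f) (\<lambda>j y \<omega>. y \<omega> + \<Delta> n *\<^sub>R (L (s n j) \<omega> *v y \<omega> + v (s n j) \<omega>))" for n
  have e0: "e n 0 \<omega> = f" and eS: "e n (Suc j) \<omega> = e n j \<omega> + \<Delta> n *\<^sub>R (L (s n j) \<omega> *v e n j \<omega> + v (s n j) \<omega>)" for n j \<omega>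
    by (simp_all add: e_def)
  have \<Delta>0: "0 \<le> \<Delta> n" for n using t by (simp add: \<Delta>_def)
  have \<Delta>n: "real (Suc n) * \<Delta> n = T - t" for n unfolding \<Delta>_def by (simp del: of_nat_Suc)
  have sT: "s n j \<in> {0..T}" if "j \<le> Suc n" for n j
  proof -
    have "real j * \<Delta> n \<le> real (Suc n) * \<Delta> n" using that \<Delta>0 by (intro mult_right_mono) auto
    moreover have "0 \<le> real j * \<Delta> n" using \<Delta>0 by simp
    ultimately show ?thesis using \<Delta>n[of n] t by (auto simp: s_def)
  qed
  have em: "e n j \<in> borel_measurable N" if "j \<le> Suc n" for n j
    using that
  proof (induction j)
    case 0
    then show ?case by (simp add: e_def)
  next
    case (Suc j)
    have [measurable]: "e n j \<in> borel_measurable N" "L (s n j) \<in> borel_measurable N" "v (s n j) \<in> borel_measurable N"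
      using Suc Lm[OF sT] vm[OF sT] by auto
    show ?case unfolding eS[abs_def] by measurable
  qed
  show ?thesis
  proof (rule borel_measurable_LIMSEQ_metric)
    show "e n (Suc n) \<in> borel_measurable N" for n by (rule em) simp
    fix \<omega> assume \<omega>: "\<omega> \<in> space N"
    define F where "F r = L r \<omega> *v Y r \<omega> + v r \<omega>" for r
    have Yc: "continuous_on {0..T} (\<lambda>s. Y s \<omega>)"
      unfolding continuous_on_eq_continuous_within by (blast intro: has_vector_derivative_continuous Y[OF \<omega>])
    have Fc: "continuous_on {0..T} F"
      unfolding F_def matrix_vector_mult_def by (intro continuous_intros Lc[OF \<omega>] vc[OF \<omega>] Yc)
    obtain C where C: "0 \<le> C" "\<And>r x. r \<in> {0..T} \<Longrightarrow> norm (L r \<omega> *v x) \<le> C * norm x"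
    proof -
      obtain c where c: "0 \<le> c" "\<And>r. r \<in> {0..T} \<Longrightarrow> norm (L r \<omega>) \<le> c"
        using riemann_path_bound[OF riemann_path_continuous[OF Lc[OF \<omega>]]] by blast
      show thesis
      proof (rule that[of "real CARD('d) * c"])
        fix r and x :: "real^'d" assume r: "r \<in> {0..T}"
        have "norm (L r \<omega> *v x) \<le> (\<Sum>i\<in>UNIV. \<bar>(L r \<omega> *v x) $ i\<bar>)" by (rule norm_le_l1_cart)
        also have "\<dots> \<le> (\<Sum>i\<in>(UNIV :: 'd set). c * norm x)"
        proof (rule sum_mono)
          fix i :: 'd
          have "\<bar>(L r \<omega> *v x) $ i\<bar> \<le> norm (L r \<omega> $ i) * norm x"
            unfolding matrix_vector_mul_component by (rule Cauchy_Schwarz_ineq2)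
          also have "\<dots> \<le> c * norm x"
            using Finite_Cartesian_Product.norm_nth_le[of "L r \<omega>" i] c(2)[OF r] by (intro mult_right_mono) auto
          finally show "\<bar>(L r \<omega> *v x) $ i\<bar> \<le> c * norm x" .
        qed
        finally show "norm (L r \<omega> *v x) \<le> real CARD('d) * c * norm x" by simp
      qed (use c in simp)
    qed
    show "(\<lambda>n. e n (Suc n) \<omega>) \<longlonglongrightarrow> Y t \<omega>"
    proof (rule LIMSEQ_I)
      fix r :: real assume r: "0 < r"
      \<comment> \<open>The \<open>Suc n\<close> local errors add up to at most
        \<open>(T - t) * \<eta>\<close>, amplified by at most \<open>exp (C * (T - t))\<close>;
        \<open>\<eta>\<close> is chosen to keep the product below \<open>r\<close>.\<close>
      define \<eta> where "\<eta> = r / ((T - t) * exp (C * (T - t)) + 1)"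
      have p: "0 < (T - t) * exp (C * (T - t)) + 1" using t by (intro add_nonneg_pos) auto
      have \<eta>: "0 < \<eta>" using r p by (simp add: \<eta>_def)
      have "uniformly_continuous_on {0..T} F" using Fc by (intro compact_uniformly_continuous) auto
      then obtain d where d: "0 < d" "\<And>a b. a \<in> {0..T} \<Longrightarrow> b \<in> {0..T} \<Longrightarrow> dist b a < d \<Longrightarrow> dist (F b) (F a) < \<eta>"
        using \<eta> unfolding uniformly_continuous_on_def by metis
      have "(\<lambda>n. (T - t) * inverse (real (Suc n))) \<longlonglongrightarrow> 0"
        by (rule tendsto_mult_right_zero[OF LIMSEQ_inverse_real_of_nat])
      then have "\<forall>\<^sub>F n in sequentially. (T - t) * inverse (real (Suc n)) < d"
        using d(1) by (rule order_tendstoD(2))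
      then have "\<forall>\<^sub>F n in sequentially. norm (e n (Suc n) \<omega> - Y t \<omega>) < r"
      proof eventually_elim
        case (elim n)
        then have \<Delta>d: "\<Delta> n < d" by (simp add: \<Delta>_def divide_inverse)
        define z where "z = 1 + \<Delta> n * C"
        have z1: "1 \<le> z" using \<Delta>0 C by (simp add: z_def)
        \<comment> \<open>Each step adds an error of at most \<open>\<Delta> n * \<eta>\<close> and
          multiplies the previous one by at most \<open>z = 1 + \<Delta> n * C\<close>.\<close>
        have err: "norm (e n j \<omega> - Y (s n j) \<omega>) \<le> real j * \<Delta> n * \<eta> * z ^ j" if "j \<le> Suc n" for j
          using that
        proof (induction j)
          case 0
          then show ?case using YT[OF \<omega>] by (simp add: e0 s_def)
        next
          case (Suc j)
          let ?a = "s n (Suc j)" and ?b = "s n j"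
          have ab: "?b - ?a = \<Delta> n" by (simp add: s_def algebra_simps)
          have abT: "?a \<in> {0..T}" "?b \<in> {0..T}" "?a \<le> ?b" using sT Suc.prems ab \<Delta>0[of n] by auto
          have "((\<lambda>r. - F r) has_integral (Y ?b \<omega> - Y ?a \<omega>)) {?a..?b}"
            unfolding F_def using abT
            by (intro fundamental_theorem_of_calculus has_vector_derivative_within_subset[OF Y[OF \<omega>]]) auto
          from has_integral_neg[OF this]
          have hF: "(F has_integral (Y ?a \<omega> - Y ?b \<omega>)) {?a..?b}" by simp
          have "((\<lambda>_. F ?b) has_integral (\<Delta> n *\<^sub>R F ?b)) {?a..?b}"
            using has_integral_const_real[of "F ?b" ?a ?b] abT ab by simp
          from has_integral_diff[OF hF this]
          have hd: "((\<lambda>r. F r - F ?b) has_integral (Y ?a \<omega> - Y ?b \<omega> - \<Delta> n *\<^sub>R F ?b)) {?a..?b}" .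
          \<comment> \<open>The local error is measured along the exact solution, so uniform
            continuity of \<open>F\<close> suffices.\<close>
          have loc: "norm (Y ?a \<omega> - Y ?b \<omega> - \<Delta> n *\<^sub>R F ?b) \<le> \<Delta> n * \<eta>"
          proof -
            have "norm (integral {?a..?b} (\<lambda>r. F r - F ?b)) \<le> \<eta> * (?b - ?a)"
            proof (rule norm_integral_le[OF abT(3)])
              show "(\<lambda>r. F r - F ?b) integrable_on {?a..?b}" using hd by (rule has_integral_integrable)
              fix q assume q: "q \<in> {?a..?b}"
              have "dist (F q) (F ?b) < \<eta>"
                using q abT ab \<Delta>d by (intro d(2)) (auto simp: dist_real_def)
              then show "norm (F q - F ?b) \<le> \<eta>" by (simp add: dist_norm)
            qed
            then show ?thesis using integral_unique[OF hd] ab by (simp add: mult.commute)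
          qed
          have "e n (Suc j) \<omega> - Y ?a \<omega> = (e n j \<omega> - Y ?b \<omega>) + \<Delta> n *\<^sub>R (L ?b \<omega> *v (e n j \<omega> - Y ?b \<omega>))
              - (Y ?a \<omega> - Y ?b \<omega> - \<Delta> n *\<^sub>R F ?b)"
            by (simp add: eS F_def matrix_vector_mult_diff_distrib algebra_simps)
          also have "norm \<dots> \<le> norm (e n j \<omega> - Y ?b \<omega>) + \<Delta> n * (C * norm (e n j \<omega> - Y ?b \<omega>)) + \<Delta> n * \<eta>"
          proof -
            have "norm (\<Delta> n *\<^sub>R (L ?b \<omega> *v (e n j \<omega> - Y ?b \<omega>))) \<le> \<Delta> n * (C * norm (e n j \<omega> - Y ?b \<omega>))"
              using C(2)[OF abT(2)] \<Delta>0[of n] by (simp add: mult_left_mono)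
            then show ?thesis
              using loc norm_triangle_ineq4[of "(e n j \<omega> - Y ?b \<omega>) + \<Delta> n *\<^sub>R (L ?b \<omega> *v (e n j \<omega> - Y ?b \<omega>))"
                  "Y ?a \<omega> - Y ?b \<omega> - \<Delta> n *\<^sub>R F ?b"]
                norm_triangle_ineq[of "e n j \<omega> - Y ?b \<omega>" "\<Delta> n *\<^sub>R (L ?b \<omega> *v (e n j \<omega> - Y ?b \<omega>))"] by linarith
          qed
          also have "\<dots> = z * norm (e n j \<omega> - Y ?b \<omega>) + \<Delta> n * \<eta>" by (simp add: z_def algebra_simps)
          also have "\<dots> \<le> z * (real j * \<Delta> n * \<eta> * z ^ j) + \<Delta> n * \<eta> * z ^ Suc j"
          proof (intro add_mono mult_left_mono)
            show "\<Delta> n * \<eta> \<le> \<Delta> n * \<eta> * z ^ Suc j"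
              using mult_left_mono[OF one_le_power[OF z1, of "Suc j"], of "\<Delta> n * \<eta>"] \<Delta>0[of n] \<eta> by simp
          qed (use Suc z1 in auto)
          also have "\<dots> = real (Suc j) * \<Delta> n * \<eta> * z ^ Suc j" by (simp add: algebra_simps)
          finally show ?case .
        qed
        have "z ^ Suc n \<le> exp (\<Delta> n * C) ^ Suc n"
          using z1 by (intro power_mono) (auto simp: z_def)
        also have "\<dots> = exp (C * (T - t))"
          unfolding exp_of_nat_mult[symmetric] mult.assoc[symmetric] \<Delta>n by (simp add: mult.commute)
        finally have zn: "z ^ Suc n \<le> exp (C * (T - t))" .
        have st: "s n (Suc n) = t" unfolding s_def \<Delta>n by simp
        have "norm (e n (Suc n) \<omega> - Y t \<omega>) \<le> (T - t) * \<eta> * z ^ Suc n"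
          using err[OF order_refl] unfolding st \<Delta>n .
        also have "\<dots> \<le> (T - t) * \<eta> * exp (C * (T - t))"
          using zn t \<eta> by (intro mult_left_mono) auto
        also have "\<dots> = \<eta> * ((T - t) * exp (C * (T - t)))" by simp
        also have "\<dots> < \<eta> * ((T - t) * exp (C * (T - t)) + 1)" using \<eta> by simp
        also have "\<dots> = r" using p by (simp add: \<eta>_def)
        finally show ?case .
      qed
      then show "\<exists>no. \<forall>n\<ge>no. norm (e n (Suc n) \<omega> - Y t \<omega>) < r" by (simp add: eventually_sequentially)
    qed
  qed
qed

text \<open>The constant \<open>C\<close> may depend on the sample point because only almost sure
  convergence along the subsequence is at stake; this accommodates integrands bounded merely path by
  path.\<close>

lemma subseq_limit_dominated:
  fixes S S' :: "real list \<Rightarrow> 'a \<Rightarrow> real"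
  assumes S: "subseq_limit M t S (\<lambda>_. 0)"
    and le: "\<And>\<omega>. \<omega> \<in> space M \<Longrightarrow> \<exists>C. \<forall>ts\<in>partitions t 1. \<bar>S' ts \<omega>\<bar> \<le> C * S ts \<omega>"
  shows "subseq_limit M t S' (\<lambda>_. 0)"
  unfolding subseq_limit_def
proof (intro allI impI)
  fix \<pi> assume \<pi>: "mesh_seq t \<pi>"
  then obtain r where r: "strict_mono r" "AE \<omega> in M. (\<lambda>n. S (\<pi> (r n)) \<omega>) \<longlonglongrightarrow> 0"
    using S unfolding subseq_limit_def by blast
  have "AE \<omega> in M. (\<lambda>n. S' (\<pi> (r n)) \<omega>) \<longlonglongrightarrow> 0"
    using r(2) AE_space
  proof eventually_elim
    case (elim \<omega>)
    obtain C where C: "\<forall>ts\<in>partitions t 1. \<bar>S' ts \<omega>\<bar> \<le> C * S ts \<omega>" using le[OF elim(2)] by blast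
    have "\<forall>\<^sub>F n in sequentially. norm (S' (\<pi> (r n)) \<omega>) \<le> C * S (\<pi> (r n)) \<omega>"
      using mesh_seq_eventually[OF mesh_seq_subseq[OF \<pi> r(1)]] by (rule eventually_mono) (use C in auto)
    from Lim_null_comparison[OF this tendsto_mult_right_zero[OF elim(1)]] show ?case .
  qed
  with r(1) show "\<exists>r. strict_mono r \<and> (AE \<omega> in M. (\<lambda>n. S' (\<pi> (r n)) \<omega>) \<longlonglongrightarrow> 0)" by blast
qed

lemma partition_max_sum_le:
  assumes "ts \<noteq> []" "\<And>l. l < length ts \<Longrightarrow> \<bar>x l\<bar> \<le> (\<Sum>a\<in>A. \<bar>y a l\<bar>)"
  shows "partition_max ts x \<le> (\<Sum>a\<in>A. partition_max ts (y a))"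
proof (rule partition_max_le[OF assms(1)])
  fix l assume l: "l < length ts"
  show "\<bar>x l\<bar> \<le> (\<Sum>a\<in>A. partition_max ts (y a))"
    using assms(2)[OF l] sum_mono[of A "\<lambda>a. \<bar>y a l\<bar>" "\<lambda>a. partition_max ts (y a)"] partition_max_ge[OF l]
    by fastforce
qed

lemma partition_not_empty: "ts \<in> partitions t \<delta> \<Longrightarrow> ts \<noteq> []"
  by (simp add: partitions_def)

lemma matrix_vector_axis_component:
  fixes k :: "real^'m^'e"
  shows "(k *v x) $ p = (\<Sum>j\<in>UNIV. k $ p $ j * (axis j 1 \<bullet> x))"
  by (simp add: matrix_vector_mult_def inner_axis')

text \<open>Products of two components are reduced to squares of projections on
  \<open>axis j 1 + axis l 1\<close>, \<open>axis j 1\<close> and \<open>axis l 1\<close>, the form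
  in which quadratic sums have been estimated. Symmetry of \<open>R\<close> merges the two mixed
  entries.\<close>

lemma polarization:
  fixes R :: "real^'m^'m"
  assumes R: "transpose R = R"
  shows "x $ j * x $ l - R $ j $ l * d
    = (((axis j 1 + axis l 1) \<bullet> x)\<^sup>2 - d * ((axis j 1 + axis l 1) \<bullet> (R *v (axis j 1 + axis l 1)))
      - ((axis j 1 \<bullet> x)\<^sup>2 - d * (axis j 1 \<bullet> (R *v axis j 1)))
      - ((axis l 1 \<bullet> x)\<^sup>2 - d * (axis l 1 \<bullet> (R *v axis l 1)))) / 2"
proof -
  have e: "axis a 1 \<bullet> (R *v axis b 1) = R $ a $ b" for a b
    by (simp add: inner_axis' matrix_vector_mult_basis column_def)
  have s: "R $ l $ j = R $ j $ l" using R by (metis transpose_def vec_lambda_beta)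
  have i: "axis a 1 \<bullet> x = x $ a" for a by (simp add: inner_axis')
  show ?thesis
    unfolding matrix_vector_right_distrib inner_add_left inner_add_right e i s
    by (simp add: power2_eq_square field_simps)
qed

section \<open>Stochastic integrals of matrix-valued integrands\<close>

context wiener_filtration
begin

text \<open>Scalar integrals of the entries are summed along each row. The clauses of
  \<open>ito_approximates\<close>, for all components at once, are dominated by one sum of finitely
  many null quantities, which makes a common subsequence available.\<close>

lemma stochastic_integral_exists:
  fixes k :: "real \<Rightarrow> 'a \<Rightarrow> real^'m^'e"
  assumes T: "0 \<le> T" and km: "\<And>s. 0 \<le> s \<Longrightarrow> s \<le> T \<Longrightarrow> k s \<in> borel_measurable (G s)"
    and kc: "\<And>\<omega>. \<omega> \<in> space M \<Longrightarrow> continuous_on {0..T} (\<lambda>s. k s \<omega>)"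
  shows "\<exists>N. (AE \<omega> in M. continuous_on {0..T} (\<lambda>s. N s \<omega>)) \<and>
    (\<forall>t\<in>{0..T}. \<forall>\<pi>. mesh_seq t \<pi> \<longrightarrow> (\<exists>r. strict_mono r \<and>
      (AE \<omega> in M. ito_approximates (\<lambda>s. k s \<omega>) (\<lambda>s. W s \<omega>) (\<lambda>s. N s \<omega>) R (\<lambda>n. \<pi> (r n)))))"
proof -
  have bm: "(\<lambda>\<omega>. k s \<omega> $ p $ j) \<in> borel_measurable (G s)" if "0 \<le> s" "s \<le> T" for s p j
  proof -
    have "continuous_on UNIV (\<lambda>K :: real^'m^'e. K $ p $ j)" by (intro continuous_intros)
    from borel_measurable_continuous_on[OF this km[OF that]] show ?thesis .
  qed
  have bc: "continuous_on {0..T} (\<lambda>s. k s \<omega> $ p $ j)" if "\<omega> \<in> space M" for \<omega> p j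
    by (intro continuous_intros kc that)
  let ?dW = "\<lambda>ts i \<omega>. W (ts ! Suc i) \<omega> - W (ts ! i) \<omega>"
  let ?lin = "\<lambda>p j ts \<omega> l. \<Sum>i<l. k (ts ! i) \<omega> $ p $ j * (axis j 1 \<bullet> ?dW ts i \<omega>)"
  define good where "good p j N \<longleftrightarrow> (\<forall>s\<in>{0..T}. N s \<in> borel_measurable (G s)) \<and>
    (AE \<omega> in M. continuous_on {0..T} (\<lambda>s. N s \<omega>)) \<and>
    (\<forall>t\<in>{0..T}. subseq_limit M t (\<lambda>ts \<omega>. partition_max ts (\<lambda>l. ?lin p j ts \<omega> l - N (ts ! l) \<omega>)) (\<lambda>_. 0))" for p j N
  have "\<forall>p j. \<exists>N. good p j N"
    unfolding good_def by (intro allI ito_integral_exists T bm bc)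
  then obtain N' where N'': "\<And>p j. good p j (N' p j)" by metis
  have N': "\<And>p j s. s \<in> {0..T} \<Longrightarrow> N' p j s \<in> borel_measurable (G s)"
    "\<And>p j. AE \<omega> in M. continuous_on {0..T} (\<lambda>s. N' p j s \<omega>)"
    "\<And>p j t. t \<in> {0..T} \<Longrightarrow> subseq_limit M t (\<lambda>ts \<omega>. partition_max ts (\<lambda>l. ?lin p j ts \<omega> l - N' p j (ts ! l) \<omega>)) (\<lambda>_. 0)"
    using N'' unfolding good_def by blast+
  define N where "N s \<omega> = (\<chi> p. \<Sum>j\<in>UNIV. N' p j s \<omega>)" for s \<omega>
  let ?n = "\<lambda>ts \<omega>. increment_sum (\<lambda>s. k s \<omega>) (\<lambda>s. W s \<omega>) ts"
  let ?z = "\<lambda>ts \<omega> i. k (ts ! i) \<omega> *v ?dW ts i \<omega>"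
  have n_comp: "?n ts \<omega> l $ p = (\<Sum>j\<in>UNIV. ?lin p j ts \<omega> l)" for ts \<omega> l p
    unfolding increment_sum_def sum_component matrix_vector_axis_component by (rule sum.swap)
  have nN: "(?n ts \<omega> l - N (ts ! l) \<omega>) $ p = (\<Sum>j\<in>UNIV. ?lin p j ts \<omega> l - N' p j (ts ! l) \<omega>)" for ts \<omega> l p
    unfolding vector_minus_component n_comp N_def by (simp add: sum_subtractf)
  have Nc: "AE \<omega> in M. continuous_on {0..T} (\<lambda>s. N s \<omega>)"
  proof -
    have "AE \<omega> in M. \<forall>p\<in>(UNIV::'e set). \<forall>j\<in>(UNIV::'m set). continuous_on {0..T} (\<lambda>s. N' p j s \<omega>)"
      by (intro AE_finite_allI N'(2)) auto
    then show ?thesis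
      by eventually_elim (auto simp: N_def intro!: continuous_intros)
  qed
  have approx: "\<exists>r. strict_mono r \<and>
      (AE \<omega> in M. ito_approximates (\<lambda>s. k s \<omega>) (\<lambda>s. W s \<omega>) (\<lambda>s. N s \<omega>) R (\<lambda>n. \<pi> (r n)))"
    if t: "t \<in> {0..T}" and \<pi>: "mesh_seq t \<pi>" for t \<pi>
  proof -
    \<comment> \<open>A single null bound for all components of the approximation error at all
      points of the partition.\<close>
    define S1 where "S1 ts \<omega> = (\<Sum>p\<in>UNIV. \<Sum>j\<in>UNIV. partition_max ts (\<lambda>l. ?lin p j ts \<omega> l - N' p j (ts ! l) \<omega>))" for ts \<omega>
    have S1: "subseq_limit M t S1 (\<lambda>_. 0)"
      unfolding S1_def[abs_def] by (intro subseq_limit_sum_0 N'(3) t) auto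
    have comp_le: "(\<Sum>p\<in>UNIV. \<bar>(?n ts \<omega> l - N (ts ! l) \<omega>) $ p\<bar>) \<le> S1 ts \<omega>" if l: "l < length ts" for ts \<omega> l
      unfolding nN S1_def
      by (intro sum_mono order_trans[OF sum_abs] partition_max_ge[OF l])
    have norm_le: "norm (?n ts \<omega> l - N (ts ! l) \<omega>) \<le> S1 ts \<omega>" if l: "l < length ts" for ts \<omega> l
      using norm_le_l1_cart comp_le[OF l] by (rule order_trans)
    define P1 where "P1 ts \<omega> = partition_max ts (\<lambda>l. norm (?n ts \<omega> l - N (ts ! l) \<omega>))" for ts \<omega>
    define P2 where "P2 p q ts \<omega> = partition_max ts (\<lambda>l. \<Sum>i<l. covariation_term (\<lambda>s. k s \<omega>) (\<lambda>s. W s \<omega>) R p q ts i)" for p q ts \<omega>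
    define P3 where "P3 p q ts \<omega> = partition_max ts (\<lambda>l. \<Sum>i<l. (?n ts \<omega> i - N (ts ! i) \<omega>) $ p * ?z ts \<omega> i $ q)" for p q ts \<omega>
    have P1: "subseq_limit M t P1 (\<lambda>_. 0)"
    proof (rule subseq_limit_dominated[OF S1])
      fix \<omega>
      have "\<bar>P1 ts \<omega>\<bar> \<le> 1 * S1 ts \<omega>" if "ts \<in> partitions t 1" for ts
        using partition_max_le[OF partition_not_empty[OF that], of "\<lambda>l. norm (?n ts \<omega> l - N (ts ! l) \<omega>)" "S1 ts \<omega>"]
          partition_max_nonneg[OF partition_not_empty[OF that], of "\<lambda>l. norm (?n ts \<omega> l - N (ts ! l) \<omega>)"] norm_le
        by (auto simp: P1_def)
      then show "\<exists>C. \<forall>ts\<in>partitions t 1. \<bar>P1 ts \<omega>\<bar> \<le> C * S1 ts \<omega>" by blast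
    qed
    have P2: "subseq_limit M t (P2 p q) (\<lambda>_. 0)" for p q
    proof -
      \<comment> \<open>By polarization each covariation term is a combination of quadratic sums in
        three directions \<open>c\<close>, with the product of two entries of \<open>k\<close> as an
        adapted continuous coefficient.\<close>
      define Z where "Z j l c ts \<omega> = partition_max ts (\<lambda>n. \<Sum>i<n. (k (ts ! i) \<omega> $ p $ j * k (ts ! i) \<omega> $ q $ l) *
        ((c \<bullet> ?dW ts i \<omega>)\<^sup>2 - (ts ! Suc i - ts ! i) * (c \<bullet> (R *v c))))" for j l c ts \<omega>
      have Z: "subseq_limit M t (Z j l c) (\<lambda>_. 0)" for j l c
        unfolding Z_def[abs_def]
        by (intro subseq_limit_quadratic_sums[OF t, where b="\<lambda>s \<omega>. k s \<omega> $ p $ j * k s \<omega> $ q $ l"]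
            borel_measurable_times bm continuous_on_mult bc)
      have Zs: "subseq_limit M t (\<lambda>ts \<omega>. \<Sum>j\<in>UNIV. \<Sum>l\<in>UNIV.
          Z j l (axis j 1 + axis l 1) ts \<omega> + Z j l (axis j 1) ts \<omega> + Z j l (axis l 1) ts \<omega>) (\<lambda>_. 0)"
        using subseq_limit_add[OF subseq_limit_add[OF Z Z] Z] by (intro subseq_limit_sum_0) auto
      show ?thesis
      proof (rule subseq_limit_dominated[OF Zs])
        fix \<omega>
        have "\<bar>P2 p q ts \<omega>\<bar> \<le> 1 * (\<Sum>j\<in>UNIV. \<Sum>l\<in>UNIV.
          Z j l (axis j 1 + axis l 1) ts \<omega> + Z j l (axis j 1) ts \<omega> + Z j l (axis l 1) ts \<omega>)"
          if ts: "ts \<in> partitions t 1" for ts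
        proof -
          let ?b = "\<lambda>j l i. k (ts ! i) \<omega> $ p $ j * k (ts ! i) \<omega> $ q $ l"
          let ?y = "\<lambda>c i. (c \<bullet> ?dW ts i \<omega>)\<^sup>2 - (ts ! Suc i - ts ! i) * (c \<bullet> (R *v c))"
          have cov_eq: "covariation_term (\<lambda>s. k s \<omega>) (\<lambda>s. W s \<omega>) R p q ts i
              = (\<Sum>j\<in>UNIV. \<Sum>l\<in>UNIV. (?b j l i * ?y (axis j 1 + axis l 1) i - ?b j l i * ?y (axis j 1) i - ?b j l i * ?y (axis l 1) i) / 2)" for i
          proof -
            have "?z ts \<omega> i $ p * ?z ts \<omega> i $ q = (\<Sum>j\<in>UNIV. \<Sum>l\<in>UNIV. ?b j l i * (?dW ts i \<omega> $ j * ?dW ts i \<omega> $ l))"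
              unfolding matrix_vector_mult_def vec_lambda_beta sum_product by (intro sum.cong refl) (simp only: mult_ac)
            moreover have "(k (ts ! i) \<omega> ** R ** transpose (k (ts ! i) \<omega>)) $ p $ q
                = (\<Sum>j\<in>UNIV. \<Sum>l\<in>UNIV. ?b j l i * R $ j $ l)"
            proof -
              have "(k (ts ! i) \<omega> ** R ** transpose (k (ts ! i) \<omega>)) $ p $ q
                  = (\<Sum>l\<in>UNIV. \<Sum>j\<in>UNIV. ?b j l i * R $ j $ l)"
                unfolding matrix_matrix_mult_def transpose_def vec_lambda_beta sum_distrib_right
                by (intro sum.cong refl) (simp only: mult_ac)
              also have "\<dots> = (\<Sum>j\<in>UNIV. \<Sum>l\<in>UNIV. ?b j l i * R $ j $ l)" by (rule sum.swap)
              finally show ?thesis .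
            qed
            ultimately have "covariation_term (\<lambda>s. k s \<omega>) (\<lambda>s. W s \<omega>) R p q ts i
                = (\<Sum>j\<in>UNIV. \<Sum>l\<in>UNIV. ?b j l i * (?dW ts i \<omega> $ j * ?dW ts i \<omega> $ l - R $ j $ l * (ts ! Suc i - ts ! i)))"
              unfolding covariation_term_def by (simp only: sum_distrib_right sum_subtractf[symmetric] right_diff_distrib mult.assoc)
            also have "\<dots> = (\<Sum>j\<in>UNIV. \<Sum>l\<in>UNIV. (?b j l i * ?y (axis j 1 + axis l 1) i - ?b j l i * ?y (axis j 1) i - ?b j l i * ?y (axis l 1) i) / 2)"
              using R_pos_def unfolding pos_def_matrix_def
              by (subst polarization) (auto simp: right_diff_distrib)
            finally show ?thesis .
          qed
          have "partition_max ts (\<lambda>n. \<Sum>i<n. covariation_term (\<lambda>s. k s \<omega>) (\<lambda>s. W s \<omega>) R p q ts i)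
              \<le> (\<Sum>j\<in>UNIV. \<Sum>l\<in>UNIV. Z j l (axis j 1 + axis l 1) ts \<omega> + Z j l (axis j 1) ts \<omega> + Z j l (axis l 1) ts \<omega>)"
          proof (rule partition_max_le[OF partition_not_empty[OF ts]])
            fix n assume n: "n < length ts"
            let ?s = "\<lambda>j l c. \<Sum>i<n. ?b j l i * ?y c i"
            have eq: "(\<Sum>i<n. covariation_term (\<lambda>s. k s \<omega>) (\<lambda>s. W s \<omega>) R p q ts i)
                = (\<Sum>j\<in>UNIV. \<Sum>l\<in>UNIV. (?s j l (axis j 1 + axis l 1) - ?s j l (axis j 1) - ?s j l (axis l 1)) / 2)"
              unfolding cov_eq by (simp only: sum.swap[of _ _ "{..<n}"] sum_divide_distrib[symmetric] sum_subtractf)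
            show "\<bar>\<Sum>i<n. covariation_term (\<lambda>s. k s \<omega>) (\<lambda>s. W s \<omega>) R p q ts i\<bar>
              \<le> (\<Sum>j\<in>UNIV. \<Sum>l\<in>UNIV. Z j l (axis j 1 + axis l 1) ts \<omega> + Z j l (axis j 1) ts \<omega> + Z j l (axis l 1) ts \<omega>)"
              unfolding eq
            proof (intro order_trans[OF sum_abs] sum_mono)
              fix j l
              have "\<bar>?s j l c\<bar> \<le> Z j l c ts \<omega>" for c
                unfolding Z_def using partition_max_ge[OF n, of "\<lambda>n. \<Sum>i<n. ?b j l i * ?y c i"] .
              note le = this
              have half: "\<bar>(a - b - c) / 2\<bar> \<le> x + y + z" if "\<bar>a\<bar> \<le> x" "\<bar>b\<bar> \<le> y" "\<bar>c\<bar> \<le> z" for a b c x y z :: real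
              proof -
                have "\<bar>a - b - c\<bar> \<le> \<bar>a\<bar> + \<bar>b\<bar> + \<bar>c\<bar>" by arith
                then have "\<bar>a - b - c\<bar> \<le> x + y + z" using that by linarith
                moreover have "\<bar>(a - b - c) / 2\<bar> \<le> \<bar>a - b - c\<bar>" by simp
                ultimately show ?thesis by (rule order_trans[rotated])
              qed
              show "\<bar>(?s j l (axis j 1 + axis l 1) - ?s j l (axis j 1) - ?s j l (axis l 1)) / 2\<bar>
                \<le> Z j l (axis j 1 + axis l 1) ts \<omega> + Z j l (axis j 1) ts \<omega> + Z j l (axis l 1) ts \<omega>"
                by (rule half) (rule le)+
            qed
          qed
          then show ?thesis
            using partition_max_nonneg[OF partition_not_empty[OF ts], of "\<lambda>n. \<Sum>i<n. covariation_term (\<lambda>s. k s \<omega>) (\<lambda>s. W s \<omega>) R p q ts i"]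
            unfolding P2_def by (simp only: abs_of_nonneg mult_1)
        qed
        then show "\<exists>C. \<forall>ts\<in>partitions t 1. \<bar>P2 p q ts \<omega>\<bar> \<le> C * (\<Sum>j\<in>UNIV. \<Sum>l\<in>UNIV.
          Z j l (axis j 1 + axis l 1) ts \<omega> + Z j l (axis j 1) ts \<omega> + Z j l (axis l 1) ts \<omega>)" by blast
      qed
    qed
    have P3: "subseq_limit M t (P3 p q) (\<lambda>_. 0)" for p q
    proof -
      \<comment> \<open>The approximation error times an entry of \<open>k\<close>, both at the left
        endpoint, is adapted; it is null because the error is and the path of \<open>k\<close> is
        bounded. The sums are therefore martingale sums with small coefficients.\<close>
      define \<beta> where "\<beta> j ts i \<omega> = (?n ts \<omega> i - N (ts ! i) \<omega>) $ p * k (ts ! i) \<omega> $ q $ j" for j ts i \<omega>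
      define Z where "Z j ts \<omega> = partition_max ts (\<lambda>l. \<Sum>i<l. \<beta> j ts i \<omega> * (axis j 1 \<bullet> ?dW ts i \<omega>))" for j ts \<omega>
      have Z: "subseq_limit M t (Z j) (\<lambda>_. 0)" for j
        unfolding Z_def[abs_def]
      proof (rule subseq_limit_linear_sums[OF t])
        fix ts i assume ts: "ts \<in> partitions t 1" and i: "i < length ts"
        have mem: "ts ! i' \<in> {0..T}" if "i' < length ts" for i' using partition_nth_mem[OF ts that] t by auto

        have Wm: "W (ts ! i') \<in> borel_measurable (G (ts ! i))" if "i' \<le> i" for i'
          using that i mem[of i'] mem[of i] by (intro measurable_G_mono[OF W_measurable_G] partition_nth_le[OF ts]) auto
        have bm': "(\<lambda>\<omega>. k (ts ! i') \<omega> $ p' $ j') \<in> borel_measurable (G (ts ! i))" if "i' \<le> i" for i' p' j'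
          using that i mem[of i'] mem[of i] by (intro measurable_G_mono[OF bm] partition_nth_le[OF ts]) auto
        have "(\<lambda>\<omega>. (\<Sum>j\<in>UNIV. ?lin p j ts \<omega> i - N' p j (ts ! i) \<omega>) * k (ts ! i) \<omega> $ q $ j) \<in> borel_measurable (G (ts ! i))"
          by (intro borel_measurable_times borel_measurable_sum borel_measurable_diff borel_measurable_inner
              borel_measurable_const bm' Wm N'(1) mem i) auto
        then show "\<beta> j ts i \<in> borel_measurable (G (ts ! i))"
          unfolding \<beta>_def[abs_def] nN .
      next
        show "subseq_limit M t (\<lambda>ts \<omega>. partition_max ts (\<lambda>i. \<beta> j ts i \<omega>)) (\<lambda>_. 0)"
        proof (rule subseq_limit_dominated[OF S1])
          fix \<omega> assume \<omega>: "\<omega> \<in> space M"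
          obtain C where C: "0 \<le> C" "\<And>s. s \<in> {0..T} \<Longrightarrow> norm (k s \<omega> $ q $ j) \<le> C"
            using riemann_path_bound[OF riemann_path_continuous[OF bc[OF \<omega>, of q j]]] by blast
          have "\<bar>partition_max ts (\<lambda>i. \<beta> j ts i \<omega>)\<bar> \<le> C * S1 ts \<omega>" if ts: "ts \<in> partitions t 1" for ts
          proof -
            have "partition_max ts (\<lambda>i. \<beta> j ts i \<omega>) \<le> C * S1 ts \<omega>"
            proof (rule partition_max_le[OF partition_not_empty[OF ts]])
              fix i assume i: "i < length ts"
              have "\<bar>(?n ts \<omega> i - N (ts ! i) \<omega>) $ p\<bar> \<le> S1 ts \<omega>"
                using component_le_norm_cart norm_le[OF i] by (rule order_trans)
              moreover have "\<bar>k (ts ! i) \<omega> $ q $ j\<bar> \<le> C"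
                using C(2)[of "ts ! i"] partition_nth_mem[OF ts i] t by auto
              ultimately have "\<bar>\<beta> j ts i \<omega>\<bar> \<le> S1 ts \<omega> * C"
                unfolding \<beta>_def abs_mult by (intro mult_mono) auto
              then show "\<bar>\<beta> j ts i \<omega>\<bar> \<le> C * S1 ts \<omega>" by (simp add: mult.commute)
            qed
            then show ?thesis using partition_max_nonneg[OF partition_not_empty[OF ts], of "\<lambda>i. \<beta> j ts i \<omega>"] by simp
          qed
          then show "\<exists>C. \<forall>ts\<in>partitions t 1. \<bar>partition_max ts (\<lambda>i. \<beta> j ts i \<omega>)\<bar> \<le> C * S1 ts \<omega>" by blast
        qed
      qed
      have Zs: "subseq_limit M t (\<lambda>ts \<omega>. \<Sum>j\<in>UNIV. Z j ts \<omega>) (\<lambda>_. 0)" by (intro subseq_limit_sum_0 Z) auto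
      show ?thesis
      proof (rule subseq_limit_dominated[OF Zs])
        fix \<omega>
        have "\<bar>P3 p q ts \<omega>\<bar> \<le> 1 * (\<Sum>j\<in>UNIV. Z j ts \<omega>)" if ts: "ts \<in> partitions t 1" for ts
        proof -
          have "(\<Sum>i<l. (?n ts \<omega> i - N (ts ! i) \<omega>) $ p * ?z ts \<omega> i $ q)
              = (\<Sum>j\<in>UNIV. \<Sum>i<l. \<beta> j ts i \<omega> * (axis j 1 \<bullet> ?dW ts i \<omega>))" for l
            unfolding matrix_vector_axis_component \<beta>_def sum_distrib_left sum.swap[of _ _ "{..<l}"]
            by (simp only: mult.assoc)
          then have "P3 p q ts \<omega> \<le> (\<Sum>j\<in>UNIV. Z j ts \<omega>)"
            unfolding P3_def Z_def
            by (intro partition_max_sum_le[OF partition_not_empty[OF ts]]) (simp only: sum_abs)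
          then show ?thesis
            using partition_max_nonneg[OF partition_not_empty[OF ts]] unfolding P3_def by simp
        qed
        then show "\<exists>C. \<forall>ts\<in>partitions t 1. \<bar>P3 p q ts \<omega>\<bar> \<le> C * (\<Sum>j\<in>UNIV. Z j ts \<omega>)" by blast
      qed
    qed
    \<comment> \<open>The summands are nonnegative, so convergence of the total to zero along a
      subsequence entails that of each one.\<close>
    define S where "S ts \<omega> = P1 ts \<omega> + (\<Sum>p\<in>UNIV. \<Sum>q\<in>UNIV. P2 p q ts \<omega>) + (\<Sum>p\<in>UNIV. \<Sum>q\<in>UNIV. P3 p q ts \<omega>)" for ts \<omega>
    have "subseq_limit M t S (\<lambda>_. 0)"
    proof -
      have "subseq_limit M t (\<lambda>ts \<omega>. \<Sum>p\<in>UNIV. \<Sum>q\<in>UNIV. P2 p q ts \<omega>) (\<lambda>_. 0)"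
        "subseq_limit M t (\<lambda>ts \<omega>. \<Sum>p\<in>UNIV. \<Sum>q\<in>UNIV. P3 p q ts \<omega>) (\<lambda>_. 0)"
        by (intro subseq_limit_sum_0 P2 P3 finite)+
      from subseq_limit_add[OF subseq_limit_add[OF P1 this(1)] this(2)]
      show ?thesis unfolding S_def[abs_def] by simp
    qed
    then obtain r where r: "strict_mono r" "AE \<omega> in M. (\<lambda>n. S (\<pi> (r n)) \<omega>) \<longlonglongrightarrow> 0"
      using \<pi> unfolding subseq_limit_def by blast
    have "AE \<omega> in M. ito_approximates (\<lambda>s. k s \<omega>) (\<lambda>s. W s \<omega>) (\<lambda>s. N s \<omega>) R (\<lambda>n. \<pi> (r n))"
      using r(2)
    proof eventually_elim
      case (elim \<omega>)
      have ev: "\<forall>\<^sub>F n in sequentially. \<pi> (r n) \<in> partitions t 1"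
        by (rule mesh_seq_eventually[OF mesh_seq_subseq[OF \<pi> r(1)]])
      have nonneg: "0 \<le> P1 ts \<omega>" "0 \<le> P2 p q ts \<omega>" "0 \<le> P3 p q ts \<omega>" if "ts \<in> partitions t 1" for ts p q
        using partition_max_nonneg[OF partition_not_empty[OF that]] by (auto simp: P1_def P2_def P3_def)
      have le: "P1 ts \<omega> \<le> S ts \<omega>" "P2 p q ts \<omega> \<le> S ts \<omega>" "P3 p q ts \<omega> \<le> S ts \<omega>" if ts: "ts \<in> partitions t 1" for ts p q
      proof -
        note nn = nonneg[OF ts]
        have "P2 p q ts \<omega> \<le> (\<Sum>q\<in>UNIV. P2 p q ts \<omega>)" "P3 p q ts \<omega> \<le> (\<Sum>q\<in>UNIV. P3 p q ts \<omega>)"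
          using nn by (auto intro!: member_le_sum)
        moreover have "(\<Sum>q\<in>UNIV. P2 p q ts \<omega>) \<le> (\<Sum>p\<in>UNIV. \<Sum>q\<in>UNIV. P2 p q ts \<omega>)"
          "(\<Sum>q\<in>UNIV. P3 p q ts \<omega>) \<le> (\<Sum>p\<in>UNIV. \<Sum>q\<in>UNIV. P3 p q ts \<omega>)"
          using nn by (auto intro!: member_le_sum[where f="\<lambda>p. \<Sum>q\<in>UNIV. P2 p q ts \<omega>"]
              member_le_sum[where f="\<lambda>p. \<Sum>q\<in>UNIV. P3 p q ts \<omega>"] sum_nonneg)
        moreover have "0 \<le> (\<Sum>p\<in>UNIV. \<Sum>q\<in>UNIV. P2 p q ts \<omega>)" "0 \<le> (\<Sum>p\<in>UNIV. \<Sum>q\<in>UNIV. P3 p q ts \<omega>)"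
          using nn by (auto intro!: sum_nonneg)
        ultimately show "P1 ts \<omega> \<le> S ts \<omega>" "P2 p q ts \<omega> \<le> S ts \<omega>" "P3 p q ts \<omega> \<le> S ts \<omega>"
          using nn(1) by (auto simp: S_def)
      qed
      have null: "(\<lambda>n. f (\<pi> (r n)) \<omega>) \<longlonglongrightarrow> 0"
        if "\<And>ts. ts \<in> partitions t 1 \<Longrightarrow> 0 \<le> f ts \<omega> \<and> f ts \<omega> \<le> S ts \<omega>" for f
        by (rule tendsto_sandwich[OF _ _ tendsto_const elim]) (use ev that in \<open>auto elim!: eventually_mono\<close>)
      show ?case
        unfolding ito_approximates_def
        using null[of P1] null[of "P2 _ _"] null[of "P3 _ _"] nonneg le
        unfolding P1_def P2_def P3_def by blast
    qed
    with r(1) show ?thesis by blast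
  qed
  show ?thesis using Nc approx by (intro exI[of _ N]) blast
qed

end

subsection \<open>The controlled filtering model\<close>

text \<open>A sequence of partitions brings in only countably many exceptional null sets, so an
  integrand or integrator known up to a null set at each time can be exchanged for a pathwise
  version.\<close>

lemma subseq_limit_cong:
  fixes S S' :: "real list \<Rightarrow> 'a \<Rightarrow> 'b::topological_space"
  assumes S: "subseq_limit M t S L" and eq: "\<And>ts. ts \<in> partitions t 1 \<Longrightarrow> AE \<omega> in M. S ts \<omega> = S' ts \<omega>"
  shows "subseq_limit M t S' L"
proof (rule subseq_limit_refineI)
  fix \<pi> assume \<pi>: "\<And>n. \<pi> n \<in> partitions t (inverse (real (Suc n)))"
  have \<pi>1: "\<pi> n \<in> partitions t 1" for n
    using \<pi>[of n] partitions_mono[of "inverse (real (Suc n))" 1 t] by (auto simp: inverse_eq_divide)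
  have "mesh_seq t \<pi>" unfolding mesh_seq_def
  proof (intro allI impI)
    fix d :: real assume "0 < d"
    from inverse_Suc_small[OF this] show "\<forall>\<^sub>F n in sequentially. \<pi> n \<in> partitions t d"
      by eventually_elim (use \<pi> partitions_mono less_imp_le in blast)
  qed
  then obtain r where r: "strict_mono r" "AE \<omega> in M. (\<lambda>n. S (\<pi> (r n)) \<omega>) \<longlonglongrightarrow> L \<omega>"
    using S unfolding subseq_limit_def by blast
  have "AE \<omega> in M. \<forall>n. S (\<pi> (r n)) \<omega> = S' (\<pi> (r n)) \<omega>"
    by (simp add: AE_all_countable eq \<pi>1)
  with r(2) have "AE \<omega> in M. (\<lambda>n. S' (\<pi> (r n)) \<omega>) \<longlonglongrightarrow> L \<omega>"
    by eventually_elim simp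
  with r(1) show "\<exists>r. strict_mono r \<and> (AE \<omega> in M. (\<lambda>n. S' (\<pi> (r n)) \<omega>) \<longlonglongrightarrow> L \<omega>)" by blast
qed

lemma outer_product_quadratic: "y \<bullet> (outer_product h h *v y) = (y \<bullet> h)\<^sup>2"
proof -
  have "outer_product h h *v y = (h \<bullet> y) *\<^sub>R h"
    by (simp add: vec_eq_iff outer_product_def matrix_vector_mult_def inner_vec_def sum_distrib_left mult_ac)
  then show ?thesis by (simp add: power2_eq_square inner_commute)
qed

locale controlled_filter =
  fixes M :: "'a measure" and T :: real
    and A :: "real^'d^'d" and H :: "real^'m^'d" and R :: "real^'m^'m"
    and p f :: "real^'d"
    and X Y :: "real \<Rightarrow> 'a \<Rightarrow> real^'d" and W U V :: "real \<Rightarrow> 'a \<Rightarrow> real^'m"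
    and K :: "real \<Rightarrow> 'a \<Rightarrow> real^'m^'d"
  assumes T_pos: "0 < T"
    and model: "filtering_model M T A p R X W"
    and K_adapted: "K \<in> continuous_adapted M T (observation H X W)"
    and V_adapted: "V \<in> continuous_adapted M T (observation H X W)"
    and U_eq: "\<And>t \<omega>. t \<in> {0..T} \<Longrightarrow> \<omega> \<in> space M \<Longrightarrow> U t \<omega> = transpose (K t \<omega>) *v Y t \<omega> + V t \<omega>"
    and ode: "backward_ode M T A H f U Y"
begin

sublocale prob_space M using model by (simp add: filtering_model_def)

abbreviation G :: "real \<Rightarrow> 'a measure" where "G \<equiv> enlarged_filtration M T X W"

lemma X_measurable: "s \<in> {0..T} \<Longrightarrow> X s \<in> borel_measurable M"
  and X_Basis: "s \<in> {0..T} \<Longrightarrow> \<omega> \<in> space M \<Longrightarrow> X s \<omega> \<in> Basis"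
  and X_cadlag: "\<omega> \<in> space M \<Longrightarrow> cadlag_on T (\<lambda>s. X s \<omega>)"
  using model by (auto simp: filtering_model_def markov_chain_def)

lemma W_random: "s \<in> {0..T} \<Longrightarrow> W s \<in> borel_measurable M"
  using model by (auto simp: filtering_model_def wiener_process_def)

sublocale wiener_filtration M T G R W
proof
  have XE: "sets (generated_algebra M {0..T} X) \<subseteq> events"
    by (rule sets_generated_algebra_subset[OF refl X_measurable])
  have WE: "sets (generated_algebra M {0..t} W) \<subseteq> events" if "t \<le> T" for t
    by (rule sets_generated_algebra_subset[OF refl W_random]) (use that in auto)
  fix s t :: real
  show "subalgebra (G t) (G s)" if "0 \<le> s" "s \<le> t" "t \<le> T"
    unfolding subalgebra_def
  proof
    have "sets (generated_algebra M {0..s} W) \<subseteq> sets (generated_algebra M {0..t} W)"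
      by (rule sets_generated_algebra_subset) (use that in \<open>auto intro: measurable_generated_algebra\<close>)
    then show "sets (G s) \<subseteq> sets (G t)"
      by (intro enlarged_filtration_subset) (auto simp: sets_enlarged_filtration)
  qed simp
  show "subalgebra M (G t)" if "0 \<le> t" "t \<le> T"
    unfolding subalgebra_def using enlarged_filtration_subset[OF refl XE WE[OF that(2)]] by simp
  show "W t \<in> borel_measurable (G t)" if "0 \<le> t" "t \<le> T"
    by (rule measurable_enlarged_filtration) (use that in \<open>auto intro: measurable_generated_algebra\<close>)
  show "continuous_on {0..T} (\<lambda>t. W t \<omega>)" if "\<omega> \<in> space M" for \<omega>
    using model that by (auto simp: filtering_model_def wiener_process_def)
  show "indep_var borel g borel (\<lambda>\<omega>. h (W t \<omega> - W s \<omega>))"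
    if "0 \<le> s" "s < t" "t \<le> T" "g \<in> borel_measurable (G s)" "h \<in> borel_measurable borel"
    for g :: "'a \<Rightarrow> real" and h :: "real^'m \<Rightarrow> real"
    using model that
    by (intro increment_indep_enlarged[OF X_measurable W_random])
      (auto simp: filtering_model_def wiener_process_def)
  show "distributed M lborel (\<lambda>\<omega>. c \<bullet> (W t \<omega> - W s \<omega>)) (normal_density 0 (sqrt ((t - s) * (c \<bullet> (R *v c)))))"
    if "0 \<le> s" "s < t" "t \<le> T" "c \<noteq> 0" for c
    using model that by (auto simp: filtering_model_def wiener_process_def)
  show "pos_def_matrix R" using model by (simp add: filtering_model_def)
qed

lemma X_measurable_G: "r \<in> {0..T} \<Longrightarrow> X r \<in> borel_measurable (G s)"
  by (rule measurable_enlarged_filtration) (auto intro: measurable_generated_algebra)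

text \<open>A choice for each sample point separately; no measurability of the jump times is
  claimed, since measurable versions of the limits come from the sums.\<close>

definition jumps :: "'a \<Rightarrow> real set \<times> (real \<Rightarrow> real^'d)" where
  "jumps \<omega> = (SOME Jh. step_path T (\<lambda>s. X s \<omega>) (fst Jh) (snd Jh))"

abbreviation J :: "'a \<Rightarrow> real set" where "J \<omega> \<equiv> fst (jumps \<omega>)"
abbreviation h :: "'a \<Rightarrow> real \<Rightarrow> real^'d" where "h \<omega> \<equiv> snd (jumps \<omega>)"

lemma X_step_path:
  assumes \<omega>: "\<omega> \<in> space M"
  shows "step_path T (\<lambda>s. X s \<omega>) (J \<omega>) (h \<omega>)"
proof -
  have "\<exists>J h. step_path T (\<lambda>s. X s \<omega>) J h"
    using T_pos X_Basis \<omega> by (intro step_path_cadlag[OF _ X_cadlag[OF \<omega>] finite_Basis]) auto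
  then have "\<exists>Jh. step_path T (\<lambda>s. X s \<omega>) (fst Jh) (snd Jh)" by auto
  from someI_ex[OF this] show ?thesis unfolding jumps_def .
qed

lemma X_riemann_path: "\<omega> \<in> space M \<Longrightarrow> riemann_path T (\<lambda>s. X s \<omega>)"
  by (rule riemann_path_step[OF X_step_path])

lemma linear_X_riemann_path: "\<omega> \<in> space M \<Longrightarrow> riemann_path T (\<lambda>s. L *v X s \<omega>)" for L :: "real^'d^'n"
  by (rule riemann_path_linear[OF matrix_vector_mul_linear X_riemann_path])

text \<open>The drift of the observation is a functional of the state alone, and the enlarged
  algebra contains the whole state at every time; hence whatever is adapted to the observation is
  adapted to the enlarged filtration.\<close>

lemma observation_measurable:
  assumes r: "0 \<le> r" "r \<le> s" "s \<le> T"
  shows "observation H X W r \<in> borel_measurable (G s)"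
proof -
  have "(\<lambda>\<omega>. integral {0..r} (\<lambda>s. transpose H *v X s \<omega>)) \<in> borel_measurable (G s)"
  proof (rule borel_measurable_riemann_integral[where T=T])
    show "(\<lambda>\<omega>. transpose H *v X q \<omega>) \<in> borel_measurable (G s)" if "q \<in> {0..r}" for q
      using that r by (intro borel_measurable_matrix_vector_mult borel_measurable_const X_measurable_G) auto
  qed (use r linear_X_riemann_path in \<open>auto simp del: transpose_matrix_vector\<close>)
  moreover have "W r \<in> borel_measurable (G s)"
    by (rule measurable_G_mono[OF W_measurable_G]) (use r in auto)
  ultimately show ?thesis unfolding observation_def[abs_def] by (rule borel_measurable_add)
qed

lemma adapted_measurable_G:
  fixes P :: "real \<Rightarrow> 'a \<Rightarrow> 'c::topological_space"
  assumes P: "P \<in> continuous_adapted M T (observation H X W)" and s: "0 \<le> s" "s \<le> T"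
  shows "P s \<in> borel_measurable (G s)"
proof -
  have "sets (generated_algebra M {0..s} (observation H X W)) \<subseteq> sets (G s)"
    using s by (intro sets_generated_algebra_subset) (auto intro: observation_measurable)
  moreover have "P s \<in> borel_measurable (generated_algebra M {0..s} (observation H X W))"
    using P s by (auto simp: continuous_adapted_def)
  ultimately show ?thesis by (auto simp: measurable_def)
qed

lemma adapted_continuous:
  "P \<in> continuous_adapted M T (observation H X W) \<Longrightarrow> \<omega> \<in> space M \<Longrightarrow> continuous_on {0..T} (\<lambda>s. P s \<omega>)"
  by (simp add: continuous_adapted_def)

text \<open>The affine control is written as a linear one by adjoining the component \<open>1\<close> to \<open>Y\<close>.\<close>

definition yh :: "real \<Rightarrow> 'a \<Rightarrow> real^('d option)" where
  "yh s \<omega> = (\<chi> a. case a of None \<Rightarrow> 1 | Some i \<Rightarrow> Y s \<omega> $ i)"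

definition yh' :: "real \<Rightarrow> 'a \<Rightarrow> real^('d option)" where
  "yh' s \<omega> = (\<chi> a. case a of None \<Rightarrow> 0 | Some i \<Rightarrow> (- (A *v Y s \<omega>) - H *v U s \<omega>) $ i)"

definition kh :: "real \<Rightarrow> 'a \<Rightarrow> real^'m^('d option)" where
  "kh s \<omega> = (\<chi> a. case a of None \<Rightarrow> V s \<omega> | Some i \<Rightarrow> K s \<omega> $ i)"

lemma kh_yh: "transpose (kh s \<omega>) *v yh s \<omega> = transpose (K s \<omega>) *v Y s \<omega> + V s \<omega>"
  by (simp add: vec_eq_iff matrix_vector_mult_def transpose_def kh_def yh_def UNIV_option_conv
      sum.reindex inj_Some)

lemma kh_measurable: "0 \<le> s \<Longrightarrow> s \<le> T \<Longrightarrow> kh s \<in> borel_measurable (G s)"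
proof -
  assume s: "0 \<le> s" "s \<le> T"
  have "continuous_on UNIV (\<lambda>x :: (real^'m^'d) \<times> (real^'m).
      (\<chi> a. case a of None \<Rightarrow> snd x | Some i \<Rightarrow> fst x $ i) :: real^'m^('d option))"
  proof (rule continuous_on_vec_lambda)
    fix a :: "'d option"
    show "continuous_on UNIV (\<lambda>x :: (real^'m^'d) \<times> (real^'m). case a of None \<Rightarrow> snd x | Some i \<Rightarrow> fst x $ i)"
      by (cases a) (auto intro!: continuous_intros)
  qed
  from borel_measurable_continuous_Pair[OF adapted_measurable_G[OF K_adapted s] adapted_measurable_G[OF V_adapted s] this]
  show ?thesis unfolding kh_def[abs_def] .
qed

lemma kh_continuous: "\<omega> \<in> space M \<Longrightarrow> continuous_on {0..T} (\<lambda>s. kh s \<omega>)"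
  unfolding kh_def
proof (rule continuous_on_vec_lambda)
  fix a :: "'d option" assume \<omega>: "\<omega> \<in> space M"
  show "continuous_on {0..T} (\<lambda>s. case a of None \<Rightarrow> V s \<omega> | Some i \<Rightarrow> K s \<omega> $ i)"
    using adapted_continuous[OF V_adapted \<omega>] adapted_continuous[OF K_adapted \<omega>]
    by (cases a) (auto intro!: continuous_intros)
qed

lemma Y_T: "\<omega> \<in> space M \<Longrightarrow> Y T \<omega> = f"
  and Y_derivative: "\<omega> \<in> space M \<Longrightarrow> s \<in> {0..T} \<Longrightarrow>
    ((\<lambda>s. Y s \<omega>) has_vector_derivative (- (A *v Y s \<omega>) - H *v U s \<omega>)) (at s within {0..T})"
  using ode by (auto simp: backward_ode_def)

lemma Y_continuous: "\<omega> \<in> space M \<Longrightarrow> continuous_on {0..T} (\<lambda>s. Y s \<omega>)"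
  unfolding continuous_on_eq_continuous_within by (blast intro: has_vector_derivative_continuous Y_derivative)

lemma U_continuous:
  assumes \<omega>: "\<omega> \<in> space M"
  shows "continuous_on {0..T} (\<lambda>s. U s \<omega>)"
proof -
  have "continuous_on {0..T} (\<lambda>s. transpose (K s \<omega>) *v Y s \<omega> + V s \<omega>)"
    unfolding matrix_vector_mult_def transpose_def
    by (intro continuous_intros Y_continuous adapted_continuous K_adapted V_adapted \<omega>)
  then show ?thesis by (rule continuous_on_cong[THEN iffD1, rotated -1]) (auto simp: U_eq \<omega>)
qed

lemma yh_derivative:
  assumes \<omega>: "\<omega> \<in> space M" and s: "s \<in> {0..T}"
  shows "((\<lambda>s. yh s \<omega>) has_vector_derivative yh' s \<omega>) (at s within {0..T})"
proof -
  have comp: "((\<lambda>s. yh s \<omega> $ a) has_vector_derivative yh' s \<omega> $ a) (at s within {0..T})" for a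
  proof (cases a)
    case (Some i)
    have "((\<lambda>s. Y s \<omega> $ i) has_vector_derivative (- (A *v Y s \<omega>) - H *v U s \<omega>) $ i) (at s within {0..T})"
      by (rule bounded_linear.has_vector_derivative[OF bounded_linear_vec_nth Y_derivative[OF \<omega> s]])
    then show ?thesis by (simp add: Some yh_def yh'_def)
  qed (simp add: yh_def yh'_def)
  then show ?thesis
    unfolding has_vector_derivative_def has_derivative_componentwise_within[of "\<lambda>s. yh s \<omega>"] Basis_vec_def
    by (auto simp: inner_axis has_vector_derivative_def)
qed

lemma yh'_continuous: "\<omega> \<in> space M \<Longrightarrow> continuous_on {0..T} (\<lambda>s. yh' s \<omega>)"
  unfolding yh'_def
proof (rule continuous_on_vec_lambda)
  fix a :: "'d option" assume \<omega>: "\<omega> \<in> space M"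
  have C: "continuous_on {0..T} (\<lambda>s. - (A *v Y s \<omega>) - H *v U s \<omega>)"
    by (intro continuous_intros linear_continuous_on_compose[OF _ matrix_vector_mul_linear]
        Y_continuous U_continuous \<omega>)
  show "continuous_on {0..T} (\<lambda>s. case a of None \<Rightarrow> 0 | Some i \<Rightarrow> (- (A *v Y s \<omega>) - H *v U s \<omega>) $ i)"
  proof (cases a)
    case (Some i)
    show ?thesis unfolding Some option.case by (rule bounded_linear.continuous_on[OF bounded_linear_vec_nth C])
  qed simp
qed

definition is_integral :: "(real \<Rightarrow> 'a \<Rightarrow> real^('d option)) \<Rightarrow> bool" where
  "is_integral N \<longleftrightarrow> (AE \<omega> in M. continuous_on {0..T} (\<lambda>s. N s \<omega>)) \<and>
    (\<forall>t\<in>{0..T}. \<forall>\<pi>. mesh_seq t \<pi> \<longrightarrow> (\<exists>r. strict_mono r \<and>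
      (AE \<omega> in M. ito_approximates (\<lambda>s. kh s \<omega>) (\<lambda>s. W s \<omega>) (\<lambda>s. N s \<omega>) R (\<lambda>n. \<pi> (r n)))))"

definition N :: "real \<Rightarrow> 'a \<Rightarrow> real^('d option)" where "N = (SOME N. is_integral N)"

lemma N_is_integral: "is_integral N"
proof -
  have "\<exists>N. is_integral N"
    unfolding is_integral_def
    by (rule stochastic_integral_exists) (use T_pos kh_measurable kh_continuous in auto)
  then show ?thesis unfolding N_def by (rule someI_ex)
qed

definition regular :: "'a \<Rightarrow> bool" where
  "regular \<omega> \<longleftrightarrow> \<omega> \<in> space M \<and> continuous_on {0..T} (\<lambda>s. N s \<omega>)"

lemma AE_regular: "AE \<omega> in M. regular \<omega>"
  using N_is_integral AE_space unfolding is_integral_def regular_def by auto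

lemma regular_path:
  assumes "regular \<omega>"
  shows "filtering_path T (\<lambda>s. yh s \<omega>) (\<lambda>s. yh' s \<omega>) (\<lambda>s. kh s \<omega>) (\<lambda>s. W s \<omega>) (\<lambda>s. N s \<omega>) A H
    (\<lambda>s. X s \<omega>) (\<lambda>s. Y s \<omega>) (J \<omega>) (h \<omega>)"
proof -
  have \<omega>: "\<omega> \<in> space M" and Nc: "continuous_on {0..T} (\<lambda>s. N s \<omega>)" using assms by (auto simp: regular_def)
  interpret ito_path T "\<lambda>s. yh s \<omega>" "\<lambda>s. yh' s \<omega>" "\<lambda>s. kh s \<omega>" "\<lambda>s. W s \<omega>" "\<lambda>s. N s \<omega>" R
    by standard (use yh_derivative[OF \<omega>] yh'_continuous[OF \<omega>] kh_continuous[OF \<omega>] W_continuous[OF \<omega>] Nc in auto)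
  show ?thesis
  proof
    show "step_path T (\<lambda>s. X s \<omega>) (J \<omega>) (h \<omega>)" by (rule X_step_path[OF \<omega>])
    show "((\<lambda>s. Y s \<omega>) has_vector_derivative - (A *v Y s \<omega>) - H *v u s) (at s within {0..T})"
      if "s \<in> {0..T}" for s
      using Y_derivative[OF \<omega> that] U_eq[OF that \<omega>] by (simp add: u_def kh_yh del: transpose_matrix_vector)
  qed
qed

lemma u_eq_U:
  assumes "regular \<omega>" "s \<in> {0..T}"
  shows "ito_path.u (\<lambda>s. yh s \<omega>) (\<lambda>s. kh s \<omega>) s = U s \<omega>"
proof -
  interpret filtering_path T "\<lambda>s. yh s \<omega>" "\<lambda>s. yh' s \<omega>" "\<lambda>s. kh s \<omega>" "\<lambda>s. W s \<omega>" "\<lambda>s. N s \<omega>" R A H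
    "\<lambda>s. X s \<omega>" "\<lambda>s. Y s \<omega>" "J \<omega>" "h \<omega>" 0
    by (rule regular_path[OF assms(1)])
  show ?thesis using assms U_eq[of s \<omega>] by (simp add: u_def kh_yh regular_def del: transpose_matrix_vector)
qed

abbreviation I :: "real \<Rightarrow> 'a \<Rightarrow> real" where
  "I t \<omega> \<equiv> ito_path.I (\<lambda>s. yh s \<omega>) (\<lambda>s. yh' s \<omega>) (\<lambda>s. N s \<omega>) t"
abbreviation Q :: "real \<Rightarrow> 'a \<Rightarrow> real" where
  "Q t \<omega> \<equiv> filtering_path.Q (\<lambda>s. yh s \<omega>) (\<lambda>s. kh s \<omega>) H (\<lambda>s. X s \<omega>) (\<lambda>s. Y s \<omega>) t"
abbreviation E0 :: "'a \<Rightarrow> real" where "E0 \<omega> \<equiv> Y 0 \<omega> \<bullet> (X 0 \<omega> - p)"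
abbreviation E :: "real \<Rightarrow> 'a \<Rightarrow> real" where
  "E t \<omega> \<equiv> filtering_path.E (\<lambda>s. yh s \<omega>) (\<lambda>s. yh' s \<omega>) (\<lambda>s. kh s \<omega>) (\<lambda>s. N s \<omega>) H
     (\<lambda>s. X s \<omega>) (\<lambda>s. Y s \<omega>) (E0 \<omega>) t"
abbreviation EB :: "real \<Rightarrow> 'a \<Rightarrow> real" where
  "EB t \<omega> \<equiv> filtering_path.EB (\<lambda>s. yh s \<omega>) (\<lambda>s. yh' s \<omega>) (\<lambda>s. kh s \<omega>) (\<lambda>s. N s \<omega>) A H
     (\<lambda>s. X s \<omega>) (\<lambda>s. Y s \<omega>) (J \<omega>) (h \<omega>) (E0 \<omega>) t"
abbreviation EW :: "real \<Rightarrow> 'a \<Rightarrow> real" where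
  "EW t \<omega> \<equiv> filtering_path.EW (\<lambda>s. yh s \<omega>) (\<lambda>s. yh' s \<omega>) (\<lambda>s. kh s \<omega>) (\<lambda>s. N s \<omega>) R A H
     (\<lambda>s. X s \<omega>) (\<lambda>s. Y s \<omega>) (J \<omega>) (h \<omega>) (E0 \<omega>) t"
abbreviation X_bracket :: "real \<Rightarrow> 'a \<Rightarrow> real^'d^'d" where
  "X_bracket t \<omega> \<equiv> \<Sum>\<tau>\<in>J \<omega> \<inter> {..t}. outer_product (h \<omega> \<tau>) (h \<omega> \<tau>)"

text \<open>All probability is absorbed here: along a suitable subsequence almost every trajectory
  is regular and satisfies \<open>ito_approximates\<close>, so that limits may be proved for one
  fixed trajectory.\<close>

lemma subseq_limitI:
  fixes S :: "real list \<Rightarrow> 'a \<Rightarrow> 'b::topological_space"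
  assumes t: "t \<in> {0..T}"
    and lim: "\<And>\<pi> \<omega>. mesh_seq t \<pi> \<Longrightarrow> regular \<omega> \<Longrightarrow>
      ito_approximates (\<lambda>s. kh s \<omega>) (\<lambda>s. W s \<omega>) (\<lambda>s. N s \<omega>) R \<pi> \<Longrightarrow> (\<lambda>n. S (\<pi> n) \<omega>) \<longlonglongrightarrow> L \<omega>"
  shows "subseq_limit M t S L"
  unfolding subseq_limit_def
proof (intro allI impI)
  fix \<pi> assume \<pi>: "mesh_seq t \<pi>"
  then obtain r where r: "strict_mono r"
    "AE \<omega> in M. ito_approximates (\<lambda>s. kh s \<omega>) (\<lambda>s. W s \<omega>) (\<lambda>s. N s \<omega>) R (\<lambda>n. \<pi> (r n))"
    using N_is_integral t unfolding is_integral_def by blast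
  have "AE \<omega> in M. (\<lambda>n. S (\<pi> (r n)) \<omega>) \<longlonglongrightarrow> L \<omega>"
    using r(2) AE_regular by eventually_elim (rule lim[OF mesh_seq_subseq[OF \<pi> r(1)]])
  with r(1) show "\<exists>r. strict_mono r \<and> (AE \<omega> in M. (\<lambda>n. S (\<pi> (r n)) \<omega>) \<longlonglongrightarrow> L \<omega>)" by blast
qed

lemma KV_measurable:
  assumes "s \<in> {0..T}"
  shows "K s \<in> borel_measurable M" "V s \<in> borel_measurable M"
  using assms by (auto intro: measurable_G_M[OF adapted_measurable_G[OF K_adapted]]
      measurable_G_M[OF adapted_measurable_G[OF V_adapted]])

text \<open>Inserting the feedback turns the backward equation into a linear one with measurable
  coefficients. As the terminal value is prescribed, \<open>Y t\<close> depends on the coefficients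
  up to time \<open>T\<close>, so measurability is claimed with respect to \<open>M\<close> and not
  to the past.\<close>

lemma Y_measurable:
  assumes t: "t \<in> {0..T}"
  shows "Y t \<in> borel_measurable M"
proof (rule backward_linear_ode_measurable[where L="\<lambda>s \<omega>. A + H ** transpose (K s \<omega>)" and v="\<lambda>s \<omega>. H *v V s \<omega>" and T=T and f=f])
  fix s assume s: "s \<in> {0..T}"
  have "continuous_on UNIV (\<lambda>K :: real^'m^'d. A + H ** transpose K)"
    unfolding matrix_matrix_mult_def transpose_def by (intro continuous_intros)
  from borel_measurable_continuous_on[OF this KV_measurable(1)[OF s]]
  show "(\<lambda>\<omega>. A + H ** transpose (K s \<omega>)) \<in> borel_measurable M" .
  show "(\<lambda>\<omega>. H *v V s \<omega>) \<in> borel_measurable M"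
    by (intro borel_measurable_matrix_vector_mult borel_measurable_const KV_measurable s)
next
  fix \<omega> assume \<omega>: "\<omega> \<in> space M"
  show "continuous_on {0..T} (\<lambda>s. A + H ** transpose (K s \<omega>))" "continuous_on {0..T} (\<lambda>s. H *v V s \<omega>)"
    unfolding matrix_matrix_mult_def transpose_def matrix_vector_mult_def
    by (intro continuous_intros adapted_continuous[OF K_adapted \<omega>] adapted_continuous[OF V_adapted \<omega>])+
  show "Y T \<omega> = f" by (rule Y_T[OF \<omega>])
  fix s assume s: "s \<in> {0..T}"
  have "- ((A + H ** transpose (K s \<omega>)) *v Y s \<omega> + H *v V s \<omega>) = - (A *v Y s \<omega>) - H *v U s \<omega>"
    unfolding U_eq[OF s \<omega>] by (simp add: matrix_vector_mult_add_rdistrib matrix_vector_right_distrib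
        matrix_vector_mul_assoc[symmetric] del: transpose_matrix_vector)
  then show "((\<lambda>s. Y s \<omega>) has_vector_derivative - ((A + H ** transpose (K s \<omega>)) *v Y s \<omega> + H *v V s \<omega>)) (at s within {0..T})"
    using Y_derivative[OF \<omega> s] by simp
qed (rule t)

lemma U_measurable:
  assumes s: "s \<in> {0..T}"
  shows "U s \<in> borel_measurable M"
proof -
  have "(\<lambda>\<omega>. transpose (K s \<omega>) *v Y s \<omega> + V s \<omega>) \<in> borel_measurable M"
    by (intro borel_measurable_add borel_measurable_matrix_vector_mult borel_measurable_transpose
        Y_measurable KV_measurable s)
  then show ?thesis by (rule measurable_cong[THEN iffD1, rotated]) (simp add: U_eq[OF s] del: transpose_matrix_vector)
qed

lemma martingale_part_measurable:
  assumes s: "s \<in> {0..T}"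
  shows "martingale_part A X s \<in> borel_measurable M"
proof -
  have "(\<lambda>\<omega>. integral {0..s} (\<lambda>r. transpose A *v X r \<omega>)) \<in> borel_measurable M"
  proof (rule borel_measurable_riemann_integral[OF s])
    show "(\<lambda>\<omega>. transpose A *v X r \<omega>) \<in> borel_measurable M" if "r \<in> {0..s}" for r
      using that s by (intro borel_measurable_matrix_vector_mult borel_measurable_const X_measurable) auto
  qed (rule linear_X_riemann_path)
  then show ?thesis unfolding martingale_part_def[abs_def] by (intro borel_measurable_diff X_measurable s)
qed

lemma forward_sum_inner_measurable:
  fixes \<phi> \<psi> :: "real \<Rightarrow> 'a \<Rightarrow> 'b::euclidean_space"
  assumes t: "t \<in> {0..T}" and ts: "ts \<in> partitions t 1"
    and "\<And>s. s \<in> {0..T} \<Longrightarrow> \<phi> s \<in> borel_measurable M" "\<And>s. s \<in> {0..T} \<Longrightarrow> \<psi> s \<in> borel_measurable M"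
  shows "forward_sum (\<bullet>) \<phi> \<psi> ts \<in> borel_measurable M"
  unfolding forward_sum_def[abs_def]
proof (intro borel_measurable_sum borel_measurable_inner borel_measurable_diff assms(3,4))
  fix i assume "i \<in> {..<length ts - 1}"
  then show "ts ! i \<in> {0..T}" "ts ! i \<in> {0..T}" "ts ! Suc i \<in> {0..T}"
    using partition_pairs[OF ts, of i] t by auto
qed

section \<open>Identification of the forward integrals and of the bracket\<close>

lemma forward_integral_U_W:
  assumes t: "t \<in> {0..T}"
  shows "forward_integral M (\<bullet>) U W t \<in> borel_measurable M" "AE \<omega> in M. forward_integral M (\<bullet>) U W t \<omega> = I t \<omega>"
proof -
  have "subseq_limit M t (forward_sum (\<bullet>) U W) (I t)"
  proof (rule subseq_limitI[OF t])
    fix \<pi> \<omega> assume \<pi>: "mesh_seq t \<pi>" and reg: "regular \<omega>"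
      and approx: "ito_approximates (\<lambda>s. kh s \<omega>) (\<lambda>s. W s \<omega>) (\<lambda>s. N s \<omega>) R \<pi>"
    interpret P: filtering_path T "\<lambda>s. yh s \<omega>" "\<lambda>s. yh' s \<omega>" "\<lambda>s. kh s \<omega>" "\<lambda>s. W s \<omega>" "\<lambda>s. N s \<omega>" R A H
      "\<lambda>s. X s \<omega>" "\<lambda>s. Y s \<omega>" "J \<omega>" "h \<omega>" "E0 \<omega>"
      by (rule regular_path[OF reg])
    show "(\<lambda>n. forward_sum (\<bullet>) U W (\<pi> n) \<omega>) \<longlonglongrightarrow> I t \<omega>"
    proof (rule Lim_transform_eventually[OF P.isum_tendsto[OF t \<pi> approx]])
      show "\<forall>\<^sub>F n in sequentially. P.isum (\<pi> n) (length (\<pi> n) - 1) = forward_sum (\<bullet>) U W (\<pi> n) \<omega>"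
        using mesh_seq_eventually[OF \<pi>]
      proof eventually_elim
        case (elim n)
        show ?case unfolding P.isum_def forward_sum_def
        proof (rule sum.cong[OF refl])
          fix i assume "i \<in> {..<length (\<pi> n) - 1}"
          then have "\<pi> n ! i \<in> {0..T}" using partition_pairs[OF elim, of i] t by auto
          then show "P.u (\<pi> n ! i) \<bullet> (W (\<pi> n ! Suc i) \<omega> - W (\<pi> n ! i) \<omega>)
              = U (\<pi> n ! i) \<omega> \<bullet> (W (\<pi> n ! Suc i) \<omega> - W (\<pi> n ! i) \<omega>)" by (simp add: u_eq_U[OF reg])
        qed
      qed
    qed
  qed
  with t show "forward_integral M (\<bullet>) U W t \<in> borel_measurable M" "AE \<omega> in M. forward_integral M (\<bullet>) U W t \<omega> = I t \<omega>"
    by (auto intro!: forward_integral_limit forward_sum_inner_measurable[OF t] U_measurable W_random)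
qed

lemma forward_integral_Y_B:
  assumes t: "t \<in> {0..T}"
  shows "forward_integral M (\<bullet>) Y (martingale_part A X) t \<in> borel_measurable M"
    "AE \<omega> in M. forward_integral M (\<bullet>) Y (martingale_part A X) t \<omega> = Q t \<omega>"
proof -
  have "subseq_limit M t (forward_sum (\<bullet>) Y (martingale_part A X)) (Q t)"
  proof (rule subseq_limitI[OF t])
    fix \<pi> \<omega> assume \<pi>: "mesh_seq t \<pi>" and reg: "regular \<omega>"
    interpret P: filtering_path T "\<lambda>s. yh s \<omega>" "\<lambda>s. yh' s \<omega>" "\<lambda>s. kh s \<omega>" "\<lambda>s. W s \<omega>" "\<lambda>s. N s \<omega>" R A H
      "\<lambda>s. X s \<omega>" "\<lambda>s. Y s \<omega>" "J \<omega>" "h \<omega>" "E0 \<omega>"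
      by (rule regular_path[OF reg])
    show "(\<lambda>n. forward_sum (\<bullet>) Y (martingale_part A X) (\<pi> n) \<omega>) \<longlonglongrightarrow> Q t \<omega>"
      using P.jsum_tendsto[OF t \<pi>] unfolding P.jsum_def P.B_def forward_sum_def martingale_part_def .
  qed
  with t show "forward_integral M (\<bullet>) Y (martingale_part A X) t \<in> borel_measurable M"
    "AE \<omega> in M. forward_integral M (\<bullet>) Y (martingale_part A X) t \<omega> = Q t \<omega>"
    by (auto intro!: forward_integral_limit forward_sum_inner_measurable[OF t] Y_measurable martingale_part_measurable)
qed

abbreviation err :: "real \<Rightarrow> 'a \<Rightarrow> real" where "err \<equiv> error_process M A p X W U Y"

lemma err_eq:
  assumes t: "t \<in> {0..T}"
  shows "err t \<in> borel_measurable M" "AE \<omega> in M. err t \<omega> = E t \<omega>"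
proof -
  have "0 \<in> {0..T}" using T_pos by simp
  then show "err t \<in> borel_measurable M"
    unfolding error_process_def[abs_def]
    by (intro borel_measurable_add borel_measurable_inner borel_measurable_diff borel_measurable_const
        Y_measurable X_measurable forward_integral_U_W(1)[OF t] forward_integral_Y_B(1)[OF t])
  show "AE \<omega> in M. err t \<omega> = E t \<omega>"
    using forward_integral_U_W(2)[OF t] forward_integral_Y_B(2)[OF t] AE_regular
  proof eventually_elim
    case (elim \<omega>)
    interpret P: filtering_path T "\<lambda>s. yh s \<omega>" "\<lambda>s. yh' s \<omega>" "\<lambda>s. kh s \<omega>" "\<lambda>s. W s \<omega>" "\<lambda>s. N s \<omega>" R A H
      "\<lambda>s. X s \<omega>" "\<lambda>s. Y s \<omega>" "J \<omega>" "h \<omega>" "E0 \<omega>"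
      by (rule regular_path[OF elim(3)])
    show ?case unfolding error_process_def P.E_def using elim by simp
  qed
qed

text \<open>The error process is identified with its pathwise formula only up to a null set for each
  time; a partition has finitely many points, so the sums agree almost surely.\<close>

lemma forward_sum_err_AE:
  fixes \<phi> \<psi> :: "real \<Rightarrow> 'a \<Rightarrow> 'b::euclidean_space"
  assumes t: "t \<in> {0..T}" and ts: "ts \<in> partitions t 1"
  shows "AE \<omega> in M. forward_sum (\<bullet>) (\<lambda>s \<omega>. E s \<omega> *\<^sub>R \<phi> s \<omega>) \<psi> ts \<omega> = forward_sum (\<bullet>) (\<lambda>s \<omega>. err s \<omega> *\<^sub>R \<phi> s \<omega>) \<psi> ts \<omega>"
proof -
  have "AE \<omega> in M. \<forall>i\<in>{..<length ts - 1}. err (ts ! i) \<omega> = E (ts ! i) \<omega>"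
  proof (rule AE_finite_allI)
    fix i assume "i \<in> {..<length ts - 1}"
    then have "ts ! i \<in> {0..T}" using partition_pairs[OF ts, of i] t by auto
    then show "AE \<omega> in M. err (ts ! i) \<omega> = E (ts ! i) \<omega>" by (rule err_eq)
  qed simp
  then show ?thesis by eventually_elim (simp add: forward_sum_def)
qed

lemma forward_integral_EU_W:
  assumes t: "t \<in> {0..T}"
  shows "AE \<omega> in M. forward_integral M (\<bullet>) (\<lambda>s \<omega>. err s \<omega> *\<^sub>R U s \<omega>) W t \<omega> = EW t \<omega>"
proof (rule forward_integral_limit(2))
  show "subseq_limit M t (forward_sum (\<bullet>) (\<lambda>s \<omega>. err s \<omega> *\<^sub>R U s \<omega>) W) (EW t)"
  proof (rule subseq_limit_cong[OF subseq_limitI[OF t] forward_sum_err_AE[OF t]])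
    fix \<pi> \<omega> assume \<pi>: "mesh_seq t \<pi>" and reg: "regular \<omega>"
      and approx: "ito_approximates (\<lambda>s. kh s \<omega>) (\<lambda>s. W s \<omega>) (\<lambda>s. N s \<omega>) R \<pi>"
    interpret P: filtering_path T "\<lambda>s. yh s \<omega>" "\<lambda>s. yh' s \<omega>" "\<lambda>s. kh s \<omega>" "\<lambda>s. W s \<omega>" "\<lambda>s. N s \<omega>" R A H
      "\<lambda>s. X s \<omega>" "\<lambda>s. Y s \<omega>" "J \<omega>" "h \<omega>" "E0 \<omega>"
      by (rule regular_path[OF reg])
    show "(\<lambda>n. forward_sum (\<bullet>) (\<lambda>s \<omega>. E s \<omega> *\<^sub>R U s \<omega>) W (\<pi> n) \<omega>) \<longlonglongrightarrow> EW t \<omega>"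
    proof (rule Lim_transform_eventually[OF P.EU_dW_tendsto[OF t \<pi> approx]])
      show "\<forall>\<^sub>F n in sequentially. (\<Sum>i<length (\<pi> n) - 1. P.E (\<pi> n ! i) * P.dW (\<pi> n) i)
          = forward_sum (\<bullet>) (\<lambda>s \<omega>. E s \<omega> *\<^sub>R U s \<omega>) W (\<pi> n) \<omega>"
        using mesh_seq_eventually[OF \<pi>]
      proof eventually_elim
        case (elim n)
        show ?case unfolding forward_sum_def
        proof (rule sum.cong[OF refl])
          fix i assume "i \<in> {..<length (\<pi> n) - 1}"
          then have "\<pi> n ! i \<in> {0..T}" using partition_pairs[OF elim, of i] t by auto
          then show "P.E (\<pi> n ! i) * P.dW (\<pi> n) i
              = (E (\<pi> n ! i) \<omega> *\<^sub>R U (\<pi> n ! i) \<omega>) \<bullet> (W (\<pi> n ! Suc i) \<omega> - W (\<pi> n ! i) \<omega>)"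
            by (simp add: u_eq_U[OF reg])
        qed
      qed
    qed
  qed
qed (use t in \<open>auto intro!: forward_sum_inner_measurable[OF t] borel_measurable_scaleR err_eq U_measurable W_random\<close>)

lemma forward_integral_EY_B:
  assumes t: "t \<in> {0..T}"
  shows "AE \<omega> in M. forward_integral M (\<bullet>) (\<lambda>s \<omega>. err s \<omega> *\<^sub>R Y s \<omega>) (martingale_part A X) t \<omega> = EB t \<omega>"
proof (rule forward_integral_limit(2))
  show "subseq_limit M t (forward_sum (\<bullet>) (\<lambda>s \<omega>. err s \<omega> *\<^sub>R Y s \<omega>) (martingale_part A X)) (EB t)"
  proof (rule subseq_limit_cong[OF subseq_limitI[OF t] forward_sum_err_AE[OF t]])
    fix \<pi> \<omega> assume \<pi>: "mesh_seq t \<pi>" and reg: "regular \<omega>"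
    interpret P: filtering_path T "\<lambda>s. yh s \<omega>" "\<lambda>s. yh' s \<omega>" "\<lambda>s. kh s \<omega>" "\<lambda>s. W s \<omega>" "\<lambda>s. N s \<omega>" R A H
      "\<lambda>s. X s \<omega>" "\<lambda>s. Y s \<omega>" "J \<omega>" "h \<omega>" "E0 \<omega>"
      by (rule regular_path[OF reg])
    show "(\<lambda>n. forward_sum (\<bullet>) (\<lambda>s \<omega>. E s \<omega> *\<^sub>R Y s \<omega>) (martingale_part A X) (\<pi> n) \<omega>) \<longlonglongrightarrow> EB t \<omega>"
      using P.EY_dB_tendsto[OF t \<pi>] unfolding P.B_def forward_sum_def martingale_part_def inner_scaleR_left .
  qed
qed (use t in \<open>auto intro!: forward_sum_inner_measurable[OF t] borel_measurable_scaleR err_eq Y_measurable martingale_part_measurable\<close>)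

text \<open>The state is a step path, so for fine partitions the outer products of its increments
  are exactly those of its jumps.\<close>

lemma bracket_X:
  assumes t: "t \<in> {0..T}"
  shows "bracket M X X t \<in> borel_measurable M" "AE \<omega> in M. bracket M X X t \<omega> = X_bracket t \<omega>"
proof -
  have lim: "subseq_limit M t (bracket_sum X X) (X_bracket t)"
  proof (rule subseq_limitI[OF t])
    fix \<pi> \<omega> assume \<pi>: "mesh_seq t \<pi>" and reg: "regular \<omega>"
    then have "\<omega> \<in> space M" by (simp add: regular_def)
    show "(\<lambda>n. bracket_sum X X (\<pi> n) \<omega>) \<longlonglongrightarrow> X_bracket t \<omega>"
      unfolding bracket_sum_def
      by (rule step_path_sum_tendsto[where F="\<lambda>n i x. outer_product x x", OF X_step_path[OF \<open>\<omega> \<in> space M\<close>] t \<pi>])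
        (auto simp: outer_product_def zero_vec_def)
  qed
  have cont: "continuous_on UNIV (\<lambda>x :: (real^'d) \<times> (real^'d). outer_product (fst x) (snd x))"
    unfolding outer_product_def by (intro continuous_intros)
  have meas: "bracket_sum X X ts \<in> borel_measurable M" if ts: "ts \<in> partitions t 1" for ts
    unfolding bracket_sum_def[abs_def]
  proof (rule borel_measurable_sum)
    fix i assume "i \<in> {..<length ts - 1}"
    then have "ts ! i \<in> {0..T}" "ts ! Suc i \<in> {0..T}" using partition_pairs[OF ts, of i] t by auto
    then have "(\<lambda>\<omega>. X (ts ! Suc i) \<omega> - X (ts ! i) \<omega>) \<in> borel_measurable M"
      by (intro borel_measurable_diff X_measurable)
    from borel_measurable_continuous_Pair[OF this this cont]
    show "(\<lambda>\<omega>. outer_product (X (ts ! Suc i) \<omega> - X (ts ! i) \<omega>) (X (ts ! Suc i) \<omega> - X (ts ! i) \<omega>)) \<in> borel_measurable M" .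
  qed
  show "bracket M X X t \<in> borel_measurable M" "AE \<omega> in M. bracket M X X t \<omega> = X_bracket t \<omega>"
    using bracket_limit[OF _ meas lim] t by auto
qed

text \<open>The bracket jumps only when the state does, so integrals against it reduce to sums over
  the same jump times.\<close>

lemma X_bracket_step_path:
  assumes \<omega>: "\<omega> \<in> space M"
  shows "step_path T (\<lambda>s. X_bracket s \<omega>) (J \<omega>) (\<lambda>\<tau>. outer_product (h \<omega> \<tau>) (h \<omega> \<tau>))"
proof -
  have "J \<omega> \<inter> {..0} = {}" using X_step_path[OF \<omega>] by (auto simp: step_path_def)
  then show ?thesis using X_step_path[OF \<omega>] by (auto simp: step_path_def)
qed

text \<open>A jump \<open>outer_product h h\<close> of the bracket contributes
  \<open>(Y \<bullet> h)\<^sup>2 / 2\<close>; because \<open>Y\<close> is continuous, its left limit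
  at the jump is its value there.\<close>

lemma forward_integral_bracket:
  assumes t: "t \<in> {0..T}"
  shows "AE \<omega> in M. forward_integral M (\<lambda>y q. 1/2 * (y \<bullet> (q *v y))) Y (bracket M X X) t \<omega>
    = (\<Sum>\<tau>\<in>J \<omega> \<inter> {..t}. (Y \<tau> \<omega> \<bullet> h \<omega> \<tau>)\<^sup>2 / 2)"
proof (rule forward_integral_limit(2))
  let ?b = "\<lambda>(y :: real^'d) (q :: real^'d^'d). 1/2 * (y \<bullet> (q *v y))"
  have mem: "ts ! i \<in> {0..T}" "ts ! Suc i \<in> {0..T}" if "ts \<in> partitions t 1" "i < length ts - 1" for ts i
    using partition_pairs[OF that] t by auto
  show "subseq_limit M t (forward_sum ?b Y (bracket M X X)) (\<lambda>\<omega>. \<Sum>\<tau>\<in>J \<omega> \<inter> {..t}. (Y \<tau> \<omega> \<bullet> h \<omega> \<tau>)\<^sup>2 / 2)"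
  proof (rule subseq_limit_cong[OF subseq_limitI[OF t]])
    fix \<pi> \<omega> assume \<pi>: "mesh_seq t \<pi>" and reg: "regular \<omega>"
    then have \<omega>: "\<omega> \<in> space M" by (simp add: regular_def)
    interpret P: filtering_path T "\<lambda>s. yh s \<omega>" "\<lambda>s. yh' s \<omega>" "\<lambda>s. kh s \<omega>" "\<lambda>s. W s \<omega>" "\<lambda>s. N s \<omega>" R A H
      "\<lambda>s. X s \<omega>" "\<lambda>s. Y s \<omega>" "J \<omega>" "h \<omega>" "E0 \<omega>"
      by (rule regular_path[OF reg])
    show "(\<lambda>n. forward_sum ?b Y X_bracket (\<pi> n) \<omega>) \<longlonglongrightarrow> (\<Sum>\<tau>\<in>J \<omega> \<inter> {..t}. (Y \<tau> \<omega> \<bullet> h \<omega> \<tau>)\<^sup>2 / 2)"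
      unfolding forward_sum_def
    proof (rule step_path_sum_tendsto[where F="\<lambda>n i q. ?b (Y (\<pi> n ! i) \<omega>) q", OF X_bracket_step_path[OF \<omega>] t \<pi>])
      fix \<tau> assume "\<tau> \<in> J \<omega>" "\<tau> \<le> t"
      from P.continuous_left_limit[OF P.Y_cont t \<pi> this]
      have "(\<lambda>n. (Y (\<pi> n ! jump_index (\<pi> n) \<tau>) \<omega> \<bullet> h \<omega> \<tau>)\<^sup>2 / 2) \<longlonglongrightarrow> (Y \<tau> \<omega> \<bullet> h \<omega> \<tau>)\<^sup>2 / 2"
        by (intro tendsto_intros) auto
      then show "(\<lambda>n. ?b (Y (\<pi> n ! jump_index (\<pi> n) \<tau>) \<omega>) (outer_product (h \<omega> \<tau>) (h \<omega> \<tau>))) \<longlonglongrightarrow> (Y \<tau> \<omega> \<bullet> h \<omega> \<tau>)\<^sup>2 / 2"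
        by (simp add: outer_product_quadratic)
    qed simp
  next
    fix ts assume ts: "ts \<in> partitions t 1"
    have "AE \<omega> in M. \<forall>i\<in>{..<length ts - 1}. bracket M X X (ts ! i) \<omega> = X_bracket (ts ! i) \<omega> \<and>
        bracket M X X (ts ! Suc i) \<omega> = X_bracket (ts ! Suc i) \<omega>"
      using bracket_X(2) mem[OF ts] by (intro AE_finite_allI) auto
    then show "AE \<omega> in M. forward_sum ?b Y X_bracket ts \<omega> = forward_sum ?b Y (bracket M X X) ts \<omega>"
      by eventually_elim (simp add: forward_sum_def)
  qed
  show "forward_sum ?b Y (bracket M X X) ts \<in> borel_measurable M" if ts: "ts \<in> partitions t 1" for ts
    unfolding forward_sum_def[abs_def]
    by (intro borel_measurable_sum borel_measurable_times borel_measurable_const borel_measurable_inner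
        borel_measurable_matrix_vector_mult borel_measurable_diff Y_measurable bracket_X(1) mem[OF ts]) auto
qed (use t in simp)

text \<open>An increment of the observation is the increment of the noise plus an exact integral of
  the signal, so the sum splits into the one for \<open>I\<close> and a Riemann sum.\<close>

lemma forward_integral_U_Z:
  shows "forward_integral M (\<bullet>) U (observation H X W) T \<in> borel_measurable M"
    "AE \<omega> in M. forward_integral M (\<bullet>) U (observation H X W) T \<omega>
      = I T \<omega> + integral {0..T} (\<lambda>s. U s \<omega> \<bullet> (transpose H *v X s \<omega>))"
proof -
  have t: "T \<in> {0..T}" using T_pos by simp
  have "subseq_limit M T (forward_sum (\<bullet>) U (observation H X W))
      (\<lambda>\<omega>. I T \<omega> + integral {0..T} (\<lambda>s. U s \<omega> \<bullet> (transpose H *v X s \<omega>)))"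
  proof (rule subseq_limitI[OF t])
    fix \<pi> \<omega> assume \<pi>: "mesh_seq T \<pi>" and reg: "regular \<omega>"
      and approx: "ito_approximates (\<lambda>s. kh s \<omega>) (\<lambda>s. W s \<omega>) (\<lambda>s. N s \<omega>) R \<pi>"
    then have \<omega>: "\<omega> \<in> space M" by (simp add: regular_def)
    interpret P: filtering_path T "\<lambda>s. yh s \<omega>" "\<lambda>s. yh' s \<omega>" "\<lambda>s. kh s \<omega>" "\<lambda>s. W s \<omega>" "\<lambda>s. N s \<omega>" R A H
      "\<lambda>s. X s \<omega>" "\<lambda>s. Y s \<omega>" "J \<omega>" "h \<omega>" "E0 \<omega>"
      by (rule regular_path[OF reg])
    have "(\<lambda>n. \<Sum>i<length (\<pi> n) - 1. U (\<pi> n ! i) \<omega> \<bullet> integral {\<pi> n ! i..\<pi> n ! Suc i} (\<lambda>s. transpose H *v X s \<omega>))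
        \<longlonglongrightarrow> integral {0..T} (\<lambda>s. U s \<omega> \<bullet> (transpose H *v X s \<omega>))"
      by (rule riemann_sum_tendsto[OF riemann_path_continuous[OF U_continuous[OF \<omega>]] P.HX_riemann t \<pi>])
    from tendsto_add[OF P.isum_tendsto[OF t \<pi> approx] this]
    show "(\<lambda>n. forward_sum (\<bullet>) U (observation H X W) (\<pi> n) \<omega>)
        \<longlonglongrightarrow> I T \<omega> + integral {0..T} (\<lambda>s. U s \<omega> \<bullet> (transpose H *v X s \<omega>))"
    proof (rule Lim_transform_eventually)
      show "\<forall>\<^sub>F n in sequentially. P.isum (\<pi> n) (length (\<pi> n) - 1) +
          (\<Sum>i<length (\<pi> n) - 1. U (\<pi> n ! i) \<omega> \<bullet> integral {\<pi> n ! i..\<pi> n ! Suc i} (\<lambda>s. transpose H *v X s \<omega>))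
          = forward_sum (\<bullet>) U (observation H X W) (\<pi> n) \<omega>"
        using mesh_seq_eventually[OF \<pi>]
      proof eventually_elim
        case (elim n)
        show ?case unfolding P.isum_def forward_sum_def sum.distrib[symmetric]
        proof (rule sum.cong[OF refl])
          fix i assume "i \<in> {..<length (\<pi> n) - 1}"
          then have i: "0 \<le> \<pi> n ! i" "\<pi> n ! i \<le> \<pi> n ! Suc i" "\<pi> n ! Suc i \<le> T"
            using partition_pairs[OF elim, of i] by auto
          have "integral {0..\<pi> n ! i} (\<lambda>s. transpose H *v X s \<omega>) + integral {\<pi> n ! i..\<pi> n ! Suc i} (\<lambda>s. transpose H *v X s \<omega>)
              = integral {0..\<pi> n ! Suc i} (\<lambda>s. transpose H *v X s \<omega>)"
            using i by (intro Henstock_Kurzweil_Integration.integral_combine riemann_path_integrable[OF P.HX_riemann]) auto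
          then have "observation H X W (\<pi> n ! Suc i) \<omega> - observation H X W (\<pi> n ! i) \<omega>
              = (W (\<pi> n ! Suc i) \<omega> - W (\<pi> n ! i) \<omega>) + integral {\<pi> n ! i..\<pi> n ! Suc i} (\<lambda>s. transpose H *v X s \<omega>)"
            unfolding observation_def by (simp add: algebra_simps)
          then show "P.dW (\<pi> n) i + U (\<pi> n ! i) \<omega> \<bullet> integral {\<pi> n ! i..\<pi> n ! Suc i} (\<lambda>s. transpose H *v X s \<omega>)
            = U (\<pi> n ! i) \<omega> \<bullet> (observation H X W (\<pi> n ! Suc i) \<omega> - observation H X W (\<pi> n ! i) \<omega>)"
            using i by (simp only: inner_add_right) (simp add: u_eq_U[OF reg])
        qed
      qed
    qed
  qed
  moreover have "observation H X W s \<in> borel_measurable M" if "s \<in> {0..T}" for s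
    using measurable_G_M[OF observation_measurable[of s s]] that by auto
  ultimately show "forward_integral M (\<bullet>) U (observation H X W) T \<in> borel_measurable M"
    "AE \<omega> in M. forward_integral M (\<bullet>) U (observation H X W) T \<omega>
      = I T \<omega> + integral {0..T} (\<lambda>s. U s \<omega> \<bullet> (transpose H *v X s \<omega>))"
    using T_pos by (auto intro!: forward_integral_limit forward_sum_inner_measurable[OF t] U_measurable)
qed

section \<open>The estimation error and the integrand of the objective\<close>

abbreviation est_error :: "'a \<Rightarrow> real" where
  "est_error \<omega> \<equiv> \<bar>estimator M T p (observation H X W) U Y \<omega> - f \<bullet> X T \<omega>\<bar>\<^sup>2"

lemma est_error_measurable: "est_error \<in> borel_measurable M"
  unfolding estimator_def using T_pos
  by (intro borel_measurable_power borel_measurable_abs borel_measurable_diff borel_measurable_inner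
      borel_measurable_const forward_integral_U_Z(1) Y_measurable X_measurable) auto

lemma est_error_eq: "AE \<omega> in M. est_error \<omega> = (E T \<omega>)\<^sup>2"
  using forward_integral_U_Z(2) AE_regular
proof eventually_elim
  case (elim \<omega>)
  have \<omega>: "\<omega> \<in> space M" using elim(2) by (simp add: regular_def)
  interpret P: filtering_path T "\<lambda>s. yh s \<omega>" "\<lambda>s. yh' s \<omega>" "\<lambda>s. kh s \<omega>" "\<lambda>s. W s \<omega>" "\<lambda>s. N s \<omega>" R A H
    "\<lambda>s. X s \<omega>" "\<lambda>s. Y s \<omega>" "J \<omega>" "h \<omega>" "E0 \<omega>"
    by (rule regular_path[OF elim(2)])
  have "integral {0..T} (\<lambda>s. P.u s \<bullet> (transpose H *v X s \<omega>)) = integral {0..T} (\<lambda>s. U s \<omega> \<bullet> (transpose H *v X s \<omega>))"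
    by (rule integral_cong) (simp add: u_eq_U[OF elim(2)])
  \<comment> \<open>The signal integral hidden in the observation matches the one in
    \<open>Q\<close>, the products \<open>Y 0 \<bullet> X 0\<close> in \<open>E0\<close> and
    \<open>Q\<close> cancel, and \<open>Y T = f\<close> turns \<open>Y T \<bullet> X T\<close> into
    the estimated quantity.\<close>
  then have "estimator M T p (observation H X W) U Y \<omega> - f \<bullet> X T \<omega> = - E T \<omega>"
    unfolding estimator_def elim(1) P.E_def P.Q_def Y_T[OF \<omega>] by (simp add: inner_diff_right)
  then show ?case by simp
qed

text \<open>\<open>EW\<close> is what remains of the square formula, so adding the other four terms
  restores half of the square of the final error.\<close>

lemma objective_integrand:
  "AE \<omega> in M. 1/2 * \<bar>Y 0 \<omega> \<bullet> X 0 \<omega> - Y 0 \<omega> \<bullet> p\<bar>\<^sup>2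
        + integral {0..T} (\<lambda>t. 1/2 * (U t \<omega> \<bullet> (R *v U t \<omega>)))
        + forward_integral M (\<lambda>y q. 1/2 * (y \<bullet> (q *v y))) Y (bracket M X X) T \<omega>
        + forward_integral M (\<bullet>) (\<lambda>t \<omega>. err t \<omega> *\<^sub>R U t \<omega>) W T \<omega>
        + forward_integral M (\<bullet>) (\<lambda>t \<omega>. err t \<omega> *\<^sub>R Y t \<omega>) (martingale_part A X) T \<omega>
      = 1/2 * est_error \<omega>"
proof -
  have t: "T \<in> {0..T}" using T_pos by simp
  show ?thesis
    using est_error_eq AE_regular forward_integral_bracket[OF t] forward_integral_EU_W[OF t] forward_integral_EY_B[OF t]
  proof eventually_elim
    case (elim \<omega>)
    interpret P: filtering_path T "\<lambda>s. yh s \<omega>" "\<lambda>s. yh' s \<omega>" "\<lambda>s. kh s \<omega>" "\<lambda>s. W s \<omega>" "\<lambda>s. N s \<omega>" R A H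
      "\<lambda>s. X s \<omega>" "\<lambda>s. Y s \<omega>" "J \<omega>" "h \<omega>" "E0 \<omega>"
      by (rule regular_path[OF elim(2)])
    have "integral {0..T} (\<lambda>t. 1/2 * (U t \<omega> \<bullet> (R *v U t \<omega>))) = integral {0..T} (\<lambda>s. P.u s \<bullet> (R *v P.u s)) / 2"
    proof -
      have "integral {0..T} (\<lambda>t. U t \<omega> \<bullet> (R *v U t \<omega>)) = integral {0..T} (\<lambda>s. P.u s \<bullet> (R *v P.u s))"
        by (rule integral_cong) (simp add: u_eq_U[OF elim(2)])
      then show ?thesis by (simp only: integral_mult_right)
    qed
    then show ?case
      unfolding elim(1,3,4,5) P.EW_def by (simp add: sum_divide_distrib[symmetric] inner_diff_right field_simps)
  qed
qed

end

text \<open>Almost everywhere \<open>\<xi>\<close> is nonnegative, so its negative part has integral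
  zero and the difference defining the extended expectation is never infinity minus infinity; both
  sides may be infinite.\<close>

lemma ext_expectation_half:
  assumes eq: "AE \<omega> in M. \<xi> \<omega> = 1/2 * g \<omega>" and g: "g \<in> borel_measurable M" and pos: "\<And>\<omega>. 0 \<le> g \<omega>"
  shows "ext_expectation M \<xi> = ereal (1/2) * ext_expectation M g" "0 \<le> ext_expectation M \<xi>"
proof -
  have 1: "(\<integral>\<^sup>+\<omega>. ennreal (\<xi> \<omega>) \<partial>M) = ennreal (1/2) * (\<integral>\<^sup>+\<omega>. ennreal (g \<omega>) \<partial>M)"
  proof -
    have "(\<integral>\<^sup>+\<omega>. ennreal (\<xi> \<omega>) \<partial>M) = (\<integral>\<^sup>+\<omega>. ennreal (1/2) * ennreal (g \<omega>) \<partial>M)"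
      by (rule nn_integral_cong_AE) (use eq in eventually_elim, simp only: ennreal_mult[OF _ pos])
    also have "\<dots> = ennreal (1/2) * (\<integral>\<^sup>+\<omega>. ennreal (g \<omega>) \<partial>M)"
      by (rule nn_integral_cmult) (use g in measurable)
    finally show ?thesis .
  qed
  have "(\<integral>\<^sup>+\<omega>. ennreal (- \<xi> \<omega>) \<partial>M) = (\<integral>\<^sup>+\<omega>. 0 \<partial>M)"
    by (rule nn_integral_cong_AE) (use eq in eventually_elim, simp only: , simp add: ennreal_neg pos)
  then have 2: "(\<integral>\<^sup>+\<omega>. ennreal (- \<xi> \<omega>) \<partial>M) = 0" by simp
  have 3: "(\<integral>\<^sup>+\<omega>. ennreal (- g \<omega>) \<partial>M) = 0" by (simp add: ennreal_neg pos)
  have 4: "enn2ereal (ennreal (1/2)) = ereal (1/2)" by (rule enn2ereal_ennreal) simp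
  show "ext_expectation M \<xi> = ereal (1/2) * ext_expectation M g" "0 \<le> ext_expectation M \<xi>"
    unfolding ext_expectation_def 1 2 3 times_ennreal.rep_eq 4 by (simp_all add: zero_ennreal.rep_eq)
qed

theorem proposition2:
  fixes M :: "'a measure" and T :: real
    and A :: "real^'d^'d" and H :: "real^'m^'d" and R :: "real^'m^'m"
    and \<pi>\<^sub>0 f :: "real^'d"
    and X Y :: "real \<Rightarrow> 'a \<Rightarrow> real^'d" and W U V :: "real \<Rightarrow> 'a \<Rightarrow> real^'m"
    and K :: "real \<Rightarrow> 'a \<Rightarrow> real^'m^'d"
  assumes "0 < T"
    and "filtering_model M T A \<pi>\<^sub>0 R X W"
    and "K \<in> continuous_adapted M T (observation H X W)"
    and "V \<in> continuous_adapted M T (observation H X W)"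
    and "\<And>t \<omega>. t \<in> {0..T} \<Longrightarrow> \<omega> \<in> space M \<Longrightarrow> U t \<omega> = transpose (K t \<omega>) *v Y t \<omega> + V t \<omega>"
    and "backward_ode M T A H f U Y"
  shows "objective M T A \<pi>\<^sub>0 R X W U Y =
           ereal (1/2) * ext_expectation M
             (\<lambda>\<omega>. \<bar>estimator M T \<pi>\<^sub>0 (observation H X W) U Y \<omega> - f \<bullet> X T \<omega>\<bar>\<^sup>2)
       \<and> 0 \<le> objective M T A \<pi>\<^sub>0 R X W U Y"
proof -
  interpret controlled_filter M T A H R \<pi>\<^sub>0 f X Y W U V K
    by (rule controlled_filter.intro[OF assms])
  show ?thesis
    unfolding objective_def Let_def
    using ext_expectation_half[OF objective_integrand est_error_measurable] by simp
qed

end
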